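(* For all integers $n\ge 0$ and $l\ge 1$, $$\begin{aligned} &\operatorname{tr.deg}_{\overline{k}}\,\overline{k}\left(\partial_\theta^{(i)}\left(\Gamma\left(q^j/(1-q^l)\right)\right)\ \middle|\ 0\le i\le n,\ 0\le j\le l-1\right)\\ =\;&\operatorname{tr.deg}_{\overline{k}}\,\overline{k}\left(\partial_\theta^{(i)}\left(\Omega_l^{(-j)}|_{t=\theta}\right)\ \middle|\ 0\le i\le n,\ 0\le j\le l-1\right)=l(n+1). \end{aligned}$$
   Context: Let $q$ be a power of a prime $p$, $k=\mathbb{F}_q(\theta)$, $k_\infty=\mathbb{F}_q((1/\theta))$, $\mathbb{C}_\infty$ the completion of an algebraic closure of $k_\infty$, $k_\infty^{\mathrm{sep}}$ the separable closure of $k_\infty$ in that algebraic closure, and $\overline{k}$ the algebraic closure of $k$ in $\mathbb{C}_\infty$. Let $t$ be a variable independent of $\theta$. For $s=\sum_{j\ge 0}s_jq^j\in\mathbb{Z}_p$ with $0\le s_j\le q-1$, the arithmetic gamma value is $\Gamma(s):=\prod_i\left(\prod_{j=0}^{i-1}\left(1-\frac{\theta^{q^j}}{\theta^{q^i}}\right)\right)^{s_i}\in k_\infty$. For $m\in\mathbb{Z}$, the $m$-fold Frobenius twist of $f=\sum_i a_it^i\in\mathbb{C}_\infty((t))$ is $f^{(m)}:=\sum_i a_i^{q^m}t^i$. For $l\ge 1$, fix a $(q^l-1)$-th root of $-\theta$ and put $\Omega_l:=(-\theta)^{\frac{-q^l}{q^l-1}}\prod_{i=1}^\infty\left(1-\frac{t}{\theta^{q^{il}}}\right)$;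 $\Omega_l^{(-j)}$ is its $(-j)$-fold twist, an entire function of $t$ with $\Omega_l^{(-j)}|_{t=\theta}\in k_\infty^{\mathrm{sep}}$ for $0\le j\le l-1$. For $n\ge 0$, the hyperderivative $\partial_\theta^{(n)}$ with respect to $\theta$ is the $\mathbb{F}_q$-linear operator on $k_\infty$ given by $\sum_{i\ge m}a_i\theta^{-i}\mapsto\sum_{i\ge m}\binom{-i}{n}a_i\theta^{-i-n}$ ($a_i\in\mathbb{F}_q$). The family $(\partial_\theta^{(n)})_{n\ge 0}$ satisfies the generalized Leibniz rule and extends uniquely to such a family on $k_\infty^{\mathrm{sep}}$. *)

theory Defs
  imports
    "HOL-Algebra.Algebraic_Closure_Type"
    "HOL-Algebra.Generated_Fields"
    "HOL-Analysis.Infinite_Products"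
    "HOL-Library.Poly_Mapping"
    "HOL-Library.Extended_Nat"
begin

text \<open>
  Conventions.  \<open>\<F>\<^sub>q\<close> is a finite field type \<open>'a\<close>, with \<open>q = CARD('a)\<close>.
  \<open>k\<^sub>\<infinity> = \<F>\<^sub>q((1/\<theta>))\<close> is \<open>'a fls\<close> with the formal variable \<open>fls_X\<close> standing for \<open>1/\<theta>\<close>, so that
  \<open>\<theta> = fls_X_inv\<close>, the coefficient of \<open>\<theta>\<^sup>-\<^sup>i\<close> in \<open>f\<close> is \<open>fls_nth f i\<close>, and the library metric on \<open>'a fls\<close>
  is the one of the \<open>\<infinity>\<close>-adic absolute value, normalised by \<open>\<bar>\<theta>\<bar> = 2\<close>.
\<close>

section \<open>Generated subfields, algebraic elements, transcendence degree\<close>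

text \<open>Subfields of a field type are represented by their carrier sets.\<close>

definition adjoin :: "'c::field set \<Rightarrow> 'c set \<Rightarrow> 'c set" where
  "adjoin K S = generate_field ring_of_type_algebra (K \<union> S)"

definition algebraic_over :: "'c::field set \<Rightarrow> 'c \<Rightarrow> bool" where
  "algebraic_over K x \<longleftrightarrow>
     (\<exists>p. p \<noteq> 0 \<and> (\<forall>i. Polynomial.coeff p i \<in> K) \<and> poly p x = 0)"

text \<open>
  Multivariate polynomials whose variables are named by the elements of the field; evaluation
  substitutes for each variable the element naming it.
\<close>

definition eval_at_names :: "(('c \<Rightarrow>\<^sub>0 nat) \<Rightarrow>\<^sub>0 'c) \<Rightarrow> 'c::field" where
  "eval_at_names P =
     (\<Sum>m\<in>Poly_Mapping.keys P.
        Poly_Mapping.lookup P m * (\<Prod>x\<in>Poly_Mapping.keys m. x ^ Poly_Mapping.lookup m x))"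

definition alg_indep :: "'c::field set \<Rightarrow> 'c set \<Rightarrow> bool" where
  "alg_indep K B \<longleftrightarrow>
     (\<forall>P. (\<forall>m. Poly_Mapping.lookup P m \<in> K) \<and>
            (\<forall>m\<in>Poly_Mapping.keys P. Poly_Mapping.keys m \<subseteq> B) \<and>
            eval_at_names P = 0
            \<longrightarrow> P = 0)"

text \<open>For infinite transcendence degree the value is \<open>\<infinity>\<close>.\<close>

definition transc_deg :: "'c::field set \<Rightarrow> 'c set \<Rightarrow> enat" where
  "transc_deg K L = (SUP B\<in>{B. finite B \<and> B \<subseteq> L \<and> alg_indep K B}. enat (card B))"


section \<open>The field \<open>\<C>\<^sub>\<infinity>\<close> and its subfields\<close>

text \<open>
  \<open>emb\<close> exhibits the field \<open>'c\<close> as a completion of the algebraic closure of \<open>k\<^sub>\<infinity>\<close>: \<open>'c\<close> is complete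
  for the metric of an absolute value \<open>\<lambda>x. dist x 0\<close> extending the one of \<open>k\<^sub>\<infinity>\<close>, and \<open>emb\<close> is a field
  embedding with dense image.  The absolute value is automatically non-archimedean (positive
  characteristic), and its restriction to the algebraic closure is the unique extension from \<open>k\<^sub>\<infinity>\<close>.
\<close>

locale completed_alg_closure =
  fixes emb :: "'a::{field,finite} fls alg_closure \<Rightarrow> 'c::{field,complete_space}"
  assumes emb_1: "emb 1 = 1"
    and emb_add: "emb (x + y) = emb x + emb y"
    and emb_mult: "emb (x * y) = emb x * emb y"
    and dist_diff: "dist a b = dist (a - b) (0 :: 'c)"
    and dist_mult: "dist (a * b) (0 :: 'c) = dist a 0 * dist b 0"
    and emb_isometry: "dist (emb (to_ac f)) (emb (to_ac g)) = dist f g"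
    and emb_dense: "closure (range emb) = UNIV"

definition theta :: "('a::{field,finite} fls alg_closure \<Rightarrow> 'c::field) \<Rightarrow> 'c" where
  "theta emb = emb (to_ac fls_X_inv)"

definition const_field :: "('a::{field,finite} fls alg_closure \<Rightarrow> 'c::field) \<Rightarrow> 'c set" where
  "const_field emb = range (\<lambda>c. emb (to_ac (fls_const c)))"

definition k_field :: "('a::{field,finite} fls alg_closure \<Rightarrow> 'c::field) \<Rightarrow> 'c set" where
  "k_field emb = adjoin (const_field emb) {theta emb}"

definition k_bar :: "('a::{field,finite} fls alg_closure \<Rightarrow> 'c::field) \<Rightarrow> 'c set" where
  "k_bar emb = {x. algebraic_over (k_field emb) x}"

text \<open>\<open>k\<^sub>\<infinity>\<^sup>s\<^sup>e\<^sup>p\<close>: the irreducible polynomial has only simple roots in the algebraic closure.\<close>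

definition k_inf_sep :: "('a::{field,finite} fls alg_closure \<Rightarrow> 'c::field) \<Rightarrow> 'c set" where
  "k_inf_sep emb =
     emb ` {x. \<exists>p :: 'a fls poly. Factorial_Ring.irreducible p \<and>
                 poly (map_poly to_ac p) x = 0 \<and> rsquarefree (map_poly to_ac p)}"


section \<open>Hyperderivatives\<close>

text \<open>
  The binomial coefficient of an arbitrary integer; the division is exact.  (The library's
  \<open>gchoose\<close> is constrained to fields of characteristic 0.)
\<close>

definition int_choose :: "int \<Rightarrow> nat \<Rightarrow> int" where
  "int_choose a n = (\<Prod>j<n. a - int j) div fact n"

text \<open>
  \<open>a\<^sub>i \<theta>\<^sup>-\<^sup>i\<close> is sent to \<open>int_choose (-i) n * a\<^sub>i \<theta>\<^sup>-\<^sup>i\<^sup>-\<^sup>n\<close>; below, \<open>m = i + n\<close>.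
\<close>

definition hyperderiv_fls :: "nat \<Rightarrow> 'a::field fls \<Rightarrow> 'a fls" where
  "hyperderiv_fls n f =
     Abs_fls (\<lambda>m. of_int (int_choose (int n - m) n) * fls_nth f (m - int n))"

lemma hyperderiv_fls_nth:
  "fls_nth (hyperderiv_fls n f) (i + int n) = of_int (int_choose (- i) n) * fls_nth f i"
proof -
  have "fls_nth (hyperderiv_fls n f) m = of_int (int_choose (int n - m) n) * fls_nth f (m - int n)" for m
    unfolding hyperderiv_fls_def
    by (rule nth_Abs_fls_lower_bound[of "fls_subdegree f + int n"]) auto
  then show ?thesis by simp
qed

definition hyperderiv_family ::
    "('a::{field,finite} fls alg_closure \<Rightarrow> 'c::field) \<Rightarrow> (nat \<Rightarrow> 'c \<Rightarrow> 'c) \<Rightarrow> bool" where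
  "hyperderiv_family emb D \<longleftrightarrow>
     (\<forall>n. \<forall>x\<in>k_inf_sep emb. D n x \<in> k_inf_sep emb) \<and>
     (\<forall>x\<in>k_inf_sep emb. D 0 x = x) \<and>
     (\<forall>n. \<forall>x\<in>k_inf_sep emb. \<forall>y\<in>k_inf_sep emb. D n (x + y) = D n x + D n y) \<and>
     (\<forall>n. \<forall>c\<in>const_field emb. \<forall>x\<in>k_inf_sep emb. D n (c * x) = c * D n x) \<and>
     (\<forall>n. \<forall>x\<in>k_inf_sep emb. \<forall>y\<in>k_inf_sep emb.
        D n (x * y) = (\<Sum>i\<le>n. D i x * D (n - i) y)) \<and>
     (\<forall>n f. D n (emb (to_ac f)) = emb (to_ac (hyperderiv_fls n f)))"

text \<open>
  The extension exists and is unique on \<open>k\<^sub>\<infinity>\<^sup>s\<^sup>e\<^sup>p\<close>; values outside \<open>k\<^sub>\<infinity>\<^sup>s\<^sup>e\<^sup>p\<close> are irrelevant.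
\<close>

definition hyperderiv ::
    "('a::{field,finite} fls alg_closure \<Rightarrow> 'c::field) \<Rightarrow> nat \<Rightarrow> 'c \<Rightarrow> 'c" where
  "hyperderiv emb = (SOME D. hyperderiv_family emb D)"


section \<open>Arithmetic gamma values\<close>

text \<open>
  An element of \<open>\<int>\<^sub>p\<close> is given by its sequence of base-\<open>q\<close> digits.  The digits of a rational number
  \<open>s\<close> with denominator prime to \<open>p\<close> are characterised by \<open>s \<equiv> (\<Sum>i<N. d\<^sub>i q\<^sup>i)\<close> modulo \<open>q\<^sup>N \<int>\<^sub>p\<close> for all
  \<open>N\<close>; a rational number is in \<open>\<int>\<^sub>p\<close> iff its reduced denominator is coprime to \<open>q\<close>.
\<close>

definition qadic_digits :: "nat \<Rightarrow> rat \<Rightarrow> nat \<Rightarrow> nat" where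
  "qadic_digits q s = (THE d. (\<forall>i. d i < q) \<and>
     (\<forall>N. coprime (snd (quotient_of ((s - (\<Sum>i<N. of_nat (d i) * of_nat q ^ i)) / of_nat q ^ N)))
                  (int q)))"

definition arith_gamma_digits :: "(nat \<Rightarrow> nat) \<Rightarrow> 'a::{field,finite} fls" where
  "arith_gamma_digits s =
     prodinf (\<lambda>i. (\<Prod>j<i. 1 - fls_X_inv ^ (CARD('a) ^ j) / fls_X_inv ^ (CARD('a) ^ i)) ^ s i)"

definition arith_gamma :: "rat \<Rightarrow> 'a::{field,finite} fls" where
  "arith_gamma s = arith_gamma_digits (qadic_digits (CARD('a)) s)"


section \<open>Frobenius twists and \<open>\<Omega>\<^sub>l\<close>\<close>

text \<open>\<open>a\<close> to the power \<open>q\<^sup>m\<close>; for \<open>m < 0\<close> this is the unique \<open>q\<^sup>-\<^sup>m\<close>-th root of \<open>a\<close> in \<open>\<C>\<^sub>\<infinity>\<close>.\<close>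

definition frob_power :: "nat \<Rightarrow> int \<Rightarrow> 'c::field \<Rightarrow> 'c" where
  "frob_power q m a =
     (if m \<ge> 0 then a ^ (q ^ nat m) else (THE b. b ^ (q ^ nat (- m)) = a))"

text \<open>Only power series in \<open>t\<close> are ever twisted here, so \<open>'c fps\<close> is used instead of \<open>'c fls\<close>.\<close>

definition twist :: "nat \<Rightarrow> int \<Rightarrow> 'c::field fps \<Rightarrow> 'c fps" where
  "twist q m f = Abs_fps (\<lambda>i. frob_power q m (fps_nth f i))"

text \<open>
  The product is the coefficientwise limit in \<open>\<C>\<^sub>\<infinity>\<close> of the partial products; it does not converge
  for the \<open>t\<close>-adic metric which the library puts on \<open>fps\<close>.  The argument \<open>r\<close> is the chosen
  \<open>(q\<^sup>l - 1)\<close>-th root of \<open>-\<theta>\<close>.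
\<close>

definition Omega ::
    "('a::{field,finite} fls alg_closure \<Rightarrow> 'c::{field,complete_space}) \<Rightarrow> nat \<Rightarrow> 'c \<Rightarrow> 'c fps" where
  "Omega emb l r =
     fps_const (inverse (r ^ (CARD('a) ^ l))) *
     Abs_fps (\<lambda>n. lim (\<lambda>N. fps_nth
       (\<Prod>i=1..N. 1 - fps_const (1 / theta emb ^ (CARD('a) ^ (i * l))) * fps_X) n))"

definition fps_value :: "'c::{field,complete_space} fps \<Rightarrow> 'c \<Rightarrow> 'c" where
  "fps_value f x = suminf (\<lambda>n. fps_nth f n * x ^ n)"

end

theory Submission
  imports Defs
begin

text \<open>
  Write \<open>z = 1/\<theta>\<close> and, for \<open>1 \<le> c \<le> l\<close>, let \<open>P\<^sub>c = \<Prod>\<^sub>m (1 - \<theta> z\<^bsup>w(c,m)\<^esup>)\<close> with \<open>w(c,m) = q\<^bsup>c+lm\<^esup>\<close>, \<open>m \<ge> 0\<close>.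
  Both families of values are made from these \<open>l\<close> products.  The base-\<open>q\<close> digits of \<open>q\<^sup>j/(1 - q\<^sup>l)\<close> are \<open>1\<close> at
  the places congruent to \<open>j\<close> modulo \<open>l\<close> and \<open>0\<close> elsewhere, which gives \<open>\<Gamma>\<^sub>j\<^sub>+\<^sub>1 = P\<^sub>j\<^sub>+\<^sub>1 \<Gamma>\<^sub>j\<^sup>q\<close> with indices modulo \<open>l\<close>
  (\<open>arith_gamma_relation\<close>), and \<open>\<Omega>\<^sub>l\<^bsup>(-j)\<^esup>(\<theta>)\<close> is \<open>P\<^sub>l\<^sub>-\<^sub>j\<close> times a power of an algebraic number (\<open>Omega_value\<close>).
  Taylor expansion \<open>f \<mapsto> \<Sum> \<partial>\<^sup>(\<^sup>i\<^sup>)f \<epsilon>\<^sup>i\<close> is a ring homomorphism, so the hyperderivatives of the \<open>P\<^sub>c\<close> up to order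
  \<open>n\<close> lie in the field generated by either family.

  The hyperderivatives of \<open>P\<^sub>c\<close> are replaced by its jets \<open>y\<^sub>c\<^sub>,\<^sub>k\<close>, the coefficients of
  \<open>\<Prod>\<^sub>m (1 - (\<theta> + \<epsilon>) z\<^bsup>w(c,m)\<^esup>)\<close>, where \<open>z\<close> stays fixed.  The Taylor expansion of \<open>z\<^bsup>w(c,m)\<^esup>\<close> is constant modulo
  \<open>\<epsilon>\<^bsup>w(c,m)\<^esup>\<close>; hence, modulo \<open>\<epsilon>\<^sup>n\<^sup>+\<^sup>1\<close>, only finitely many factors distinguish the jets from the Taylor
  coefficients, and the jets with \<open>k \<le> n\<close> lie in the same fields (\<open>jetval_in_field\<close>).  Each field has at most
  \<open>l(n+1)\<close> generators and contains \<open>l(n+1)\<close> jets.  So the theorem follows once the jets are known to be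
  algebraically independent over \<open>k\<close>; independence passes to the algebraic closure of \<open>k\<close> by a dimension count
  (\<open>aindep_algebraic\<close>), which also bounds the transcendence degree by the number of generators
  (\<open>aindep_card_le\<close>).

  Independence over \<open>k\<close> (\<open>jetval_independent\<close>) is proved by a variant of Mahler's method.  Let \<open>Y\<^sub>c\<^sub>,\<^sub>k(t,z)\<close> be the
  jets with a variable \<open>t\<close> in place of \<open>\<theta>\<close>.  Splitting off the first \<open>j\<close> factors of the products expresses
  \<open>Y(t,z)\<close> by \<open>Y(t,z\<^bsup>q\<^sup>l\<^sup>j\<^esup>)\<close> through a triangular linear substitution \<open>A\<close> (\<open>jet_add\<close>).

  The functions are independent (\<open>function_rel_imp_0\<close>): a relation \<open>R(t,Y) = 0\<close> can be carried from \<open>z\<close> to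
  \<open>z\<^bsup>q\<^sup>l\<^sup>j\<^esup>\<close> by this functional equation and also by the Frobenius twist, which fixes \<open>t\<close>.  Cancelling a leading
  term between the two results shows that for a minimal \<open>R\<close> they are proportional, \<open>R(AX) \<sim> R\<^sup>\<sigma>(X)\<close>.
  The factor on the right vanishes at the zeros \<open>t = \<theta>\<^bsup>w(c,m)\<^esup>\<close> of a product, whereas there \<open>A\<close> is
  invertible apart from the variable \<open>X\<^sub>c\<^sub>,\<^sub>0\<close>.  So \<open>X\<^sub>c\<^sub>,\<^sub>0\<close> divides \<open>R\<close>, and can be cancelled.

  The values inherit this (\<open>value_rel_imp_0\<close>): from a relation \<open>R(y) = 0\<close> with coefficients in \<open>\<F>\<^sub>q[\<theta>]\<close> one constructs by
  the pigeonhole principle a combination of monomials in the \<open>Y(t,z\<^sup>Q)\<close> which is a multiple of a power of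
  \<open>R(y)\<close> at the points \<open>t = \<theta>\<^bsup>q\<^sup>l\<^sup>\<mu>\<^esup>\<close>.  A Schwarz lemma shows that all its coefficients are
  small.  Sorting the powers of \<open>\<theta>\<close> modulo \<open>Q\<close> turns it into an approximate relation between the functions, of a shape
  that does not depend on the precision; hence there is an exact one.

  Finally, the hyperderivatives have to be extended to \<open>k\<^sub>\<infinity>\<^sup>s\<^sup>e\<^sup>p\<close>.  For \<open>Q = q\<^sup>N\<close> every separable \<open>x\<close> is uniquely
  \<open>\<Sum>\<^sub>e\<^sub><\<^sub>Q \<theta>\<^sup>e y\<^sub>e\<^sup>Q\<close> with separable \<open>y\<^sub>e\<close>, and its Taylor series modulo \<open>\<epsilon>\<^sup>Q\<close> must be \<open>\<Sum> (\<theta> + \<epsilon>)\<^sup>e y\<^sub>e\<^sup>Q\<close>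
  (\<open>hyperderiv_family_exists\<close>).
\<close>

section \<open>The Frobenius endomorphism\<close>

lemma finite_field_power_card:
  fixes x :: "'a::{field,finite}"
  shows "x ^ CARD('a) = x"
proof (cases "x = 0")
  case False
  let ?U = "UNIV - {0 :: 'a}"
  have "(\<Prod>y\<in>?U. y) = (\<Prod>y\<in>?U. x * y)"
    by (rule prod.reindex_bij_witness[of _ "\<lambda>y. x * y" "\<lambda>y. y / x"]) (use False in auto)
  also have "\<dots> = x ^ (CARD('a) - 1) * (\<Prod>y\<in>?U. y)"
    by (simp add: prod.distrib card_Diff_singleton)
  finally have "x ^ (CARD('a) - 1) = 1" by (simp add: prod_zero_iff)
  then show ?thesis using power_minus_mult[of "CARD('a)" x] finite_UNIV_card_ge_0[where 'a='a] by simp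
qed (simp add: finite_UNIV_card_ge_0)

lemma card_ge_2: "CARD('a::{field,finite}) \<ge> 2"
proof -
  have "card {0, 1 :: 'a} \<le> CARD('a)" by (rule card_mono) auto
  then show ?thesis by simp
qed

text \<open>The polynomial \<open>(1 + X)\<^sup>q - X\<^sup>q - 1\<close> has degree less than \<open>q\<close> and vanishes on all \<open>q\<close> elements of the field.\<close>

lemma finite_field_binomial_zero:
  assumes "0 < i" "i < CARD('a)"
  shows "of_nat (CARD('a) choose i) = (0::'a::{field,finite})"
proof -
  let ?q = "CARD('a)"
  define p where "p = [:1, 1 :: 'a:] ^ ?q - (monom 1 ?q + 1)"
  have c: "poly.coeff p j = of_nat (?q choose j) - (if j = ?q then 1 else 0) - (if j = 0 then 1 else 0)" for j
  proof (cases "j \<le> ?q")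
    case False
    have "Polynomial.degree ([:1, 1 :: 'a:] ^ ?q) < j"
      using False degree_power_le[of "[:1, 1 :: 'a:]" ?q] by simp
    then have "poly.coeff ([:1, 1 :: 'a:] ^ ?q) j = 0" by (rule coeff_eq_0)
    with False show ?thesis unfolding p_def by (auto simp: binomial_eq_0)
  qed (auto simp: p_def coeff_linear_poly_power)
  have q2: "?q \<ge> 2" by (rule card_ge_2)
  have "p = 0"
  proof (rule ccontr)
    assume "p \<noteq> 0"
    have "poly p x = 0" for x
      by (simp add: p_def poly_monom finite_field_power_card)
    then have "{x. poly p x = 0} = UNIV" by auto
    then have "?q \<le> Polynomial.degree p" using card_poly_roots_bound[OF \<open>p \<noteq> 0\<close>] by simp
    moreover have "Polynomial.degree p < ?q"
    proof (rule degree_lessI)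
      show "p \<noteq> 0 \<or> ?q > 0" using q2 by auto
      show "\<forall>k\<ge>?q. poly.coeff p k = 0" using q2 by (auto simp: c binomial_eq_0)
    qed
    ultimately show False by simp
  qed
  then have "poly.coeff p i = 0" by simp
  with assms show ?thesis by (simp add: c)
qed

text \<open>The rings in question are Laurent series over \<open>\<F>\<^sub>q\<close>, their algebraic closure, \<open>\<C>\<^sub>\<infinity>\<close>, and polynomials and power series
  over these; what they share is the characteristic.\<close>

lemma frobenius_add:
  fixes x y :: "'r::comm_ring_1"
  assumes "CHAR('r) = CHAR('a::{field,finite})"
  shows "(x + y) ^ CARD('a) = x ^ CARD('a) + y ^ CARD('a)"
proof -
  let ?q = "CARD('a)"
  have q2: "?q \<ge> 2" by (rule card_ge_2)
  have "(x + y) ^ ?q = (\<Sum>k\<le>?q. of_nat (?q choose k) * x ^ k * y ^ (?q - k))"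
    by (rule binomial_ring)
  also have "\<dots> = (\<Sum>k\<in>{0,?q}. of_nat (?q choose k) * x ^ k * y ^ (?q - k))"
  proof (rule sum.mono_neutral_right)
    show "\<forall>i\<in>{..?q} - {0, ?q}. of_nat (?q choose i) * x ^ i * y ^ (?q - i) = 0"
    proof
      fix i assume "i \<in> {..?q} - {0, ?q}"
      then have "of_nat (?q choose i) = (0::'a)"
        by (intro finite_field_binomial_zero) auto
      then have "of_nat (?q choose i) = (0::'r)"
        by (simp add: of_nat_eq_0_iff_char_dvd assms)
      then show "of_nat (?q choose i) * x ^ i * y ^ (?q - i) = 0" by simp
    qed
  qed auto
  also have "\<dots> = x ^ ?q + y ^ ?q" using q2 by simp
  finally show ?thesis .
qed

lemma frobenius_pow_add:
  fixes x y :: "'r::comm_ring_1"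
  assumes "CHAR('r) = CHAR('a::{field,finite})"
  shows "(x + y) ^ (CARD('a) ^ m) = x ^ (CARD('a) ^ m) + y ^ (CARD('a) ^ m)"
proof (induction m)
  case (Suc m)
  have e: "z ^ (CARD('a) ^ Suc m) = (z ^ (CARD('a) ^ m)) ^ CARD('a)" for z :: 'r
    by (metis power_Suc2 power_mult)
  show ?case unfolding e Suc.IH by (rule frobenius_add[OF assms])
qed simp

lemma frobenius_pow_pos: "CARD('a::{field,finite}) ^ m > 0"
  using card_ge_2[where 'a='a] by simp

lemma frobenius_pow_sum:
  fixes f :: "'i \<Rightarrow> 'r::comm_ring_1"
  assumes "CHAR('r) = CHAR('a::{field,finite})"
  shows "(\<Sum>i\<in>S. f i) ^ (CARD('a) ^ m) = (\<Sum>i\<in>S. f i ^ (CARD('a) ^ m))"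
  by (induction S rule: infinite_finite_induct)
     (simp_all add: frobenius_pow_add[OF assms] frobenius_pow_pos power_0_left)

lemma frobenius_pow_uminus:
  fixes x :: "'r::comm_ring_1"
  assumes "CHAR('r) = CHAR('a::{field,finite})"
  shows "(- x) ^ (CARD('a) ^ m) = - (x ^ (CARD('a) ^ m))"
proof -
  have "(- x) ^ (CARD('a) ^ m) + x ^ (CARD('a) ^ m) = 0"
    by (subst frobenius_pow_add[OF assms, symmetric]) (simp add: frobenius_pow_pos power_0_left)
  then show ?thesis by (simp add: eq_neg_iff_add_eq_0)
qed

lemma frobenius_pow_diff:
  fixes x y :: "'r::comm_ring_1"
  assumes "CHAR('r) = CHAR('a::{field,finite})"
  shows "(x - y) ^ (CARD('a) ^ m) = x ^ (CARD('a) ^ m) - y ^ (CARD('a) ^ m)"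
  using frobenius_pow_add[OF assms, of x "- y" m] by (simp add: frobenius_pow_uminus[OF assms])

lemma frobenius_pow_inj:
  fixes x y :: "'r::idom"
  assumes "CHAR('r) = CHAR('a::{field,finite})" and "x ^ (CARD('a) ^ m) = y ^ (CARD('a) ^ m)"
  shows "x = y"
proof -
  have "(x - y) ^ (CARD('a) ^ m) = 0" using assms by (simp add: frobenius_pow_diff)
  then show ?thesis by simp
qed

lemma finite_field_power_card_pow:
  fixes x :: "'a::{field,finite}"
  shows "x ^ (CARD('a) ^ m) = x"
  by (induction m) (simp_all add: power_mult finite_field_power_card)

section \<open>Lower bounds for the order of a Laurent series\<close>

text \<open>The library has \<open>fls_subdegree 0 = 0\<close>; here \<open>0\<close> has every order, so that estimates need no case distinction.\<close>

definition ord_ge :: "'a::zero fls \<Rightarrow> int \<Rightarrow> bool" where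
  "ord_ge f k \<longleftrightarrow> (\<forall>i<k. fls_nth f i = 0)"

lemma ord_ge_iff_subdegree: "ord_ge f k \<longleftrightarrow> f = 0 \<or> k \<le> fls_subdegree f"
  unfolding ord_ge_def by (metis fls_eq0_below_subdegree fls_zero_nth le_less_linear linorder_not_le
      nth_fls_subdegree_nonzero order_less_le_trans)

lemma ord_ge_0 [simp]: "ord_ge 0 k" by (simp add: ord_ge_def)
lemma ord_ge_mono: "ord_ge f k \<Longrightarrow> j \<le> k \<Longrightarrow> ord_ge f j" by (simp add: ord_ge_def)
lemma ord_ge_add: "ord_ge f k \<Longrightarrow> ord_ge g k \<Longrightarrow> ord_ge (f + g) k" by (simp add: ord_ge_def)
lemma ord_ge_diff: "ord_ge f k \<Longrightarrow> ord_ge g k \<Longrightarrow> ord_ge ((f::'a::ab_group_add fls) - g) k" by (simp add: ord_ge_def)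
lemma ord_ge_uminus: "ord_ge f k \<Longrightarrow> ord_ge (- (f::'a::ab_group_add fls)) k" by (simp add: ord_ge_def)
lemma ord_ge_sum: "(\<And>i. i \<in> S \<Longrightarrow> ord_ge (f i) k) \<Longrightarrow> ord_ge (\<Sum>i\<in>S. f i) k"
  by (induction S rule: infinite_finite_induct) (auto intro: ord_ge_add)
lemma ord_ge_mult: "ord_ge f a \<Longrightarrow> ord_ge g b \<Longrightarrow> ord_ge ((f::'a::idom fls) * g) (a + b)"
  by (cases "f = 0"; cases "g = 0") (simp_all add: ord_ge_iff_subdegree)
lemma ord_ge_1 [simp]: "k \<le> 0 \<Longrightarrow> ord_ge (1 :: 'a::zero_neq_one fls) k" by (simp add: ord_ge_def)
lemma ord_ge_const [simp]: "k \<le> 0 \<Longrightarrow> ord_ge (fls_const c) k" by (simp add: ord_ge_def)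
lemma ord_ge_power: "ord_ge f a \<Longrightarrow> ord_ge ((f::'a::idom fls) ^ n) (int n * a)"
  by (induction n) (auto simp: algebra_simps dest: ord_ge_mult)
lemma ord_ge_mult0: "ord_ge f 0 \<Longrightarrow> ord_ge g k \<Longrightarrow> ord_ge ((f::'a::idom fls) * g) k"
  using ord_ge_mult[of f 0 g k] by simp
lemma ord_ge_power0: "ord_ge f 0 \<Longrightarrow> ord_ge ((f::'a::idom fls) ^ n) 0"
  using ord_ge_power[of f 0 n] by simp
lemma ord_ge_prod0: "(\<And>i. i \<in> S \<Longrightarrow> ord_ge (f i) 0) \<Longrightarrow> ord_ge (\<Prod>i\<in>S. f i :: 'a::idom fls) 0"
  by (induction S rule: infinite_finite_induct) (auto intro: ord_ge_mult0)
lemma ord_ge_all_imp_0: "(\<And>k. ord_ge f k) \<Longrightarrow> f = 0"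
  by (rule fls_zero_eqI) (metis ord_ge_def less_add_one)
lemma ord_ge_X_power: "k \<le> int n \<Longrightarrow> ord_ge (fls_X ^ n :: 'a::idom fls) k" by (auto simp: ord_ge_def)
lemma ord_ge_X_inv_power: "k \<le> - int n \<Longrightarrow> ord_ge (fls_X_inv ^ n :: 'a::idom fls) k" by (auto simp: ord_ge_def)
lemma ord_ge_exists: "\<exists>k. ord_ge f k" by (auto simp: ord_ge_iff_subdegree)
lemma ord_ge_cancel:
  fixes f a :: "'a::idom fls"
  assumes "ord_ge (f * a) k" "a \<noteq> 0" "fls_subdegree a \<le> 0"
  shows "ord_ge f k"
  using assms by (cases "f = 0") (simp_all add: ord_ge_iff_subdegree)

lemma fls_nth_sum: "fls_nth (\<Sum>i\<in>S. f i) k = (\<Sum>i\<in>S. fls_nth (f i) k)"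
  by (induction S rule: infinite_finite_induct) auto

lemma fls_truncate_split:
  fixes f :: "'a::comm_ring_1 fls"
  assumes "ord_ge f d"
  shows "ord_ge (f - (\<Sum>i\<in>{d..<e}. fls_const (fls_nth f i) * fls_X_intpow i)) e"
  unfolding ord_ge_def
proof (intro allI impI)
  fix k assume "k < e"
  have "fls_nth (\<Sum>i\<in>{d..<e}. fls_const (fls_nth f i) * fls_X_intpow i) k
      = (\<Sum>i\<in>{d..<e}. if k = i then fls_nth f i else 0)"
    by (simp add: fls_nth_sum if_distrib mult.commute cong: if_cong)
  also have "\<dots> = fls_nth f k" using assms \<open>k < e\<close> by (simp add: ord_ge_def)
  finally show "fls_nth (f - (\<Sum>i\<in>{d..<e}. fls_const (fls_nth f i) * fls_X_intpow i)) k = 0" by simp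
qed

lemma fls_X_inv_X_power: "(fls_X_inv ^ n :: 'a::field fls) * fls_X ^ n = 1"
  by (simp add: fls_X_inv_power_times_conv_shift fls_X_power_conv_shift_1)

lemma CHAR_fls: "CHAR('a::{field,finite} fls) = CHAR('a)" by simp

text \<open>The coefficients lie in \<open>\<F>\<^sub>q\<close>, so raising a Laurent series to the power \<open>q\<^sup>m\<close> is the
  substitution \<open>z \<mapsto> z^q\<^sup>m\<close>.\<close>

lemma fls_nth_frobenius:
  fixes f :: "'a::{field,finite} fls"
  shows "fls_nth (f ^ (CARD('a) ^ m)) k =
           (if int (CARD('a) ^ m) dvd k then fls_nth f (k div int (CARD('a) ^ m)) else 0)"
proof -
  define Q where "Q = CARD('a) ^ m"
  have Q: "Q > 0" by (simp add: Q_def frobenius_pow_pos)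
  obtain d where d: "ord_ge f d" using ord_ge_exists by blast
  define e where "e = \<bar>k\<bar> + 1"
  define S where "S = (\<Sum>i\<in>{d..<e}. fls_const (fls_nth f i) * fls_X_intpow i)"
  have "ord_ge (f - S) e" unfolding S_def by (rule fls_truncate_split[OF d])
  then have "ord_ge ((f - S) ^ Q) (int Q * e)" by (rule ord_ge_power)
  moreover have "k < int Q * e"
  proof -
    have "k < 1 * e" by (simp add: e_def)
    also have "1 * e \<le> int Q * e" using Q by (intro mult_right_mono) (auto simp: e_def)
    finally show ?thesis .
  qed
  ultimately have "fls_nth (f ^ Q - S ^ Q) k = 0"
    using frobenius_pow_diff[where 'a='a, OF CHAR_fls, of f S m] by (simp add: ord_ge_def Q_def)
  then have "fls_nth (f ^ Q) k = fls_nth (S ^ Q) k" by simp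
  also have "S ^ Q = (\<Sum>i\<in>{d..<e}. (fls_const (fls_nth f i) * fls_X_intpow i) ^ Q)"
    unfolding S_def Q_def by (rule frobenius_pow_sum) simp
  also have "\<dots> = (\<Sum>i\<in>{d..<e}. fls_const (fls_nth f i) * fls_X_intpow (int Q * i))"
    by (intro sum.cong refl)
       (simp add: power_mult_distrib fls_const_power[symmetric] Q_def finite_field_power_card_pow fls_X_intpow_power del: fls_shift_nth of_nat_power)
  also have "fls_nth \<dots> k = (\<Sum>i\<in>{d..<e}. if int Q * i = k then fls_nth f i else 0)"
    by (simp add: fls_nth_sum if_distrib mult.commute cong: if_cong) (rule sum.cong, auto)
  also have "\<dots> = (if int Q dvd k then fls_nth f (k div int Q) else 0)"
  proof (cases "int Q dvd k")
    case False
    then have "int Q * i \<noteq> k" for i by auto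
    with False show ?thesis by simp
  next
    case True
    then obtain j where j: "k = int Q * j" by auto
    have "\<bar>j\<bar> \<le> \<bar>k\<bar>" unfolding j abs_mult using Q by (simp add: mult_le_cancel_right1)
    then have "j < e" by (simp add: e_def)
    have "(\<Sum>i\<in>{d..<e}. if int Q * i = k then fls_nth f i else 0) = (\<Sum>i\<in>{d..<e}. if j = i then fls_nth f i else 0)"
      using Q j by (intro sum.cong) auto
    also have "\<dots> = fls_nth f j" using d \<open>j < e\<close> by (simp add: ord_ge_def)
    finally show ?thesis using j Q by simp
  qed
  finally show ?thesis by (simp add: Q_def)
qed

section \<open>Multivariate polynomials\<close>

text \<open>Evaluations, Frobenius powers, Taylor expansions and embeddings of fields are all moved past polynomials as such maps.\<close>

definition rhom :: "('r::comm_ring_1 \<Rightarrow> 's::comm_ring_1) \<Rightarrow> bool" where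
  "rhom \<phi> \<longleftrightarrow> \<phi> 0 = 0 \<and> \<phi> 1 = 1 \<and> (\<forall>x y. \<phi> (x + y) = \<phi> x + \<phi> y) \<and> (\<forall>x y. \<phi> (x * y) = \<phi> x * \<phi> y)"

lemma rhom_0: "rhom \<phi> \<Longrightarrow> \<phi> 0 = 0" and rhom_1: "rhom \<phi> \<Longrightarrow> \<phi> 1 = 1"
  and rhom_add: "rhom \<phi> \<Longrightarrow> \<phi> (x + y) = \<phi> x + \<phi> y"
  and rhom_mult: "rhom \<phi> \<Longrightarrow> \<phi> (x * y) = \<phi> x * \<phi> y"
  by (simp_all add: rhom_def)
lemma rhom_uminus: "rhom \<phi> \<Longrightarrow> \<phi> (- x) = - \<phi> x"
  using rhom_add[of \<phi> "- x" x] by (simp add: rhom_0 eq_neg_iff_add_eq_0)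
lemma rhom_diff: "rhom \<phi> \<Longrightarrow> \<phi> (x - y) = \<phi> x - \<phi> y"
  using rhom_add[of \<phi> x "- y"] by (simp add: rhom_uminus)
lemma rhom_power: "rhom \<phi> \<Longrightarrow> \<phi> (x ^ n) = \<phi> x ^ n"
  by (induction n) (auto simp: rhom_def)
lemma rhom_sum: "rhom \<phi> \<Longrightarrow> \<phi> (\<Sum>i\<in>S. f i) = (\<Sum>i\<in>S. \<phi> (f i))"
  by (induction S rule: infinite_finite_induct) (auto simp: rhom_def)
lemma rhom_prod: "rhom \<phi> \<Longrightarrow> \<phi> (\<Prod>i\<in>S. f i) = (\<Prod>i\<in>S. \<phi> (f i))"
  by (induction S rule: infinite_finite_induct) (auto simp: rhom_def)
lemma rhom_id: "rhom (\<lambda>x. x)" by (simp add: rhom_def)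
lemma rhom_comp: "rhom \<phi> \<Longrightarrow> rhom \<psi> \<Longrightarrow> rhom (\<lambda>x. \<psi> (\<phi> x))" by (simp add: rhom_def)

definition mmon :: "('i \<Rightarrow> 's::comm_monoid_mult) \<Rightarrow> ('i \<Rightarrow>\<^sub>0 nat) \<Rightarrow> 's" where
  "mmon x m = (\<Prod>i\<in>Poly_Mapping.keys m. x i ^ Poly_Mapping.lookup m i)"

text \<open>Mapping the coefficients by \<open>\<phi>\<close> makes substitution of polynomials (\<open>\<phi> = cst\<close>) and base change special cases of
  evaluation.\<close>

definition mev :: "('r \<Rightarrow> 's) \<Rightarrow> ('i \<Rightarrow> 's) \<Rightarrow> (('i \<Rightarrow>\<^sub>0 nat) \<Rightarrow>\<^sub>0 'r::zero) \<Rightarrow> 's::comm_semiring_1" where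
  "mev \<phi> x P = (\<Sum>m\<in>Poly_Mapping.keys P. \<phi> (Poly_Mapping.lookup P m) * mmon x m)"

abbreviation cst :: "'r \<Rightarrow> (('i \<Rightarrow>\<^sub>0 nat) \<Rightarrow>\<^sub>0 'r::zero)" where
  "cst c \<equiv> Poly_Mapping.single 0 c"

abbreviation mvar :: "'i \<Rightarrow> (('i \<Rightarrow>\<^sub>0 nat) \<Rightarrow>\<^sub>0 'r::zero_neq_one)" where
  "mvar i \<equiv> Poly_Mapping.single (Poly_Mapping.single i 1) 1"

lemma mmon_superset:
  assumes "finite S" "Poly_Mapping.keys m \<subseteq> S"
  shows "mmon x m = (\<Prod>i\<in>S. x i ^ Poly_Mapping.lookup m i)"
  unfolding mmon_def
  by (rule prod.mono_neutral_left) (use assms in \<open>auto simp: in_keys_iff\<close>)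

lemma mmon_0 [simp]: "mmon x 0 = 1" by (simp add: mmon_def)
lemma mmon_add: "mmon x (m + n) = mmon x m * mmon x n"
proof -
  let ?S = "Poly_Mapping.keys m \<union> Poly_Mapping.keys n"
  have "Poly_Mapping.keys (m + n) \<subseteq> ?S" by (rule Poly_Mapping.keys_add)
  then show ?thesis
    by (simp add: mmon_superset[of ?S] lookup_add power_add prod.distrib)
qed
lemma mmon_single [simp]: "mmon x (Poly_Mapping.single i k) = x i ^ k"
  by (cases "k = 0") (simp_all add: mmon_def)
lemma rhom_mmon: "rhom \<phi> \<Longrightarrow> \<phi> (mmon x m) = mmon (\<lambda>i. \<phi> (x i)) m"
  by (simp add: mmon_def rhom_prod rhom_power)
lemma mmon_power: "mmon x m ^ n = mmon (\<lambda>i. (x i :: 's::comm_semiring_1) ^ n) m"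
  by (simp add: mmon_def prod_power_distrib power_mult[symmetric] mult.commute[of n])

lemma mev_superset:
  assumes "\<phi> 0 = 0" "finite S" "Poly_Mapping.keys P \<subseteq> S"
  shows "mev \<phi> x P = (\<Sum>m\<in>S. \<phi> (Poly_Mapping.lookup P m) * mmon x m)"
  unfolding mev_def
  by (rule sum.mono_neutral_left) (use assms in \<open>auto simp: in_keys_iff\<close>)

lemma mev_0 [simp]: "mev \<phi> x 0 = 0" by (simp add: mev_def)

lemma mev_single: "\<phi> 0 = 0 \<Longrightarrow> mev \<phi> x (Poly_Mapping.single m c) = \<phi> c * mmon x m"
  by (simp add: mev_def)

lemma mev_add:
  assumes "rhom \<phi>" shows "mev \<phi> x (P + P') = mev \<phi> x P + mev \<phi> x P'"
proof -
  let ?S = "Poly_Mapping.keys P \<union> Poly_Mapping.keys P'"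
  have "Poly_Mapping.keys (P + P') \<subseteq> ?S" by (rule Poly_Mapping.keys_add)
  then show ?thesis using assms
    by (simp add: mev_superset[of \<phi> ?S] rhom_0 lookup_add rhom_add distrib_right sum.distrib)
qed

lemma mev_sum:
  assumes "rhom \<phi>" shows "mev \<phi> x (\<Sum>i\<in>S. P i) = (\<Sum>i\<in>S. mev \<phi> x (P i))"
  by (induction S rule: infinite_finite_induct) (auto simp: mev_add[OF assms])

lemma poly_mapping_sum_single:
  "P = (\<Sum>m\<in>Poly_Mapping.keys P. Poly_Mapping.single m (Poly_Mapping.lookup P m))"
proof (rule poly_mapping_eqI)
  fix k
  have "Poly_Mapping.lookup (\<Sum>m\<in>Poly_Mapping.keys P. Poly_Mapping.single m (Poly_Mapping.lookup P m)) k
      = (\<Sum>m\<in>Poly_Mapping.keys P. if m = k then Poly_Mapping.lookup P k else 0)"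
    by (simp add: lookup_sum lookup_single when_def)
  then show "Poly_Mapping.lookup P k =
      Poly_Mapping.lookup (\<Sum>m\<in>Poly_Mapping.keys P. Poly_Mapping.single m (Poly_Mapping.lookup P m)) k"
    by (simp add: in_keys_iff)
qed

lemma mev_mult:
  assumes "rhom \<phi>" shows "mev \<phi> x (P * P') = mev \<phi> x P * mev \<phi> x P'"
proof -
  have \<phi>0: "\<phi> 0 = 0" using assms by (rule rhom_0)
  have "P * P' = (\<Sum>m\<in>Poly_Mapping.keys P. \<Sum>n\<in>Poly_Mapping.keys P'.
      Poly_Mapping.single (m + n) (Poly_Mapping.lookup P m * Poly_Mapping.lookup P' n))"
    by (subst (1) poly_mapping_sum_single[of P], subst (1) poly_mapping_sum_single[of P'])
       (simp add: sum_product mult_single)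
  then have "mev \<phi> x (P * P') = (\<Sum>m\<in>Poly_Mapping.keys P. \<Sum>n\<in>Poly_Mapping.keys P'.
      (\<phi> (Poly_Mapping.lookup P m) * mmon x m) * (\<phi> (Poly_Mapping.lookup P' n) * mmon x n))"
    by (simp add: mev_sum[OF assms] mev_single \<phi>0 mmon_add rhom_mult[OF assms] mult_ac)
  also have "\<dots> = mev \<phi> x P * mev \<phi> x P'" unfolding mev_def by (simp add: sum_product)
  finally show ?thesis .
qed

lemma rhom_mev:
  assumes "rhom \<phi>" shows "rhom (mev \<phi> x)"
  unfolding rhom_def
  using assms by (auto simp: mev_add mev_mult mev_single rhom_0 rhom_1 simp flip: single_one)

lemma rhom_cst: "rhom (cst :: 'r::comm_ring_1 \<Rightarrow> (('i \<Rightarrow>\<^sub>0 nat) \<Rightarrow>\<^sub>0 'r))"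
  by (auto simp: rhom_def single_add mult_single)

lemma mev_cst: "\<phi> 0 = 0 \<Longrightarrow> mev \<phi> x (cst c) = \<phi> c" by (simp add: mev_single)
lemma mev_mvar: "\<phi> 0 = 0 \<Longrightarrow> \<phi> 1 = 1 \<Longrightarrow> mev \<phi> x (mvar i) = x i" by (simp add: mev_single)

lemma rhom_mev_comp:
  assumes "rhom \<psi>" shows "\<psi> (mev \<phi> x P) = mev (\<lambda>c. \<psi> (\<phi> c)) (\<lambda>i. \<psi> (x i)) P"
  unfolding mev_def using assms by (simp add: rhom_sum rhom_mult rhom_mmon)

lemma mev_subst:
  assumes "rhom \<psi>"
  shows "mev \<psi> y (mev cst g P) = mev \<psi> (\<lambda>i. mev \<psi> y (g i)) P"
  by (subst rhom_mev_comp[OF rhom_mev[OF assms]]) (simp add: mev_cst rhom_0[OF assms])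

lemma mmon_mvar: "mmon mvar m = Poly_Mapping.single m (1 :: 'r::comm_ring_1)"
proof -
  have pw: "(mvar i :: ('i \<Rightarrow>\<^sub>0 nat) \<Rightarrow>\<^sub>0 'r) ^ k = Poly_Mapping.single (Poly_Mapping.single i k) 1" for i k
    by (induction k) (simp_all add: mult_single single_add[symmetric])
  have "(\<Prod>i\<in>S. Poly_Mapping.single (Poly_Mapping.single i (f i)) (1::'r)) =
      Poly_Mapping.single (\<Sum>i\<in>S. Poly_Mapping.single i (f i)) 1" for S :: "'i set" and f
    by (induction S rule: infinite_finite_induct) (auto simp: mult_single)
  then have "mmon mvar m = Poly_Mapping.single (\<Sum>i\<in>Poly_Mapping.keys m. Poly_Mapping.single i (Poly_Mapping.lookup m i)) (1::'r)"
    by (simp add: mmon_def pw del: One_nat_def)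
  then show ?thesis using poly_mapping_sum_single[of m] by simp
qed

lemma mev_map:
  assumes "rhom \<phi>" "\<psi> 0 = 0"
  shows "mev \<phi> x (Poly_Mapping.map \<psi> P) = mev (\<lambda>c. \<phi> (\<psi> c)) x P"
proof -
  have "Poly_Mapping.keys (Poly_Mapping.map \<psi> P) \<subseteq> Poly_Mapping.keys P"
    by (auto simp: in_keys_iff map.rep_eq when_def split: if_splits)
  then have "mev \<phi> x (Poly_Mapping.map \<psi> P) = (\<Sum>m\<in>Poly_Mapping.keys P. \<phi> (Poly_Mapping.lookup (Poly_Mapping.map \<psi> P) m) * mmon x m)"
    by (intro mev_superset) (auto simp: rhom_0 assms)
  also have "\<dots> = mev (\<lambda>c. \<phi> (\<psi> c)) x P" unfolding mev_def
    by (intro sum.cong) (auto simp: map.rep_eq when_def in_keys_iff)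
  finally show ?thesis .
qed

lemma lookup_map: "\<psi> 0 = 0 \<Longrightarrow> Poly_Mapping.lookup (Poly_Mapping.map \<psi> P) m = \<psi> (Poly_Mapping.lookup P m)"
  by (auto simp: map.rep_eq when_def)

lemma lookup_cst_mult: "Poly_Mapping.lookup (cst c * P) m = c * Poly_Mapping.lookup P m" for P :: "('i \<Rightarrow>\<^sub>0 nat) \<Rightarrow>\<^sub>0 'r::comm_ring_1"
  by (simp flip: mult_map_scale_conv_mult add: lookup_map)

section \<open>Weights of monomials and leading terms\<close>

text \<open>The variable \<open>(c, k)\<close> stands for the \<open>k\<close>-th jet of the \<open>c\<close>-th product and has weight \<open>k + 1\<close>.  The functional equation
  sends it to a combination of the \<open>(c, k - i)\<close>, so lower jets count less; the summand \<open>1\<close> gives every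
  nonconstant monomial a positive weight.\<close>

definition wt :: "(nat \<times> nat \<Rightarrow>\<^sub>0 nat) \<Rightarrow> nat" where
  "wt m = (\<Sum>i\<in>Poly_Mapping.keys m. Suc (snd i) * Poly_Mapping.lookup m i)"

lemma wt_superset:
  assumes "finite S" "Poly_Mapping.keys m \<subseteq> S"
  shows "wt m = (\<Sum>i\<in>S. Suc (snd i) * Poly_Mapping.lookup m i)"
  unfolding wt_def by (rule sum.mono_neutral_left) (use assms in \<open>auto simp: in_keys_iff\<close>)

lemma wt_0 [simp]: "wt 0 = 0" by (simp add: wt_def)

lemma wt_add: "wt (m + n) = wt m + wt n"
proof -
  let ?S = "Poly_Mapping.keys m \<union> Poly_Mapping.keys n"
  have "Poly_Mapping.keys (m + n) \<subseteq> ?S" by (rule Poly_Mapping.keys_add)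
  then show ?thesis
    by (simp add: wt_superset[of ?S] lookup_add distrib_left sum.distrib del: mult_Suc)
qed

lemma wt_single: "wt (Poly_Mapping.single i k) = Suc (snd i) * k"
  by (cases "k = 0") (simp_all add: wt_def)

lemma wt_eq_0: "wt m = 0 \<Longrightarrow> m = 0"
  by (auto simp: wt_def in_keys_iff intro!: poly_mapping_eqI)

lemma wt_ge: "Suc (snd i) * Poly_Mapping.lookup m i \<le> wt m"
proof (cases "i \<in> Poly_Mapping.keys m")
  case True
  show ?thesis unfolding wt_def by (rule member_le_sum[OF True]) auto
qed (simp add: in_keys_iff)

definition low :: "nat \<Rightarrow> ((nat \<times> nat \<Rightarrow>\<^sub>0 nat) \<Rightarrow>\<^sub>0 'r::comm_ring_1) \<Rightarrow> bool" where
  "low w P \<longleftrightarrow> (\<forall>n\<in>Poly_Mapping.keys P. wt n < w)"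

text \<open>Leading terms modulo all monomials of smaller weight.\<close>

definition lead :: "((nat \<times> nat \<Rightarrow>\<^sub>0 nat) \<Rightarrow>\<^sub>0 'r::comm_ring_1) \<Rightarrow> (nat \<times> nat \<Rightarrow>\<^sub>0 nat) \<Rightarrow> 'r \<Rightarrow> bool" where
  "lead P m c \<longleftrightarrow> low (wt m) (P - Poly_Mapping.single m c)"

lemma low_0 [simp]: "low w 0" by (simp add: low_def)
lemma low_add: "low w P \<Longrightarrow> low w P' \<Longrightarrow> low w (P + P')"
  unfolding low_def using Poly_Mapping.keys_add[of P P'] by blast
lemma low_sum: "(\<And>i. i \<in> S \<Longrightarrow> low w (P i)) \<Longrightarrow> low w (\<Sum>i\<in>S. P i)"
  by (induction S rule: infinite_finite_induct) (auto intro: low_add)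
lemma low_mult:
  assumes "\<And>n. n \<in> Poly_Mapping.keys P \<Longrightarrow> wt n \<le> v" "low w P'"
  shows "low (v + w) (P * P')"
  unfolding low_def
proof
  fix n assume "n \<in> Poly_Mapping.keys (P * P')"
  then obtain a b where ab: "n = a + b" "a \<in> Poly_Mapping.keys P" "b \<in> Poly_Mapping.keys P'"
    using Poly_Mapping.keys_mult[of P P'] by blast
  have "wt a \<le> v" "wt b < w" using ab assms by (auto simp: low_def)
  then show "wt n < v + w" by (simp add: ab wt_add)
qed

lemma lead_1 [simp]: "lead 1 0 1" by (simp add: lead_def)

lemma lead_mult:
  assumes "lead P m c" "lead P' m' c'"
  shows "lead (P * P') (m + m') (c * c')"
proof -
  define u u' where "u = P - Poly_Mapping.single m c" and "u' = P' - Poly_Mapping.single m' c'"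
  have u: "low (wt m) u" "low (wt m') u'" using assms by (simp_all add: lead_def u_def u'_def)
  have e: "P * P' - Poly_Mapping.single (m + m') (c * c') =
      Poly_Mapping.single m c * u' + Poly_Mapping.single m' c' * u + u * u'"
    by (simp add: u_def u'_def mult_single algebra_simps)
  have "low (wt m + wt m') (Poly_Mapping.single m c * u')"
    by (rule low_mult) (use u in \<open>auto split: if_splits\<close>)
  moreover have "low (wt m' + wt m) (Poly_Mapping.single m' c' * u)"
    by (rule low_mult) (use u in \<open>auto split: if_splits\<close>)
  moreover have "low (wt m + wt m') (u * u')"
    by (rule low_mult) (use u in \<open>auto simp: low_def less_imp_le\<close>)
  ultimately show ?thesis unfolding lead_def e wt_add by (intro low_add) (auto simp: add.commute)
qed

lemma lead_power:
  assumes "lead P (Poly_Mapping.single i 1) c"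
  shows "lead (P ^ k) (Poly_Mapping.single i k) (c ^ k)"
proof (induction k)
  case (Suc k)
  have "Poly_Mapping.single i 1 + Poly_Mapping.single i k = Poly_Mapping.single i (Suc k)"
    by (simp add: single_add[symmetric])
  then show ?case using lead_mult[OF assms Suc.IH] by simp
qed simp

lemma lead_mmon:
  assumes "\<And>i. lead (g i) (Poly_Mapping.single i 1) (b i)"
  shows "lead (mmon g m) m (mmon b m)"
proof -
  have p: "lead (g i ^ k) (Poly_Mapping.single i k) (b i ^ k)" for i k
    by (rule lead_power[OF assms])
  have "lead (\<Prod>i\<in>S. g i ^ f i) (\<Sum>i\<in>S. Poly_Mapping.single i (f i)) (\<Prod>i\<in>S. b i ^ f i)"
    for S :: "(nat \<times> nat) set" and f
    by (induction S rule: infinite_finite_induct) (auto intro: lead_mult p)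
  from this[of "Poly_Mapping.lookup m" "Poly_Mapping.keys m"] show ?thesis
    unfolding mmon_def using poly_mapping_sum_single[of m] by simp
qed

text \<open>A substitution that preserves the leading monomials acts diagonally on the top weight.\<close>

lemma lookup_subst_top:
  fixes R :: "(nat \<times> nat \<Rightarrow>\<^sub>0 nat) \<Rightarrow>\<^sub>0 'r::comm_ring_1"
  assumes g: "\<And>i. lead (g i) (Poly_Mapping.single i 1) (b i)"
    and R: "\<And>n. n \<in> Poly_Mapping.keys R \<Longrightarrow> wt n \<le> w" and n: "wt n \<ge> w"
  shows "Poly_Mapping.lookup (mev cst g R) n = Poly_Mapping.lookup R n * mmon b n"
proof -
  have e: "mev cst g R - (\<Sum>m\<in>Poly_Mapping.keys R. Poly_Mapping.single m (Poly_Mapping.lookup R m * mmon b m))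
     = (\<Sum>m\<in>Poly_Mapping.keys R. cst (Poly_Mapping.lookup R m) * (mmon g m - Poly_Mapping.single m (mmon b m)))"
    unfolding mev_def by (simp add: sum_subtractf right_diff_distrib mult_single)
  have "low w (mev cst g R - (\<Sum>m\<in>Poly_Mapping.keys R. Poly_Mapping.single m (Poly_Mapping.lookup R m * mmon b m)))"
    unfolding e
  proof (rule low_sum)
    fix m assume m: "m \<in> Poly_Mapping.keys R"
    have "low (0 + wt m) (cst (Poly_Mapping.lookup R m) * (mmon g m - Poly_Mapping.single m (mmon b m)))"
      by (rule low_mult) (use lead_mmon[of g b m, OF g] in \<open>auto simp: lead_def split: if_splits\<close>)
    then show "low w (cst (Poly_Mapping.lookup R m) * (mmon g m - Poly_Mapping.single m (mmon b m)))"
      using R[OF m] by (fastforce simp: low_def)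
  qed
  then have "Poly_Mapping.lookup (mev cst g R - (\<Sum>m\<in>Poly_Mapping.keys R. Poly_Mapping.single m (Poly_Mapping.lookup R m * mmon b m))) n = 0"
    using n by (force simp: low_def in_keys_iff)
  then have "Poly_Mapping.lookup (mev cst g R) n = (\<Sum>m\<in>Poly_Mapping.keys R. if m = n then Poly_Mapping.lookup R n * mmon b n else 0)"
    by (simp add: lookup_minus lookup_sum lookup_single when_def)
  then show ?thesis by (auto simp: in_keys_iff)
qed

definition mvars_in :: "'i set \<Rightarrow> (('i \<Rightarrow>\<^sub>0 nat) \<Rightarrow>\<^sub>0 'r::comm_ring_1) \<Rightarrow> bool" where
  "mvars_in V P \<longleftrightarrow> (\<forall>n\<in>Poly_Mapping.keys P. Poly_Mapping.keys n \<subseteq> V)"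

lemma mvars_in_0 [simp]: "mvars_in V 0" and mvars_in_1 [simp]: "mvars_in V 1"
  by (auto simp: mvars_in_def)
lemma mvars_in_add: "mvars_in V P \<Longrightarrow> mvars_in V P' \<Longrightarrow> mvars_in V (P + P')"
  unfolding mvars_in_def using Poly_Mapping.keys_add[of P P'] by blast
lemma mvars_in_diff: "mvars_in V P \<Longrightarrow> mvars_in V P' \<Longrightarrow> mvars_in V (P - P')"
  unfolding mvars_in_def using keys_diff[of P P'] by blast
lemma mvars_in_single: "Poly_Mapping.keys m \<subseteq> V \<Longrightarrow> mvars_in V (Poly_Mapping.single m c)"
  by (auto simp: mvars_in_def split: if_splits)
lemma mvars_in_mult:
  assumes "mvars_in V P" "mvars_in V P'" shows "mvars_in V (P * P')"
  unfolding mvars_in_def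
proof
  fix n assume "n \<in> Poly_Mapping.keys (P * P')"
  then obtain a b where ab: "n = a + b" "a \<in> Poly_Mapping.keys P" "b \<in> Poly_Mapping.keys P'"
    using Poly_Mapping.keys_mult[of P P'] by blast
  then show "Poly_Mapping.keys n \<subseteq> V"
    using assms Poly_Mapping.keys_add[of a b] unfolding mvars_in_def by blast
qed
lemma mvars_in_sum: "(\<And>i. i \<in> S \<Longrightarrow> mvars_in V (P i)) \<Longrightarrow> mvars_in V (\<Sum>i\<in>S. P i)"
  by (induction S rule: infinite_finite_induct) (auto intro: mvars_in_add)
lemma mvars_in_prod: "(\<And>i. i \<in> S \<Longrightarrow> mvars_in V (P i)) \<Longrightarrow> mvars_in V (\<Prod>i\<in>S. P i)"
  by (induction S rule: infinite_finite_induct) (auto intro: mvars_in_mult)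
lemma mvars_in_power: "mvars_in V P \<Longrightarrow> mvars_in V (P ^ k)"
  by (induction k) (auto intro: mvars_in_mult)
lemma mvars_in_subst:
  assumes "mvars_in V R" "\<And>i. i \<in> V \<Longrightarrow> mvars_in V (g i)"
  shows "mvars_in V (mev cst g R)"
  unfolding mev_def mmon_def
  using assms by (intro mvars_in_sum mvars_in_mult mvars_in_prod mvars_in_power mvars_in_single)
    (auto simp: mvars_in_def[of V R])

lemma mev_cong:
  assumes "\<And>m i. m \<in> Poly_Mapping.keys P \<Longrightarrow> i \<in> Poly_Mapping.keys m \<Longrightarrow> x i = y i"
  shows "mev \<phi> x P = mev \<phi> y P"
  unfolding mev_def mmon_def using assms by (auto intro!: sum.cong prod.cong)

section \<open>Jets of the infinite products\<close>

text \<open>The product of the first \<open>M\<close> factors \<open>1 - (t + \<epsilon>) z\<^bsup>w(c,m)\<^esup>\<close>, as a polynomial in \<open>\<epsilon>\<close>.\<close>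

definition jetp :: "nat \<Rightarrow> nat \<Rightarrow> nat \<Rightarrow> nat \<Rightarrow> 'r::comm_ring_1 \<Rightarrow> 'r \<Rightarrow> 'r poly" where
  "jetp q l c M t z = (\<Prod>m<M. [:1 - t * z ^ (q ^ (c + l * m)), - (z ^ (q ^ (c + l * m))):])"

definition jet :: "nat \<Rightarrow> nat \<Rightarrow> nat \<Rightarrow> nat \<Rightarrow> nat \<Rightarrow> 'r::comm_ring_1 \<Rightarrow> 'r \<Rightarrow> 'r" where
  "jet q l c M k t z = poly.coeff (jetp q l c M t z) k"

lemma jetp_add: "jetp q l c (a + M) t z = jetp q l c a t z * jetp q l c M t (z ^ (q ^ (l * a)))"
proof -
  have "jetp q l c (a + M) t z = (\<Prod>m<a. [:1 - t * z ^ (q ^ (c + l * m)), - (z ^ (q ^ (c + l * m))):]) *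
     (\<Prod>m\<in>{a..<a+M}. [:1 - t * z ^ (q ^ (c + l * m)), - (z ^ (q ^ (c + l * m))):])"
    unfolding jetp_def by (subst prod.union_disjoint[symmetric]) (auto intro!: prod.cong)
  also have "(\<Prod>m\<in>{a..<a+M}. [:1 - t * z ^ (q ^ (c + l * m)), - (z ^ (q ^ (c + l * m))):]) =
     (\<Prod>m<M. [:1 - t * z ^ (q ^ (c + l * (a + m))), - (z ^ (q ^ (c + l * (a + m)))):])"
    by (rule prod.reindex_bij_witness[of _ "\<lambda>m. a + m" "\<lambda>m. m - a"]) auto
  also have "\<dots> = jetp q l c M t (z ^ (q ^ (l * a)))"
    unfolding jetp_def
    by (intro prod.cong refl) (simp add: power_mult[symmetric] power_add[symmetric] algebra_simps)
  finally show ?thesis by (simp add: jetp_def)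
qed

text \<open>The functional equation: without its first \<open>a\<close> factors the product is the product for \<open>z\<^bsup>q\<^sup>l\<^sup>a\<^esup>\<close>.\<close>

lemma jet_add:
  "jet q l c (a + M) k t z = (\<Sum>i\<le>k. jet q l c a i t z * jet q l c M (k - i) t (z ^ (q ^ (l * a))))"
  unfolding jet_def jetp_add by (rule coeff_mult)

lemma jet_M_0: "jet q l c 0 k t z = (if k = 0 then 1 else 0)"
  by (simp add: jet_def jetp_def)

lemma jet_Suc_0: "jet q l c (Suc M) 0 t z = jet q l c M 0 t z * (1 - t * z ^ (q ^ (c + l * M)))"
  by (simp add: jet_def jetp_def mult.commute)

lemma jet_Suc_Suc: "jet q l c (Suc M) (Suc k) t z =
    jet q l c M (Suc k) t z * (1 - t * z ^ (q ^ (c + l * M))) - jet q l c M k t z * z ^ (q ^ (c + l * M))"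
  by (simp add: jet_def jetp_def algebra_simps)

lemma jet_0: "jet q l c M 0 t z = (\<Prod>m<M. 1 - t * z ^ (q ^ (c + l * m)))"
  by (induction M) (simp_all add: jet_M_0 jet_Suc_0)

lemma rhom_jet:
  assumes "rhom \<phi>" shows "\<phi> (jet q l c M k t z) = jet q l c M k (\<phi> t) (\<phi> z)"
proof (induction M arbitrary: k)
  case 0
  show ?case by (simp add: jet_M_0 rhom_0[OF assms] rhom_1[OF assms])
next
  case (Suc M)
  show ?case
    by (cases k) (simp_all add: jet_Suc_0 jet_Suc_Suc Suc rhom_diff[OF assms] rhom_mult[OF assms] rhom_power[OF assms] rhom_1[OF assms])
qed

text \<open>The functional equation as a substitution of variables, see \<open>mev_jet_subst_jetv\<close>.\<close>

definition jet_subst :: "nat \<Rightarrow> nat \<Rightarrow> nat \<Rightarrow> 'r::comm_ring_1 \<Rightarrow> 'r \<Rightarrow> nat \<times> nat \<Rightarrow> ((nat \<times> nat \<Rightarrow>\<^sub>0 nat) \<Rightarrow>\<^sub>0 'r)" where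
  "jet_subst q l j t z = (\<lambda>(c, k). \<Sum>i\<le>k. cst (jet q l c j i t z) * mvar (c, k - i))"

abbreviation jetv :: "nat \<Rightarrow> nat \<Rightarrow> nat \<Rightarrow> 'r::comm_ring_1 \<Rightarrow> 'r \<Rightarrow> nat \<times> nat \<Rightarrow> 'r" where
  "jetv q l M t z \<equiv> (\<lambda>(c, k). jet q l c M k t z)"

lemma mev_jet_subst:
  assumes "rhom \<phi>"
  shows "mev \<phi> x (jet_subst q l j t z (c, k)) = (\<Sum>i\<le>k. \<phi> (jet q l c j i t z) * x (c, k - i))"
  unfolding jet_subst_def prod.case
  by (simp add: mev_sum[OF assms] mev_mult[OF assms] mev_cst mev_mvar rhom_0[OF assms] rhom_1[OF assms] del: One_nat_def)

lemma mev_jet_subst_jetv: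
  "mev (\<lambda>x. x) (jetv q l M t (z ^ (q ^ (l * j)))) (mev cst (jet_subst q l j t z) R) =
   mev (\<lambda>x. x) (jetv q l (j + M) t z) R"
  unfolding mev_subst[OF rhom_id]
  by (rule mev_cong) (auto simp: mev_jet_subst[OF rhom_id] jet_add)

lemma lead_jet_subst: "lead (jet_subst q l j t z i) (Poly_Mapping.single i 1) (jet q l (fst i) j 0 t z)"
proof -
  obtain c k where i: "i = (c, k)" by (cases i)
  have "jet_subst q l j t z i - Poly_Mapping.single (Poly_Mapping.single i 1) (jet q l c j 0 t z) =
     (\<Sum>a\<in>{..k} - {0}. cst (jet q l c j a t z) * mvar (c, k - a))"
    unfolding jet_subst_def i prod.case by (subst sum.remove[of _ 0]) (auto simp: mult_single)
  moreover have "low (Suc k) (\<Sum>a\<in>{..k} - {0}. cst (jet q l c j a t z) * mvar (c, k - a))"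
    by (rule low_sum) (auto simp: low_def mult_single wt_single split: if_splits)
  ultimately show ?thesis by (simp add: lead_def i wt_single)
qed

lemma mvars_in_jet_subst:
  assumes "fst i \<in> L" shows "mvars_in (L \<times> UNIV) (jet_subst q l j t z i)"
  using assms by (cases i) (auto simp: jet_subst_def mult_single intro!: mvars_in_sum mvars_in_single split: if_splits)

section \<open>Independence of the functions\<close>

text \<open>Functions of \<open>t\<close> are polynomials in \<open>t\<close> over \<open>\<F>\<^sub>q((z))\<close>; they are small if all coefficients have a large order.\<close>

definition pord_ge :: "'a::zero fls poly \<Rightarrow> int \<Rightarrow> bool" where
  "pord_ge p k \<longleftrightarrow> (\<forall>b. ord_ge (poly.coeff p b) k)"

lemma pord_ge_mono: "pord_ge p k \<Longrightarrow> j \<le> k \<Longrightarrow> pord_ge p j" by (auto simp: pord_ge_def intro: ord_ge_mono)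
lemma pord_ge_0 [simp]: "pord_ge 0 k" by (simp add: pord_ge_def)
lemma pord_ge_add: "pord_ge p k \<Longrightarrow> pord_ge p' k \<Longrightarrow> pord_ge (p + p') k" by (auto simp: pord_ge_def intro: ord_ge_add)
lemma pord_ge_diff: "pord_ge p k \<Longrightarrow> pord_ge p' k \<Longrightarrow> pord_ge ((p :: 'a::ab_group_add fls poly) - p') k"
  by (auto simp: pord_ge_def intro: ord_ge_diff)
lemma pord_ge_mult: "pord_ge p a \<Longrightarrow> pord_ge p' b \<Longrightarrow> pord_ge ((p :: 'a::idom fls poly) * p') (a + b)"
  by (auto simp: pord_ge_def coeff_mult intro!: ord_ge_sum ord_ge_mult)
lemma pord_ge_exists: "\<exists>k. pord_ge p k"
proof -
  have "\<forall>b. \<exists>k. ord_ge (poly.coeff p b) k" using ord_ge_exists by blast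
  then obtain f where f: "\<And>b. ord_ge (poly.coeff p b) (f b)" by metis
  define k where "k = (MIN b\<in>{..Polynomial.degree p}. f b)"
  have "ord_ge (poly.coeff p b) k" for b
  proof (cases "b \<le> Polynomial.degree p")
    case True
    then have "k \<le> f b" unfolding k_def by (intro Min_le) auto
    then show ?thesis using f ord_ge_mono by blast
  qed (simp add: coeff_eq_0)
  then show ?thesis by (auto simp: pord_ge_def)
qed
lemma pord_ge_all_imp_0: "(\<And>k. pord_ge p k) \<Longrightarrow> p = 0"
  by (rule poly_eqI) (auto simp: pord_ge_def intro!: ord_ge_all_imp_0)

lemma pord_ge_unit_cancel:
  fixes p u :: "'a::idom fls poly"
  assumes u: "pord_ge (u - 1) 1" and up: "pord_ge (u * p) k"
  shows "pord_ge p k"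
proof -
  obtain k0 where k0: "pord_ge p k0" using pord_ge_exists by blast
  have "pord_ge p (min k (k0 + int n))" for n
  proof (induction n)
    case 0 then show ?case using k0 by (rule pord_ge_mono) simp
  next
    case (Suc n)
    have "p = u * p - (u - 1) * p" by (simp add: algebra_simps)
    moreover have "pord_ge (u * p - (u - 1) * p) (min k (k0 + int (Suc n)))"
    proof (rule pord_ge_diff)
      show "pord_ge (u * p) (min k (k0 + int (Suc n)))" by (rule pord_ge_mono[OF up]) simp
      show "pord_ge ((u - 1) * p) (min k (k0 + int (Suc n)))"
        by (rule pord_ge_mono[OF pord_ge_mult[OF u Suc.IH]]) simp
    qed
    ultimately show ?case by simp
  qed
  from this[of "nat (k - k0)"] show ?thesis by (rule pord_ge_mono) simp
qed

text \<open>The Frobenius twist of polynomials in \<open>t\<close>.\<close>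

definition frob_twist :: "nat \<Rightarrow> 'a::{field,finite} fls poly \<Rightarrow> 'a fls poly" where
  "frob_twist n p = map_poly (\<lambda>f. f ^ (CARD('a) ^ n)) p"

lemma coeff_frob_twist: "poly.coeff (frob_twist n (p :: 'a::{field,finite} fls poly)) b = poly.coeff p b ^ (CARD('a) ^ n)"
  unfolding frob_twist_def by (rule coeff_map_poly) (simp add: frobenius_pow_pos power_0_left)

lemma rhom_frob_twist: "rhom (frob_twist n :: 'a::{field,finite} fls poly \<Rightarrow> _)"
  unfolding rhom_def
proof (intro conjI allI)
  fix x y :: "'a fls poly"
  show "frob_twist n 0 = (0 :: 'a fls poly)" "frob_twist n 1 = (1 :: 'a fls poly)" by (simp_all add: frob_twist_def)
  show "frob_twist n (x + y) = frob_twist n x + frob_twist n y"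
    by (rule poly_eqI) (simp add: coeff_frob_twist frobenius_pow_add)
  show "frob_twist n (x * y) = frob_twist n x * frob_twist n y"
    by (rule poly_eqI) (simp add: coeff_frob_twist coeff_mult frobenius_pow_sum power_mult_distrib)
qed

lemma frob_twist_t [simp]: "frob_twist n [:0, 1:] = [:0, 1 :: 'a::{field,finite} fls:]"
  by (simp add: frob_twist_def map_poly_pCons frobenius_pow_pos power_0_left)
lemma frob_twist_const: "frob_twist n [:f:] = [:f ^ (CARD('a) ^ n) :: 'a::{field,finite} fls:]"
  by (simp add: frob_twist_def map_poly_pCons frobenius_pow_pos power_0_left)
lemma pord_ge_frob_twist:
  fixes p :: "'a::{field,finite} fls poly"
  assumes "pord_ge p k" "k \<ge> 0" shows "pord_ge (frob_twist n p) k"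
  unfolding pord_ge_def coeff_frob_twist
proof
  fix b
  have "ord_ge (poly.coeff p b ^ (CARD('a) ^ n)) (int (CARD('a) ^ n) * k)"
    by (rule ord_ge_power) (use assms in \<open>auto simp: pord_ge_def\<close>)
  moreover have "1 * k \<le> int (CARD('a) ^ n) * k"
    using frobenius_pow_pos[where 'a='a, of n] assms(2) by (intro mult_right_mono) linarith+
  ultimately show "ord_ge (poly.coeff p b ^ (CARD('a) ^ n)) k" by (auto intro: ord_ge_mono)
qed

text \<open>The twist multiplies the orders of the coefficients by \<open>q\<^sup>n\<close>.  For large \<open>n\<close> the orders of the terms at a power of \<open>\<theta>\<close> are
  then distinct, as differences of coefficient orders outweigh differences of degrees.\<close>

lemma poly_frob_twist_nonzero:
  fixes r :: "'a::{field,finite} fls poly"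
  assumes "r \<noteq> 0" "e > 0"
  shows "\<exists>J. \<forall>n\<ge>J. poly (frob_twist n r) (fls_X_inv ^ e) \<noteq> 0"
proof -
  let ?q = "CARD('a)"
  define d where "d = Polynomial.degree r"
  define B where "B = {b. b \<le> d \<and> poly.coeff r b \<noteq> 0}"
  define v where "v b = fls_subdegree (poly.coeff r b)" for b
  \<comment> \<open>minimal for the term of least order: first the order of the coefficient counts, then the degree, which is at most d\<close>
  define \<kappa> where "\<kappa> b = v b * (int d + 1) - int b" for b
  have "d \<in> B" using assms by (simp add: B_def d_def)
  moreover have "finite B" by (simp add: B_def)
  ultimately obtain b0 where b0: "b0 \<in> B" "\<And>b. b \<in> B \<Longrightarrow> \<kappa> b0 \<le> \<kappa> b"
    using arg_min_if_finite[of B \<kappa>] by (metis empty_iff linorder_not_le)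
  have q2: "?q \<ge> 2" by (rule card_ge_2)
  show ?thesis
  proof (intro exI allI impI)
    fix n assume n: "n \<ge> e * (d + 1)"
    define Q where "Q = ?q ^ n"
    have "e * (d + 1) < 2 ^ (e * (d + 1))" by (rule less_exp)
    also have "\<dots> \<le> ?q ^ (e * (d + 1))" by (rule power_mono) (use q2 in auto)
    also have "\<dots> \<le> Q" unfolding Q_def by (rule power_increasing) (use q2 n in auto)
    finally have "int (e * (d + 1)) < int Q" by (rule iffD2[OF of_nat_less_iff])
    then have Q: "int e * (int d + 1) < int Q" by (simp only: of_nat_mult of_nat_add of_nat_1)
    let ?N = "int Q * v b0 - int e * int b0"
    have nth: "fls_nth (poly.coeff r b ^ Q * fls_X_inv ^ (e * b)) ?N =
       (if b = b0 then fls_nth (poly.coeff r b0) (v b0) else 0)" if b: "b \<le> d" for b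
    proof (cases "b \<in> B")
      case False
      with b b0 have "poly.coeff r b = 0" "b \<noteq> b0" by (auto simp: B_def)
      moreover have "Q > 0" by (simp add: Q_def frobenius_pow_pos)
      ultimately show ?thesis by (simp add: power_0_left)
    next
      case True
      have "fls_nth (poly.coeff r b ^ Q * fls_X_inv ^ (e * b)) ?N = fls_nth (poly.coeff r b ^ Q) (?N + int (e * b))"
        by (simp add: fls_X_inv_power_times_conv_shift)
      also have "\<dots> = (if b = b0 then fls_nth (poly.coeff r b0) (v b0) else 0)"
      proof (cases "b = b0")
        case True
        then show ?thesis using frobenius_pow_pos[where 'a='a, of n]
          unfolding Q_def fls_nth_frobenius by simp
      next
        case False
        have k: "\<kappa> b0 \<le> \<kappa> b" by (rule b0(2)[OF \<open>b \<in> B\<close>])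
        have "v b0 \<le> v b"
        proof (rule ccontr)
          assume "\<not> v b0 \<le> v b"
          then have "(v b + 1) * (int d + 1) \<le> v b0 * (int d + 1)" by (intro mult_right_mono) auto
          then have "v b0 * (int d + 1) - int b0 \<ge> v b * (int d + 1) + 1 + (int d - int b0)" by (simp add: algebra_simps)
          moreover have "int b0 \<le> int d" using b0(1) by (simp add: B_def)
          ultimately show False using k unfolding \<kappa>_def by linarith
        qed
        have "?N + int (e * b) < int Q * v b"
        proof (cases "v b0 = v b")
          case True
          then have "b < b0" using k False by (simp add: \<kappa>_def)
          then have "int e * int b < int e * int b0" using \<open>e > 0\<close> by simp
          then show ?thesis using True by simp
        next
          case False
          with \<open>v b0 \<le> v b\<close> have "int Q * (v b0 + 1) \<le> int Q * v b" by (intro mult_left_mono) auto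
          moreover have "int e * int b \<le> int e * (int d + 1)" using b by (intro mult_left_mono) auto
          moreover have "int e * int b0 \<ge> 0" by simp
          ultimately show ?thesis using Q
            unfolding of_nat_mult distrib_left mult_1_right by linarith
        qed
        moreover have "ord_ge (poly.coeff r b ^ Q) (int Q * v b)"
          by (rule ord_ge_power) (simp add: ord_ge_iff_subdegree v_def)
        ultimately show ?thesis using False by (auto simp: ord_ge_def)
      qed
      finally show ?thesis .
    qed
    have "poly (frob_twist n r) (fls_X_inv ^ e) = (\<Sum>b\<le>d. poly.coeff r b ^ Q * fls_X_inv ^ (e * b))"
    proof -
      have "Polynomial.degree (frob_twist n r) \<le> d"
        by (rule degree_le) (auto simp: coeff_frob_twist d_def coeff_eq_0 frobenius_pow_pos power_0_left)
      then have "poly (frob_twist n r) (fls_X_inv ^ e) = (\<Sum>b\<le>d. poly.coeff (frob_twist n r) b * (fls_X_inv ^ e) ^ b)"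
        unfolding poly_altdef by (intro sum.mono_neutral_left) (auto simp: coeff_eq_0)
      then show ?thesis by (simp add: coeff_frob_twist Q_def power_mult)
    qed
    then have "fls_nth (poly (frob_twist n r) (fls_X_inv ^ e)) ?N = (\<Sum>b\<le>d. if b = b0 then fls_nth (poly.coeff r b0) (v b0) else 0)"
      using nth by (simp add: fls_nth_sum)
    also have "\<dots> \<noteq> 0" using b0(1) by (simp add: B_def v_def)
    finally show "poly (frob_twist n r) (fls_X_inv ^ e) \<noteq> 0" by auto
  qed
qed

text \<open>The relation \<open>R(Y(t, z\<^bsup>q\<^sup>l\<^sup>a\<^esup>)) = 0\<close>, by means of the truncated products.  The level \<open>a\<close> is a parameter because
  the functional equation and the Frobenius twist raise it.\<close>

definition function_rel :: "nat \<Rightarrow> nat \<Rightarrow> ((nat \<times> nat \<Rightarrow>\<^sub>0 nat) \<Rightarrow>\<^sub>0 'a::{field,finite} fls poly) \<Rightarrow> bool" where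
  "function_rel l a R \<longleftrightarrow> (\<forall>W. \<exists>M0. \<forall>M\<ge>M0.
     pord_ge (mev (\<lambda>x. x) (jetv CARD('a) l M [:0, 1:] [:fls_X ^ (CARD('a) ^ (l * a)):]) R) W)"

context
  fixes l :: nat
begin

abbreviation zz :: "nat \<Rightarrow> 'a::{field,finite} fls poly" where
  "zz a \<equiv> [:fls_X ^ (CARD('a) ^ (l * a)):]"

lemma zz_power: "zz a ^ (CARD('a) ^ (l * j)) = (zz (a + j) :: 'a::{field,finite} fls poly)"
  by (simp add: poly_const_pow power_mult[symmetric] power_add[symmetric] algebra_simps)

lemma function_rel_mult:
  fixes R :: "(nat \<times> nat \<Rightarrow>\<^sub>0 nat) \<Rightarrow>\<^sub>0 'a::{field,finite} fls poly"
  assumes "function_rel l a R" shows "function_rel l a (cst c * R)"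
  unfolding function_rel_def
proof
  fix W
  obtain k where k: "pord_ge c k" using pord_ge_exists by blast
  from assms obtain M0 where M0: "\<And>M. M \<ge> M0 \<Longrightarrow> pord_ge (mev (\<lambda>x. x) (jetv CARD('a) l M [:0, 1:] (zz a)) R) (W - k)"
    unfolding function_rel_def by blast
  have "pord_ge (mev (\<lambda>x. x) (jetv CARD('a) l M [:0, 1:] (zz a)) (cst c * R)) W" if "M \<ge> M0" for M
    using pord_ge_mult[OF k M0[OF that]] by (simp add: mev_mult[OF rhom_id] mev_cst)
  then show "\<exists>M0. \<forall>M\<ge>M0. pord_ge (mev (\<lambda>x. x) (jetv CARD('a) l M [:0, 1:] (zz a)) (cst c * R)) W" by blast
qed

lemma function_rel_diff:
  fixes R :: "(nat \<times> nat \<Rightarrow>\<^sub>0 nat) \<Rightarrow>\<^sub>0 'a::{field,finite} fls poly"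
  assumes "function_rel l a R" "function_rel l a R'" shows "function_rel l a (R - R')"
  unfolding function_rel_def
proof
  fix W
  from assms obtain M0 M1 where
    "\<And>M. M \<ge> M0 \<Longrightarrow> pord_ge (mev (\<lambda>x. x) (jetv CARD('a) l M [:0, 1:] (zz a)) R) W"
    "\<And>M. M \<ge> M1 \<Longrightarrow> pord_ge (mev (\<lambda>x. x) (jetv CARD('a) l M [:0, 1:] (zz a)) R') W"
    unfolding function_rel_def by meson
  then have "\<forall>M\<ge>max M0 M1. pord_ge (mev (\<lambda>x. x) (jetv CARD('a) l M [:0, 1:] (zz a)) (R - R')) W"
    by (simp add: rhom_diff[OF rhom_mev[OF rhom_id]] pord_ge_diff)
  then show "\<exists>M0. \<forall>M\<ge>M0. pord_ge (mev (\<lambda>x. x) (jetv CARD('a) l M [:0, 1:] (zz a)) (R - R')) W" by blast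
qed

text \<open>By the functional equation the substitution undoes the omission of \<open>j\<close> factors.\<close>

lemma function_rel_subst:
  fixes R :: "(nat \<times> nat \<Rightarrow>\<^sub>0 nat) \<Rightarrow>\<^sub>0 'a::{field,finite} fls poly"
  assumes "function_rel l a R"
  shows "function_rel l (a + j) (mev cst (jet_subst CARD('a) l j [:0, 1:] (zz a)) R)"
  unfolding function_rel_def
proof
  fix W
  from assms obtain M0 where M0: "\<And>M. M \<ge> M0 \<Longrightarrow> pord_ge (mev (\<lambda>x. x) (jetv CARD('a) l M [:0, 1:] (zz a)) R) W"
    unfolding function_rel_def by blast
  have "pord_ge (mev (\<lambda>x. x) (jetv CARD('a) l M [:0, 1:] (zz (a + j)))
      (mev cst (jet_subst CARD('a) l j [:0, 1:] (zz a)) R)) W" if "M \<ge> M0" for M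
    using M0[of "j + M"] that
      mev_jet_subst_jetv[of "CARD('a)" l M "[:0, 1:]" "zz a" j R] by (simp only: zz_power)
  then show "\<exists>M0. \<forall>M\<ge>M0. pord_ge (mev (\<lambda>x. x) (jetv CARD('a) l M [:0, 1:] (zz (a + j)))
      (mev cst (jet_subst CARD('a) l j [:0, 1:] (zz a)) R)) W" by blast
qed

text \<open>The twist fixes \<open>t\<close> and sends \<open>z\<close> to \<open>z\<^bsup>q\<^sup>l\<^sup>j\<^esup>\<close>; orders do not decrease, once they are nonnegative.\<close>

lemma function_rel_frob_twist:
  fixes R :: "(nat \<times> nat \<Rightarrow>\<^sub>0 nat) \<Rightarrow>\<^sub>0 'a::{field,finite} fls poly"
  assumes "function_rel l a R"
  shows "function_rel l (a + j) (Poly_Mapping.map (frob_twist (l * j)) R)"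
  unfolding function_rel_def
proof
  fix W
  from assms obtain M0 where M0: "\<And>M. M \<ge> M0 \<Longrightarrow> pord_ge (mev (\<lambda>x. x) (jetv CARD('a) l M [:0, 1:] (zz a)) R) (max W 0)"
    unfolding function_rel_def by blast
  have "pord_ge (mev (\<lambda>x. x) (jetv CARD('a) l M [:0, 1:] (zz (a + j))) (Poly_Mapping.map (frob_twist (l * j)) R)) W"
    if "M \<ge> M0" for M
  proof -
    have "(\<lambda>i. frob_twist (l * j) (jetv CARD('a) l M [:0, 1:] (zz a :: 'a fls poly) i)) = jetv CARD('a) l M [:0, 1:] (zz (a + j))"
      by (auto simp: fun_eq_iff rhom_jet[OF rhom_frob_twist] frob_twist_const power_mult[symmetric] power_add[symmetric] algebra_simps)
    then have "mev (\<lambda>x. x) (jetv CARD('a) l M [:0, 1:] (zz (a + j))) (Poly_Mapping.map (frob_twist (l * j)) R)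
       = frob_twist (l * j) (mev (\<lambda>x. x) (jetv CARD('a) l M [:0, 1:] (zz a)) R)"
      by (simp only: mev_map[OF rhom_id, where \<psi> = "frob_twist (l * j)", OF rhom_0[OF rhom_frob_twist]] rhom_mev_comp[OF rhom_frob_twist])
    moreover have "pord_ge (frob_twist (l * j) (mev (\<lambda>x. x) (jetv CARD('a) l M [:0, 1:] (zz a)) R)) W"
      by (rule pord_ge_mono[OF pord_ge_frob_twist[OF M0[OF that]]]) auto
    ultimately show ?thesis by simp
  qed
  then show "\<exists>M0. \<forall>M\<ge>M0. pord_ge (mev (\<lambda>x. x) (jetv CARD('a) l M [:0, 1:] (zz (a + j)))
      (Poly_Mapping.map (frob_twist (l * j)) R)) W" by blast
qed

lemma pord_ge_jet_0: "pord_ge (jet CARD('a) l c M 0 [:0, 1:] (zz a) - (1 :: 'a::{field,finite} fls poly)) 1"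
proof (induction M)
  case (Suc M)
  let ?J = "jet CARD('a) l c M 0 [:0, 1:] (zz a) :: 'a fls poly"
  let ?e = "CARD('a) ^ (l * a) * CARD('a) ^ (c + l * M)"
  have "?e > 0" using frobenius_pow_pos[where 'a='a] by simp
  then have "int ?e \<ge> 1" by linarith
  then have z: "pord_ge ([:0, 1:] * zz a ^ (CARD('a) ^ (c + l * M)) :: 'a fls poly) 1"
    by (auto simp: pord_ge_def poly_const_pow power_mult[symmetric] coeff_pCons split: nat.splits intro!: ord_ge_X_power)
  have "pord_ge ?J 0"
    using pord_ge_add[OF pord_ge_mono[OF Suc.IH], of 0 1] by (simp add: pord_ge_def coeff_1)
  have "jet CARD('a) l c (Suc M) 0 [:0, 1:] (zz a) - 1 = (?J - 1) - ?J * ([:0, 1:] * zz a ^ (CARD('a) ^ (c + l * M)))"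
    by (simp add: jet_Suc_0 algebra_simps)
  moreover have "pord_ge (?J * ([:0, 1:] * zz a ^ (CARD('a) ^ (c + l * M)))) 1"
    using pord_ge_mult[OF \<open>pord_ge ?J 0\<close> z] by (simp only: add_0)
  ultimately show ?case using pord_ge_diff[OF Suc.IH] by metis
qed (simp add: jet_M_0)

text \<open>The series \<open>Y\<^sub>c\<^sub>,\<^sub>0\<close> is congruent to \<open>1\<close> modulo \<open>z\<close>.\<close>

lemma function_rel_cancel:
  fixes R :: "(nat \<times> nat \<Rightarrow>\<^sub>0 nat) \<Rightarrow>\<^sub>0 'a::{field,finite} fls poly"
  assumes "function_rel l a (mvar (c, 0) * R)" shows "function_rel l a R"
  using assms unfolding function_rel_def
  by (simp add: mev_mult[OF rhom_id] mev_mvar del: One_nat_def) (meson pord_ge_unit_cancel pord_ge_jet_0)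

text \<open>A polynomial of weight \<open>0\<close> is a constant, which cannot have arbitrarily large order unless it is \<open>0\<close>.\<close>

lemma function_rel_const:
  fixes R :: "(nat \<times> nat \<Rightarrow>\<^sub>0 nat) \<Rightarrow>\<^sub>0 'a::{field,finite} fls poly"
  assumes "function_rel l a R" "\<And>n. n \<in> Poly_Mapping.keys R \<Longrightarrow> wt n = 0" shows "R = 0"
proof -
  have "Poly_Mapping.keys R \<subseteq> {0}" using assms(2) wt_eq_0 by blast
  then have e: "R = cst (Poly_Mapping.lookup R 0)"
    by (intro poly_mapping_eqI) (auto simp: lookup_single when_def in_keys_iff)
  have "pord_ge (Poly_Mapping.lookup R 0) W" for W
    using assms(1) unfolding function_rel_def by (subst (asm) e) (auto simp: mev_cst)
  then show ?thesis using pord_ge_all_imp_0 e by (metis single_zero)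
qed

lemma jet_factor_nonzero:
  assumes "c \<in> {1..l}" "c' \<in> {1..l}" "c \<noteq> c' \<or> m \<noteq> a + i"
  shows "1 - fls_X_inv ^ (CARD('a) ^ (c + l * m)) * (fls_X ^ (CARD('a) ^ (l * a))) ^ (CARD('a) ^ (c' + l * i)) \<noteq> (0 :: 'a::{field,finite} fls)"
proof
  let ?q = "CARD('a)"
  assume *: "1 - fls_X_inv ^ (?q ^ (c + l * m)) * (fls_X ^ (?q ^ (l * a))) ^ (?q ^ (c' + l * i)) = (0 :: 'a fls)"
  have q2: "?q \<ge> 2" by (rule card_ge_2)
  have "(1 :: 'a fls) = fls_X_inv ^ (?q ^ (c + l * m)) * (fls_X ^ (?q ^ (c' + l * (a + i))))"
    using * by (simp add: power_mult[symmetric] power_add[symmetric] algebra_simps)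
  then have "fls_nth (1 :: 'a fls) 0 = fls_nth (fls_X_inv ^ (?q ^ (c + l * m)) * (fls_X ^ (?q ^ (c' + l * (a + i)))) :: 'a fls) 0"
    by simp
  then have "int (?q ^ (c + l * m)) = int (?q ^ (c' + l * (a + i)))"
    by (simp add: fls_X_inv_power_times_conv_shift split: if_splits)
  then have "?q ^ (c + l * m) = ?q ^ (c' + l * (a + i))" by linarith
  then have eq: "c + l * m = c' + l * (a + i)" using q2 by (simp add: power_inject_exp)
  have "m = a + i"
  proof (rule ccontr)
    assume "m \<noteq> a + i"
    then consider "m \<ge> a + i + 1" | "a + i \<ge> m + 1" by linarith
    then show False
    proof cases
      case 1
      then have "l * m \<ge> l * (a + i) + l" using mult_le_mono2[OF 1, of l] by (simp add: algebra_simps)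
      with eq assms show False by auto
    next
      case 2
      then have "l * (a + i) \<ge> l * m + l" using mult_le_mono2[OF 2, of l] by (simp add: algebra_simps)
      with eq assms show False by auto
    qed
  qed
  with eq assms show False by auto
qed

lemma factor_zero:
  assumes "a \<le> m"
  shows "fls_X_inv ^ (CARD('a) ^ (c + l * m)) * (fls_X ^ (CARD('a) ^ (l * a))) ^ (CARD('a) ^ (c + l * (m - a))) = (1 :: 'a::{field,finite} fls)"
proof -
  have "l * a + (c + l * (m - a)) = c + l * m"
    using assms arg_cong[of "a + (m - a)" m "(*) l"] unfolding distrib_left by simp
  then have "(fls_X ^ (CARD('a) ^ (l * a))) ^ (CARD('a) ^ (c + l * (m - a))) = (fls_X ^ (CARD('a) ^ (c + l * m)) :: 'a fls)"
    by (metis power_add power_mult)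
  then show ?thesis by (simp add: fls_X_inv_X_power)
qed

text \<open>At the zero \<open>t = \<theta>\<^bsup>w(c,m)\<^esup>\<close> of the \<open>c\<close>-th product its truncation is, as a power series in \<open>\<epsilon>\<close>, \<open>\<epsilon>\<close> times a unit,
  while the other truncations are units.  Dividing by them solves the linear substitution for all
  variables except \<open>(c, 0)\<close>, which is set to \<open>0\<close>.\<close>

lemma jet_subst_solve:
  fixes j a m c :: nat
  defines "\<tau> \<equiv> fls_X_inv ^ (CARD('a) ^ (c + l * m)) :: 'a::{field,finite} fls"
  defines "x \<equiv> fls_X ^ (CARD('a) ^ (l * a)) :: 'a fls"
  defines "Xt \<equiv> (\<lambda>i. if i = (c, 0) then 0 else mvar i) :: nat \<times> nat \<Rightarrow> ((nat \<times> nat \<Rightarrow>\<^sub>0 nat) \<Rightarrow>\<^sub>0 'a fls)"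
  assumes c: "c \<in> {1..l}" and m: "a \<le> m" "m < a + j"
  shows "\<exists>Z. \<forall>c'\<in>{1..l}. \<forall>k. (\<Sum>i\<le>k. cst (jet CARD('a) l c' j i \<tau> x) * Z (c', k - i)) = Xt (c', k)"
proof -
  let ?q = "CARD('a)"
  define f where "f c' = Abs_fps (\<lambda>i. jet ?q l c' j i \<tau> x)" for c'
  define lift :: "'a fls fps \<Rightarrow> ((nat \<times> nat \<Rightarrow>\<^sub>0 nat) \<Rightarrow>\<^sub>0 'a fls) fps" where "lift g = Abs_fps (\<lambda>i. cst (fps_nth g i))" for g
  define Xf where "Xf c' = Abs_fps (\<lambda>k. Xt (c', k))" for c'
  have lift_mult: "lift (g * h) = lift g * lift h" for g h
    by (rule fps_ext) (simp add: lift_def fps_mult_nth mult_single rhom_sum[OF rhom_cst])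
  have lift_1: "lift 1 = 1"
    by (rule fps_ext) (simp add: lift_def)
  have lift_X: "lift fps_X = fps_X"
    by (rule fps_ext) (simp add: lift_def fps_X_def)
  have "\<exists>G. lift (f c') * G = Xf c'" if c': "c' \<in> {1..l}" for c'
  proof (cases "c' = c")
    case False
    have "fps_nth (f c') 0 \<noteq> 0"
      using jet_factor_nonzero[where 'a='a, OF c c'] False by (simp add: f_def jet_0 \<tau>_def x_def)
    then have "f c' * inverse (f c') = 1" by (rule inverse_mult_eq_1')
    then have "lift (f c') * lift (inverse (f c')) = 1" by (simp flip: lift_mult add: lift_1)
    then have "lift (f c') * (lift (inverse (f c')) * Xf c') = Xf c'" by (simp flip: mult.assoc)
    then show ?thesis by blast
  next
    case True
    define g where "g = fps_shift 1 (f c)"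
    let ?F = "\<lambda>i. [:1 - \<tau> * x ^ (?q ^ (c + l * i)), - (x ^ (?q ^ (c + l * i))):]"
    have i0: "m - a \<in> {..<j}" using m by auto
    have "\<tau> * x ^ (?q ^ (c + l * (m - a))) = 1"
      unfolding \<tau>_def x_def by (rule factor_zero[OF m(1)])
    then have F0: "?F (m - a) = [:0, - (x ^ (?q ^ (c + l * (m - a)))):]" by simp
    have jp: "jetp ?q l c j \<tau> x = ?F (m - a) * (\<Prod>i\<in>{..<j} - {m - a}. ?F i)"
      unfolding jetp_def by (rule prod.remove[OF _ i0]) simp
    have "poly.coeff (jetp ?q l c j \<tau> x) 0 = 0" unfolding jp F0 by (simp add: coeff_mult)
    then have f0: "fps_nth (f c) 0 = 0" by (simp add: f_def jet_def)
    have others: "poly.coeff (\<Prod>i\<in>{..<j} - {m - a}. ?F i) 0 \<noteq> 0"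
    proof -
      have "poly.coeff (\<Prod>i\<in>{..<j} - {m - a}. ?F i) 0 = (\<Prod>i\<in>{..<j} - {m - a}. poly.coeff (?F i) 0)"
        unfolding poly_0_coeff_0[symmetric] by (rule poly_prod)
      also have "\<dots> \<noteq> 0"
      proof -
        have "1 - \<tau> * x ^ (?q ^ (c + l * i)) \<noteq> 0" if "i \<in> {..<j} - {m - a}" for i
          unfolding \<tau>_def x_def by (rule jet_factor_nonzero[OF c c]) (use that m in auto)
        then show ?thesis by simp
      qed
      finally show ?thesis .
    qed
    have "poly.coeff (jetp ?q l c j \<tau> x) 1 \<noteq> 0"
      unfolding jp F0 using others by (simp add: coeff_mult x_def)
    then have g0: "fps_nth g 0 \<noteq> 0" by (simp add: g_def f_def jet_def)
    have fg: "f c = fps_X * g"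
      unfolding g_def by (rule fps_ext) (use f0 in \<open>simp add: fps_X_mult_nth\<close>)
    have "Xf c = fps_X * fps_shift 1 (Xf c)"
      by (rule fps_ext) (auto simp: fps_X_mult_nth Xf_def Xt_def)
    moreover have "lift (f c) * (lift (inverse g) * fps_shift 1 (Xf c)) =
        fps_X * fps_shift 1 (Xf c) * (lift g * lift (inverse g))"
      by (simp only: fg lift_mult lift_X mult_ac)
    moreover have "lift g * lift (inverse g) = 1"
      using inverse_mult_eq_1'[OF g0] by (simp flip: lift_mult add: lift_1)
    ultimately have "lift (f c) * (lift (inverse g) * fps_shift 1 (Xf c)) = Xf c"
      by simp
    then show ?thesis using True by blast
  qed
  then obtain G where G: "\<And>c'. c' \<in> {1..l} \<Longrightarrow> lift (f c') * G c' = Xf c'" by metis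
  have "(\<Sum>i\<le>k. cst (jet ?q l c' j i \<tau> x) * fps_nth (G c') (k - i)) = Xt (c', k)" if "c' \<in> {1..l}" for c' k
    using arg_cong[OF G[OF that], of "\<lambda>h. fps_nth h k"]
    by (simp add: fps_mult_nth lift_def f_def Xf_def atLeast0AtMost)
  then show ?thesis by (intro exI[of _ "\<lambda>(c', k). fps_nth (G c') k"]) simp
qed

text \<open>The premise \<open>R0\<close> says that \<open>R(AX)\<close> is proportional to \<open>R\<^sup>\<sigma>\<close>.  At a zero \<open>t\<close> of the \<open>c\<close>-th product the
  factor of \<open>R\<^sup>\<sigma>\<close> is \<open>0\<close>, as the leading monomial \<open>m0\<close> contains a variable with index \<open>c\<close>, and the factor of \<open>R(AX)\<close> is not.
  Solving for \<open>X\<close> gives \<open>R(t, X) = 0\<close> up to monomials divisible by \<open>X\<^sub>c\<^sub>,\<^sub>0\<close>.  So the coefficient of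
  every other monomial has infinitely many zeros.\<close>

lemma function_rel_imp_0_step:
  fixes R :: "(nat \<times> nat \<Rightarrow>\<^sub>0 nat) \<Rightarrow>\<^sub>0 'a::{field,finite} fls poly"
  assumes l: "l \<ge> 1" and vars: "mvars_in ({1..l} \<times> UNIV) R"
    and w: "\<And>n. n \<in> Poly_Mapping.keys R \<Longrightarrow> wt n \<le> w"
    and m0: "m0 \<in> Poly_Mapping.keys R" "wt m0 = w" and c: "(c, k) \<in> Poly_Mapping.keys m0"
    and R0: "\<And>j. cst (frob_twist (l * j) (Poly_Mapping.lookup R m0)) * mev cst (jet_subst CARD('a) l j [:0, 1:] (zz a)) R =
       cst (Poly_Mapping.lookup R m0 * mmon (\<lambda>i. jet CARD('a) l (fst i) j 0 [:0, 1:] (zz a)) m0) * Poly_Mapping.map (frob_twist (l * j)) R"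
    and n: "n \<in> Poly_Mapping.keys R"
  shows "(c, 0) \<in> Poly_Mapping.keys n"
proof (rule ccontr)
  assume n0: "(c, 0) \<notin> Poly_Mapping.keys n"
  let ?q = "CARD('a)"
  have q2: "?q \<ge> 2" by (rule card_ge_2)
  define r where "r = Poly_Mapping.lookup R m0"
  have r: "r \<noteq> 0" using m0 by (simp add: r_def in_keys_iff)
  have "(c, k) \<in> {1..l} \<times> UNIV" using vars m0(1) c unfolding mvars_in_def by blast
  then have cl: "c \<in> {1..l}" by simp
  define \<tau> :: "nat \<Rightarrow> 'a fls" where "\<tau> m = fls_X_inv ^ (?q ^ (c + l * m))" for m
  define x :: "'a fls" where "x = fls_X ^ (?q ^ (l * a))"
  have "poly (Poly_Mapping.lookup R n) (\<tau> m) = 0" if m: "m \<ge> a" for m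
  proof -
    \<comment> \<open>j is large enough for the twisted leading coefficient not to vanish, and for the j split factors to contain the one with zero at this point\<close>
    obtain J where J: "\<And>n. n \<ge> J \<Longrightarrow> poly (frob_twist n r) (\<tau> m) \<noteq> 0"
      using poly_frob_twist_nonzero[OF r, of "?q ^ (c + l * m)"] frobenius_pow_pos[where 'a='a] unfolding \<tau>_def by auto
    define j where "j = J + Suc m"
    have "l * j \<ge> J" using l unfolding j_def by (metis le_add1 le_trans mult_le_mono1 nat_mult_1)
    then have sr: "poly (frob_twist (l * j) r) (\<tau> m) \<noteq> 0" by (rule J)
    have mj: "m < a + j" by (simp add: j_def)
    define Xt :: "nat \<times> nat \<Rightarrow> ((nat \<times> nat \<Rightarrow>\<^sub>0 nat) \<Rightarrow>\<^sub>0 'a fls)" where "Xt = (\<lambda>i. if i = (c, 0) then 0 else mvar i)"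
    obtain Z where Z: "\<And>c' k. c' \<in> {1..l} \<Longrightarrow> (\<Sum>i\<le>k. cst (jet ?q l c' j i (\<tau> m) x) * Z (c', k - i)) = Xt (c', k)"
      using jet_subst_solve[OF cl m mj] unfolding \<tau>_def x_def Xt_def by blast
    define \<phi> :: "'a fls poly \<Rightarrow> ((nat \<times> nat \<Rightarrow>\<^sub>0 nat) \<Rightarrow>\<^sub>0 'a fls)" where "\<phi> p = cst (poly p (\<tau> m))" for p
    have hom: "rhom (\<lambda>p. poly p (\<tau> m))" by (simp add: rhom_def)
    have \<phi>: "rhom \<phi>" unfolding \<phi>_def by (rule rhom_comp[OF hom rhom_cst])
    have jm: "poly (jet ?q l c' j i [:0, 1:] (zz a)) (\<tau> m) = jet ?q l c' j i (\<tau> m) x" for c' i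
      by (simp add: rhom_jet[OF hom] x_def)
    have "poly (mmon (\<lambda>i. jet ?q l (fst i) j 0 [:0, 1:] (zz a)) m0) (\<tau> m) = mmon (\<lambda>i. jet ?q l (fst i) j 0 (\<tau> m) x) m0"
      using rhom_mmon[OF hom, of "\<lambda>i. jet ?q l (fst i) j 0 [:0, 1:] (zz a)" m0] by (simp add: jm)
    also have "\<dots> = 0"
    proof -
      have "jet ?q l c j 0 (\<tau> m) x = 0"
      proof -
        have "\<tau> m * x ^ (?q ^ (c + l * (m - a))) = 1"
          unfolding \<tau>_def x_def by (rule factor_zero[OF m])
        moreover have "m - a < j" using m mj by auto
        ultimately show ?thesis by (auto simp: jet_0 intro!: bexI[of _ "m - a"])
      qed
      moreover have "Poly_Mapping.lookup m0 (c, k) > 0" using c by (simp add: in_keys_iff)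
      ultimately show ?thesis unfolding mmon_def using c
        by (intro prod_zero) (auto intro!: bexI[of _ "(c, k)"] simp: power_0_left)
    qed
    finally have z: "\<phi> (r * mmon (\<lambda>i. jet ?q l (fst i) j 0 [:0, 1:] (zz a)) m0) = 0" by (simp add: \<phi>_def)
    have "mev \<phi> Z (mev cst (jet_subst ?q l j [:0, 1:] (zz a)) R) = mev \<phi> (\<lambda>i. mev \<phi> Z (jet_subst ?q l j [:0, 1:] (zz a) i)) R"
      by (rule mev_subst[OF \<phi>])
    also have "\<dots> = mev \<phi> Xt R"
    proof (rule mev_cong)
      fix u i assume "u \<in> Poly_Mapping.keys R" "i \<in> Poly_Mapping.keys u"
      then have "i \<in> {1..l} \<times> UNIV" using vars unfolding mvars_in_def by blast
      then have "fst i \<in> {1..l}" by auto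
      then show "mev \<phi> Z (jet_subst ?q l j [:0, 1:] (zz a) i) = Xt i"
        using Z[of "fst i" "snd i"] by (cases i) (simp add: mev_jet_subst[OF \<phi>] \<phi>_def jm)
    qed
    finally have e: "mev \<phi> Z (mev cst (jet_subst ?q l j [:0, 1:] (zz a)) R) = mev \<phi> Xt R" .
    have "\<phi> (frob_twist (l * j) r) * mev \<phi> Xt R = 0"
      using arg_cong[OF R0[of j], of "mev \<phi> Z"] z
      by (simp add: mev_mult[OF \<phi>] mev_cst rhom_0[OF \<phi>] e flip: r_def)
    then have "cst (inverse (poly (frob_twist (l * j) r) (\<tau> m))) * (\<phi> (frob_twist (l * j) r) * mev \<phi> Xt R) = 0" by simp
    then have "mev \<phi> Xt R = 0" using sr by (simp add: \<phi>_def mult_single flip: mult.assoc)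
    then have "0 = Poly_Mapping.lookup (mev \<phi> Xt R) n" by simp
    also have "\<dots> = (\<Sum>u\<in>Poly_Mapping.keys R. if u = n then poly (Poly_Mapping.lookup R n) (\<tau> m) else 0)"
      unfolding mev_def lookup_sum
    proof (rule sum.cong[OF refl])
      fix u assume "u \<in> Poly_Mapping.keys R"
      show "Poly_Mapping.lookup (\<phi> (Poly_Mapping.lookup R u) * mmon Xt u) n = (if u = n then poly (Poly_Mapping.lookup R n) (\<tau> m) else 0)"
      proof (cases "(c, 0) \<in> Poly_Mapping.keys u")
        case True
        then have "mmon Xt u = 0"
          unfolding mmon_def Xt_def by (intro prod_zero) (auto intro!: bexI[of _ "(c, 0)"] simp: in_keys_iff power_0_left)
        then show ?thesis using True n0 by auto
      next
        case False
        then have "mmon Xt u = mmon mvar u"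
          unfolding mmon_def Xt_def by (intro prod.cong) auto
        then show ?thesis by (simp add: \<phi>_def mmon_mvar lookup_cst_mult lookup_single when_def del: One_nat_def)
      qed
    qed
    also have "\<dots> = poly (Poly_Mapping.lookup R n) (\<tau> m)" using n by simp
    finally show ?thesis by simp
  qed
  then have "\<tau> ` {a..} \<subseteq> {y. poly (Poly_Mapping.lookup R n) y = 0}" by auto
  moreover have "inj_on \<tau> {a..}"
  proof (rule inj_onI)
    fix m m' assume "\<tau> m = \<tau> m'"
    then have "fls_subdegree (\<tau> m) = fls_subdegree (\<tau> m')" by simp
    then have "int (?q ^ (c + l * m)) = int (?q ^ (c + l * m'))" by (simp add: \<tau>_def)
    then have "c + l * m = c + l * m'" using q2 by (simp add: power_inject_exp del: of_nat_power)
    then show "m = m'" using l by simp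
  qed
  ultimately have "infinite {y. poly (Poly_Mapping.lookup R n) y = 0}"
    using finite_imageD finite_subset infinite_Ici by blast
  moreover have "Poly_Mapping.lookup R n \<noteq> 0" using n by (simp add: in_keys_iff)
  ultimately show False using poly_roots_finite by blast
qed

lemma mvar_factor:
  fixes R :: "('i \<Rightarrow>\<^sub>0 nat) \<Rightarrow>\<^sub>0 'r::comm_ring_1"
  assumes "\<And>n. n \<in> Poly_Mapping.keys R \<Longrightarrow> v \<in> Poly_Mapping.keys n"
  shows "\<exists>R'. R = mvar v * R' \<and> (\<forall>n\<in>Poly_Mapping.keys R'. n + Poly_Mapping.single v 1 \<in> Poly_Mapping.keys R)"
proof -
  let ?s = "Poly_Mapping.single v (1::nat)"
  define R' where "R' = (\<Sum>n\<in>Poly_Mapping.keys R. Poly_Mapping.single (n - ?s) (Poly_Mapping.lookup R n))"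
  have s: "?s + (n - ?s) = n" if "n \<in> Poly_Mapping.keys R" for n
  proof (rule poly_mapping_eqI)
    fix i
    have "Poly_Mapping.lookup n v \<noteq> 0" using assms[OF that] by (simp add: in_keys_iff)
    then show "Poly_Mapping.lookup (?s + (n - ?s)) i = Poly_Mapping.lookup n i"
      by (cases "v = i") (simp_all add: lookup_add lookup_minus lookup_single_not_eq)
  qed
  have "mvar v * R' = (\<Sum>n\<in>Poly_Mapping.keys R. Poly_Mapping.single n (Poly_Mapping.lookup R n))"
    unfolding R'_def sum_distrib_left mult_single
    by (intro sum.cong refl) (simp add: s del: One_nat_def)
  then have "R = mvar v * R'" using poly_mapping_sum_single[of R] by simp
  moreover have "n + ?s \<in> Poly_Mapping.keys R" if "n \<in> Poly_Mapping.keys R'" for n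
  proof -
    have "n \<in> (\<Union>u\<in>Poly_Mapping.keys R. Poly_Mapping.keys (Poly_Mapping.single (u - ?s) (Poly_Mapping.lookup R u)))"
      using that unfolding R'_def by (rule subsetD[OF keys_sum])
    then obtain u where "u \<in> Poly_Mapping.keys R" "n = u - ?s" by (auto split: if_splits)
    then show ?thesis using s[of u] by (simp add: add.commute del: One_nat_def)
  qed
  ultimately show ?thesis by blast
qed

text \<open>Induction on the weight and, for a given weight, on the number of monomials of that weight.  Carrying \<open>R\<close> from level \<open>a\<close> to
  \<open>a + j\<close> by the functional equation and by the Frobenius twist multiplies a leading coefficient in two ways; the
  cross-combination in which it cancels has fewer leading monomials and is \<open>0\<close>.  This is the proportionality used in
  \<open>function_rel_imp_0_step\<close>, which makes \<open>R\<close> divisible by \<open>X\<^sub>c\<^sub>,\<^sub>0\<close>; the quotient has smaller weight.\<close>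

theorem function_rel_imp_0:
  fixes R :: "(nat \<times> nat \<Rightarrow>\<^sub>0 nat) \<Rightarrow>\<^sub>0 'a::{field,finite} fls poly"
  assumes l: "l \<ge> 1"
  shows "function_rel l a R \<Longrightarrow> mvars_in ({1..l} \<times> UNIV) R \<Longrightarrow> (\<And>n. n \<in> Poly_Mapping.keys R \<Longrightarrow> wt n \<le> w) \<Longrightarrow> R = 0"
proof (induction w arbitrary: a R rule: less_induct)
  case (less w)
  let ?q = "CARD('a)"
  have main: "R = 0" if "function_rel l a R" "mvars_in ({1..l} \<times> UNIV) R" "\<And>n. n \<in> Poly_Mapping.keys R \<Longrightarrow> wt n \<le> w"
      "card {n \<in> Poly_Mapping.keys R. wt n = w} = N"
    for N a and R :: "(nat \<times> nat \<Rightarrow>\<^sub>0 nat) \<Rightarrow>\<^sub>0 'a fls poly"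
    using that
  proof (induction N arbitrary: a R rule: less_induct)
    case inner: (less N)
    show "R = 0"
    proof (cases "w = 0")
      case True
      then show ?thesis using function_rel_const[OF inner.prems(1)] inner.prems(3) by simp
    next
      case False
      show ?thesis
      proof (cases "{n \<in> Poly_Mapping.keys R. wt n = w} = {}")
        case True
        show ?thesis
        proof (rule less.IH[of "w - 1"])
          fix n assume "n \<in> Poly_Mapping.keys R"
          with True inner.prems(3)[of n] show "wt n \<le> w - 1" by force
        qed (use False inner.prems in auto)
      next
        case nonempty: False
        then obtain m0 where m0: "m0 \<in> Poly_Mapping.keys R" "wt m0 = w" by blast
        have "Poly_Mapping.keys m0 \<noteq> {}" using False m0(2) by (auto simp: wt_def)
        then obtain c k where ck: "(c, k) \<in> Poly_Mapping.keys m0" by (metis all_not_in_conv surj_pair)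
        have sl: "lead (jet_subst ?q l j [:0, 1:] (zz a) i) (Poly_Mapping.single i 1) (jet ?q l (fst i) j 0 [:0, 1:] (zz a :: 'a fls poly))" for j i
          by (rule lead_jet_subst)
        have cross: "cst (frob_twist (l * j) (Poly_Mapping.lookup R m0)) * mev cst (jet_subst ?q l j [:0, 1:] (zz a)) R =
          cst (Poly_Mapping.lookup R m0 * mmon (\<lambda>i. jet ?q l (fst i) j 0 [:0, 1:] (zz a)) m0) * Poly_Mapping.map (frob_twist (l * j)) R"
          (is "?A j = ?B j") for j
        proof -
          have top: "Poly_Mapping.lookup (?A j - ?B j) n =
             frob_twist (l * j) (Poly_Mapping.lookup R m0) * (Poly_Mapping.lookup R n * mmon (\<lambda>i. jet ?q l (fst i) j 0 [:0, 1:] (zz a)) n)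
             - Poly_Mapping.lookup R m0 * mmon (\<lambda>i. jet ?q l (fst i) j 0 [:0, 1:] (zz a)) m0 * frob_twist (l * j) (Poly_Mapping.lookup R n)"
            if "wt n \<ge> w" for n
            by (simp add: lookup_minus lookup_cst_mult lookup_map rhom_0[OF rhom_frob_twist]
                lookup_subst_top[where g="jet_subst ?q l j [:0, 1:] (zz a)" and R=R, OF sl inner.prems(3) that])
          have top0: "n \<in> Poly_Mapping.keys R" if "n \<in> Poly_Mapping.keys (?A j - ?B j)" "wt n \<ge> w" for n
          proof (rule ccontr)
            assume "n \<notin> Poly_Mapping.keys R"
            then have "Poly_Mapping.lookup R n = 0" by (simp add: in_keys_iff)
            then show False using that top[OF that(2)] by (simp add: in_keys_iff rhom_0[OF rhom_frob_twist])
          qed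
          have "?A j - ?B j = 0"
          proof (rule inner.IH)
            show "function_rel l (a + j) (?A j - ?B j)"
              by (intro function_rel_diff function_rel_mult function_rel_subst function_rel_frob_twist inner.prems)
            have "Poly_Mapping.keys (Poly_Mapping.map (frob_twist (l * j)) R) \<subseteq> Poly_Mapping.keys R"
              by (auto simp: in_keys_iff lookup_map rhom_0[OF rhom_frob_twist])
            then have "mvars_in ({1..l} \<times> UNIV) (Poly_Mapping.map (frob_twist (l * j)) R)"
              using inner.prems(2) by (auto simp: mvars_in_def)
            then show "mvars_in ({1..l} \<times> UNIV) (?A j - ?B j)"
              by (intro mvars_in_diff mvars_in_mult mvars_in_subst inner.prems mvars_in_single mvars_in_jet_subst) auto
            show "wt n \<le> w" if "n \<in> Poly_Mapping.keys (?A j - ?B j)" for n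
              using top0[OF that] inner.prems(3) by force
            show "card {n \<in> Poly_Mapping.keys (?A j - ?B j). wt n = w} < N"
              unfolding inner.prems(4)[symmetric]
            proof (rule psubset_card_mono)
              have "m0 \<notin> Poly_Mapping.keys (?A j - ?B j)"
                using top[of m0] m0(2) by (simp add: in_keys_iff algebra_simps)
              then show "{n \<in> Poly_Mapping.keys (?A j - ?B j). wt n = w} \<subset> {n \<in> Poly_Mapping.keys R. wt n = w}"
                using top0 m0 by auto
            qed simp
          qed simp
          then show ?thesis by simp
        qed
        have "(c, 0) \<in> Poly_Mapping.keys n" if "n \<in> Poly_Mapping.keys R" for n
          by (rule function_rel_imp_0_step[OF l inner.prems(2,3) m0 ck cross that])
        then obtain R' where R': "R = mvar (c, 0) * R'"
          "\<And>n. n \<in> Poly_Mapping.keys R' \<Longrightarrow> n + Poly_Mapping.single (c, 0) 1 \<in> Poly_Mapping.keys R"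
          using mvar_factor[of R "(c, 0)"] by blast
        have "R' = 0"
        proof (rule less.IH[of "w - 1"])
          show "w - 1 < w" using False by simp
          show "function_rel l a R'" using inner.prems(1) R'(1) function_rel_cancel by blast
          show "mvars_in ({1..l} \<times> UNIV) R'"
            unfolding mvars_in_def
          proof
            fix n assume "n \<in> Poly_Mapping.keys R'"
            then have "Poly_Mapping.keys (n + Poly_Mapping.single (c, 0) 1) \<subseteq> {1..l} \<times> UNIV"
              using R'(2) inner.prems(2) by (auto simp: mvars_in_def)
            moreover have "Poly_Mapping.keys n \<subseteq> Poly_Mapping.keys (n + Poly_Mapping.single (c, 0) 1)"
              by (auto simp: in_keys_iff lookup_add)
            ultimately show "Poly_Mapping.keys n \<subseteq> {1..l} \<times> UNIV" by blast
          qed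
          show "wt n \<le> w - 1" if "n \<in> Poly_Mapping.keys R'" for n
            using inner.prems(3)[OF R'(2)[OF that]] by (simp add: wt_add wt_single)
        qed
        then show ?thesis using R'(1) by simp
      qed
    qed
  qed
  show ?case by (rule main[OF less.prems(1,2,3) refl])
qed

end

section \<open>Tools for the transfer from values to functions\<close>

text \<open>Gaussian elimination: a nonzero entry eliminates one unknown from all equations, hence from every finite subsystem.\<close>

lemma elimination_limit:
  fixes x :: "nat \<Rightarrow> 'i \<Rightarrow> 'r::idom"
  assumes "finite I" and "\<And>W. \<exists>g. (\<exists>i\<in>I. g i \<noteq> 0) \<and> (\<forall>w<W. (\<Sum>i\<in>I. g i * x w i) = 0)"
  shows "\<exists>g. (\<exists>i\<in>I. g i \<noteq> 0) \<and> (\<forall>w. (\<Sum>i\<in>I. g i * x w i) = 0)"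
  using assms
proof (induction I arbitrary: x rule: finite_psubset_induct)
  case (psubset I)
  obtain i1 where "i1 \<in> I" using psubset.prems[of 0] by blast
  show ?case
  proof (cases "\<forall>w. \<forall>i\<in>I. x w i = 0")
    case True
    then show ?thesis using \<open>i1 \<in> I\<close> by (intro exI[of _ "\<lambda>_. 1"]) auto
  next
    case False
    then obtain w0 i0 where i0: "i0 \<in> I" "x w0 i0 \<noteq> 0" by blast
    let ?I = "I - {i0}"
    define x' where "x' w i = x w0 i0 * x w i - x w i0 * x w0 i" for w i
    have sp: "(\<Sum>i\<in>I. f i) = f i0 + (\<Sum>i\<in>?I. f i)" for f :: "'i \<Rightarrow> 'r"
      using psubset.hyps i0(1) by (rule sum.remove)
    have "\<exists>g. (\<exists>i\<in>?I. g i \<noteq> 0) \<and> (\<forall>w<W. (\<Sum>i\<in>?I. g i * x' w i) = 0)" for W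
    proof -
      obtain g where g: "\<exists>i\<in>I. g i \<noteq> 0" "\<And>w. w < max W (Suc w0) \<Longrightarrow> (\<Sum>i\<in>I. g i * x w i) = 0"
        using psubset.prems[of "max W (Suc w0)"] by blast
      have g0: "(\<Sum>i\<in>?I. g i * x w i) = - g i0 * x w i0" if "w < max W (Suc w0)" for w
        using g(2)[OF that] unfolding sp by (simp add: eq_neg_iff_add_eq_0 add.commute)
      have "\<exists>i\<in>?I. g i \<noteq> 0"
      proof (rule ccontr)
        assume no: "\<not> (\<exists>i\<in>?I. g i \<noteq> 0)"
        then have "g i0 * x w0 i0 = 0" using g0[of w0] by simp
        then show False using g(1) no i0 by auto
      qed
      moreover have "(\<Sum>i\<in>?I. g i * x' w i) = 0" if "w < W" for w
      proof -
        have "(\<Sum>i\<in>?I. g i * x' w i) = x w0 i0 * (\<Sum>i\<in>?I. g i * x w i) - x w i0 * (\<Sum>i\<in>?I. g i * x w0 i)"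
          unfolding x'_def sum_distrib_left sum_subtractf[symmetric] by (intro sum.cong) (auto simp: algebra_simps)
        also have "\<dots> = 0" using g0[of w] g0[of w0] that by simp
        finally show ?thesis .
      qed
      ultimately show ?thesis by blast
    qed
    then obtain g where g: "\<exists>i\<in>?I. g i \<noteq> 0" "\<And>w. (\<Sum>i\<in>?I. g i * x' w i) = 0"
      using psubset.IH[of ?I x'] i0(1) by blast
    define g' where "g' i = (if i = i0 then - (\<Sum>i\<in>?I. g i * x w0 i) else x w0 i0 * g i)" for i
    have "(\<Sum>i\<in>I. g' i * x w i) = 0" for w
    proof -
      have "(\<Sum>i\<in>?I. g' i * x w i) = (\<Sum>i\<in>?I. x w0 i0 * g i * x w i)"
        by (intro sum.cong) (auto simp: g'_def)
      then have "(\<Sum>i\<in>I. g' i * x w i) = (\<Sum>i\<in>?I. g i * x' w i)"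
        unfolding sp x'_def
        by (simp add: g'_def sum_subtractf sum_distrib_left sum_distrib_right algebra_simps)
      then show ?thesis using g(2) by simp
    qed
    moreover have "\<exists>i\<in>I. g' i \<noteq> 0" using g(1) i0(2) by (auto simp: g'_def)
    ultimately show ?thesis by blast
  qed
qed

lemma ord_ge_div:
  fixes f c :: "'a::idom fls"
  assumes "ord_ge (f * c) k" "c \<noteq> 0" shows "ord_ge f (k - fls_subdegree c)"
  using assms by (cases "f = 0") (auto simp: ord_ge_iff_subdegree)

text \<open>Dividing by a factor \<open>t - a\<close> improves the Gauss norm of the polynomial by the radius \<open>\<rho>\<close>, and the quotient is still small at
  the other points because their distances from \<open>a\<close> are at least \<open>1\<close>.  Multiplying back costs the size \<open>L a\<close> of the point.\<close>

lemma schwarz_lemma: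
  fixes p :: "'a::idom fls poly" and \<rho> :: int
  assumes "finite A" "\<rho> \<ge> 0"
    and "\<And>a. a \<in> A \<Longrightarrow> ord_ge a (- \<rho>)" "\<And>a. a \<in> A \<Longrightarrow> ord_ge a (- L a)" "\<And>a. a \<in> A \<Longrightarrow> L a \<ge> 0"
    and "\<And>a b. a \<in> A \<Longrightarrow> b \<in> A \<Longrightarrow> a \<noteq> b \<Longrightarrow> fls_subdegree (a - b) \<le> 0"
    and "\<And>b. ord_ge (poly.coeff p b) (Z + \<rho> * int b)"
    and "\<And>a. a \<in> A \<Longrightarrow> ord_ge (poly p a) W"
  shows "ord_ge (poly.coeff p b) (min W (Z + \<rho> * int (card A)) - (\<Sum>a\<in>A. L a))"
  using assms
proof (induction A arbitrary: p Z b rule: finite_induct)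
  case empty
  have "Z \<le> Z + \<rho> * int b" using empty.prems by simp
  then show ?case using empty.prems(6)[of b] by (auto intro: ord_ge_mono)
next
  case (insert a A)
  define G where "G = synthetic_div p a"
  have pG: "p = [:- a, 1:] * G + [:poly p a:]" unfolding G_def by (rule synthetic_div_correct'[symmetric])
  have cG: "poly.coeff p (Suc b) = poly.coeff G b - a * poly.coeff G (Suc b)" for b
    by (subst pG) simp
  have c0: "poly.coeff p 0 = poly p a - a * poly.coeff G 0"
    by (subst pG) simp
  have "ord_ge (poly.coeff G b) (Z + \<rho> * int (Suc b))" if "b + d = Suc (Polynomial.degree G)" for b d
    using that
  proof (induction d arbitrary: b)
    case 0
    then show ?case by (simp add: coeff_eq_0)
  next
    case (Suc d)
    have "ord_ge (a * poly.coeff G (Suc b)) (- \<rho> + (Z + \<rho> * int (Suc (Suc b))))"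
      by (rule ord_ge_mult[OF _ Suc.IH]) (use insert.prems(2) Suc.prems in auto)
    then have "ord_ge (a * poly.coeff G (Suc b)) (Z + \<rho> * int (Suc b))" by (simp add: algebra_simps)
    then have "ord_ge (poly.coeff p (Suc b) + a * poly.coeff G (Suc b)) (Z + \<rho> * int (Suc b))"
      using insert.prems(6)[of "Suc b"] by (intro ord_ge_add) auto
    then show ?case by (simp add: cG)
  qed
  then have Gb: "ord_ge (poly.coeff G b) (Z + \<rho> * int (Suc b))" for b
    by (cases "b \<le> Suc (Polynomial.degree G)") (auto simp: coeff_eq_0 dest: le_Suc_ex)
  have "ord_ge (poly G a') W" if a': "a' \<in> A" for a'
  proof -
    have "poly p a' = poly G a' * (a' - a) + poly p a" by (subst pG) (simp add: algebra_simps)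
    then have "poly G a' * (a' - a) = poly p a' - poly p a" by simp
    then have "ord_ge (poly G a' * (a' - a)) W" using insert.prems(7) a' by (auto intro: ord_ge_diff)
    moreover have "a' \<noteq> a" using a' insert.hyps by auto
    ultimately show ?thesis using insert.prems(5)[of a' a] a' by (auto intro: ord_ge_cancel[of "poly G a'" "a' - a" W])
  qed
  then have IH: "ord_ge (poly.coeff G b) (min W ((Z + \<rho>) + \<rho> * int (card A)) - (\<Sum>a\<in>A. L a))" for b
    using insert.prems Gb by (intro insert.IH) (auto simp: algebra_simps)
  let ?k = "min W (Z + \<rho> * int (card (insert a A))) - (\<Sum>a\<in>insert a A. L a)"
  have k: "?k = - L a + (min W ((Z + \<rho>) + \<rho> * int (card A)) - (\<Sum>a\<in>A. L a))"
    using insert.hyps by (simp add: algebra_simps)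
  have La: "L a \<ge> 0" using insert.prems by simp
  have "(\<Sum>a\<in>A. L a) \<ge> 0" using insert.prems by (intro sum_nonneg) auto
  then have "?k \<le> W" using La insert.hyps by auto
  then have pa: "ord_ge (poly p a) ?k" using insert.prems(7)[of a] by (auto intro: ord_ge_mono)
  have aG: "ord_ge (a * poly.coeff G b) ?k" for b
    unfolding k by (rule ord_ge_mult[OF _ IH]) (use insert.prems in auto)
  have G: "ord_ge (poly.coeff G b) ?k" for b
    by (rule ord_ge_mono[OF IH]) (use La in \<open>simp add: k\<close>)
  show ?case
    by (cases b) (auto simp: c0 cG intro!: ord_ge_diff G[simplified] aG pa simp del: sum.insert card.insert)
qed

text \<open>Elements of \<open>\<F>\<^sub>q[\<theta>, z]\<close> of bounded degrees: they are determined by a bounded number of coefficients in \<open>\<F>\<^sub>q\<close>.\<close>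

definition laurent_within :: "nat \<Rightarrow> nat \<Rightarrow> 'a::zero fls \<Rightarrow> bool" where
  "laurent_within a b f \<longleftrightarrow> (\<forall>i. fls_nth f i \<noteq> 0 \<longrightarrow> - int a \<le> i \<and> i \<le> int b)"

lemma laurent_within_0 [simp]: "laurent_within a b 0" by (simp add: laurent_within_def)
lemma laurent_within_1 [simp]: "laurent_within a b 1" by (simp add: laurent_within_def)
lemma laurent_within_const [simp]: "laurent_within a b (fls_const c)" by (simp add: laurent_within_def)
lemma laurent_within_mono: "laurent_within a b f \<Longrightarrow> a \<le> a' \<Longrightarrow> b \<le> b' \<Longrightarrow> laurent_within a' b' f" by (force simp: laurent_within_def)
lemma laurent_within_add: "laurent_within a b f \<Longrightarrow> laurent_within a b g \<Longrightarrow> laurent_within a b (f + g)" by (force simp: laurent_within_def)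
lemma laurent_within_diff: "laurent_within a b f \<Longrightarrow> laurent_within a b g \<Longrightarrow> laurent_within a b ((f :: 'a::ab_group_add fls) - g)" by (force simp: laurent_within_def)
lemma laurent_within_sum: "(\<And>i. i \<in> S \<Longrightarrow> laurent_within a b (f i)) \<Longrightarrow> laurent_within a b (\<Sum>i\<in>S. f i)"
  by (induction S rule: infinite_finite_induct) (auto intro: laurent_within_add)
lemma laurent_within_mult:
  fixes f g :: "'a::idom fls"
  assumes "laurent_within a b f" "laurent_within a' b' g" shows "laurent_within (a + a') (b + b') (f * g)"
  unfolding laurent_within_def
proof (intro allI impI)
  fix n assume n: "fls_nth (f * g) n \<noteq> 0"
  then obtain i where "fls_nth f i * fls_nth g (n - i) \<noteq> 0"
    unfolding fls_times_nth(2) by (meson sum.not_neutral_contains_not_neutral)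
  then have "fls_nth f i \<noteq> 0" "fls_nth g (n - i) \<noteq> 0" by auto
  then have "- int a \<le> i \<and> i \<le> int b" "- int a' \<le> n - i \<and> n - i \<le> int b'"
    using assms by (auto simp: laurent_within_def)
  then show "- int (a + a') \<le> n \<and> n \<le> int (b + b')" by simp
qed
lemma laurent_within_power: "laurent_within a b f \<Longrightarrow> laurent_within (n * a) (n * b) ((f :: 'a::idom fls) ^ n)"
  by (induction n) (auto dest: laurent_within_mult)
lemma laurent_within_X_power: "n \<le> b \<Longrightarrow> laurent_within a b (fls_X ^ n :: 'a::idom fls)" by (auto simp: laurent_within_def)
lemma laurent_within_X_inv_power: "n \<le> a \<Longrightarrow> laurent_within a b (fls_X_inv ^ n :: 'a::idom fls)" by (auto simp: laurent_within_def)
lemma laurent_within_ord_ge: "laurent_within a b f \<Longrightarrow> ord_ge f (- int a)" by (force simp: laurent_within_def ord_ge_def)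

definition coeffs_laurent_within :: "nat \<Rightarrow> nat \<Rightarrow> (('i \<Rightarrow>\<^sub>0 nat) \<Rightarrow>\<^sub>0 'a::idom fls) \<Rightarrow> bool" where
  "coeffs_laurent_within a b P \<longleftrightarrow> (\<forall>m. laurent_within a b (Poly_Mapping.lookup P m))"

lemma coeffs_laurent_within_sum: "(\<And>i. i \<in> S \<Longrightarrow> coeffs_laurent_within a b (P i)) \<Longrightarrow> coeffs_laurent_within a b (\<Sum>i\<in>S. P i)"
  by (auto simp: coeffs_laurent_within_def lookup_sum intro: laurent_within_sum)
lemma coeffs_laurent_within_single: "laurent_within a b c \<Longrightarrow> coeffs_laurent_within a b (Poly_Mapping.single m c)"
  by (auto simp: coeffs_laurent_within_def lookup_single when_def)
lemma coeffs_laurent_within_mono: "coeffs_laurent_within a b P \<Longrightarrow> a \<le> a' \<Longrightarrow> b \<le> b' \<Longrightarrow> coeffs_laurent_within a' b' P"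
  by (auto simp: coeffs_laurent_within_def intro: laurent_within_mono)
lemma coeffs_laurent_within_mult:
  assumes "coeffs_laurent_within a b P" "coeffs_laurent_within a' b' P'" shows "coeffs_laurent_within (a + a') (b + b') (P * P')"
proof -
  have "P * P' = (\<Sum>m\<in>Poly_Mapping.keys P. \<Sum>n\<in>Poly_Mapping.keys P'.
      Poly_Mapping.single (m + n) (Poly_Mapping.lookup P m * Poly_Mapping.lookup P' n))"
    by (subst (1) poly_mapping_sum_single[of P], subst (1) poly_mapping_sum_single[of P'])
       (simp add: sum_product mult_single)
  then show ?thesis using assms
    by (auto simp: coeffs_laurent_within_def[of a] coeffs_laurent_within_def[of a'] intro!: coeffs_laurent_within_sum coeffs_laurent_within_single laurent_within_mult)
qed
lemma coeffs_laurent_within_power: "coeffs_laurent_within a b P \<Longrightarrow> coeffs_laurent_within (n * a) (n * b) (P ^ n)"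
proof (induction n)
  case (Suc n)
  then show ?case using coeffs_laurent_within_mult[of a b P "n * a" "n * b" "P ^ n"] by simp
qed (simp add: coeffs_laurent_within_def lookup_one when_def)
lemma coeffs_laurent_within_mmon:
  assumes "\<And>i. i \<in> Poly_Mapping.keys m \<Longrightarrow> coeffs_laurent_within 0 b (g i)"
  shows "coeffs_laurent_within 0 ((\<Sum>i\<in>Poly_Mapping.keys m. Poly_Mapping.lookup m i) * b) (mmon g m)"
proof -
  have "coeffs_laurent_within 0 ((\<Sum>i\<in>S. Poly_Mapping.lookup m i) * b) (\<Prod>i\<in>S. g i ^ Poly_Mapping.lookup m i)"
    if "S \<subseteq> Poly_Mapping.keys m" for S
  proof -
    have "finite S" using finite_subset[OF that] by simp
    then show ?thesis using that
    proof (induction S rule: finite_induct)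
      case empty
      then show ?case by (simp add: coeffs_laurent_within_def lookup_one when_def)
    next
      case (insert i S)
      have "coeffs_laurent_within 0 (Poly_Mapping.lookup m i * b) (g i ^ Poly_Mapping.lookup m i)"
        using coeffs_laurent_within_power[OF assms, of i "Poly_Mapping.lookup m i"] insert.prems by simp
      from coeffs_laurent_within_mult[OF this insert.IH] insert show ?case by (simp add: algebra_simps)
    qed
  qed
  from this[OF order_refl] show ?thesis unfolding mmon_def .
qed

lemma geometric_sum_le: "(q::nat) \<ge> 2 \<Longrightarrow> (\<Sum>m<n. q ^ m) \<le> q ^ n"
proof (induction n)
  case (Suc n)
  have "(\<Sum>m<Suc n. q ^ m) \<le> 2 * q ^ n" using Suc by simp
  also have "\<dots> \<le> q ^ Suc n" using Suc.prems by simp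
  finally show ?case .
qed simp

lemma laurent_within_jet:
  assumes "c \<ge> 1"
  shows "laurent_within 0 (\<Sum>m<M. CARD('a) ^ (c + l * m)) (jet CARD('a) l c M k fls_X_inv (fls_X :: 'a::{field,finite} fls))"
proof (induction M arbitrary: k)
  case 0
  show ?case by (simp add: jet_M_0)
next
  case (Suc M)
  let ?e = "CARD('a) ^ (c + l * M)"
  have e: "?e \<ge> 1" using frobenius_pow_pos[where 'a='a] by (simp add: Suc_leI)
  have "(fls_X_inv :: 'a fls) * fls_X ^ ?e = fls_X ^ (?e - 1)"
    using fls_X_inv_power_times_conv_shift(1)[of 1 "fls_X ^ ?e :: 'a fls"] e
    by (intro fls_eqI) auto
  then have "laurent_within 0 ?e (1 - fls_X_inv * fls_X ^ ?e :: 'a fls)"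
    by (auto intro!: laurent_within_diff laurent_within_X_power)
  then have 1: "laurent_within (0 + 0) ((\<Sum>m<M. CARD('a) ^ (c + l * m)) + ?e) (jet CARD('a) l c M k fls_X_inv fls_X * (1 - fls_X_inv * fls_X ^ ?e :: 'a fls))" for k
    by (rule laurent_within_mult[OF Suc.IH])
  have 2: "laurent_within (0 + 0) ((\<Sum>m<M. CARD('a) ^ (c + l * m)) + ?e) (jet CARD('a) l c M k fls_X_inv fls_X * (fls_X ^ ?e :: 'a fls))" for k
    by (rule laurent_within_mult[OF Suc.IH laurent_within_X_power]) simp
  show ?case using 1 2 by (cases k) (auto simp: jet_Suc_0 jet_Suc_Suc intro!: laurent_within_diff)
qed

lemma laurent_within_jet':
  assumes "c \<in> {1..l}" "l \<ge> 1"
  shows "laurent_within 0 (CARD('a) ^ (l * Suc M)) (jet CARD('a) l c M k fls_X_inv (fls_X :: 'a::{field,finite} fls))"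
proof (rule laurent_within_mono[OF laurent_within_jet])
  let ?q = "CARD('a)"
  have q2: "?q \<ge> 2" by (rule card_ge_2)
  have "?q ^ 1 \<le> ?q ^ l" using q2 assms by (intro power_increasing) auto
  then have Q2: "?q ^ l \<ge> 2" using q2 by simp
  have "(\<Sum>m<M. ?q ^ (c + l * m)) \<le> (\<Sum>m<M. ?q ^ l * (?q ^ l) ^ m)"
    unfolding power_mult[symmetric] power_add[symmetric] using assms q2 by (intro sum_mono power_increasing) auto
  also have "\<dots> \<le> ?q ^ l * (?q ^ l) ^ M"
    unfolding sum_distrib_left[symmetric] using geometric_sum_le[OF Q2] by (rule mult_le_mono2)
  also have "\<dots> = ?q ^ (l * Suc M)" by (simp add: power_mult power_add)
  finally show "(\<Sum>m<M. ?q ^ (c + l * m)) \<le> ?q ^ (l * Suc M)" .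
qed (use assms in auto)

text \<open>\<open>S\<close> is a subring and \<open>J\<close> an ideal of it.  They are predicates, since order bounds are used both for Laurent series and for
  polynomials over these.\<close>

lemma mmon_diff_ideal:
  fixes x y :: "'i \<Rightarrow> 's::comm_ring_1"
  assumes S: "S 1" "\<And>a b. S a \<Longrightarrow> S b \<Longrightarrow> S (a * b)"
    and J: "J 0" "\<And>a b. J a \<Longrightarrow> J b \<Longrightarrow> J (a + b)" "\<And>a b. S a \<Longrightarrow> J b \<Longrightarrow> J (a * b)"
    and xy: "\<And>i. i \<in> Poly_Mapping.keys m \<Longrightarrow> S (x i)" "\<And>i. i \<in> Poly_Mapping.keys m \<Longrightarrow> S (y i)"
       "\<And>i. i \<in> Poly_Mapping.keys m \<Longrightarrow> J (x i - y i)"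
  shows "J (mmon x m - mmon y m)" "S (mmon x m)"
proof -
  have step: "J (a * b - a' * b')" if "S a" "S b'" "J (a - a')" "J (b - b')" for a b a' b'
  proof -
    have "a * b - a' * b' = a * (b - b') + b' * (a - a')" by (simp add: algebra_simps)
    then show ?thesis using that J by simp
  qed
  have pS: "S (a ^ n)" if "S a" for a n using that S by (induction n) auto
  have pJ: "J (a ^ n - b ^ n)" if "S a" "S b" "J (a - b)" for a b n
    using that J(1) by (induction n) (auto intro!: step pS)
  have "S (\<Prod>i\<in>A. x i ^ Poly_Mapping.lookup m i) \<and> S (\<Prod>i\<in>A. y i ^ Poly_Mapping.lookup m i) \<and>
     J ((\<Prod>i\<in>A. x i ^ Poly_Mapping.lookup m i) - (\<Prod>i\<in>A. y i ^ Poly_Mapping.lookup m i))"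
    if "A \<subseteq> Poly_Mapping.keys m" for A
  proof -
    have "finite A" using finite_subset[OF that] by simp
    then show ?thesis using that
      by (induction A rule: finite_induct) (use S(1) J(1) xy in \<open>auto intro!: step pS pJ S(2)\<close>)
  qed
  then show "J (mmon x m - mmon y m)" "S (mmon x m)" by (auto simp: mmon_def)
qed

text \<open>The factors from the \<open>M0\<close>-th on are congruent to \<open>1\<close>.\<close>

lemma jet_stable:
  fixes t z :: "'r::comm_ring_1"
  assumes S: "S 1" "\<And>a b. S a \<Longrightarrow> S b \<Longrightarrow> S (a * b)" "\<And>a b. S a \<Longrightarrow> S b \<Longrightarrow> S (a - b)"
    and J: "J 0" "\<And>a b. J a \<Longrightarrow> J b \<Longrightarrow> J (a + b)" "\<And>a b. S a \<Longrightarrow> J b \<Longrightarrow> J (a * b)"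
    and z: "\<And>m. S (t * z ^ (q ^ (c + l * m)))" "\<And>m. S (z ^ (q ^ (c + l * m)))"
      "\<And>m. m \<ge> M0 \<Longrightarrow> J (t * z ^ (q ^ (c + l * m)))" "\<And>m. m \<ge> M0 \<Longrightarrow> J (z ^ (q ^ (c + l * m)))"
  shows "S (jet q l c M k t z)" "M \<ge> M0 \<Longrightarrow> J (jet q l c M k t z - jet q l c M0 k t z)"
proof -
  have S0: "S 0" using S(3)[OF S(1) S(1)] by simp
  show Sj: "S (jet q l c M k t z)" for M k
  proof (induction M arbitrary: k)
    case 0 show ?case using S(1) S0 by (simp add: jet_M_0)
  next
    case (Suc M)
    have "S (1 - t * z ^ (q ^ (c + l * M)))" by (rule S(3)[OF S(1) z(1)])
    then show ?case by (cases k) (auto simp: jet_Suc_0 jet_Suc_Suc intro!: S(2,3) Suc z(2))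
  qed
  have Jn: "J (- a)" if "J a" for a using J(3)[OF _ that, of "-1"] S(3)[OF S0 S(1)] by simp
  assume "M \<ge> M0"
  then show "J (jet q l c M k t z - jet q l c M0 k t z)"
  proof (induction M arbitrary: k rule: dec_induct)
    case base show ?case using J(1) by simp
  next
    case (step M)
    have 1: "J (jet q l c M k' t z * (t * z ^ (q ^ (c + l * M))))" for k' by (rule J(3)[OF Sj z(3)]) (use step in auto)
    have 2: "J (jet q l c M k' t z * (z ^ (q ^ (c + l * M))))" for k' by (rule J(3)[OF Sj z(4)]) (use step in auto)
    have "J (jet q l c (Suc M) k t z - jet q l c M k t z)"
    proof (cases k)
      case 0
      have "jet q l c (Suc M) 0 t z - jet q l c M 0 t z = - (jet q l c M 0 t z * (t * z ^ (q ^ (c + l * M))))"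
        by (simp add: jet_Suc_0 algebra_simps)
      then show ?thesis using Jn[OF 1] 0 by simp
    next
      case (Suc k')
      have "jet q l c (Suc M) (Suc k') t z - jet q l c M (Suc k') t z =
         - (jet q l c M (Suc k') t z * (t * z ^ (q ^ (c + l * M)))) + - (jet q l c M k' t z * (z ^ (q ^ (c + l * M))))"
        by (simp add: jet_Suc_Suc algebra_simps)
      then show ?thesis using J(2)[OF Jn[OF 1] Jn[OF 2]] Suc by simp
    qed
    from J(2)[OF this step.IH[of k]] show ?case by simp
  qed
qed

section \<open>Transfer of relations from values to functions\<close>

definition monomials_upto :: "nat \<Rightarrow> nat \<Rightarrow> (nat \<times> nat \<Rightarrow>\<^sub>0 nat) set" where
  "monomials_upto l w = {m. Poly_Mapping.keys m \<subseteq> {1..l} \<times> UNIV \<and> wt m \<le> w}"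

text \<open>Since \<open>(c, k)\<close> has weight \<open>k + 1\<close>, the weight bounds both the exponents and the orders \<open>k\<close> of the jets.\<close>

lemma finite_monomials_upto: "finite (monomials_upto l w)"
proof -
  let ?S = "{1..l} \<times> {..w}"
  have sub: "Poly_Mapping.keys m \<subseteq> ?S" "Poly_Mapping.lookup m i \<le> w" if "m \<in> monomials_upto l w" for m i
  proof -
    have g: "Suc (snd i) * Poly_Mapping.lookup m i \<le> w" for i using wt_ge[of i m] that by (auto simp: monomials_upto_def)
    have "Poly_Mapping.lookup m i \<le> Suc (snd i) * Poly_Mapping.lookup m i" by simp
    then show "Poly_Mapping.lookup m i \<le> w" using g[of i] by linarith
    have "snd j \<le> w" if "j \<in> Poly_Mapping.keys m" for j
    proof -
      have "Suc (snd j) * 1 \<le> Suc (snd j) * Poly_Mapping.lookup m j"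
        using that by (intro mult_le_mono2) (auto simp: in_keys_iff)
      then have "Suc (snd j) \<le> w" using g[of j] by (metis mult.right_neutral le_trans)
      then show ?thesis by simp
    qed
    then show "Poly_Mapping.keys m \<subseteq> ?S" using that by (force simp: monomials_upto_def)
  qed
  let ?f = "\<lambda>m. restrict (Poly_Mapping.lookup m) ?S"
  have "?f ` monomials_upto l w \<subseteq> ?S \<rightarrow>\<^sub>E {..w}"
    by (rule image_subsetI) (simp add: restrict_PiE_iff sub(2))
  moreover have "finite (?S \<rightarrow>\<^sub>E {..w})" by (intro finite_PiE) auto
  ultimately have "finite (?f ` monomials_upto l w)" by (rule finite_subset)
  moreover have "inj_on ?f (monomials_upto l w)"
  proof (rule inj_onI, rule poly_mapping_eqI)
    fix m n i assume m: "m \<in> monomials_upto l w" "n \<in> monomials_upto l w" "?f m = ?f n"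
    show "Poly_Mapping.lookup m i = Poly_Mapping.lookup n i"
    proof (cases "i \<in> ?S")
      case True then show ?thesis using fun_cong[OF m(3), of i] by simp
    next
      case False
      then have "i \<notin> Poly_Mapping.keys m" "i \<notin> Poly_Mapping.keys n" using sub(1)[OF m(1)] sub(1)[OF m(2)] by blast+
      then show ?thesis by (simp add: in_keys_iff)
    qed
  qed
  ultimately show ?thesis by (rule finite_imageD)
qed

text \<open>Two of the \<open>q\<^bsup>card I\<^esup>\<close> assignments on \<open>I\<close> have the same image; their difference is a solution.\<close>

lemma linear_pigeonhole:
  fixes \<Phi> :: "('i \<Rightarrow> 'a::{field,finite}) \<Rightarrow> 'j \<Rightarrow> 'a"
  assumes "finite I" "finite J" "card J < card I"
    and diff: "\<And>h h' j. j \<in> J \<Longrightarrow> \<Phi> (\<lambda>i. h i - h' i) j = \<Phi> h j - \<Phi> h' j"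
  shows "\<exists>h. (\<exists>i\<in>I. h i \<noteq> 0) \<and> (\<forall>j\<in>J. \<Phi> h j = 0)"
proof -
  let ?U = "I \<rightarrow>\<^sub>E (UNIV :: 'a set)"
  let ?V = "J \<rightarrow>\<^sub>E (UNIV :: 'a set)"
  have "\<not> inj_on (\<lambda>h. restrict (\<Phi> h) J) ?U"
  proof
    assume "inj_on (\<lambda>h. restrict (\<Phi> h) J) ?U"
    then have "card ?U \<le> card ?V"
      by (rule card_inj_on_le) (auto intro: finite_PiE assms)
    then have "CARD('a) ^ card I \<le> CARD('a) ^ card J" using assms by (simp add: card_PiE)
    then show False using assms(3) card_ge_2[where 'a='a] by simp
  qed
  then obtain h h' where h: "h \<in> ?U" "h' \<in> ?U" "h \<noteq> h'" "restrict (\<Phi> h) J = restrict (\<Phi> h') J"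
    by (auto simp: inj_on_def)
  have "\<exists>i\<in>I. h i - h' i \<noteq> 0"
  proof (rule ccontr)
    assume "\<not> ?thesis"
    then have "h = h'" using h by (intro PiE_ext[of h I _ h']) auto
    with h show False by simp
  qed
  moreover have "\<Phi> (\<lambda>i. h i - h' i) j = 0" if "j \<in> J" for j
    using diff[OF that, of h h'] fun_cong[OF h(4), of j] that by simp
  ultimately show ?thesis by (intro exI[of _ "\<lambda>i. h i - h' i"]) simp
qed

text \<open>The unknowns \<open>h\<close> are the coefficients, in \<open>\<F>\<^sub>q\<close>, of a polynomial in \<open>t\<close> and \<open>\<theta>\<close>.  The exponent of \<open>\<theta>\<close> is written as \<open>e0 + e1 * Q2\<close> to keep
  its residue modulo \<open>Q2\<close> visible.\<close>

definition aux_poly :: "nat \<Rightarrow> nat \<Rightarrow> nat \<Rightarrow> ('m \<times> nat \<times> nat \<times> nat \<Rightarrow> 'a::field) \<Rightarrow> 'm \<Rightarrow> 'a fls poly" where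
  "aux_poly Q2 B C h m = (\<Sum>b<B. \<Sum>e1\<le>C. \<Sum>e0<Q2. monom (fls_const (h (m, b, e1, e0)) * fls_X_inv ^ (e0 + e1 * Q2)) b)"

lemma aux_poly_diff:
  "aux_poly Q2 B C (\<lambda>i. h i - h' i) m = aux_poly Q2 B C h m - aux_poly Q2 B C h' m"
  by (simp add: aux_poly_def sum_subtractf diff_monom[symmetric] fls_minus_const[symmetric] left_diff_distrib)

lemma laurent_within_aux_poly:
  assumes "b0 * B \<le> A"
  shows "laurent_within (Suc C * Q2 + A) 0 (poly (aux_poly Q2 B C h m) (fls_X_inv ^ b0) :: 'a::field fls)"
  unfolding aux_poly_def poly_sum poly_monom
proof (intro laurent_within_sum)
  fix b e1 e0 assume *: "b \<in> {..<B}" "e1 \<in> {..C}" "e0 \<in> {..<Q2}"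
  have "e1 * Q2 \<le> C * Q2" using * by (intro mult_le_mono1) simp
  moreover have "b0 * b \<le> A" using * assms by (meson le_trans lessThan_iff less_imp_le mult_le_mono2)
  ultimately have le: "(e0 + e1 * Q2) + b0 * b \<le> Suc C * Q2 + A" using * unfolding mult_Suc lessThan_iff by linarith
  have "fls_const (h (m, b, e1, e0)) * fls_X_inv ^ (e0 + e1 * Q2) * (fls_X_inv ^ b0) ^ b
     = fls_const (h (m, b, e1, e0)) * fls_X_inv ^ ((e0 + e1 * Q2) + b0 * b)"
    by (simp add: power_add power_mult mult.assoc)
  moreover have "laurent_within (0 + (Suc C * Q2 + A)) (0 + 0) (fls_const (h (m, b, e1, e0)) * fls_X_inv ^ ((e0 + e1 * Q2) + b0 * b))"
    by (intro laurent_within_mult laurent_within_X_inv_power le) simp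
  ultimately show "laurent_within (Suc C * Q2 + A) 0 (fls_const (h (m, b, e1, e0)) * fls_X_inv ^ (e0 + e1 * Q2) * (fls_X_inv ^ b0) ^ b)"
    by (simp only: add_0)
qed

text \<open>There are \<open>D B (C + 1) Q2\<close> unknowns.  Each of the \<open>N (D - 1)\<close> conditions is an equation between Laurent polynomials in \<open>\<theta>\<close> whose
  exponents take at most \<open>(C + 1 + 2 + \<delta> + \<beta>) Q2\<close> values, hence that many linear equations over \<open>\<F>\<^sub>q\<close>; the parameters are such that there are fewer of them.
  The bound \<open>C\<close> does not depend on the precision \<open>K\<close>, and the number \<open>N = B + K\<close> of points exceeds the bound \<open>B\<close> for the degree in \<open>t\<close> by \<open>K\<close>.\<close>

lemma aux_exists:
  fixes V :: "nat \<Rightarrow> 'm \<Rightarrow> 'a::{field,finite} fls" and p :: "nat \<Rightarrow> nat"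
  assumes fin: "finite Mon" and m0: "m0 \<in> Mon"
    and V: "\<And>\<mu> m. \<mu> \<in> {1..N} \<Longrightarrow> m \<in> Mon \<Longrightarrow> laurent_within (\<delta> * Q2) (\<beta> * Q2) (V \<mu> m)"
    and D: "D = card Mon" and C: "Suc C = 2 * D * (2 + \<delta> + \<beta>)"
    and N: "N = 2 * D * K" and B: "B = (2 * D - 1) * K" and K: "K \<ge> 1" and Q2: "Q2 \<ge> 1"
    and p: "\<And>\<mu>. \<mu> \<in> {1..N} \<Longrightarrow> p \<mu> * B \<le> Q2"
  shows "\<exists>h. (\<exists>i\<in>Mon \<times> {..<B} \<times> {..C} \<times> {..<Q2}. h i \<noteq> 0) \<and>
     (\<forall>\<mu>\<in>{1..N}. \<forall>m\<in>Mon. poly (aux_poly Q2 B C h m) (fls_X_inv ^ p \<mu>) * V \<mu> m0 =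
        poly (aux_poly Q2 B C h m0) (fls_X_inv ^ p \<mu>) * V \<mu> m)"
proof -
  let ?I = "Mon \<times> {..<B} \<times> {..C} \<times> {..<Q2}"
  define a where "a = Suc C * Q2 + Q2 + \<delta> * Q2"
  define b where "b = \<beta> * Q2"
  let ?J = "{1..N} \<times> (Mon - {m0}) \<times> {..a + b}"
  define G where "G h \<mu> m = poly (aux_poly Q2 B C h m) (fls_X_inv ^ p \<mu>) * V \<mu> m0 -
     poly (aux_poly Q2 B C h m0) (fls_X_inv ^ p \<mu>) * V \<mu> m" for h \<mu> m
  define \<Phi> where "\<Phi> h = (\<lambda>(\<mu>, m, i). fls_nth (G h \<mu> m) (int i - int a))" for h
  have D1: "D \<ge> 1" using fin m0 D by (metis Suc_leI card_gt_0_iff empty_iff One_nat_def)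
  have "card ?J < card ?I"
  proof -
    have "card ?J = N * ((D - 1) * Suc (a + b))"
      using fin m0 D by (simp add: card_cartesian_product card_Diff_singleton)
    also have "\<dots> \<le> N * ((D - 1) * ((Suc C + (2 + \<delta> + \<beta>)) * Q2))"
      using Q2 by (intro mult_le_mono2) (simp add: a_def b_def algebra_simps)
    also have "\<dots> < D * (B * (Suc C * Q2))"
    proof -
      obtain d where d: "D = Suc d" using D1 by (cases D) auto
      let ?c = "2 + \<delta> + \<beta>"
      have "N * ((D - 1) * ((Suc C + ?c) * Q2)) = 2 * D * K * ?c * Q2 * ((D - 1) * (2 * D + 1))"
      proof -
        have "Suc C + ?c = ?c * (2 * D + 1)" unfolding C by (simp add: algebra_simps)
        then show ?thesis unfolding N by (simp only: mult_ac)
      qed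
      moreover have "D * (B * (Suc C * Q2)) = 2 * D * K * ?c * Q2 * (D * (2 * D - 1))"
        unfolding B C by (simp only: mult_ac)
      moreover have "(D - 1) * (2 * D + 1) < D * (2 * D - 1)" unfolding d by (simp add: algebra_simps)
      moreover have "2 * D * K * ?c * Q2 > 0" using D1 K Q2 by simp
      ultimately show ?thesis by (simp only: mult_less_cancel1)
    qed
    also have "D * (B * (Suc C * Q2)) = card ?I"
      using fin D by (simp add: card_cartesian_product)
    finally show ?thesis .
  qed
  moreover have "\<Phi> (\<lambda>i. h i - h' i) j = \<Phi> h j - \<Phi> h' j" for h h' j
    by (auto simp: \<Phi>_def G_def aux_poly_diff algebra_simps split: prod.splits)
  moreover have "finite ?I" "finite ?J" by (simp_all add: fin)
  ultimately have "\<exists>h. (\<exists>i\<in>?I. h i \<noteq> 0) \<and> (\<forall>j\<in>?J. \<Phi> h j = 0)"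
    by (intro linear_pigeonhole)
  then obtain h where h: "\<exists>i\<in>?I. h i \<noteq> 0" "\<And>j. j \<in> ?J \<Longrightarrow> \<Phi> h j = 0"
    by meson
  have "G h \<mu> m = 0" if \<mu>: "\<mu> \<in> {1..N}" and m: "m \<in> Mon" for \<mu> m
  proof (cases "m = m0")
    case False
    have l: "laurent_within a b (poly (aux_poly Q2 B C h m) (fls_X_inv ^ p \<mu>) * V \<mu> m')" if "m' \<in> Mon" for m m'
      using laurent_within_mult[OF laurent_within_aux_poly[OF p[OF \<mu>]] V[OF \<mu> that]] by (simp add: a_def b_def)
    have lG: "laurent_within a b (G h \<mu> m)" unfolding G_def by (intro laurent_within_diff l m m0)
    show ?thesis
    proof (rule fls_zero_eqI)
      fix i
      show "fls_nth (G h \<mu> m) i = 0"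
      proof (rule ccontr)
        assume nz: "fls_nth (G h \<mu> m) i \<noteq> 0"
        then have i: "- int a \<le> i" "i \<le> int b" using lG by (auto simp: laurent_within_def)
        define n where "n = nat (i + int a)"
        have n: "n \<in> {..a + b}" "i = int n - int a" using i by (auto simp: n_def)
        then have "\<Phi> h (\<mu>, m, n) = 0" using \<mu> m False by (intro h(2)) auto
        then show False using nz n by (simp add: \<Phi>_def)
      qed
    qed
  qed (simp add: G_def)
  then show ?thesis using h(1) unfolding G_def by (intro exI[of _ h]) auto
qed

text \<open>A bound for the Gauss norm of the disc \<open>ord t \<ge> - \<rho>\<close>.\<close>

definition gauss :: "'a::zero fls poly \<Rightarrow> int \<Rightarrow> int \<Rightarrow> bool" where
  "gauss p Z \<rho> \<longleftrightarrow> (\<forall>b. ord_ge (poly.coeff p b) (Z + \<rho> * int b))"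

lemma gauss_diff: "gauss p Z \<rho> \<Longrightarrow> gauss p' Z \<rho> \<Longrightarrow> gauss ((p :: 'a::idom fls poly) - p') Z \<rho>"
  by (auto simp: gauss_def intro: ord_ge_diff)
lemma gauss_sum: "(\<And>i. i \<in> S \<Longrightarrow> gauss (p i) Z \<rho>) \<Longrightarrow> gauss (\<Sum>i\<in>S. p i :: 'a::idom fls poly) Z \<rho>"
  by (auto simp: gauss_def coeff_sum intro: ord_ge_sum)
lemma gauss_mult:
  fixes p p' :: "'a::idom fls poly"
  assumes "gauss p Z \<rho>" "gauss p' Z' \<rho>" shows "gauss (p * p') (Z + Z') \<rho>"
  unfolding gauss_def coeff_mult
proof (intro allI ord_ge_sum)
  fix b i :: nat assume "i \<in> {..b}"
  then have "Z + \<rho> * int i + (Z' + \<rho> * int (b - i)) = Z + Z' + \<rho> * int b"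
    by (simp add: of_nat_diff algebra_simps)
  then show "ord_ge (poly.coeff p i * poly.coeff p' (b - i)) (Z + Z' + \<rho> * int b)"
    using ord_ge_mult[of "poly.coeff p i" "Z + \<rho> * int i" "poly.coeff p' (b - i)" "Z' + \<rho> * int (b - i)"] assms
    unfolding gauss_def by metis
qed
lemma gauss_1 [simp]: "gauss 1 0 \<rho>" by (auto simp: gauss_def coeff_1)

lemma gauss_jet:
  assumes "Q2 \<ge> 1"
  shows "gauss (jet CARD('a) l c M k [:0, 1:] [:fls_X ^ Q2 :: 'a::{field,finite} fls:]) 0 (int Q2)"
proof (rule jet_stable(1)[where J = "\<lambda>_. True" and S = "\<lambda>p. gauss p 0 (int Q2)"])
  fix m
  let ?e = "CARD('a) ^ (c + l * m)"
  have "Q2 * 1 \<le> Q2 * ?e" using frobenius_pow_pos[where 'a='a, of "c + l * m"] by (intro mult_le_mono2) simp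
  then have e: "int Q2 \<le> int (Q2 * ?e)" unfolding of_nat_le_iff by simp
  have z: "[:fls_X ^ Q2 :: 'a fls:] ^ ?e = [:fls_X ^ (Q2 * ?e):]"
    by (simp add: poly_const_pow power_mult)
  show "gauss ([:0, 1:] * [:fls_X ^ Q2 :: 'a fls:] ^ ?e) 0 (int Q2)"
    unfolding z gauss_def using e by (auto simp: coeff_pCons split: nat.splits intro!: ord_ge_X_power)
  show "gauss ([:fls_X ^ Q2 :: 'a fls:] ^ ?e) 0 (int Q2)"
    unfolding z gauss_def by (auto simp: coeff_pCons split: nat.splits intro!: ord_ge_X_power)
next
  fix a b :: "'a fls poly" assume "gauss a 0 (int Q2)" "gauss b 0 (int Q2)"
  then show "gauss (a * b) 0 (int Q2)" using gauss_mult[of a 0 "int Q2" b 0] by simp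
qed (auto intro: gauss_diff)

lemma gauss_mmon:
  fixes x :: "'i \<Rightarrow> 'a::idom fls poly"
  assumes "\<And>i. gauss (x i) 0 \<rho>" shows "gauss (mmon x m) 0 \<rho>"
proof (rule mmon_diff_ideal(2)[where J = "\<lambda>_. True" and S = "\<lambda>p. gauss p 0 \<rho>" and y = x])
  fix a b :: "'a fls poly" assume "gauss a 0 \<rho>" "gauss b 0 \<rho>"
  then show "gauss (a * b) 0 \<rho>" using gauss_mult[of a 0 \<rho> b 0] by simp
qed (use assms in auto)

lemma gauss_aux_poly:
  "gauss (aux_poly Q2 B C h m :: 'a::field fls poly) (- int (Suc C * Q2 + B * Q2)) (int Q2)"
  unfolding aux_poly_def
proof (intro gauss_sum)
  fix b e1 e0 assume *: "b \<in> {..<B}" "e1 \<in> {..C}" "e0 \<in> {..<Q2}"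
  have "e1 * Q2 \<le> C * Q2" using * by (intro mult_le_mono1) simp
  then have le: "e0 + e1 * Q2 \<le> Suc C * Q2" using * unfolding mult_Suc lessThan_iff by linarith
  have bB: "Q2 * b \<le> B * Q2" using * by simp
  show "gauss (monom (fls_const (h (m, b, e1, e0)) * fls_X_inv ^ (e0 + e1 * Q2)) b :: 'a fls poly)
         (- int (Suc C * Q2 + B * Q2)) (int Q2)"
    unfolding gauss_def coeff_monom
  proof (intro allI)
    fix b'
    have "- int (Suc C * Q2 + B * Q2) + int Q2 * int b \<le> - int (e0 + e1 * Q2)"
      using le bB by (simp only: of_nat_mult[symmetric] of_nat_add)
    then show "ord_ge (if b = b' then fls_const (h (m, b, e1, e0)) * fls_X_inv ^ (e0 + e1 * Q2) else 0)
       (- int (Suc C * Q2 + B * Q2) + int Q2 * int b')"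
      by (auto intro!: ord_ge_mult0 ord_ge_X_inv_power)
  qed
qed

text \<open>The terms of \<open>aux_poly\<close> whose exponent of \<open>\<theta>\<close> is congruent to \<open>e0\<close>, divided by a power of \<open>\<theta>\<close> and with the inverse
  of the Frobenius twist applied, see \<open>aux_poly_split\<close>.\<close>

definition aux_part :: "nat \<Rightarrow> nat \<Rightarrow> ('m \<times> nat \<times> nat \<times> nat \<Rightarrow> 'a::field) \<Rightarrow> nat \<Rightarrow> 'm \<Rightarrow> 'a fls poly" where
  "aux_part B C h e0 m = (\<Sum>b<B. \<Sum>e1\<le>C. monom (fls_const (h (m, b, e1, e0)) * fls_X ^ (C - e1)) b)"

lemma frob_twist_monom: "frob_twist n (monom f b) = monom (f ^ (CARD('a) ^ n)) b" for f :: "'a::{field,finite} fls"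
  by (rule poly_eqI) (simp add: coeff_frob_twist frobenius_pow_pos power_0_left)

lemma aux_poly_split:
  fixes h :: "'m \<times> nat \<times> nat \<times> nat \<Rightarrow> 'a::{field,finite}"
  assumes Q2: "Q2 = CARD('a) ^ n"
  shows "aux_poly Q2 B C h m = (\<Sum>e0<Q2. [:fls_X_inv ^ (e0 + C * Q2):] * frob_twist n (aux_part B C h e0 m))"
proof -
  have e: "[:fls_X_inv ^ (e0 + C * Q2):] * frob_twist n (monom (fls_const c * fls_X ^ (C - e1)) b)
     = monom (fls_const c * fls_X_inv ^ (e0 + e1 * Q2)) b" if "e1 \<le> C" for e0 e1 b and c :: 'a
  proof -
    have "e0 + C * Q2 = (e0 + e1 * Q2) + (C - e1) * Q2" using that by (simp flip: distrib_right)
    then have "(fls_X_inv ^ (e0 + C * Q2) :: 'a fls) = fls_X_inv ^ (e0 + e1 * Q2) * fls_X_inv ^ ((C - e1) * Q2)"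
      by (simp only: power_add)
    moreover have "(fls_const c * fls_X ^ (C - e1)) ^ Q2 = fls_const c * fls_X ^ ((C - e1) * Q2)"
      by (simp add: power_mult_distrib power_mult Q2 fls_const_power[symmetric] finite_field_power_card_pow)
    ultimately have "fls_X_inv ^ (e0 + C * Q2) * (fls_const c * fls_X ^ (C - e1)) ^ Q2 =
       fls_const c * fls_X_inv ^ (e0 + e1 * Q2) * (fls_X_inv ^ ((C - e1) * Q2) * fls_X ^ ((C - e1) * Q2))"
      by (simp only: mult_ac)
    then show ?thesis unfolding frob_twist_monom Q2[symmetric]
      by (simp add: smult_monom fls_X_inv_X_power)
  qed
  have "(\<Sum>e0<Q2. [:fls_X_inv ^ (e0 + C * Q2):] * frob_twist n (aux_part B C h e0 m)) =
     (\<Sum>e0<Q2. \<Sum>b<B. \<Sum>e1\<le>C. monom (fls_const (h (m, b, e1, e0)) * fls_X_inv ^ (e0 + e1 * Q2)) b)"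
    unfolding aux_part_def rhom_sum[OF rhom_frob_twist] sum_distrib_left
    by (intro sum.cong refl e) simp
  also have "\<dots> = (\<Sum>b<B. \<Sum>e0<Q2. \<Sum>e1\<le>C. monom (fls_const (h (m, b, e1, e0)) * fls_X_inv ^ (e0 + e1 * Q2)) b)"
    by (rule sum.swap)
  also have "\<dots> = aux_poly Q2 B C h m" unfolding aux_poly_def
    by (intro sum.cong refl sum.swap)
  finally show ?thesis by simp
qed

text \<open>The exponents of \<open>z\<close> in the summands lie in different residue classes modulo \<open>Q2\<close>, so the summands do not cancel.\<close>

lemma pord_ge_of_split:
  fixes Y :: "nat \<Rightarrow> 'a::{field,finite} fls poly"
  assumes Q2: "Q2 = CARD('a) ^ n"
    and E: "pord_ge (\<Sum>e0<Q2. [:fls_X_inv ^ (e0 + C * Q2):] * frob_twist n (Y e0)) (int Q2 * (k - int C))"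
    and e: "e < Q2"
  shows "pord_ge (Y e) k"
  unfolding pord_ge_def ord_ge_def
proof (intro allI impI)
  fix b u assume u: "u < k"
  have Q: "Q2 > 0" by (simp add: Q2 frobenius_pow_pos)
  let ?i = "int Q2 * u - int e - int (C * Q2)"
  have t: "fls_nth (fls_X_inv ^ (e0 + C * Q2) * poly.coeff (Y e0) b ^ Q2) ?i = (if e0 = e then fls_nth (poly.coeff (Y e) b) u else 0)"
    if "e0 < Q2" for e0
  proof -
    have "fls_nth (fls_X_inv ^ (e0 + C * Q2) * poly.coeff (Y e0) b ^ Q2) ?i =
        fls_nth (poly.coeff (Y e0) b ^ Q2) (int Q2 * u + (int e0 - int e))"
      by (simp add: fls_X_inv_power_times_conv_shift algebra_simps)
    also have "\<dots> = (if e0 = e then fls_nth (poly.coeff (Y e) b) u else 0)"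
    proof (cases "e0 = e")
      case True
      then show ?thesis using Q unfolding Q2 fls_nth_frobenius by simp
    next
      case False
      have "\<not> int Q2 dvd int Q2 * u + (int e0 - int e)"
      proof
        assume "int Q2 dvd int Q2 * u + (int e0 - int e)"
        then have "int Q2 dvd int e0 - int e" by (simp only: dvd_add_right_iff[OF dvd_triv_left])
        moreover have "\<bar>int e0 - int e\<bar> < int Q2" "int e0 - int e \<noteq> 0" using that e False by auto
        ultimately show False using zdvd_imp_le[of "int Q2" "\<bar>int e0 - int e\<bar>"] by simp
      qed
      then show ?thesis using False unfolding Q2 fls_nth_frobenius by simp
    qed
    finally show ?thesis .
  qed
  have "?i < int Q2 * (k - int C)"
  proof -
    have "int Q2 * u < int Q2 * k" using u Q by simp
    then show ?thesis by (simp add: algebra_simps)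
  qed
  then have "0 = fls_nth (poly.coeff (\<Sum>e0<Q2. [:fls_X_inv ^ (e0 + C * Q2):] * frob_twist n (Y e0)) b) ?i"
    using E by (simp add: pord_ge_def ord_ge_def)
  also have "\<dots> = (\<Sum>e0<Q2. fls_nth (fls_X_inv ^ (e0 + C * Q2) * poly.coeff (Y e0) b ^ Q2) ?i)"
    by (simp add: coeff_sum fls_nth_sum coeff_frob_twist Q2[symmetric])
  also have "\<dots> = (\<Sum>e0<Q2. if e0 = e then fls_nth (poly.coeff (Y e) b) u else 0)"
    using t by (intro sum.cong) auto
  also have "\<dots> = fls_nth (poly.coeff (Y e) b) u" using e by simp
  finally show "fls_nth (poly.coeff (Y e) b) u = 0" by simp
qed

text \<open>The relation \<open>R(y) = 0\<close> between the values, by means of the truncated products.\<close>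

definition value_rel :: "nat \<Rightarrow> ((nat \<times> nat \<Rightarrow>\<^sub>0 nat) \<Rightarrow>\<^sub>0 'a::{field,finite} fls) \<Rightarrow> bool" where
  "value_rel l R \<longleftrightarrow> (\<forall>W. \<exists>M0. \<forall>M\<ge>M0. ord_ge (mev (\<lambda>x. x) (jetv CARD('a) l M fls_X_inv fls_X) R) W)"

lemma rhom_frobenius: "rhom (\<lambda>f :: 'a::{field,finite} fls. f ^ (CARD('a) ^ n))"
  by (auto simp: rhom_def power_0_left frobenius_pow_pos frobenius_pow_add power_mult_distrib)

text \<open>The functional equation at \<open>t = \<theta>\<close>.  It keeps the weight and the degree in \<open>\<theta>\<close>; the degree in \<open>z\<close> grows like \<open>q\<^bsup>l\<nu>\<^esup>\<close>.\<close>

lemma jet_subst_theta: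
  fixes R :: "(nat \<times> nat \<Rightarrow>\<^sub>0 nat) \<Rightarrow>\<^sub>0 'a::{field,finite} fls" and \<nu> :: nat
  assumes l: "l \<ge> 1" and vars: "mvars_in ({1..l} \<times> UNIV) R" and R: "coeffs_laurent_within \<delta> 0 R"
    and w: "\<And>n. n \<in> Poly_Mapping.keys R \<Longrightarrow> wt n \<le> w"
  defines "S \<equiv> mev cst (jet_subst CARD('a) l \<nu> fls_X_inv fls_X) R"
  shows "Poly_Mapping.keys S \<subseteq> monomials_upto l w"
    and "coeffs_laurent_within \<delta> (w * CARD('a) ^ (l * Suc \<nu>)) S"
    and "m0 \<in> Poly_Mapping.keys R \<Longrightarrow> wt m0 = w \<Longrightarrow> Poly_Mapping.lookup S m0 \<noteq> 0"
proof -
  let ?q = "CARD('a)"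
  have q2: "?q \<ge> 2" by (rule card_ge_2)
  have top: "Poly_Mapping.lookup S n = Poly_Mapping.lookup R n * mmon (\<lambda>i. jet ?q l (fst i) \<nu> 0 fls_X_inv fls_X) n"
    if "wt n \<ge> w" for n
    unfolding S_def by (rule lookup_subst_top[OF lead_jet_subst w that])
  have vS: "mvars_in ({1..l} \<times> UNIV) S"
    unfolding S_def by (intro mvars_in_subst vars mvars_in_jet_subst) auto
  show "Poly_Mapping.keys S \<subseteq> monomials_upto l w"
  proof
    fix n assume n: "n \<in> Poly_Mapping.keys S"
    have "wt n \<le> w"
    proof (rule ccontr)
      assume nw: "\<not> wt n \<le> w"
      then have "n \<notin> Poly_Mapping.keys R" using w by blast
      then have "Poly_Mapping.lookup S n = 0" using top[of n] nw by (simp add: in_keys_iff)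
      then show False using n by (simp add: in_keys_iff)
    qed
    then show "n \<in> monomials_upto l w" using vS n by (auto simp: monomials_upto_def mvars_in_def)
  qed
  show "coeffs_laurent_within \<delta> (w * ?q ^ (l * Suc \<nu>)) S"
    unfolding S_def mev_def
  proof (rule coeffs_laurent_within_sum)
    fix m assume m: "m \<in> Poly_Mapping.keys R"
    have kv: "Poly_Mapping.keys m \<subseteq> {1..l} \<times> UNIV" using vars m by (auto simp: mvars_in_def)
    have g: "coeffs_laurent_within 0 (?q ^ (l * Suc \<nu>)) (jet_subst ?q l \<nu> fls_X_inv (fls_X :: 'a fls) i)" if "i \<in> Poly_Mapping.keys m" for i
    proof -
      have "i \<in> {1..l} \<times> UNIV" using that kv by blast
      then obtain c k where i: "i = (c, k)" "c \<in> {1..l}" by (cases i) auto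
      show ?thesis unfolding i jet_subst_def prod.case
        by (intro coeffs_laurent_within_sum) (auto simp: mult_single intro!: coeffs_laurent_within_single laurent_within_jet'[OF i(2) l, simplified])
    qed
    have "(\<Sum>i\<in>Poly_Mapping.keys m. Poly_Mapping.lookup m i) \<le> wt m"
      unfolding wt_def by (rule sum_mono) simp
    then have "(\<Sum>i\<in>Poly_Mapping.keys m. Poly_Mapping.lookup m i) \<le> w" using w[OF m] by linarith
    then have "coeffs_laurent_within 0 (w * ?q ^ (l * Suc \<nu>)) (mmon (jet_subst ?q l \<nu> fls_X_inv (fls_X :: 'a fls)) m)"
      by (intro coeffs_laurent_within_mono[OF coeffs_laurent_within_mmon[OF g]]) auto
    moreover have "coeffs_laurent_within \<delta> 0 (cst (Poly_Mapping.lookup R m) :: (nat \<times> nat \<Rightarrow>\<^sub>0 nat) \<Rightarrow>\<^sub>0 'a fls)"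
      using R by (intro coeffs_laurent_within_single) (simp add: coeffs_laurent_within_def)
    ultimately show "coeffs_laurent_within \<delta> (w * ?q ^ (l * Suc \<nu>)) (cst (Poly_Mapping.lookup R m) * mmon (jet_subst ?q l \<nu> fls_X_inv fls_X) m)"
      using coeffs_laurent_within_mult[of \<delta> 0 _ 0] by fastforce
  qed
  assume m0: "m0 \<in> Poly_Mapping.keys R" "wt m0 = w"
  have "mmon (\<lambda>i. jet ?q l (fst i) \<nu> 0 fls_X_inv (fls_X :: 'a fls)) m0 \<noteq> 0"
  proof -
    have "jet ?q l c \<nu> 0 fls_X_inv (fls_X :: 'a fls) \<noteq> 0" if "c \<ge> 1" for c
      unfolding jet_0
    proof
      assume "(\<Prod>m<\<nu>. 1 - fls_X_inv * fls_X ^ (?q ^ (c + l * m))) = (0 :: 'a fls)"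
      then obtain m where m: "1 - fls_X_inv * fls_X ^ (?q ^ (c + l * m)) = (0 :: 'a fls)" by auto
      have "?q ^ 1 \<le> ?q ^ (c + l * m)" by (rule power_increasing) (use that q2 in auto)
      then have "1 < ?q ^ (c + l * m)" using q2 unfolding power_one_right by linarith
      then have "?q ^ (c + l * m) \<noteq> 1" by linarith
      moreover have "fls_nth (1 - fls_X_inv ^ 1 * fls_X ^ e :: 'a fls) 0 = 1" if "e \<noteq> 1" for e
        unfolding fls_X_inv_power_times_conv_shift using that by simp
      ultimately have "fls_nth (1 - fls_X_inv ^ 1 * fls_X ^ (?q ^ (c + l * m)) :: 'a fls) 0 = 1" by blast
      then show False using m by simp
    qed
    moreover have "fst i \<ge> 1" if "i \<in> Poly_Mapping.keys m0" for i
    proof -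
      have "i \<in> {1..l} \<times> UNIV" using vars m0(1) that unfolding mvars_in_def by blast
      then show ?thesis by auto
    qed
    ultimately show ?thesis by (simp add: mmon_def)
  qed
  then show "Poly_Mapping.lookup S m0 \<noteq> 0" using top[of m0] m0 by (simp add: in_keys_iff)
qed

text \<open>At \<open>t = \<theta>\<^bsup>q\<^sup>l\<^sup>\<mu>\<^esup>\<close> the jets for \<open>z\<^bsup>Q2\<^esup>\<close>, \<open>Q2 = q\<^bsup>2lN\<^esup>\<close>, are the \<open>q\<^bsup>l\<mu>\<^esup>\<close>-th powers of the jets at \<open>\<theta>\<close> for \<open>z\<^bsup>q\<^sup>l\<^sup>\<nu>\<^esup>\<close> with \<open>\<nu> = 2N - \<mu>\<close>.
  To these the relation \<open>R\<close>, carried along by the functional equation, applies: it becomes \<open>S \<nu>\<close>.  The auxiliary polynomials are chosen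
  proportional at these points to the coefficients \<open>V \<mu>\<close> of its power, so that the combination \<open>E\<close> of the monomials is a
  multiple of a power of the vanishing value of \<open>R\<close>.  The Schwarz lemma then bounds all coefficients of \<open>E\<close>, and its
  parts \<open>Y M e0\<close> with a fixed residue are approximate relations between the functions themselves.\<close>

lemma approximate_relation:
  fixes R :: "(nat \<times> nat \<Rightarrow>\<^sub>0 nat) \<Rightarrow>\<^sub>0 'a::{field,finite} fls"
  assumes l: "l \<ge> 1" and vars: "mvars_in ({1..l} \<times> UNIV) R" and R: "coeffs_laurent_within \<delta> 0 R"
    and rel: "value_rel l R" and w: "\<And>n. n \<in> Poly_Mapping.keys R \<Longrightarrow> wt n \<le> w"
    and m0: "m0 \<in> Poly_Mapping.keys R" "wt m0 = w"
    and C: "Suc C = 2 * card (monomials_upto l w) * (2 + \<delta> + w * CARD('a) ^ l)" and K: "K \<ge> 1"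
  shows "\<exists>B h e0. (\<exists>i\<in>monomials_upto l w \<times> {..<B} \<times> {..C} . h (fst i, fst (snd i), snd (snd i), e0) \<noteq> 0) \<and>
    (\<exists>M0. \<forall>M\<ge>M0. pord_ge (\<Sum>m\<in>monomials_upto l w. aux_part B C h e0 m * mmon (jetv CARD('a) l M [:0, 1:] [:fls_X :: 'a fls:]) m) (int K - 2))"
proof -
  let ?q = "CARD('a)"
  define Mon where "Mon = monomials_upto l w"
  define D where "D = card Mon"
  define N where "N = 2 * D * K"
  define B where "B = (2 * D - 1) * K"
  define n where "n = l * (2 * N)"
  define Q2 where "Q2 = ?q ^ n"
  define p where "p \<mu> = ?q ^ (l * \<mu>)" for \<mu>
  define S where "S \<nu> = mev cst (jet_subst ?q l \<nu> fls_X_inv fls_X) R" for \<nu>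
  define V where "V \<mu> m = Poly_Mapping.lookup (S (2 * N - \<mu>)) m ^ p \<mu>" for \<mu> m
  note S = jet_subst_theta[OF l vars R w, folded S_def Mon_def]
  have fin: "finite Mon" unfolding Mon_def by (rule finite_monomials_upto)
  have m0M: "m0 \<in> Mon" using m0 vars by (auto simp: Mon_def monomials_upto_def mvars_in_def)
  have D1: "D \<ge> 1" using fin m0M by (metis D_def Suc_leI card_gt_0_iff empty_iff One_nat_def)
  have q2: "?q \<ge> 2" by (rule card_ge_2)
  have N1: "N \<ge> 1" using D1 K by (simp add: N_def)
  have NB: "N = B + K" using D1 by (cases D) (simp_all add: N_def B_def algebra_simps)
  have Q2pos: "Q2 \<ge> 1" using frobenius_pow_pos[where 'a='a, of n] by (simp add: Q2_def)
  have "n = l * N + l * N" by (simp add: n_def)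
  then have Q2sq: "Q2 = ?q ^ (l * N) * ?q ^ (l * N)" by (simp only: Q2_def power_add)
  have pN: "p \<mu> \<le> ?q ^ (l * N)" if "\<mu> \<in> {1..N}" for \<mu>
    unfolding p_def using that q2 by (intro power_increasing) auto
  have NQ: "N \<le> ?q ^ (l * N)"
  proof -
    have "N < 2 ^ N" by (rule less_exp)
    also have "\<dots> \<le> ?q ^ N" using q2 by (rule power_mono) simp
    also have "\<dots> \<le> ?q ^ (l * N)" using q2 l by (intro power_increasing) auto
    finally show ?thesis by simp
  qed
  have pB: "p \<mu> * B \<le> Q2" if "\<mu> \<in> {1..N}" for \<mu>
    unfolding Q2sq using pN[OF that] NQ NB by (intro mult_le_mono) auto
  have pQ2: "p \<mu> \<le> Q2" if "\<mu> \<in> {1..N}" for \<mu>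
  proof -
    have "p \<mu> * 1 \<le> ?q ^ (l * N) * ?q ^ (l * N)"
      using pN[OF that] frobenius_pow_pos[where 'a='a, of "l * N"] by (intro mult_le_mono) auto
    then show ?thesis by (simp add: Q2sq)
  qed
  have V: "laurent_within (\<delta> * Q2) ((w * ?q ^ l) * Q2) (V \<mu> m)" if \<mu>: "\<mu> \<in> {1..N}" for \<mu> m
  proof -
    have "laurent_within (p \<mu> * \<delta>) (p \<mu> * (w * ?q ^ (l * Suc (2 * N - \<mu>)))) (V \<mu> m)"
      unfolding V_def using S(2)[of "2 * N - \<mu>"] by (intro laurent_within_power) (simp add: coeffs_laurent_within_def)
    moreover have "p \<mu> * \<delta> \<le> \<delta> * Q2" using pQ2[OF \<mu>] by (simp add: mult.commute)
    moreover have "p \<mu> * (w * ?q ^ (l * Suc (2 * N - \<mu>))) = (w * ?q ^ l) * Q2"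
    proof -
      have "l * \<mu> + l * Suc (2 * N - \<mu>) = l + n"
      proof -
        have "\<mu> + Suc (2 * N - \<mu>) = Suc (2 * N)" using \<mu> by auto
        then have "l * (\<mu> + Suc (2 * N - \<mu>)) = l * Suc (2 * N)" by simp
        then show ?thesis unfolding n_def by (simp only: distrib_left mult_Suc_right)
      qed
      then have "p \<mu> * ?q ^ (l * Suc (2 * N - \<mu>)) = ?q ^ l * Q2"
        unfolding p_def Q2_def power_add[symmetric] by (simp only:)
      then show ?thesis by (simp add: mult.left_commute mult.assoc)
    qed
    ultimately show ?thesis by (metis laurent_within_mono order_refl)
  qed
  have "\<exists>h. (\<exists>i\<in>Mon \<times> {..<B} \<times> {..C} \<times> {..<Q2}. h i \<noteq> 0) \<and>
     (\<forall>\<mu>\<in>{1..N}. \<forall>m\<in>Mon. poly (aux_poly Q2 B C h m) (fls_X_inv ^ p \<mu>) * V \<mu> m0 =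
        poly (aux_poly Q2 B C h m0) (fls_X_inv ^ p \<mu>) * V \<mu> m)"
    by (rule aux_exists[OF fin m0M V D_def C[folded Mon_def D_def] N_def B_def K Q2pos pB])
  then obtain h where h0: "\<exists>i\<in>Mon \<times> {..<B} \<times> {..C} \<times> {..<Q2}. h i \<noteq> 0"
    and h: "\<forall>\<mu>\<in>{1..N}. \<forall>m\<in>Mon. poly (aux_poly Q2 B C h m) (fls_X_inv ^ p \<mu>) * V \<mu> m0 =
        poly (aux_poly Q2 B C h m0) (fls_X_inv ^ p \<mu>) * V \<mu> m"
    by (elim exE conjE)
  note h = h[rule_format]
  define E where "E M = (\<Sum>m\<in>Mon. aux_poly Q2 B C h m * mmon (jetv ?q l M [:0, 1:] [:fls_X ^ Q2 :: 'a fls:]) m)" for M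
  define Y where "Y M e0 = (\<Sum>m\<in>Mon. aux_part B C h e0 m * mmon (jetv ?q l M [:0, 1:] [:fls_X :: 'a fls:]) m)" for M e0
  have E_split: "E M = (\<Sum>e0<Q2. [:fls_X_inv ^ (e0 + C * Q2):] * frob_twist n (Y M e0))" for M
  proof -
    have "frob_twist n (mmon (jetv ?q l M [:0, 1:] [:fls_X :: 'a fls:]) m) = mmon (jetv ?q l M [:0, 1:] [:fls_X ^ Q2 :: 'a fls:]) m" for m
    proof -
      have "(\<lambda>i. frob_twist n (jetv ?q l M [:0, 1:] [:fls_X :: 'a fls:] i)) = jetv ?q l M [:0, 1:] [:fls_X ^ Q2 :: 'a fls:]"
        by (auto simp: fun_eq_iff rhom_jet[OF rhom_frob_twist] frob_twist_const Q2_def)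
      then show ?thesis by (simp only: rhom_mmon[OF rhom_frob_twist])
    qed
    then have "(\<Sum>e0<Q2. [:fls_X_inv ^ (e0 + C * Q2):] * frob_twist n (Y M e0)) =
       (\<Sum>e0<Q2. \<Sum>m\<in>Mon. ([:fls_X_inv ^ (e0 + C * Q2):] * frob_twist n (aux_part B C h e0 m)) * mmon (jetv ?q l M [:0, 1:] [:fls_X ^ Q2 :: 'a fls:]) m)"
      unfolding Y_def by (simp only: rhom_sum[OF rhom_frob_twist] rhom_mult[OF rhom_frob_twist] sum_distrib_left mult.assoc)
    also have "\<dots> = E M" unfolding E_def aux_poly_split[OF Q2_def] sum_distrib_right by (rule sum.swap)
    finally show ?thesis by simp
  qed
  define W where "W = int Q2 * (int K - int C - 1)"
  \<comment> \<open>E M is arbitrarily small at the points, as M grows, because it is a multiple of the truncated relation\<close>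
  have small: "\<exists>M0. \<forall>M\<ge>M0. ord_ge (poly (E M) (fls_X_inv ^ p \<mu>)) W" if \<mu>: "\<mu> \<in> {1..N}" for \<mu>
  proof -
    define \<nu> where "\<nu> = 2 * N - \<mu>"
    define f where "f = poly (aux_poly Q2 B C h m0) (fls_X_inv ^ p \<mu>)"
    have "Poly_Mapping.lookup (S (2 * N - \<mu>)) m0 \<noteq> 0" by (rule S(3)) (use m0 in auto)
    then have V0: "V \<mu> m0 \<noteq> 0" by (simp add: V_def)
    obtain k1 where k1: "ord_ge f k1" using ord_ge_exists by blast
    define W' where "W' = max 0 (W + fls_subdegree (V \<mu> m0) - k1)"
    obtain M0 where M0: "\<And>M. M \<ge> M0 \<Longrightarrow> ord_ge (mev (\<lambda>x. x) (jetv ?q l M fls_X_inv fls_X) R) W'"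
      using rel unfolding value_rel_def by blast
    have "ord_ge (poly (E M) (fls_X_inv ^ p \<mu>)) W" if M: "M \<ge> M0" for M
    proof -
      define v where "v = jetv ?q l M fls_X_inv (fls_X ^ (?q ^ (l * \<nu>)) :: 'a fls)"
      have homp: "rhom (\<lambda>r. poly r (fls_X_inv ^ p \<mu> :: 'a fls))" by (simp add: rhom_def)
      have "l * \<nu> + l * \<mu> = n" using \<mu> by (simp add: \<nu>_def n_def flip: distrib_left)
      then have Q2m: "?q ^ (l * \<nu>) * p \<mu> = Q2" by (simp add: Q2_def p_def flip: power_add)
      have j: "(\<lambda>i. poly (jetv ?q l M [:0, 1:] [:fls_X ^ Q2:] i) (fls_X_inv ^ p \<mu>)) = (\<lambda>i. v i ^ p \<mu>)"
      proof
        fix i :: "nat \<times> nat"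
        obtain c k where i: "i = (c, k)" by (cases i)
        have "poly (jet ?q l c M k [:0, 1:] [:fls_X ^ Q2:]) (fls_X_inv ^ p \<mu> :: 'a fls) = jet ?q l c M k (fls_X_inv ^ p \<mu>) (fls_X ^ Q2)"
          by (simp add: rhom_jet[OF homp])
        also have "\<dots> = jet ?q l c M k fls_X_inv (fls_X ^ (?q ^ (l * \<nu>)) :: 'a fls) ^ p \<mu>"
          by (simp only: rhom_jet[OF rhom_frobenius, of _ _ _ _ _ _ _ "l * \<mu>"] power_mult[symmetric] Q2m[symmetric] p_def)
        finally show "poly (jetv ?q l M [:0, 1:] [:fls_X ^ Q2:] i) (fls_X_inv ^ p \<mu>) = v i ^ p \<mu>"
          by (simp add: i v_def)
      qed
      have "poly (E M) (fls_X_inv ^ p \<mu>) = (\<Sum>m\<in>Mon. poly (aux_poly Q2 B C h m) (fls_X_inv ^ p \<mu>) * mmon v m ^ p \<mu>)"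
        unfolding E_def poly_sum poly_mult rhom_mmon[OF homp] j mmon_power ..
      then have "poly (E M) (fls_X_inv ^ p \<mu>) * V \<mu> m0 =
         (\<Sum>m\<in>Mon. (poly (aux_poly Q2 B C h m) (fls_X_inv ^ p \<mu>) * V \<mu> m0) * mmon v m ^ p \<mu>)"
        by (simp only: sum_distrib_left mult_ac)
      also have "\<dots> = (\<Sum>m\<in>Mon. f * (Poly_Mapping.lookup (S \<nu>) m * mmon v m) ^ p \<mu>)"
      proof (rule sum.cong[OF refl])
        fix m assume "m \<in> Mon"
        then have "poly (aux_poly Q2 B C h m) (fls_X_inv ^ p \<mu>) * V \<mu> m0 = f * V \<mu> m"
          unfolding f_def by (rule h[OF \<mu>])
        then show "poly (aux_poly Q2 B C h m) (fls_X_inv ^ p \<mu>) * V \<mu> m0 * mmon v m ^ p \<mu> =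
            f * (Poly_Mapping.lookup (S \<nu>) m * mmon v m) ^ p \<mu>"
          by (simp add: V_def \<nu>_def power_mult_distrib)
      qed
      also have "\<dots> = f * (\<Sum>m\<in>Mon. Poly_Mapping.lookup (S \<nu>) m * mmon v m) ^ p \<mu>"
        unfolding p_def frobenius_pow_sum[OF CHAR_fls] sum_distrib_left ..
      also have "(\<Sum>m\<in>Mon. Poly_Mapping.lookup (S \<nu>) m * mmon v m) = mev (\<lambda>x. x) v (S \<nu>)"
        by (rule mev_superset[symmetric]) (use fin S(1) in auto)
      also have "\<dots> = mev (\<lambda>x. x) (jetv ?q l (\<nu> + M) fls_X_inv fls_X) R"
        unfolding S_def v_def by (rule mev_jet_subst_jetv)
      finally have e: "poly (E M) (fls_X_inv ^ p \<mu>) * V \<mu> m0 = f * mev (\<lambda>x. x) (jetv ?q l (\<nu> + M) fls_X_inv fls_X) R ^ p \<mu>" .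
      have "ord_ge (mev (\<lambda>x. x) (jetv ?q l (\<nu> + M) fls_X_inv fls_X) R ^ p \<mu>) (int (p \<mu>) * W')"
        by (rule ord_ge_power[OF M0]) (use M in simp)
      then have "ord_ge (mev (\<lambda>x. x) (jetv ?q l (\<nu> + M) fls_X_inv fls_X) R ^ p \<mu>) W'"
      proof (rule ord_ge_mono)
        have "1 * W' \<le> int (p \<mu>) * W'"
          using frobenius_pow_pos[where 'a='a, of "l * \<mu>"] unfolding p_def W'_def by (intro mult_right_mono) linarith+
        then show "W' \<le> int (p \<mu>) * W'" by simp
      qed
      then have "ord_ge (poly (E M) (fls_X_inv ^ p \<mu>) * V \<mu> m0) (k1 + W')" unfolding e by (rule ord_ge_mult[OF k1])
      from ord_ge_div[OF this V0] show ?thesis by (rule ord_ge_mono) (simp add: W'_def)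
    qed
    then show ?thesis by blast
  qed
  then obtain F where F: "\<And>\<mu> M. \<mu> \<in> {1..N} \<Longrightarrow> M \<ge> F \<mu> \<Longrightarrow> ord_ge (poly (E M) (fls_X_inv ^ p \<mu>)) W" by metis
  define M0 where "M0 = (\<Sum>\<mu>\<in>{1..N}. F \<mu>)"
  define A where "A = (\<lambda>\<mu>. fls_X_inv ^ p \<mu> :: 'a fls) ` {1..N}"
  have pinj: "p \<mu> = p \<mu>' \<longleftrightarrow> \<mu> = \<mu>'" for \<mu> \<mu>'
    using q2 l by (auto simp: p_def power_inject_exp)
  have Ainj: "inj_on (\<lambda>\<mu>. fls_X_inv ^ p \<mu> :: 'a fls) {1..N}"
  proof (rule inj_onI)
    fix \<mu> \<mu>' assume "(fls_X_inv ^ p \<mu> :: 'a fls) = fls_X_inv ^ p \<mu>'"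
    then have "fls_subdegree (fls_X_inv ^ p \<mu> :: 'a fls) = fls_subdegree (fls_X_inv ^ p \<mu>' :: 'a fls)" by simp
    then show "\<mu> = \<mu>'" using pinj by simp
  qed
  have cA: "card A = N" unfolding A_def using Ainj by (simp add: card_image)
  \<comment> \<open>the loss in the Schwarz lemma: the degrees of the points form a geometric progression\<close>
  have sumL: "(\<Sum>a\<in>A. - fls_subdegree a) \<le> int Q2"
  proof -
    have "(\<Sum>a\<in>A. - fls_subdegree a) = (\<Sum>\<mu>\<in>{1..N}. int (p \<mu>))"
      unfolding A_def by (subst sum.reindex[OF Ainj]) simp
    also have "\<dots> = int (\<Sum>\<mu>\<in>{1..N}. (?q ^ l) ^ \<mu>)" by (simp add: p_def power_mult)
    also have "(\<Sum>\<mu>\<in>{1..N}. (?q ^ l) ^ \<mu>) \<le> (\<Sum>\<mu><Suc N. (?q ^ l) ^ \<mu>)"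
      by (rule sum_mono2) auto
    also have "\<dots> \<le> (?q ^ l) ^ Suc N"
    proof (rule geometric_sum_le)
      have "?q ^ 1 \<le> ?q ^ l" using q2 l by (intro power_increasing) auto
      then show "?q ^ l \<ge> 2" using q2 by simp
    qed
    also have "(?q ^ l) ^ Suc N = ?q ^ (l * Suc N)" by (rule power_mult[symmetric])
    also have "\<dots> \<le> Q2" unfolding Q2_def n_def using q2 N1 by (intro power_increasing mult_le_mono2) auto
    finally show ?thesis by simp
  qed
  have bound: "pord_ge (E M) (int Q2 * ((int K - 2) - int C))" if M: "M \<ge> M0" for M
    unfolding pord_ge_def
  proof
    fix b
    have FM: "M \<ge> F \<mu>" if "\<mu> \<in> {1..N}" for \<mu>
    proof -
      have "F \<mu> \<le> M0" unfolding M0_def using that by (intro member_le_sum) auto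
      with M show ?thesis by simp
    qed
    have gE: "gauss (E M) (- int (Suc C * Q2 + B * Q2)) (int Q2)"
      unfolding E_def
    proof (rule gauss_sum)
      fix m assume "m \<in> Mon"
      have "gauss (mmon (jetv ?q l M [:0, 1:] [:fls_X ^ Q2 :: 'a fls:]) m) 0 (int Q2)"
        by (rule gauss_mmon) (auto simp: gauss_jet[OF Q2pos] split: prod.splits)
      from gauss_mult[OF gauss_aux_poly this]
      show "gauss (aux_poly Q2 B C h m * mmon (jetv ?q l M [:0, 1:] [:fls_X ^ Q2 :: 'a fls:]) m) (- int (Suc C * Q2 + B * Q2)) (int Q2)"
        by simp
    qed
    have "ord_ge (poly.coeff (E M) b) (min W (- int (Suc C * Q2 + B * Q2) + int Q2 * int (card A)) - (\<Sum>a\<in>A. - fls_subdegree a))"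
    proof (rule schwarz_lemma)
      show "finite A" by (simp add: A_def)
      show "ord_ge (poly.coeff (E M) b) (- int (Suc C * Q2 + B * Q2) + int Q2 * int b)" for b
        using gE by (simp add: gauss_def)
      show "ord_ge (poly (E M) a) W" if "a \<in> A" for a using that F FM by (auto simp: A_def)
      show "ord_ge a (- int Q2)" if "a \<in> A" for a using that pQ2 by (auto simp: A_def intro!: ord_ge_X_inv_power)
      show "ord_ge a (- (- fls_subdegree a))" "- fls_subdegree a \<ge> 0" if "a \<in> A" for a
        using that by (auto simp: A_def ord_ge_iff_subdegree)
      show "fls_subdegree (a - b) \<le> 0" if ab: "a \<in> A" "b \<in> A" "a \<noteq> b" for a b
      proof -
        obtain \<mu> \<mu>' where m: "a = fls_X_inv ^ p \<mu>" "b = fls_X_inv ^ p \<mu>'" using ab by (auto simp: A_def)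
        have "p \<mu> \<noteq> p \<mu>'" using ab m by auto
        then have "fls_nth (a - b) (- int (p \<mu>)) \<noteq> 0" by (simp add: m)
        then show ?thesis by (rule fls_subdegree_leI') simp
      qed
    qed simp
    moreover have "int Q2 * ((int K - 2) - int C) \<le> min W (- int (Suc C * Q2 + B * Q2) + int Q2 * int (card A)) - (\<Sum>a\<in>A. - fls_subdegree a)"
    proof -
      have "- int (Suc C * Q2 + B * Q2) + int Q2 * int (card A) = W"
        unfolding cA NB W_def by (simp add: algebra_simps)
      moreover have "W - int Q2 = int Q2 * ((int K - 2) - int C)" unfolding W_def by (simp add: algebra_simps)
      ultimately show ?thesis using sumL by simp
    qed
    ultimately show "ord_ge (poly.coeff (E M) b) (int Q2 * ((int K - 2) - int C))" by (rule ord_ge_mono)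
  qed
  obtain m b e1 e0 where nz: "m \<in> Mon" "b < B" "e1 \<le> C" "e0 < Q2" "h (m, b, e1, e0) \<noteq> 0" using h0 by auto
  have "pord_ge (Y M e0) (int K - 2)" if "M \<ge> M0" for M
    by (rule pord_ge_of_split[OF Q2_def bound[OF that, unfolded E_split] nz(4)])
  then show ?thesis using nz unfolding Y_def Mon_def
    by (intro exI[of _ B] exI[of _ h] exI[of _ e0] conjI bexI[of _ "(m, b, e1)"] exI[of _ M0]) auto
qed

text \<open>Read coefficientwise in \<open>z\<close>, a linear relation between functions is a system of linear equations over \<open>\<F>\<^sub>q[t]\<close>.\<close>

definition zcoeff :: "int \<Rightarrow> 'a::zero fls poly \<Rightarrow> 'a poly" where
  "zcoeff w p = map_poly (\<lambda>f. fls_nth f w) p"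

lemma coeff_zcoeff: "poly.coeff (zcoeff w p) b = fls_nth (poly.coeff p b) w"
  unfolding zcoeff_def by (rule coeff_map_poly) simp
lemma zcoeff_sum: "zcoeff w (\<Sum>i\<in>S. p i) = (\<Sum>i\<in>S. zcoeff w (p i))"
  by (rule poly_eqI) (simp add: coeff_zcoeff coeff_sum fls_nth_sum)
lemma zcoeff_mult_const:
  "zcoeff w (map_poly fls_const g * p) = g * zcoeff w (p :: 'a::comm_ring_1 fls poly)"
  by (rule poly_eqI) (simp add: coeff_zcoeff coeff_mult fls_nth_sum coeff_map_poly)
lemma pord_ge_zcoeff: "pord_ge p k \<longleftrightarrow> (\<forall>w<k. zcoeff w p = 0)"
  by (auto simp: pord_ge_def ord_ge_def poly_eq_iff coeff_zcoeff)

lemma pord_ge_jet_stable: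
  shows "pord_ge (jet CARD('a) l c M k [:0, 1:] [:fls_X :: 'a::{field,finite} fls:]) 0"
    and "l \<ge> 1 \<Longrightarrow> M \<ge> M0 \<Longrightarrow> pord_ge (jet CARD('a) l c M k [:0, 1:] [:fls_X :: 'a fls:] - jet CARD('a) l c M0 k [:0, 1:] [:fls_X:]) (int M0)"
proof -
  have q2: "CARD('a) \<ge> 2" by (rule card_ge_2)
  have S: "pord_ge (1 :: 'a fls poly) 0" "\<And>a b. pord_ge a 0 \<Longrightarrow> pord_ge b 0 \<Longrightarrow> pord_ge (a * b :: 'a fls poly) 0"
    "\<And>a b k. pord_ge a 0 \<Longrightarrow> pord_ge b k \<Longrightarrow> pord_ge (a * b :: 'a fls poly) k"
    using pord_ge_mult[where 'a='a, of _ 0] by (force simp: pord_ge_def coeff_1)+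
  have z: "pord_ge ([:fls_X :: 'a fls:] ^ e) (int M)" "pord_ge ([:0, 1:] * [:fls_X :: 'a fls:] ^ e) (int M)" if "e \<ge> M" for e M
    using that by (auto simp: pord_ge_def poly_const_pow coeff_pCons split: nat.splits intro!: ord_ge_X_power)
  have z0: "pord_ge ([:fls_X :: 'a fls:] ^ e) 0" "pord_ge ([:0, 1:] * [:fls_X :: 'a fls:] ^ e) 0" for e
    using z[of 0 e] by simp_all
  show "pord_ge (jet CARD('a) l c M k [:0, 1:] [:fls_X :: 'a fls:]) 0"
    by (rule jet_stable(1)[where J = "\<lambda>_. True" and S = "\<lambda>p. pord_ge p 0"]) (intro S pord_ge_diff z0 TrueI; assumption)+
  assume l: "l \<ge> 1" and M: "M \<ge> M0"
  have big: "CARD('a) ^ (c + l * m) \<ge> M0" if "m \<ge> M0" for m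
  proof -
    have "m < 2 ^ m" by (rule less_exp)
    also have "\<dots> \<le> CARD('a) ^ m" using q2 by (rule power_mono) simp
    also have "\<dots> \<le> CARD('a) ^ (c + l * m)"
      using q2 mult_le_mono1[OF l, of m] by (intro power_increasing trans_le_add2) auto
    finally show ?thesis using that by simp
  qed
  show "pord_ge (jet CARD('a) l c M k [:0, 1:] [:fls_X :: 'a fls:] - jet CARD('a) l c M0 k [:0, 1:] [:fls_X:]) (int M0)"
    by (rule jet_stable(2)[where J = "\<lambda>p. pord_ge p (int M0)" and S = "\<lambda>p. pord_ge p 0", OF _ _ _ _ _ _ _ _ _ _ M])
      (intro S pord_ge_diff pord_ge_add z0 z big pord_ge_0; assumption)+
qed

lemma pord_ge_mmon_jet_stable:
  shows "pord_ge (mmon (jetv CARD('a) l M [:0, 1:] [:fls_X :: 'a::{field,finite} fls:]) m) 0"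
    and "l \<ge> 1 \<Longrightarrow> M \<ge> M0 \<Longrightarrow> pord_ge (mmon (jetv CARD('a) l M [:0, 1:] [:fls_X :: 'a fls:]) m -
      mmon (jetv CARD('a) l M0 [:0, 1:] [:fls_X:]) m) (int M0)"
proof -
  have S: "pord_ge (1 :: 'a fls poly) 0" "\<And>a b k. pord_ge a 0 \<Longrightarrow> pord_ge b k \<Longrightarrow> pord_ge (a * b :: 'a fls poly) k"
    using pord_ge_mult[where 'a='a, of _ 0] by (force simp: pord_ge_def coeff_1)+
  show "pord_ge (mmon (jetv CARD('a) l M [:0, 1:] [:fls_X :: 'a::{field,finite} fls:]) m) 0"
    by (rule mmon_diff_ideal(2)[where J = "\<lambda>_. True" and S = "\<lambda>p. pord_ge p 0" and y = "jetv CARD('a) l M [:0, 1:] [:fls_X:]"])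
      (auto intro: S pord_ge_jet_stable)
  assume "l \<ge> 1" "M \<ge> M0"
  then show "pord_ge (mmon (jetv CARD('a) l M [:0, 1:] [:fls_X :: 'a fls:]) m - mmon (jetv CARD('a) l M0 [:0, 1:] [:fls_X:]) m) (int M0)"
    by (intro mmon_diff_ideal(1)[where J = "\<lambda>p. pord_ge p (int M0)" and S = "\<lambda>p. pord_ge p 0"])
      (auto intro: S pord_ge_add pord_ge_jet_stable)
qed

text \<open>For every precision there is an approximate relation between the functions, whose unknown coefficients in \<open>\<F>\<^sub>q[t]\<close> are indexed
  by a set that does not depend on the precision.  By \<open>elimination_limit\<close> there is an exact relation, which
  contradicts the independence of the functions.\<close>

theorem value_rel_imp_0:
  fixes R :: "(nat \<times> nat \<Rightarrow>\<^sub>0 nat) \<Rightarrow>\<^sub>0 'a::{field,finite} fls"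
  assumes l: "l \<ge> 1" and vars: "mvars_in ({1..l} \<times> UNIV) R" and R: "coeffs_laurent_within \<delta> 0 R" and rel: "value_rel l R"
  shows "R = 0"
proof (rule ccontr)
  assume "R \<noteq> 0"
  then have ne: "Poly_Mapping.keys R \<noteq> {}" by simp
  let ?q = "CARD('a)"
  define w where "w = Max (wt ` Poly_Mapping.keys R)"
  have w: "wt n \<le> w" if "n \<in> Poly_Mapping.keys R" for n unfolding w_def using that by (intro Max_ge) auto
  have "w \<in> wt ` Poly_Mapping.keys R" unfolding w_def using ne by (intro Max_in) auto
  then obtain m0 where m0: "m0 \<in> Poly_Mapping.keys R" "wt m0 = w" by auto
  define Mon where "Mon = monomials_upto l w"
  have fin: "finite Mon" unfolding Mon_def by (rule finite_monomials_upto)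
  have m0M: "m0 \<in> Mon" using m0 vars by (auto simp: Mon_def monomials_upto_def mvars_in_def)
  define C where "C = 2 * card Mon * (2 + \<delta> + w * ?q ^ l) - 1"
  have "card Mon > 0" using fin m0M by (metis card_gt_0_iff empty_iff)
  then have C: "Suc C = 2 * card Mon * (2 + \<delta> + w * ?q ^ l)" by (simp add: C_def)
  let ?I = "Mon \<times> {..C}"
  let ?Y = "\<lambda>M m. mmon (jetv ?q l M [:0, 1:] [:fls_X :: 'a fls:]) m"
  define x where "x j = (\<lambda>(m, e1). zcoeff (int j) ([:fls_X ^ (C - e1):] * ?Y (Suc j) m))" for j
  have stable: "zcoeff (int j) ([:fls_X ^ e:] * ?Y M m) = zcoeff (int j) ([:fls_X ^ e:] * ?Y (Suc j) m)"
    if "M \<ge> Suc j" for M m j e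
  proof -
    have "pord_ge [:fls_X ^ e :: 'a fls:] 0" by (auto simp: pord_ge_def coeff_pCons split: nat.splits intro!: ord_ge_X_power)
    from pord_ge_mult[OF this pord_ge_mmon_jet_stable(2)[OF l that]]
    have "zcoeff (int j) ([:fls_X ^ e:] * (?Y M m - ?Y (Suc j) m)) = 0" unfolding pord_ge_zcoeff by simp
    then show ?thesis by (simp add: poly_eq_iff coeff_zcoeff right_diff_distrib)
  qed
  have comb: "zcoeff (int j) (\<Sum>m\<in>Mon. (\<Sum>e1\<le>C. map_poly fls_const (g (m, e1)) * [:fls_X ^ (C - e1):]) * ?Y M m)
     = (\<Sum>i\<in>?I. g i * x j i)" if "M \<ge> Suc j" for g M j
  proof -
    have "zcoeff (int j) (\<Sum>m\<in>Mon. (\<Sum>e1\<le>C. map_poly fls_const (g (m, e1)) * [:fls_X ^ (C - e1):]) * ?Y M m) =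
      (\<Sum>m\<in>Mon. \<Sum>e1\<le>C. g (m, e1) * zcoeff (int j) ([:fls_X ^ (C - e1):] * ?Y M m))"
      unfolding sum_distrib_right mult.assoc zcoeff_sum zcoeff_mult_const ..
    also have "\<dots> = (\<Sum>m\<in>Mon. \<Sum>e1\<le>C. g (m, e1) * x j (m, e1))" by (simp only: stable[OF that] x_def prod.case)
    also have "\<dots> = (\<Sum>i\<in>?I. g i * x j i)" by (simp add: sum.cartesian_product)
    finally show ?thesis .
  qed
  have "\<exists>g. (\<exists>i\<in>?I. g i \<noteq> 0) \<and> (\<forall>j<W. (\<Sum>i\<in>?I. g i * x j i) = 0)" for W
  proof -
    have K: "W + 2 \<ge> 1" by simp
    obtain B h e0 M0 where h: "\<exists>i\<in>Mon \<times> {..<B} \<times> {..C} . h (fst i, fst (snd i), snd (snd i), e0) \<noteq> (0::'a)"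
      and p: "\<And>M. M \<ge> M0 \<Longrightarrow> pord_ge (\<Sum>m\<in>Mon. aux_part B C h e0 m * ?Y M m) (int (W + 2) - 2)"
      using approximate_relation[OF l vars R rel w m0 C[unfolded Mon_def] K] unfolding Mon_def by blast
    define g where "g = (\<lambda>(m, e1). \<Sum>b<B. monom (h (m, b, e1, e0)) b)"
    have cg: "poly.coeff (g (m, e1)) b = (if b < B then h (m, b, e1, e0) else 0)" for m e1 b
      unfolding g_def by (simp add: coeff_sum)
    have ap: "aux_part B C h e0 m = (\<Sum>e1\<le>C. map_poly fls_const (g (m, e1)) * [:fls_X ^ (C - e1):])" for m
    proof -
      have "map_poly fls_const (g (m, e1)) * [:fls_X ^ (C - e1):] =
         (\<Sum>b<B. monom (fls_const (h (m, b, e1, e0)) * fls_X ^ (C - e1)) b)" for e1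
        by (rule poly_eqI) (simp add: coeff_sum coeff_map_poly cg)
      then show ?thesis unfolding aux_part_def by (simp only: sum.swap[of _ "{..C}"])
    qed
    have "(\<Sum>i\<in>?I. g i * x j i) = 0" if j: "j < W" for j
    proof -
      have "zcoeff (int j) (\<Sum>m\<in>Mon. aux_part B C h e0 m * ?Y (max M0 (Suc j)) m) = 0"
        using p[of "max M0 (Suc j)"] j unfolding pord_ge_zcoeff by simp
      then show ?thesis unfolding ap using comb[of j "max M0 (Suc j)" g] by simp
    qed
    moreover have "\<exists>i\<in>?I. g i \<noteq> 0"
    proof -
      obtain m b e1 where i: "m \<in> Mon" "b < B" "e1 \<le> C" "h (m, b, e1, e0) \<noteq> 0" using h by auto
      then have "g (m, e1) \<noteq> 0" using cg[of m e1 b] by auto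
      then show ?thesis using i by auto
    qed
    ultimately show ?thesis by blast
  qed
  moreover have "finite ?I" using fin by simp
  ultimately obtain g where g0: "\<exists>i\<in>?I. g i \<noteq> 0" and g: "\<And>j. (\<Sum>i\<in>?I. g i * x j i) = 0"
    using elimination_limit[of ?I x] by blast
  define T where "T m = (\<Sum>e1\<le>C. map_poly fls_const (g (m, e1)) * [:fls_X ^ (C - e1):])" for m
  define R' where "R' = (\<Sum>m\<in>Mon. Poly_Mapping.single m (T m))"
  have lR': "Poly_Mapping.lookup R' n = (if n \<in> Mon then T n else 0)" for n
    using fin by (simp add: R'_def lookup_sum lookup_single when_def)
  have kR': "Poly_Mapping.keys R' \<subseteq> Mon" by (auto simp: in_keys_iff lR' split: if_splits)
  have ev: "mev (\<lambda>x. x) y R' = (\<Sum>m\<in>Mon. T m * mmon y m)" for y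
    by (subst mev_superset[OF _ fin kR']) (auto simp: lR')
  have "function_rel l 0 R'"
    unfolding function_rel_def
  proof
    fix W
    have "pord_ge (\<Sum>m\<in>Mon. T m * ?Y M m) W" if M: "M \<ge> nat W + 1" for M
      unfolding pord_ge_zcoeff
    proof (intro allI impI)
      fix u assume u: "u < W"
      show "zcoeff u (\<Sum>m\<in>Mon. T m * ?Y M m) = 0"
      proof (cases "u < 0")
        case True
        have "pord_ge (\<Sum>m\<in>Mon. T m * ?Y M m) 0"
        proof -
          have "pord_ge (map_poly fls_const (g (m, e1)) * [:fls_X ^ (C - e1):]) 0" for m e1
            by (auto simp: pord_ge_def coeff_map_poly intro!: ord_ge_mult0 ord_ge_X_power)
          then have "pord_ge (T m) 0" for m unfolding T_def by (auto simp: pord_ge_def coeff_sum intro!: ord_ge_sum)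
          from pord_ge_mult[OF this pord_ge_mmon_jet_stable(1)]
          have "pord_ge (T m * ?Y M m) 0" for m by simp
          then show ?thesis by (auto simp: pord_ge_def coeff_sum intro!: ord_ge_sum)
        qed
        then show ?thesis using True unfolding pord_ge_zcoeff by blast
      next
        case False
        then obtain j where j: "u = int j" by (metis int_nat_eq linorder_not_le nat_int zero_le_imp_eq_int not_less)
        have "M \<ge> Suc j" using M u j by linarith
        then show ?thesis using comb[of j M g] g[of j] by (simp add: T_def j)
      qed
    qed
    then show "\<exists>M0. \<forall>M\<ge>M0. pord_ge (mev (\<lambda>x. x) (jetv ?q l M [:0, 1:] [:fls_X ^ (?q ^ (l * 0)):]) R') W"
      unfolding ev by (intro exI[of _ "nat W + 1"]) simp
  qed
  moreover have "mvars_in ({1..l} \<times> UNIV) R'" using kR' by (force simp: mvars_in_def Mon_def monomials_upto_def)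
  moreover have "wt n \<le> w" if "n \<in> Poly_Mapping.keys R'" for n using kR' that by (auto simp: Mon_def monomials_upto_def)
  ultimately have "R' = 0" by (rule function_rel_imp_0[OF l])
  obtain m e where me: "m \<in> Mon" "e \<le> C" "g (m, e) \<noteq> 0" using g0 by auto
  then obtain b where b: "poly.coeff (g (m, e)) b \<noteq> 0" by (metis leading_coeff_0_iff)
  have "T m = 0" using \<open>R' = 0\<close> lR'[of m] me by simp
  then have "0 = fls_nth (poly.coeff (T m) b) (int (C - e))" by simp
  also have "\<dots> = (\<Sum>e1\<le>C. if e1 = e then poly.coeff (g (m, e)) b else 0)"
    unfolding T_def coeff_sum fls_nth_sum
    by (intro sum.cong refl) (use me in \<open>auto simp: coeff_map_poly\<close>)
  also have "\<dots> = poly.coeff (g (m, e)) b" using me by simp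
  finally show False using b by simp
qed

section \<open>Hyperderivatives of Laurent series\<close>

text \<open>Identities of \<open>int_choose\<close> are transferred from \<open>gchoose\<close> on the rational numbers.\<close>

lemma of_int_int_choose: "(of_int (int_choose a n) :: rat) = of_int a gchoose n"
proof -
  have ex: "\<exists>k :: int. (of_int a gchoose n :: rat) = of_int k"
  proof (cases "a \<ge> 0")
    case True
    then obtain b where "a = int b" by (metis zero_le_imp_eq_int)
    then have "(of_int a gchoose n :: rat) = of_int (int (b choose n))"
      by (simp add: binomial_gbinomial)
    then show ?thesis by blast
  next
    case False
    then have "int n - a - 1 \<ge> 0" by simp
    then obtain b where b: "int n - a - 1 = int b" by (metis zero_le_imp_eq_int)
    have "(of_int a gchoose n :: rat) = (-1) ^ n * (of_int (int n - a - 1) gchoose n)"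
      by (subst gbinomial_negated_upper) simp
    also have "\<dots> = of_int ((-1) ^ n * int (b choose n))"
      unfolding b by (simp add: binomial_gbinomial)
    finally show ?thesis by blast
  qed
  then obtain k where k: "(of_int a gchoose n :: rat) = of_int k" by blast
  have "(of_int (\<Prod>j<n. a - int j) :: rat) = (of_int a gchoose n) * fact n"
    by (simp add: gbinomial_prod_rev atLeast0LessThan)
  also have "\<dots> = of_int (k * fact n)" by (simp add: k)
  finally have "(\<Prod>j<n. a - int j) = k * fact n" by (simp only: of_int_eq_iff)
  then show ?thesis by (simp add: int_choose_def k)
qed

lemma int_choose_0 [simp]: "int_choose a 0 = 1" by (simp add: int_choose_def)

lemma int_choose_Vandermonde: "int_choose (a + b) n = (\<Sum>j\<le>n. int_choose a j * int_choose b (n - j))"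
proof -
  have "(of_int (int_choose (a + b) n) :: rat) = of_int (\<Sum>j\<le>n. int_choose a j * int_choose b (n - j))"
    by (simp add: of_int_int_choose gbinomial_Vandermonde[symmetric] atLeast0AtMost)
  then show ?thesis by (simp only: of_int_eq_iff)
qed

lemma int_choose_nat: "int_choose (int a) n = int (a choose n)"
proof -
  have "(of_int (int_choose (int a) n) :: rat) = of_int (int (a choose n))"
    by (simp add: of_int_int_choose binomial_gbinomial)
  then show ?thesis by (simp only: of_int_eq_iff)
qed

text \<open>The library sums between the exact orders of the factors.  With lower bounds instead, the range is also known for
  hyperderivatives, whose orders are not determined by that of the series.\<close>

lemma fls_times_nth_ranges:
  fixes f g :: "'a::idom fls"
  assumes "ord_ge f d" "ord_ge g e"
  shows "fls_nth (f * g) k = (\<Sum>i=d..k - e. fls_nth f i * fls_nth g (k - i))"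
proof (cases "f = 0 \<or> g = 0")
  case False
  then have le: "d \<le> fls_subdegree f" "e \<le> fls_subdegree g" using assms by (auto simp: ord_ge_iff_subdegree)
  show ?thesis unfolding fls_times_nth(2)
    by (rule sum.mono_neutral_left) (use le in \<open>auto intro: ccontr dest: fls_eq0_below_subdegree\<close>)
qed auto

lemma hyperderiv_fls_nth': "fls_nth (hyperderiv_fls n f) m = of_int (int_choose (int n - m) n) * fls_nth f (m - int n)"
  using hyperderiv_fls_nth[of n f "m - int n"] by simp

lemma ord_ge_hyperderiv: "ord_ge f k \<Longrightarrow> ord_ge (hyperderiv_fls n f) (k + int n)"
  by (simp add: ord_ge_def hyperderiv_fls_nth')

lemma hyperderiv_fls_mult:
  fixes f g :: "'a::field fls"
  shows "hyperderiv_fls n (f * g) = (\<Sum>j\<le>n. hyperderiv_fls j f * hyperderiv_fls (n - j) g)"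
proof (rule fls_eqI)
  fix m
  define k where "k = m - int n"
  have m: "m = k + int n" by (simp add: k_def)
  obtain d e where d: "ord_ge f d" and e: "ord_ge g e" using ord_ge_exists by blast
  have "fls_nth (hyperderiv_fls j f * hyperderiv_fls (n - j) g) m =
     (\<Sum>i=d..k - e. of_int (int_choose (- i) j * int_choose (- (k - i)) (n - j)) * (fls_nth f i * fls_nth g (k - i)))"
    if "j \<le> n" for j
  proof -
    have "fls_nth (hyperderiv_fls j f * hyperderiv_fls (n - j) g) m =
       (\<Sum>i=d + int j..m - (e + int (n - j)). fls_nth (hyperderiv_fls j f) i * fls_nth (hyperderiv_fls (n - j) g) (m - i))"
      by (rule fls_times_nth_ranges) (auto intro: ord_ge_hyperderiv d e)
    also have "\<dots> = (\<Sum>i=d..k - e. fls_nth (hyperderiv_fls j f) (i + int j) * fls_nth (hyperderiv_fls (n - j) g) (m - (i + int j)))"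
      by (rule sum.reindex_bij_witness[of _ "\<lambda>i. i + int j" "\<lambda>i. i - int j"]) (use that in \<open>auto simp: m of_nat_diff\<close>)
    also have "\<dots> = (\<Sum>i=d..k - e. of_int (int_choose (- i) j * int_choose (- (k - i)) (n - j)) * (fls_nth f i * fls_nth g (k - i)))"
      by (rule sum.cong[OF refl]) (use that in \<open>simp add: hyperderiv_fls_nth' m of_nat_diff algebra_simps\<close>)
    finally show ?thesis .
  qed
  then have "fls_nth (\<Sum>j\<le>n. hyperderiv_fls j f * hyperderiv_fls (n - j) g) m =
     (\<Sum>j\<le>n. \<Sum>i=d..k - e. of_int (int_choose (- i) j * int_choose (- (k - i)) (n - j)) * (fls_nth f i * fls_nth g (k - i)))"
    by (simp add: fls_nth_sum)
  also have "\<dots> = (\<Sum>i=d..k - e. of_int (\<Sum>j\<le>n. int_choose (- i) j * int_choose (- (k - i)) (n - j)) * (fls_nth f i * fls_nth g (k - i)))"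
    by (subst sum.swap) (simp only: of_int_sum sum_distrib_right)
  also have "\<dots> = (\<Sum>i=d..k - e. of_int (int_choose (- k) n) * (fls_nth f i * fls_nth g (k - i)))"
    by (simp add: int_choose_Vandermonde[symmetric])
  also have "\<dots> = of_int (int_choose (- k) n) * fls_nth (f * g) k"
    unfolding fls_times_nth_ranges[OF d e] sum_distrib_left ..
  also have "\<dots> = fls_nth (hyperderiv_fls n (f * g)) m" by (simp add: hyperderiv_fls_nth' m)
  finally show "fls_nth (hyperderiv_fls n (f * g)) m = fls_nth (\<Sum>j\<le>n. hyperderiv_fls j f * hyperderiv_fls (n - j) g) m" by simp
qed

lemma hyperderiv_fls_add: "hyperderiv_fls n (f + g) = hyperderiv_fls n f + hyperderiv_fls n g"
  by (rule fls_eqI) (simp add: hyperderiv_fls_nth' algebra_simps)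
lemma hyperderiv_fls_diff: "hyperderiv_fls n (f - g) = hyperderiv_fls n f - hyperderiv_fls n g"
  by (rule fls_eqI) (simp add: hyperderiv_fls_nth' algebra_simps)
lemma hyperderiv_fls_0 [simp]: "hyperderiv_fls 0 f = f"
  by (rule fls_eqI) (simp add: hyperderiv_fls_nth')
lemma hyperderiv_fls_const: "hyperderiv_fls n (fls_const c) = (if n = 0 then fls_const c else 0)"
proof -
  have "int_choose 0 n = 0" if "n > 0" using int_choose_nat[of 0 n] that by simp
  then show ?thesis by (intro fls_eqI) (auto simp: hyperderiv_fls_nth')
qed
lemma hyperderiv_fls_theta: "hyperderiv_fls n (fls_X_inv :: 'a::field fls) = (if n = 0 then fls_X_inv else if n = 1 then 1 else 0)"
proof -
  have "int_choose 1 n = (if n \<le> 1 then 1 else 0)" using int_choose_nat[of 1 n] by (cases n) auto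
  then have c: "int_choose (int n - m) n = (if n \<le> 1 then 1 else 0)" if "m - int n = - 1" for m
  proof -
    have "int n - m = 1" using that by linarith
    then show ?thesis using \<open>int_choose 1 n = _\<close> by simp
  qed
  have "fls_nth (hyperderiv_fls n (fls_X_inv :: 'a fls)) m = (if m - int n = - 1 \<and> n \<le> 1 then 1 else 0)" for m
    using c[of m] by (simp add: hyperderiv_fls_nth')
  then show ?thesis by (intro fls_eqI) auto
qed

text \<open>The expansion \<open>f(\<theta> + \<epsilon>)\<close>.\<close>

definition taylor :: "'a::field fls \<Rightarrow> 'a fls fps" where
  "taylor f = Abs_fps (\<lambda>n. hyperderiv_fls n f)"

lemma taylor_nth [simp]: "fps_nth (taylor f) n = hyperderiv_fls n f" by (simp add: taylor_def)

lemma taylor_const: "taylor (fls_const c) = fps_const (fls_const c)"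
  by (rule fps_ext) (simp add: hyperderiv_fls_const)

lemma rhom_taylor: "rhom taylor"
  unfolding rhom_def
proof (intro conjI allI)
  show "taylor 0 = 0" using taylor_const[of 0] by simp
  show "taylor 1 = 1" using taylor_const[of 1] by simp
qed (auto intro!: fps_ext simp: hyperderiv_fls_add hyperderiv_fls_mult fps_mult_nth atLeast0AtMost)

lemma taylor_theta: "taylor fls_X_inv = fps_const fls_X_inv + fps_X"
  by (rule fps_ext) (auto simp: hyperderiv_fls_theta fps_X_def)

lemma fps_frobenius_nth:
  fixes F :: "'r::comm_ring_1 fps"
  assumes "CHAR('r) = CHAR('a::{field,finite})"
  shows "fps_nth (F ^ (CARD('a) ^ m)) k = (if CARD('a) ^ m dvd k then fps_nth F (k div CARD('a) ^ m) ^ (CARD('a) ^ m) else 0)"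
proof -
  define Q where "Q = CARD('a) ^ m"
  have Q: "Q > 0" by (simp add: Q_def frobenius_pow_pos)
  have ch: "CHAR('r fps) = CHAR('a)" using assms by simp
  define S where "S = (\<Sum>i\<le>k. fps_const (fps_nth F i) * fps_X ^ i)"
  have "F - S = fps_X ^ Suc k * fps_shift (Suc k) F"
  proof (rule fps_ext)
    fix j
    have "fps_nth S j = (if j \<le> k then fps_nth F j else 0)"
      unfolding S_def by (simp add: fps_sum_nth fps_X_power_nth if_distrib cong: if_cong)
    then show "fps_nth (F - S) j = fps_nth (fps_X ^ Suc k * fps_shift (Suc k) F) j"
      by (auto simp: fps_X_power_mult_nth simp del: power_Suc)
  qed
  then have "F ^ Q - S ^ Q = fps_X ^ (Suc k * Q) * fps_shift (Suc k) F ^ Q"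
    unfolding Q_def by (simp only: frobenius_pow_diff[OF ch, symmetric] power_mult_distrib power_mult)
  moreover have "k < Suc k * Q" using Q by (cases Q) auto
  ultimately have "fps_nth (F ^ Q - S ^ Q) k = 0" by (simp only: fps_X_power_mult_nth if_True)
  then have "fps_nth (F ^ Q) k = fps_nth (S ^ Q) k" by simp
  also have "S ^ Q = (\<Sum>i\<le>k. fps_const (fps_nth F i ^ Q) * fps_X ^ (i * Q))"
    unfolding S_def Q_def frobenius_pow_sum[OF ch] by (simp add: power_mult_distrib power_mult fps_const_power)
  also have "fps_nth \<dots> k = (\<Sum>i\<le>k. if i * Q = k then fps_nth F i ^ Q else 0)"
    by (simp add: fps_sum_nth fps_X_power_nth if_distrib cong: if_cong) (rule sum.cong, auto)
  also have "\<dots> = (if Q dvd k then fps_nth F (k div Q) ^ Q else 0)"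
  proof (cases "Q dvd k")
    case True
    then obtain j where j: "k = Q * j" by blast
    have "(\<Sum>i\<le>k. if i * Q = k then fps_nth F i ^ Q else 0) = (\<Sum>i\<le>k. if i = j then fps_nth F j ^ Q else 0)"
      by (rule sum.cong) (use j Q in auto)
    also have "\<dots> = fps_nth F j ^ Q" using j Q by (simp add: sum.delta)
    finally show ?thesis using j Q by simp
  qed (auto intro!: sum.neutral)
  finally show ?thesis by (simp add: Q_def)
qed

section \<open>Fields of values\<close>

definition subfield_set :: "'c::field set \<Rightarrow> bool" where
  "subfield_set K \<longleftrightarrow> 1 \<in> K \<and> (\<forall>x\<in>K. \<forall>y\<in>K. x + y \<in> K \<and> x * y \<in> K) \<and> (\<forall>x\<in>K. - x \<in> K \<and> inverse x \<in> K)"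

lemma subfield_set_1: "subfield_set K \<Longrightarrow> 1 \<in> K"
  and subfield_set_add: "subfield_set K \<Longrightarrow> x \<in> K \<Longrightarrow> y \<in> K \<Longrightarrow> x + y \<in> K"
  and subfield_set_mult: "subfield_set K \<Longrightarrow> x \<in> K \<Longrightarrow> y \<in> K \<Longrightarrow> x * y \<in> K"
  and subfield_set_uminus: "subfield_set K \<Longrightarrow> x \<in> K \<Longrightarrow> - x \<in> K"
  and subfield_set_inverse: "subfield_set K \<Longrightarrow> x \<in> K \<Longrightarrow> inverse x \<in> K"
  by (simp_all add: subfield_set_def)
lemma subfield_set_0: "subfield_set K \<Longrightarrow> 0 \<in> K"
  using subfield_set_add[of K 1 "- 1"] by (simp add: subfield_set_1 subfield_set_uminus)
lemma subfield_set_diff: "subfield_set K \<Longrightarrow> x \<in> K \<Longrightarrow> y \<in> K \<Longrightarrow> x - y \<in> K"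
  using subfield_set_add[of K x "- y"] by (simp add: subfield_set_uminus)
lemma subfield_set_divide: "subfield_set K \<Longrightarrow> x \<in> K \<Longrightarrow> y \<in> K \<Longrightarrow> x / y \<in> K"
  unfolding divide_inverse by (intro subfield_set_mult subfield_set_inverse)
lemma subfield_set_sum: "subfield_set K \<Longrightarrow> (\<And>i. i \<in> S \<Longrightarrow> f i \<in> K) \<Longrightarrow> (\<Sum>i\<in>S. f i) \<in> K"
  by (induction S rule: infinite_finite_induct) (auto intro: subfield_set_0 subfield_set_add)
lemma subfield_set_power: "subfield_set K \<Longrightarrow> x \<in> K \<Longrightarrow> x ^ n \<in> K"
  by (induction n) (auto intro: subfield_set_1 subfield_set_mult)

definition fps_in :: "nat \<Rightarrow> 'c::field set \<Rightarrow> 'c fps \<Rightarrow> bool" where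
  "fps_in n K F \<longleftrightarrow> (\<forall>i\<le>n. fps_nth F i \<in> K)"

lemma fps_in_1: "subfield_set K \<Longrightarrow> fps_in n K 1"
  by (auto simp: fps_in_def intro: subfield_set_0 subfield_set_1)
lemma fps_in_const: "subfield_set K \<Longrightarrow> c \<in> K \<Longrightarrow> fps_in n K (fps_const c)"
  by (auto simp: fps_in_def intro: subfield_set_0)
lemma fps_in_X: "subfield_set K \<Longrightarrow> fps_in n K fps_X"
  by (auto simp: fps_in_def fps_X_def intro: subfield_set_0 subfield_set_1)
lemma fps_in_add: "subfield_set K \<Longrightarrow> fps_in n K F \<Longrightarrow> fps_in n K G \<Longrightarrow> fps_in n K (F + G)"
  by (auto simp: fps_in_def intro: subfield_set_add)
lemma fps_in_diff: "subfield_set K \<Longrightarrow> fps_in n K F \<Longrightarrow> fps_in n K G \<Longrightarrow> fps_in n K (F - G)"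
  by (auto simp: fps_in_def intro: subfield_set_diff)
lemma fps_in_mult: "subfield_set K \<Longrightarrow> fps_in n K F \<Longrightarrow> fps_in n K G \<Longrightarrow> fps_in n K (F * G)"
  unfolding fps_in_def fps_mult_nth by (intro allI impI subfield_set_sum subfield_set_mult) auto
lemma fps_in_power: "subfield_set K \<Longrightarrow> fps_in n K F \<Longrightarrow> fps_in n K (F ^ m)"
  by (induction m) (auto intro: fps_in_1 fps_in_mult)
lemma fps_in_prod: "subfield_set K \<Longrightarrow> (\<And>i. i \<in> S \<Longrightarrow> fps_in n K (F i)) \<Longrightarrow> fps_in n K (\<Prod>i\<in>S. F i)"
  by (induction S rule: infinite_finite_induct) (auto intro: fps_in_1 fps_in_mult)

text \<open>Division: the coefficients of a quotient are determined recursively.\<close>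

lemma fps_in_divide:
  fixes F G H :: "'c::field fps"
  assumes K: "subfield_set K" and F: "fps_in n K F" and H: "fps_in n K H" and F0: "fps_nth F 0 \<noteq> 0"
    and eq: "\<And>i. i \<le> n \<Longrightarrow> fps_nth (F * G) i = fps_nth H i"
  shows "fps_in n K G"
proof -
  have "fps_nth G i \<in> K" if "i \<le> n" for i
    using that
  proof (induction i rule: less_induct)
    case (less i)
    have "fps_nth H i = fps_nth F 0 * fps_nth G i + (\<Sum>j=1..i. fps_nth F j * fps_nth G (i - j))"
      unfolding eq[OF less.prems, symmetric] fps_mult_nth by (simp add: sum.atLeast_Suc_atMost)
    then have "fps_nth G i = (fps_nth H i - (\<Sum>j=1..i. fps_nth F j * fps_nth G (i - j))) / fps_nth F 0"
      using F0 by (simp add: field_simps)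
    also have "\<dots> \<in> K"
      using F H less by (intro subfield_set_divide subfield_set_diff subfield_set_sum subfield_set_mult K) (auto simp: fps_in_def)
    finally show ?case .
  qed
  then show ?thesis by (simp add: fps_in_def)
qed

section \<open>The values\<close>

lemma fls_limit_exists:
  fixes s :: "nat \<Rightarrow> 'a::ab_group_add fls"
  assumes "\<And>M0 M. M0 \<le> M \<Longrightarrow> ord_ge (s M - s M0) (int M0)"
  shows "\<exists>L. \<forall>M. ord_ge (L - s M) (int M)"
proof -
  define L where "L = Abs_fls (\<lambda>i. fls_nth (s (nat i + 1)) i)"
  obtain d where d: "ord_ge (s 1) d" using ord_ge_exists by blast
  have nth: "fls_nth L i = fls_nth (s (nat i + 1)) i" for i
    unfolding L_def
    by (rule nth_Abs_fls_lower_bound[of "min 0 d"]) (use d in \<open>auto simp: ord_ge_def\<close>)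
  have "ord_ge (L - s M) (int M)" for M
    unfolding ord_ge_def
  proof (intro allI impI)
    fix i assume i: "i < int M"
    then have le: "nat i + 1 \<le> M \<or> M = 0" by linarith
    show "fls_nth (L - s M) i = 0"
    proof (cases "M = 0")
      case True
      then have "i < 0" using i by simp
      then show ?thesis using assms[of 0 1] True by (simp add: nth ord_ge_def)
    next
      case False
      then have "ord_ge (s M - s (nat i + 1)) (int (nat i + 1))" using le by (intro assms) simp
      then show ?thesis by (simp add: nth ord_ge_def)
    qed
  qed
  then show ?thesis by blast
qed

lemma ord_ge_jet_theta:
  assumes c: "c \<ge> 1" and l: "l \<ge> 1"
  shows "ord_ge (jet CARD('a) l c M k fls_X_inv (fls_X :: 'a::{field,finite} fls)) 0"
    and "M0 \<le> M \<Longrightarrow> ord_ge (jet CARD('a) l c M k fls_X_inv (fls_X :: 'a fls) - jet CARD('a) l c M0 k fls_X_inv fls_X) (int M0)"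
proof -
  have q2: "CARD('a) \<ge> 2" by (rule card_ge_2)
  have tz: "fls_X_inv * fls_X ^ e = (fls_X ^ (e - 1) :: 'a fls)" if "e \<ge> 1" for e
    using fls_X_inv_power_times_conv_shift(1)[of 1 "fls_X ^ e :: 'a fls"] that by (intro fls_eqI) auto
  have big: "CARD('a) ^ (c + l * m) > m" for m
  proof -
    have "m < 2 ^ m" by (rule less_exp)
    also have "\<dots> \<le> CARD('a) ^ m" using q2 by (rule power_mono) simp
    also have "\<dots> \<le> CARD('a) ^ (c + l * m)"
      using q2 mult_le_mono1[OF l, of m] by (intro power_increasing trans_le_add2) auto
    finally show ?thesis .
  qed
  have z1: "ord_ge (fls_X_inv * fls_X ^ (CARD('a) ^ (c + l * m)) :: 'a fls) (int M0)" if "M0 \<le> m" for m M0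
    using big[of m] that by (subst tz) (auto intro!: ord_ge_X_power)
  have z2: "ord_ge (fls_X ^ (CARD('a) ^ (c + l * m)) :: 'a fls) (int M0)" if "M0 \<le> m" for m M0
    using big[of m] that by (auto intro!: ord_ge_X_power)
  note z0 = z1[of 0, simplified] z2[of 0, simplified]
  show "ord_ge (jet CARD('a) l c M k fls_X_inv (fls_X :: 'a::{field,finite} fls)) 0"
    by (rule jet_stable(1)[where J = "\<lambda>_. True" and S = "\<lambda>p. ord_ge p 0"]) (intro ord_ge_1 ord_ge_mult0 ord_ge_diff z0 TrueI order_refl; assumption)+
  assume M: "M0 \<le> M"
  show "ord_ge (jet CARD('a) l c M k fls_X_inv (fls_X :: 'a fls) - jet CARD('a) l c M0 k fls_X_inv fls_X) (int M0)"
    by (rule jet_stable(2)[where J = "\<lambda>p. ord_ge p (int M0)" and S = "\<lambda>p. ord_ge p 0", OF _ _ _ _ _ _ _ _ _ _ M])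
      (intro ord_ge_0 ord_ge_1 ord_ge_add ord_ge_mult0 ord_ge_diff z0 z1 z2 TrueI order_refl; assumption)+
qed

text \<open>The limits \<open>y\<^sub>c\<^sub>,\<^sub>k\<close>; \<open>jetval l (c, 0)\<close> is the product \<open>P\<^sub>c\<close>.\<close>

definition jetval :: "nat \<Rightarrow> nat \<times> nat \<Rightarrow> 'a::{field,finite} fls" where
  "jetval l i = (SOME y. \<forall>M. ord_ge (y - jet CARD('a) l (fst i) M (snd i) fls_X_inv fls_X) (int M))"

lemma jetval:
  assumes "fst i \<ge> 1" "l \<ge> 1"
  shows "ord_ge (jetval l i - jet CARD('a) l (fst i) M (snd i) fls_X_inv (fls_X :: 'a::{field,finite} fls)) (int M)"
proof -
  have "\<exists>y :: 'a fls. \<forall>M. ord_ge (y - jet CARD('a) l (fst i) M (snd i) fls_X_inv fls_X) (int M)"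
    by (rule fls_limit_exists) (rule ord_ge_jet_theta(2)[OF assms])
  from someI_ex[OF this] show ?thesis unfolding jetval_def by blast
qed

lemma ord_ge_jetval: "fst i \<ge> 1 \<Longrightarrow> l \<ge> 1 \<Longrightarrow> ord_ge (jetval l i :: 'a::{field,finite} fls) 0"
  using ord_ge_add[OF ord_ge_mono[OF jetval[where 'a='a, of i l 0]] ord_ge_jet_theta(1)[where 'a='a, of "fst i" l 0 "snd i"]] by simp

text \<open>Evaluation of \<open>R\<close> is continuous, so a relation between the limits is a relation in the sense of \<open>value_rel\<close>.\<close>

theorem jetval_independent:
  fixes R :: "(nat \<times> nat \<Rightarrow>\<^sub>0 nat) \<Rightarrow>\<^sub>0 'a::{field,finite} fls"
  assumes l: "l \<ge> 1" and vars: "mvars_in ({1..l} \<times> UNIV) R" and R: "coeffs_laurent_within \<delta> 0 R"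
    and 0: "mev (\<lambda>x. x) (jetval l) R = 0"
  shows "R = 0"
proof (rule value_rel_imp_0[OF l vars R])
  let ?J = "\<lambda>M. jetv CARD('a) l M fls_X_inv (fls_X :: 'a fls)"
  have m: "ord_ge (mmon (jetval l) m - mmon (?J M) m) (int M)" if "m \<in> Poly_Mapping.keys R" for m M
  proof (rule mmon_diff_ideal(1)[where J = "\<lambda>p. ord_ge p (int M)" and S = "\<lambda>p. ord_ge p 0"])
    fix i assume i: "i \<in> Poly_Mapping.keys m"
    then have "i \<in> {1..l} \<times> UNIV" using vars that unfolding mvars_in_def by blast
    then have i1: "fst i \<ge> 1" by auto
    show "ord_ge (jetval l i) 0" by (rule ord_ge_jetval[OF i1 l])
    show "ord_ge (?J M i) 0" using ord_ge_jet_theta(1)[OF i1 l, of M "snd i"] by (simp add: case_prod_beta)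
    show "ord_ge (jetval l i - ?J M i) (int M)" using jetval[OF i1 l, of M] by (simp add: case_prod_beta)
  qed (auto intro: ord_ge_mult0 ord_ge_add)
  have d: "ord_ge (mev (\<lambda>x. x) (?J M) R) (int M - int \<delta>)" for M
  proof -
    have "mev (\<lambda>x. x) (?J M) R = mev (\<lambda>x. x) (?J M) R - mev (\<lambda>x. x) (jetval l) R" by (simp add: 0)
    also have "\<dots> = (\<Sum>m\<in>Poly_Mapping.keys R. - (Poly_Mapping.lookup R m * (mmon (jetval l) m - mmon (?J M) m)))"
      unfolding mev_def by (simp add: sum_subtractf[symmetric] algebra_simps)
    also have "ord_ge \<dots> (int M - int \<delta>)"
    proof (intro ord_ge_sum ord_ge_uminus)
      fix m assume "m \<in> Poly_Mapping.keys R"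
      have "ord_ge (Poly_Mapping.lookup R m * (mmon (jetval l) m - mmon (?J M) m)) (- int \<delta> + int M)"
        by (rule ord_ge_mult[OF laurent_within_ord_ge m]) (use R \<open>m \<in> _\<close> in \<open>auto simp: coeffs_laurent_within_def\<close>)
      then show "ord_ge (Poly_Mapping.lookup R m * (mmon (jetval l) m - mmon (?J M) m)) (int M - int \<delta>)" by simp
    qed
    finally show ?thesis .
  qed
  show "value_rel l R"
    unfolding value_rel_def
  proof
    fix W
    have "ord_ge (mev (\<lambda>x. x) (?J M) R) W" if "M \<ge> nat (W + int \<delta>)" for M
      by (rule ord_ge_mono[OF d[of M]]) (use that in linarith)
    then show "\<exists>M0. \<forall>M\<ge>M0. ord_ge (mev (\<lambda>x. x) (?J M) R) W" by blast
  qed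
qed

lemma taylor_X: "taylor fls_X * (fps_const fls_X_inv + fps_X) = (1 :: 'a::field fls fps)"
proof -
  have "fls_X * fls_X_inv = (1 :: 'a fls)" using fls_X_inv_X_power[of 1, where 'a='a] by (simp add: mult.commute)
  then show ?thesis unfolding taylor_theta[symmetric] rhom_mult[OF rhom_taylor, symmetric]
    by (simp add: rhom_1[OF rhom_taylor])
qed

definition fps_eq_upto :: "nat \<Rightarrow> 'r::zero fps \<Rightarrow> 'r fps \<Rightarrow> bool" where
  "fps_eq_upto n F G \<longleftrightarrow> (\<forall>i\<le>n. fps_nth F i = fps_nth G i)"

lemma fps_eq_upto_refl [simp]: "fps_eq_upto n F F" by (simp add: fps_eq_upto_def)
lemma fps_eq_upto_sym: "fps_eq_upto n F G \<Longrightarrow> fps_eq_upto n G F" by (simp add: fps_eq_upto_def)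
lemma fps_eq_upto_trans: "fps_eq_upto n F G \<Longrightarrow> fps_eq_upto n G H \<Longrightarrow> fps_eq_upto n F H" by (simp add: fps_eq_upto_def)
lemma fps_eq_upto_diff: "fps_eq_upto n F G \<Longrightarrow> fps_eq_upto n F' G' \<Longrightarrow> fps_eq_upto n ((F :: 'r::comm_ring_1 fps) - F') (G - G')" by (simp add: fps_eq_upto_def)
lemma fps_eq_upto_add: "fps_eq_upto n F G \<Longrightarrow> fps_eq_upto n F' G' \<Longrightarrow> fps_eq_upto n ((F :: 'r::comm_ring_1 fps) + F') (G + G')" by (simp add: fps_eq_upto_def)
lemma fps_eq_upto_mult: "fps_eq_upto n F G \<Longrightarrow> fps_eq_upto n F' G' \<Longrightarrow> fps_eq_upto n ((F :: 'r::comm_ring_1 fps) * F') (G * G')"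
  unfolding fps_eq_upto_def fps_mult_nth by (auto intro!: sum.cong)
lemma fps_eq_upto_prod: "(\<And>i. i \<in> S \<Longrightarrow> fps_eq_upto n (F i) (G i)) \<Longrightarrow> fps_eq_upto n (\<Prod>i\<in>S. F i :: 'r::comm_ring_1 fps) (\<Prod>i\<in>S. G i)"
  by (induction S rule: infinite_finite_induct) (auto intro: fps_eq_upto_mult)

lemma fps_eq_upto_taylor_frobenius:
  fixes f :: "'a::{field,finite} fls"
  assumes "CARD('a) ^ m > n"
  shows "fps_eq_upto n (taylor (f ^ (CARD('a) ^ m))) (fps_const (f ^ (CARD('a) ^ m)))"
  unfolding fps_eq_upto_def
proof (intro allI impI)
  fix i assume "i \<le> n"
  then have i: "i < CARD('a) ^ m" using assms by simp
  then have d: "CARD('a) ^ m dvd i \<longleftrightarrow> i = 0" by (meson dvd_0_right nat_dvd_not_less neq0_conv)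
  have "taylor (f ^ (CARD('a) ^ m)) = taylor f ^ (CARD('a) ^ m)" by (rule rhom_power[OF rhom_taylor])
  then have "fps_nth (taylor (f ^ (CARD('a) ^ m))) i = fps_nth (taylor f ^ (CARD('a) ^ m)) i" by (rule arg_cong)
  also have "\<dots> = (if i = 0 then f ^ (CARD('a) ^ m) else 0)"
    unfolding fps_frobenius_nth[OF CHAR_fls] d by simp
  finally show "fps_nth (taylor (f ^ (CARD('a) ^ m))) i = fps_nth (fps_const (f ^ (CARD('a) ^ m))) i" by simp
qed

text \<open>Modulo \<open>\<epsilon>\<^sup>n\<^sup>+\<^sup>1\<close> the Taylor expansion fixes \<open>z\<^sup>w\<close> for every power \<open>w > n\<close> of \<open>q\<close>.  So the expansion of \<open>P\<^sub>c\<close> and the series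
  of the jets differ only by the first \<open>n\<close> factors, which are \<open>Nn\<close> and \<open>Dn\<close> and have coefficients in \<open>K\<close>.\<close>

lemma jetval_in_field:
  fixes K :: "'a::{field,finite} fls set"
  assumes l: "l \<ge> 1" and c: "c \<ge> 1" and K: "subfield_set K" and th: "fls_X_inv \<in> K"
    and D: "\<And>i. i \<le> n \<Longrightarrow> hyperderiv_fls i (jetval l (c, 0)) \<in> K" and k: "k \<le> n"
  shows "jetval l (c, k) \<in> K"
proof -
  let ?q = "CARD('a)"
  let ?w = "\<lambda>m. ?q ^ (c + l * m)"
  let ?P = "jetval l (c, 0) :: 'a fls"
  define Y where "Y = Abs_fps (\<lambda>k. jetval l (c, k) :: 'a fls)"
  define \<Theta> :: "'a fls fps" where "\<Theta> = fps_const fls_X_inv + fps_X"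
  define Dn where "Dn = (\<Prod>m<n. 1 - \<Theta> * fps_const (fls_X ^ ?w m))"
  define Nn where "Nn = (\<Prod>m<n. 1 - \<Theta> * taylor (fls_X ^ ?w m))"
  have q2: "?q \<ge> 2" by (rule card_ge_2)
  have big: "?w m > n" if "m \<ge> n" for m
  proof -
    have "m < 2 ^ m" by (rule less_exp)
    also have "\<dots> \<le> ?q ^ m" using q2 by (rule power_mono) simp
    also have "\<dots> \<le> ?w m"
      using q2 mult_le_mono1[OF l, of m] by (intro power_increasing trans_le_add2) auto
    finally show ?thesis using that by simp
  qed
  have jf: "fps_of_poly (jetp ?q l c M fls_X_inv (fls_X :: 'a fls)) = (\<Prod>m<M. 1 - \<Theta> * fps_const (fls_X ^ ?w m))" for M
  proof -
    have "fps_of_poly [:1 - fls_X_inv * fls_X ^ e, - (fls_X ^ e):] = 1 - \<Theta> * fps_const (fls_X ^ e :: 'a fls)" for e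
      by (simp add: fps_of_poly_pCons \<Theta>_def algebra_simps)
    then show ?thesis by (simp add: jetp_def fps_of_poly_prod)
  qed
  have tP: "taylor (jet ?q l c M 0 fls_X_inv fls_X :: 'a fls) = (\<Prod>m<M. 1 - \<Theta> * taylor (fls_X ^ ?w m))" for M
    unfolding jet_0 by (simp add: rhom_prod[OF rhom_taylor] rhom_diff[OF rhom_taylor] rhom_1[OF rhom_taylor] rhom_mult[OF rhom_taylor] taylor_theta \<Theta>_def)
  have split: "(\<Prod>m<M. F m) = (\<Prod>m<n. F m) * (\<Prod>m\<in>{n..<M}. F m)" if "M \<ge> n" for M and F :: "nat \<Rightarrow> 'a fls fps"
    using that by (subst prod.union_disjoint[symmetric]) (auto intro!: prod.cong)
  have trunc: "fps_eq_upto n (Dn * taylor (jet ?q l c M 0 fls_X_inv fls_X)) (Nn * fps_of_poly (jetp ?q l c M fls_X_inv fls_X))" if M: "M \<ge> n" for M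
  proof -
    have "fps_eq_upto n (\<Prod>m\<in>{n..<M}. 1 - \<Theta> * taylor (fls_X ^ ?w m)) (\<Prod>m\<in>{n..<M}. 1 - \<Theta> * fps_const (fls_X ^ ?w m))"
      using big by (intro fps_eq_upto_prod fps_eq_upto_diff fps_eq_upto_mult fps_eq_upto_refl fps_eq_upto_taylor_frobenius) auto
    then have "fps_eq_upto n (Dn * Nn * (\<Prod>m\<in>{n..<M}. 1 - \<Theta> * taylor (fls_X ^ ?w m))) (Dn * Nn * (\<Prod>m\<in>{n..<M}. 1 - \<Theta> * fps_const (fls_X ^ ?w m)))"
      by (intro fps_eq_upto_mult fps_eq_upto_refl)
    then show ?thesis unfolding jf tP split[OF M] Dn_def Nn_def by (simp only: mult_ac)
  qed
  have lim: "fps_nth (Dn * taylor ?P) i = fps_nth (Nn * Y) i" if i: "i \<le> n" for i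
  proof -
    obtain d where d: "\<And>j. j \<le> i \<Longrightarrow> ord_ge (fps_nth Dn j) d \<and> ord_ge (fps_nth Nn j) d"
    proof -
      have "\<forall>j. \<exists>d. ord_ge (fps_nth Dn j) d \<and> ord_ge (fps_nth Nn j) d"
        by (meson ord_ge_exists ord_ge_mono min.cobounded1 min.cobounded2)
      then obtain f where f: "\<And>j. ord_ge (fps_nth Dn j) (f j) \<and> ord_ge (fps_nth Nn j) (f j)" by metis
      have "ord_ge (fps_nth Dn j) (Min (f ` {..i})) \<and> ord_ge (fps_nth Nn j) (Min (f ` {..i}))" if "j \<le> i" for j
      proof -
        have "Min (f ` {..i}) \<le> f j" using that by (intro Min_le) auto
        then show ?thesis using f ord_ge_mono by blast
      qed
      then show ?thesis using that by blast
    qed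
    have "fps_nth (Dn * taylor ?P) i - fps_nth (Nn * Y) i = 0"
    proof (rule ord_ge_all_imp_0)
      fix W
      define M where "M = max n (nat (W - d))"
      have MW: "d + int M \<ge> W" unfolding M_def by linarith
      have "fps_nth (Dn * taylor ?P) i - fps_nth (Nn * Y) i =
         fps_nth (Dn * (taylor ?P - taylor (jet ?q l c M 0 fls_X_inv fls_X))) i - fps_nth (Nn * (Y - fps_of_poly (jetp ?q l c M fls_X_inv fls_X))) i"
        using trunc[of M] i by (simp add: M_def fps_eq_upto_def right_diff_distrib)
      moreover have "ord_ge (fps_nth (Dn * (taylor ?P - taylor (jet ?q l c M 0 fls_X_inv fls_X))) i) W"
        unfolding fps_mult_nth
      proof (rule ord_ge_sum)
        fix j assume j: "j \<in> {0..i}"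
        have "ord_ge (hyperderiv_fls (i - j) (?P - jet ?q l c M 0 fls_X_inv fls_X)) (int M + int (i - j))"
          using jetval[where 'a='a, of "(c, 0)" l M] c l by (intro ord_ge_hyperderiv) simp
        then have "ord_ge (fps_nth (taylor ?P - taylor (jet ?q l c M 0 fls_X_inv fls_X)) (i - j)) (int M)"
          by (simp add: hyperderiv_fls_diff ord_ge_mono)
        then have "ord_ge (fps_nth Dn j * fps_nth (taylor ?P - taylor (jet ?q l c M 0 fls_X_inv fls_X)) (i - j)) (d + int M)"
          using d[of j] j by (intro ord_ge_mult) auto
        then show "ord_ge (fps_nth Dn j * fps_nth (taylor ?P - taylor (jet ?q l c M 0 fls_X_inv fls_X)) (i - j)) W"
          using MW by (rule ord_ge_mono)
      qed
      moreover have "ord_ge (fps_nth (Nn * (Y - fps_of_poly (jetp ?q l c M fls_X_inv fls_X))) i) W"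
        unfolding fps_mult_nth
      proof (rule ord_ge_sum)
        fix j assume j: "j \<in> {0..i}"
        have "ord_ge (fps_nth (Y - fps_of_poly (jetp ?q l c M fls_X_inv fls_X)) (i - j)) (int M)"
          using jetval[where 'a='a, of "(c, i - j)" l M] c l by (simp add: Y_def jet_def)
        then have "ord_ge (fps_nth Nn j * fps_nth (Y - fps_of_poly (jetp ?q l c M fls_X_inv fls_X)) (i - j)) (d + int M)"
          using d[of j] j by (intro ord_ge_mult) auto
        then show "ord_ge (fps_nth Nn j * fps_nth (Y - fps_of_poly (jetp ?q l c M fls_X_inv fls_X)) (i - j)) W"
          using MW by (rule ord_ge_mono)
      qed
      ultimately show "ord_ge (fps_nth (Dn * taylor ?P) i - fps_nth (Nn * Y) i) W" by (simp add: ord_ge_diff)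
    qed
    then show ?thesis by simp
  qed
  have X: "fls_X \<in> K"
    using subfield_set_inverse[OF K th] by (simp add: fls_inverse_X_inv)
  have \<Theta>K: "fps_in n K \<Theta>" unfolding \<Theta>_def by (intro fps_in_add fps_in_const fps_in_X K th)
  have tX: "fps_in n K (taylor fls_X)"
    by (rule fps_in_divide[OF K \<Theta>K fps_in_1[OF K]]) (use taylor_X[where 'a='a] in \<open>auto simp: \<Theta>_def mult.commute\<close>)
  have DK: "fps_in n K Dn" unfolding Dn_def
    by (intro fps_in_prod fps_in_diff fps_in_1 fps_in_mult \<Theta>K fps_in_const K subfield_set_power X)
  have NK: "fps_in n K Nn" unfolding Nn_def rhom_power[OF rhom_taylor]
    by (intro fps_in_prod fps_in_diff fps_in_1 fps_in_mult \<Theta>K fps_in_power K tX)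
  have "fps_in n K (taylor ?P)" using D by (simp add: fps_in_def)
  then have "fps_in n K (Dn * taylor ?P)" by (intro fps_in_mult K DK)
  moreover have "fps_nth Nn 0 \<noteq> 0"
  proof -
    have "fps_nth Nn 0 = jet ?q l c n 0 fls_X_inv (fls_X :: 'a fls)"
      using arg_cong[OF tP[of n], of "\<lambda>F. fps_nth F 0"] by (simp add: Nn_def)
    moreover have "jet ?q l c n 0 fls_X_inv (fls_X :: 'a fls) \<noteq> 0"
    proof -
      have "1 - fls_X_inv * fls_X ^ e \<noteq> (0 :: 'a fls)" if "e \<ge> 2" for e
      proof
        assume "1 - fls_X_inv * fls_X ^ e = (0 :: 'a fls)"
        moreover have "fls_nth (1 - fls_X_inv ^ 1 * fls_X ^ e :: 'a fls) 0 = 1"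
          unfolding fls_X_inv_power_times_conv_shift using that by simp
        ultimately show False by simp
      qed
      moreover have "?w m \<ge> 2" for m
      proof -
        have "?q ^ 1 \<le> ?w m" by (rule power_increasing) (use c q2 in auto)
        then show ?thesis using q2 unfolding power_one_right by linarith
      qed
      ultimately show ?thesis unfolding jet_0 by simp
    qed
    ultimately show ?thesis by simp
  qed
  ultimately have "fps_in n K Y"
    using fps_in_divide[OF K NK _ _ lim[symmetric]] by blast
  then show ?thesis using k by (simp add: fps_in_def Y_def)
qed

section \<open>Arithmetic gamma values\<close>

text \<open>Membership in the localisation of \<open>\<int>\<close> at the primes dividing \<open>q\<close>.\<close>

definition q_integral :: "nat \<Rightarrow> rat \<Rightarrow> bool" where
  "q_integral q s \<longleftrightarrow> coprime (snd (quotient_of s)) (int q)"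

lemma q_integral_iff: "q_integral q s \<longleftrightarrow> (\<exists>a b. b \<noteq> 0 \<and> coprime b (int q) \<and> s = of_int a / of_int b)"
proof
  assume "q_integral q s"
  moreover obtain a b where "quotient_of s = (a, b)" by (cases "quotient_of s")
  moreover have "b > 0" using calculation(2) by (rule quotient_of_denom_pos)
  moreover have "s = of_int a / of_int b" using calculation(2) by (rule quotient_of_div)
  ultimately show "\<exists>a b. b \<noteq> 0 \<and> coprime b (int q) \<and> s = of_int a / of_int b"
    by (intro exI[of _ a] exI[of _ b]) (auto simp: q_integral_def)
next
  assume "\<exists>a b. b \<noteq> 0 \<and> coprime b (int q) \<and> s = of_int a / of_int b"
  then obtain a b where ab: "b \<noteq> 0" "coprime b (int q)" "s = of_int a / of_int b" by blast
  obtain c d where cd: "quotient_of s = (c, d)" by (cases "quotient_of s")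
  have d: "d > 0" using cd by (rule quotient_of_denom_pos)
  have "(of_int c / of_int d :: rat) = of_int a / of_int b" using quotient_of_div[OF cd] ab by simp
  then have "(of_int (c * b) :: rat) = of_int (a * d)" using ab d by (simp add: field_simps)
  then have "c * b = a * d" by (simp only: of_int_eq_iff)
  then have "d dvd c * b" by simp
  moreover have "coprime c d" using cd by (rule quotient_of_coprime)
  ultimately have "d dvd b" by (simp add: coprime_commute coprime_dvd_mult_right_iff)
  then show "q_integral q s" using ab cd unfolding q_integral_def
    by (simp add: coprime_divisors[OF _ dvd_refl])
qed

lemma q_integral_diff:
  assumes "q_integral q s" "q_integral q t" shows "q_integral q (s - t)"
proof -
  obtain a b c d where *: "b \<noteq> 0" "coprime b (int q)" "s = of_int a / of_int b"
    "d \<noteq> 0" "coprime d (int q)" "t = of_int c / of_int d" using assms unfolding q_integral_iff by blast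
  have "s - t = of_int (a * d - c * b) / of_int (b * d)"
    unfolding *(3,6) using *(1,4) by (simp add: diff_frac_eq)
  moreover have "coprime (b * d) (int q)" "b * d \<noteq> 0" using * by simp_all
  ultimately show ?thesis unfolding q_integral_iff by blast
qed

lemma q_integral_divide_q:
  assumes "q > 0" "q_integral q (of_int k / of_nat q)" shows "int q dvd k"
proof -
  obtain a b where *: "b \<noteq> 0" "coprime b (int q)" "of_int k / of_nat q = (of_int a / of_int b :: rat)"
    using assms unfolding q_integral_iff by blast
  then have "(of_int (k * b) :: rat) = of_int (a * int q)" using assms by (simp add: field_simps)
  then have "k * b = a * int q" by (simp only: of_int_eq_iff)
  then have "int q dvd k * b" by simp
  then show ?thesis using *(2) by (simp add: coprime_commute coprime_dvd_mult_left_iff)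
qed

text \<open>Two digit sequences agree by induction: if they agree below \<open>N\<close>, their \<open>N\<close>-th digits are congruent modulo \<open>q\<close>.\<close>

lemma qadic_digits_eqI:
  assumes q: "q > 0" and d: "\<And>i. d i < q"
    and s: "\<And>N. q_integral q ((s - (\<Sum>i<N. of_nat (d i) * of_nat q ^ i)) / of_nat q ^ N)"
  shows "qadic_digits q s = d"
  unfolding qadic_digits_def q_integral_def[symmetric]
proof (rule the_equality)
  show "(\<forall>i. d i < q) \<and> (\<forall>N. q_integral q ((s - (\<Sum>i<N. of_nat (d i) * of_nat q ^ i)) / of_nat q ^ N))"
    using d s by blast
  fix e assume e: "(\<forall>i. e i < q) \<and> (\<forall>N. q_integral q ((s - (\<Sum>i<N. of_nat (e i) * of_nat q ^ i)) / of_nat q ^ N))"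
  have "e n = d n" for n
  proof (induction n rule: less_induct)
    case (less n)
    let ?A = "\<Sum>i<n. of_nat (d i) * of_nat q ^ i :: rat"
    have A: "(\<Sum>i<n. of_nat (e i) * of_nat q ^ i) = ?A" using less by simp
    have "q_integral q ((s - (\<Sum>i<Suc n. of_nat (e i) * of_nat q ^ i)) / of_nat q ^ Suc n -
        (s - (\<Sum>i<Suc n. of_nat (d i) * of_nat q ^ i)) / of_nat q ^ Suc n)"
      using e s by (intro q_integral_diff) blast+
    also have "(s - (\<Sum>i<Suc n. of_nat (e i) * of_nat q ^ i)) / of_nat q ^ Suc n -
        (s - (\<Sum>i<Suc n. of_nat (d i) * of_nat q ^ i)) / of_nat q ^ Suc n = of_int (int (d n) - int (e n)) / of_nat q"
      using q by (simp add: A field_simps)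
    finally have "int q dvd int (d n) - int (e n)" using q by (intro q_integral_divide_q)
    moreover have "\<bar>int (d n) - int (e n)\<bar> < int q"
      using d[of n] e[THEN conjunct1, rule_format, of n] by linarith
    ultimately show "e n = d n" using dvd_imp_le_int[of "int (d n) - int (e n)" "int q"] by force
  qed
  then show "e = d" by blast
qed

text \<open>The geometric series \<open>q\<^sup>j/(1 - q\<^sup>l) = \<Sum>\<^sub>m q\<^bsup>j+lm\<^esup>\<close>.\<close>

lemma qadic_digits_periodic:
  assumes q: "q \<ge> 2" and l: "l \<ge> 1" and j: "j < l"
  shows "qadic_digits q (of_nat q ^ j / (1 - of_nat q ^ l)) = (\<lambda>i. if i mod l = j then 1 else 0)"
proof (rule qadic_digits_eqI)
  let ?d = "\<lambda>i. if i mod l = j then 1 else 0 :: nat"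
  let ?s = "of_nat q ^ j / (1 - of_nat q ^ l) :: rat"
  have q0: "(of_nat q :: rat) \<noteq> 0" using q by simp
  have "q ^ l \<noteq> 1" using q l by simp
  then have "(of_nat q ^ l :: rat) \<noteq> 1" by (metis of_nat_1 of_nat_eq_iff of_nat_power)
  then have q1: "1 - of_nat q ^ l \<noteq> (0 :: rat)" by simp
  fix N
  have "\<exists>e<l. (N + e) mod l = j \<and> (?s - (\<Sum>i<N. of_nat (?d i) * of_nat q ^ i)) / of_nat q ^ N = of_nat q ^ e / (1 - of_nat q ^ l)"
  proof (induction N)
    case 0
    then show ?case using j by (intro exI[of _ j]) simp
  next
    case (Suc N)
    then obtain e where e: "e < l" "(N + e) mod l = j"
      "(?s - (\<Sum>i<N. of_nat (?d i) * of_nat q ^ i)) / of_nat q ^ N = of_nat q ^ e / (1 - of_nat q ^ l)" by blast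
    let ?S = "\<Sum>i<N. of_nat (?d i) * of_nat q ^ i :: rat"
    have s: "?s - ?S = of_nat q ^ N * (of_nat q ^ e / (1 - of_nat q ^ l))"
      using e(3) q0 by (subst (asm) nonzero_divide_eq_eq) (simp_all only: mult.commute power_not_zero not_False_eq_True)
    have "(?s - (\<Sum>i<Suc N. of_nat (?d i) * of_nat q ^ i)) / of_nat q ^ Suc N =
       (?s - ?S - of_nat (?d N) * of_nat q ^ N) / of_nat q ^ Suc N" by simp
    also have "\<dots> = (of_nat q ^ e / (1 - of_nat q ^ l) - of_nat (?d N)) / of_nat q"
    proof -
      have "(x * a - d * x) / (y * x) = (a - d) / y" if "x \<noteq> 0" "y \<noteq> 0" for x a d y :: rat
        using that by (simp add: field_simps)
      from this[of "of_nat q ^ N" "of_nat q"] show ?thesis unfolding s power_Suc using q0 by (simp only: power_not_zero not_False_eq_True)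
    qed
    finally have st: "(?s - (\<Sum>i<Suc N. of_nat (?d i) * of_nat q ^ i)) / of_nat q ^ Suc N =
       (of_nat q ^ e / (1 - of_nat q ^ l) - of_nat (?d N)) / of_nat q" .
    show ?case
    proof (cases e)
      case 0
      then have dN: "?d N = 1" using e(2) by simp
      have "(1 / (1 - of_nat q ^ l) - 1) / of_nat q = (of_nat q ^ (l - 1) / (1 - of_nat q ^ l) :: rat)"
      proof -
        have "(of_nat q :: rat) ^ l = of_nat q * of_nat q ^ (l - 1)" using l by (cases l) auto
        then show ?thesis using q0 q1 by (simp add: field_simps)
      qed
      moreover have "(Suc N + (l - 1)) mod l = j" using e 0 l by simp
      ultimately show ?thesis using st dN 0 l by (intro exI[of _ "l - 1"]) simp
    next
      case (Suc e')
      have "N mod l \<noteq> j"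
      proof
        assume "N mod l = j"
        then have "(N + e) mod l = N mod l" using e(2) by simp
        then have "l dvd e" by (metis add_diff_cancel_left' mod_eq_dvd_iff_nat le_add1)
        then show False using e(1) Suc by (auto dest: dvd_imp_le)
      qed
      moreover have "(Suc N + e') mod l = j" using e(2) Suc by simp
      moreover have "e' < l" using e(1) Suc by simp
      ultimately show ?thesis using st q0 Suc by (intro exI[of _ e']) simp
    qed
  qed
  then obtain e where e: "(?s - (\<Sum>i<N. of_nat (?d i) * of_nat q ^ i)) / of_nat q ^ N = of_nat q ^ e / (1 - of_nat q ^ l)" by blast
  have "coprime (1 - int q ^ l) (int q)"
  proof -
    have "coprime (1 - int q ^ l) (int q ^ l)" by (metis coprime_1_left coprime_diff_one_left coprime_commute coprime_minus_right_iff minus_diff_eq coprime_minus_left_iff)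
    then show ?thesis using l by simp
  qed
  moreover have "1 - int q ^ l \<noteq> 0" using \<open>q ^ l \<noteq> 1\<close> by (metis eq_iff_diff_eq_0 of_nat_1 of_nat_eq_iff of_nat_power)
  moreover have "of_nat q ^ e / (1 - of_nat q ^ l) = (of_int (int q ^ e) / of_int (1 - int q ^ l) :: rat)" by simp
  ultimately show "q_integral q ((?s - (\<Sum>i<N. of_nat (?d i) * of_nat q ^ i)) / of_nat q ^ N)"
    unfolding e q_integral_iff by blast
qed (use q in auto)

lemma LIMSEQ_flsI:
  fixes s :: "nat \<Rightarrow> 'a::ab_group_add fls"
  assumes "\<And>n. ord_ge (s n - L) (int n)"
  shows "s \<longlonglongrightarrow> L"
proof (rule metric_LIMSEQ_I)
  fix r :: real assume "r > 0"
  then obtain N where N: "(1/2) ^ N < r" using real_arch_pow_inv[of r "1/2"] by auto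
  have "dist (s n) L < r" if n: "n \<ge> N" for n
  proof (cases "s n = L")
    case False
    then have "int n \<le> fls_subdegree (s n - L)" using assms[of n] by (auto simp: ord_ge_iff_subdegree)
    then have "N \<le> nat (fls_subdegree (s n - L))" "fls_subdegree (s n - L) \<ge> 0" using n by linarith+
    then have "dist (s n) L \<le> (1/2) ^ N"
      using False power_decreasing[of N "nat (fls_subdegree (s n - L))" "1/2 :: real"]
      by (simp add: dist_fls_def power_one_over inverse_eq_divide)
    then show ?thesis using N by simp
  qed (use \<open>r > 0\<close> in simp)
  then show "\<exists>N. \<forall>n\<ge>N. dist (s n) L < r" by blast
qed

definition gamma_factor :: "nat \<Rightarrow> 'a::{field,finite} fls" where
  "gamma_factor i = (\<Prod>j<i. 1 - fls_X_inv ^ (CARD('a) ^ j) / fls_X_inv ^ (CARD('a) ^ i))"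

text \<open>The partial product of \<open>\<Gamma>(q\<^sup>j/(1 - q\<^sup>l))\<close>, without its factors for the digit \<open>0\<close>.\<close>

definition gamma_trunc :: "nat \<Rightarrow> nat \<Rightarrow> nat \<Rightarrow> 'a::{field,finite} fls" where
  "gamma_trunc l j M = (\<Prod>m<M. gamma_factor (j + l * m))"

lemma theta_quotient:
  assumes "j < i"
  shows "fls_X_inv ^ (CARD('a) ^ j) / fls_X_inv ^ (CARD('a) ^ i) = (fls_X ^ (CARD('a) ^ i - CARD('a) ^ j) :: 'a::{field,finite} fls)"
proof -
  have "CARD('a) ^ j \<le> CARD('a) ^ i" using assms card_ge_2[where 'a='a] by (intro power_increasing) auto
  then have "(fls_X_inv ^ (CARD('a) ^ i) :: 'a fls) = fls_X_inv ^ (CARD('a) ^ j) * fls_X_inv ^ (CARD('a) ^ i - CARD('a) ^ j)"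
    by (simp flip: power_add)
  moreover have "(fls_X_inv ^ n :: 'a fls) * fls_X ^ n = 1" for n by (rule fls_X_inv_X_power)
  ultimately have "fls_X ^ (CARD('a) ^ i - CARD('a) ^ j) * (fls_X_inv ^ (CARD('a) ^ i) :: 'a fls) = fls_X_inv ^ (CARD('a) ^ j)"
    by (simp add: mult.left_commute mult.commute)
  then show ?thesis by (intro eq_divide_imp[symmetric]) simp_all
qed

lemma gamma_factor_0 [simp]: "gamma_factor 0 = 1" by (simp add: gamma_factor_def)

lemma gamma_factor_Suc:
  "gamma_factor (Suc i) = (1 - fls_X_inv * fls_X ^ (CARD('a) ^ Suc i)) * (gamma_factor i ^ CARD('a) :: 'a::{field,finite} fls)"
proof -
  let ?q = "CARD('a)"
  have h: "rhom (\<lambda>f :: 'a fls. f ^ ?q)" using rhom_frobenius[where 'a='a, of 1] by simp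
  have d: "(a / b) ^ ?q = a ^ ?q / b ^ ?q" for a b :: "'a fls" by (rule power_divide)
  have "gamma_factor i ^ ?q = (\<Prod>j<i. 1 - fls_X_inv ^ (?q ^ Suc j) / fls_X_inv ^ (?q ^ Suc i) :: 'a fls)"
    unfolding gamma_factor_def rhom_prod[OF h] rhom_diff[OF h] d
    by (simp add: power_mult[symmetric] mult.commute)
  moreover have "(1 :: 'a fls) - fls_X_inv * fls_X ^ (?q ^ Suc i) = 1 - fls_X_inv ^ (?q ^ 0) / fls_X_inv ^ (?q ^ Suc i)"
    by (simp add: fls_inverse_X_inv' divide_inverse power_inverse[symmetric] fls_inverse_X_inv)
  ultimately show ?thesis
    unfolding gamma_factor_def[of "Suc i"] by (simp only: prod.lessThan_Suc_shift comp_def)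
qed

lemma ord_ge_gamma_factor: "ord_ge (gamma_factor i - (1 :: 'a::{field,finite} fls)) (int i)"
proof -
  let ?q = "CARD('a)"
  have q2: "?q \<ge> 2" by (rule card_ge_2)
  have f: "ord_ge (fls_X_inv ^ (?q ^ j) / fls_X_inv ^ (?q ^ i) :: 'a fls) (int i)" if ji: "j < i" for j
  proof -
    obtain n where i: "i = Suc n" using ji by (cases i) auto
    have "?q ^ j \<le> ?q ^ n" using ji i q2 by (intro power_increasing) auto
    moreover have "2 * ?q ^ n \<le> ?q ^ i" using q2 by (simp add: i)
    moreover have "i \<le> ?q ^ n"
    proof -
      have "n < 2 ^ n" by (rule less_exp)
      also have "\<dots> \<le> ?q ^ n" using q2 by (rule power_mono) simp
      finally show ?thesis using i by simp
    qed
    ultimately have "i \<le> ?q ^ i - ?q ^ j" by linarith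
    then show ?thesis unfolding theta_quotient[OF ji] by (intro ord_ge_X_power) simp
  qed
  have "ord_ge ((\<Prod>j\<in>S. 1 - fls_X_inv ^ (?q ^ j) / fls_X_inv ^ (?q ^ i)) - (1 :: 'a fls)) (int i)" if "S \<subseteq> {..<i}" for S
  proof -
    have "finite S" by (rule finite_subset[OF that]) simp
    then show ?thesis using that
    proof (induction S rule: finite_induct)
      case (insert j S)
      let ?x = "fls_X_inv ^ (?q ^ j) / fls_X_inv ^ (?q ^ i) :: 'a fls"
      let ?P = "\<Prod>j\<in>S. 1 - fls_X_inv ^ (?q ^ j) / fls_X_inv ^ (?q ^ i) :: 'a fls"
      have x: "ord_ge ?x (int i)" by (rule f) (use insert.prems in auto)
      have P: "ord_ge (?P - 1) (int i)" using insert by simp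
      then have "ord_ge ?P 0" using ord_ge_add[OF ord_ge_mono[OF P, of 0] ord_ge_1[of 0]] by simp
      then have "ord_ge (?P * ?x) (int i)" using x by (rule ord_ge_mult0)
      moreover have "(1 - ?x) * ?P - 1 = (?P - 1) - ?P * ?x" by (simp add: algebra_simps)
      ultimately show ?case unfolding prod.insert[OF insert.hyps] using P by (simp only: ord_ge_diff)
    qed simp
  qed
  from this[of "{..<i}"] show ?thesis by (simp add: gamma_factor_def)
qed

lemma ord_ge_prod_diff_1:
  fixes f :: "'i \<Rightarrow> 'a::idom fls"
  assumes "k \<ge> 0" "\<And>i. i \<in> S \<Longrightarrow> ord_ge (f i - 1) k" shows "ord_ge ((\<Prod>i\<in>S. f i) - 1) k"
  using assms(2)
proof (induction S rule: infinite_finite_induct)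
  case (insert x S)
  let ?P = "\<Prod>i\<in>S. f i"
  have P: "ord_ge (?P - 1) k" using insert by simp
  then have "ord_ge ?P 0" using ord_ge_add[OF ord_ge_mono[OF P assms(1)] ord_ge_1[of 0]] by simp
  moreover have "ord_ge (f x - 1) k" using insert.prems by simp
  ultimately have "ord_ge (?P * (f x - 1)) k" by (rule ord_ge_mult0)
  moreover have "f x * ?P - 1 = ?P * (f x - 1) + (?P - 1)" by (simp add: algebra_simps)
  ultimately show ?case unfolding prod.insert[OF insert.hyps] using P by (simp only: ord_ge_add)
qed simp_all

lemma ord_ge_prod_tail:
  fixes f :: "nat \<Rightarrow> 'a::idom fls"
  assumes "\<And>i. ord_ge (f i - 1) (int i)" "a \<le> b"
  shows "ord_ge ((\<Prod>i<b. f i) - (\<Prod>i<a. f i)) (int a)"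
proof -
  have f0: "ord_ge (\<Prod>i<a. f i) 0"
  proof (rule ord_ge_prod0)
    fix i show "ord_ge (f i) 0" using ord_ge_add[OF ord_ge_mono[OF assms(1), of 0 i] ord_ge_1[of 0]] by simp
  qed
  have "(\<Prod>i<b. f i) = (\<Prod>i<a. f i) * (\<Prod>i\<in>{a..<b}. f i)"
    using assms(2) by (subst prod.union_disjoint[symmetric]) (auto intro!: prod.cong)
  then have "(\<Prod>i<b. f i) - (\<Prod>i<a. f i) = (\<Prod>i<a. f i) * ((\<Prod>i\<in>{a..<b}. f i) - 1)"
    by (simp add: algebra_simps)
  moreover have "ord_ge ((\<Prod>i\<in>{a..<b}. f i) - 1) (int a)"
    by (rule ord_ge_prod_diff_1) (auto intro: ord_ge_mono[OF assms(1)])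
  ultimately show ?thesis using ord_ge_mult0[OF f0] by simp
qed

text \<open>The factors tend to \<open>1\<close>, and the \<open>0\<close>-th one is \<open>1\<close>; so the limit is not \<open>0\<close>, as \<open>prodinf\<close> demands.\<close>

lemma arith_gamma_limit:
  fixes l j :: nat
  assumes l: "l \<ge> 1" and j: "j < l"
  defines "g \<equiv> arith_gamma (of_nat CARD('a) ^ j / (1 - of_nat CARD('a) ^ l)) :: 'a::{field,finite} fls"
  shows "ord_ge (g - gamma_trunc l j M) (int M)" "g \<noteq> 0"
proof -
  let ?q = "CARD('a)"
  define f :: "nat \<Rightarrow> 'a fls" where "f i = (if i mod l = j then gamma_factor i else 1)" for i
  have g: "g = prodinf f"
    unfolding g_def arith_gamma_def arith_gamma_digits_def qadic_digits_periodic[OF card_ge_2 l j]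
    by (rule arg_cong[where f = prodinf]) (auto simp: f_def gamma_factor_def)
  have f1: "ord_ge (f i - 1) (int i)" for i using ord_ge_gamma_factor[where 'a='a, of i] by (simp add: f_def)
  have tr: "gamma_trunc l j M = (\<Prod>i<l * M. f i)" for M
  proof -
    have "(\<Prod>i<M * l. f i) = (\<Prod>m<M. prod f {m * l..<m * l + l})" by (rule prod.nat_group[symmetric])
    also have "\<dots> = (\<Prod>m<M. gamma_factor (j + l * m))"
    proof (rule prod.cong[OF refl])
      fix m
      have "prod f {m * l..<m * l + l} = prod f {m * l + j}"
      proof (rule prod.mono_neutral_right)
        show "\<forall>i\<in>{m * l..<m * l + l} - {m * l + j}. f i = 1"
        proof
          fix i assume i: "i \<in> {m * l..<m * l + l} - {m * l + j}"
          then obtain r where r: "i = m * l + r" "r < l" "r \<noteq> j" by (metis Diff_iff atLeastLessThan_iff le_Suc_ex nat_add_left_cancel_less singletonI)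
          then have "i mod l = r" by simp
          then show "f i = 1" using r by (simp add: f_def)
        qed
      qed (use j in auto)
      then show "prod f {m * l..<m * l + l} = gamma_factor (j + l * m)"
        using j by (simp add: f_def algebra_simps)
    qed
    finally show ?thesis by (simp add: gamma_trunc_def mult.commute)
  qed
  have "\<exists>L. \<forall>M. ord_ge (L - (\<Prod>i<M. f i)) (int M)"
    by (rule fls_limit_exists) (rule ord_ge_prod_tail[OF f1])
  then obtain L where L: "\<And>M. ord_ge (L - (\<Prod>i<M. f i)) (int M)" by blast
  have L0: "L \<noteq> 0"
  proof
    assume "L = 0"
    moreover have "f 0 = 1" by (simp add: f_def)
    ultimately have "ord_ge (- 1 :: 'a fls) 1" using L[of 1] by simp
    then have "fls_nth (- 1 :: 'a fls) 0 = 0" unfolding ord_ge_def by (elim allE[of _ 0] impE) simp_all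
    then show False by simp
  qed
  have "f has_prod L"
  proof -
    have lim: "(\<lambda>n. \<Prod>i\<le>n. f (i + 0)) \<longlonglongrightarrow> L"
    proof (rule LIMSEQ_flsI)
      fix n
      have "ord_ge ((\<Prod>i\<le>n. f (i + 0)) - L) (int (Suc n))"
        using ord_ge_uminus[OF L[of "Suc n"]] by (simp add: lessThan_Suc_atMost)
      then show "ord_ge ((\<Prod>i\<le>n. f (i + 0)) - L) (int n)" by (rule ord_ge_mono) simp
    qed
    with L0 show ?thesis unfolding has_prod_def raw_has_prod_def by blast
  qed
  then have gL: "g = L" unfolding g by (rule has_prod_unique[symmetric])
  show "g \<noteq> 0" using gL L0 by simp
  have "int M \<le> int (l * M)" using mult_le_mono1[OF l, of M] unfolding of_nat_le_iff by simp
  then show "ord_ge (g - gamma_trunc l j M) (int M)"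
    unfolding gL tr using L[of "l * M"] ord_ge_mono by blast
qed

lemma gamma_trunc_Suc_index:
  "gamma_trunc l (Suc j) M = jet CARD('a) l (Suc j) M 0 fls_X_inv fls_X * (gamma_trunc l j M ^ CARD('a) :: 'a::{field,finite} fls)"
  unfolding gamma_trunc_def jet_0 add_Suc gamma_factor_Suc prod.distrib prod_power_distrib ..

lemma gamma_trunc_l: "gamma_trunc l l M = (gamma_trunc l 0 (Suc M) :: 'a::{field,finite} fls)"
  unfolding gamma_trunc_def prod.lessThan_Suc_shift by (simp add: add.commute)

text \<open>Raising \<open>\<Prod>\<^sub>a\<^sub><\<^sub>i (1 - \<theta>\<^bsup>q\<^sup>a\<^esup>/\<theta>\<^bsup>q\<^sup>i\<^esup>)\<close> to the power \<open>q\<close> gives the product for \<open>i + 1\<close> except for its factor with \<open>a = 0\<close>; these factors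
  make up \<open>P\<^sub>j\<^sub>+\<^sub>1\<close>.\<close>

lemma arith_gamma_relation:
  fixes l j :: nat
  defines "g \<equiv> \<lambda>j. arith_gamma (of_nat CARD('a) ^ j / (1 - of_nat CARD('a) ^ l)) :: 'a::{field,finite} fls"
  assumes l: "l \<ge> 1" and j: "j < l"
  shows "g (Suc j mod l) = jetval l (Suc j, 0) * g j ^ CARD('a)"
proof -
  let ?q = "CARD('a)"
  let ?P = "\<lambda>M. jet ?q l (Suc j) M 0 fls_X_inv fls_X :: 'a fls"
  have gl: "ord_ge (g i - gamma_trunc l i M) (int M)" if "i < l" for i M
    unfolding g_def by (rule arith_gamma_limit(1)[OF l that])
  have "g (Suc j mod l) - jetval l (Suc j, 0) * g j ^ ?q = 0"
  proof (rule ord_ge_all_imp_0)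
    fix W
    define M where "M = nat W"
    have MW: "int M \<ge> W" by (simp add: M_def)
    have 1: "ord_ge (g (Suc j mod l) - gamma_trunc l (Suc j) M) (int M)"
    proof (cases "Suc j < l")
      case True then show ?thesis using gl[of "Suc j" M] by simp
    next
      case False
      then have "Suc j = l" using j by simp
      then show ?thesis using gl[of 0 "Suc M"] l by (simp add: gamma_trunc_l ord_ge_mono)
    qed
    have P: "ord_ge (jetval l (Suc j, 0) - ?P M) (int M)" using jetval[where 'a='a, of "(Suc j, 0)" l M] l by simp
    have P0: "ord_ge (jetval l (Suc j, 0) :: 'a fls) 0" by (rule ord_ge_jetval) (use l in auto)
    have "ord_ge (gamma_trunc l j M :: 'a fls) 0" unfolding gamma_trunc_def
    proof (rule ord_ge_prod0)
      fix m show "ord_ge (gamma_factor (j + l * m) :: 'a fls) 0"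
        using ord_ge_add[OF ord_ge_mono[OF ord_ge_gamma_factor[where 'a='a, of "j + l * m"], of 0] ord_ge_1[of 0]] by simp
    qed
    then have T: "ord_ge (gamma_trunc l j M ^ ?q :: 'a fls) 0" by (rule ord_ge_power0)
    have G: "ord_ge (g j ^ ?q - gamma_trunc l j M ^ ?q) (int M)"
    proof -
      have "ord_ge ((g j - gamma_trunc l j M) ^ ?q) (int ?q * int M)" by (rule ord_ge_power[OF gl[OF j]])
      moreover have "(g j - gamma_trunc l j M) ^ ?q = g j ^ ?q - gamma_trunc l j M ^ ?q"
        using frobenius_pow_diff[where 'a='a, OF CHAR_fls, of "g j" "gamma_trunc l j M" 1] by simp
      moreover have "1 * int M \<le> int ?q * int M" using card_ge_2[where 'a='a] by (intro mult_right_mono) auto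
      ultimately show ?thesis by (auto intro: ord_ge_mono)
    qed
    have "g (Suc j mod l) - jetval l (Suc j, 0) * g j ^ ?q = (g (Suc j mod l) - gamma_trunc l (Suc j) M)
       - (jetval l (Suc j, 0) * (g j ^ ?q - gamma_trunc l j M ^ ?q) + gamma_trunc l j M ^ ?q * (jetval l (Suc j, 0) - ?P M))"
      unfolding gamma_trunc_Suc_index by (simp add: algebra_simps)
    also have "ord_ge \<dots> (int M)"
      by (intro ord_ge_diff ord_ge_add 1 ord_ge_mult0[OF P0 G] ord_ge_mult0[OF T P])
    finally show "ord_ge (g (Suc j mod l) - jetval l (Suc j, 0) * g j ^ ?q) W" using MW by (rule ord_ge_mono)
  qed
  then show ?thesis by simp
qed

text \<open>By \<open>arith_gamma_relation\<close> the Taylor series of \<open>P\<^sub>c\<close> is a quotient of those of gamma values.\<close>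

lemma jetval_in_gamma_field:
  fixes K :: "'a::{field,finite} fls set"
  assumes l: "l \<ge> 1" and K: "subfield_set K" and th: "fls_X_inv \<in> K" and c: "c \<in> {1..l}" and k: "k \<le> n"
    and D: "\<And>i j. i \<le> n \<Longrightarrow> j < l \<Longrightarrow> hyperderiv_fls i (arith_gamma (of_nat CARD('a) ^ j / (1 - of_nat CARD('a) ^ l))) \<in> K"
  shows "jetval l (c, k) \<in> K"
proof -
  define g where "g j = (arith_gamma (of_nat CARD('a) ^ j / (1 - of_nat CARD('a) ^ l)) :: 'a fls)" for j
  obtain j where j: "c = Suc j" "j < l" using c by (cases c) auto
  have tK: "fps_in n K (taylor (g i))" if "i < l" for i
    using D that by (simp add: fps_in_def g_def)
  have "taylor (g j ^ CARD('a)) * taylor (jetval l (c, 0)) = taylor (g (Suc j mod l))"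
    unfolding rhom_mult[OF rhom_taylor, symmetric] j(1) g_def
    by (subst arith_gamma_relation[OF l j(2)]) (simp add: mult.commute)
  moreover have "fps_in n K (taylor (g j ^ CARD('a)))"
    unfolding rhom_power[OF rhom_taylor] by (intro fps_in_power tK K j)
  moreover have "fps_nth (taylor (g j ^ CARD('a))) 0 \<noteq> 0"
    using arith_gamma_limit(2)[OF l j(2)] by (simp add: g_def)
  moreover have "fps_in n K (taylor (g (Suc j mod l)))" using l by (intro tK) simp
  ultimately have "fps_in n K (taylor (jetval l (c, 0)))"
    using fps_in_divide[OF K, of n "taylor (g j ^ CARD('a))" "taylor (g (Suc j mod l))" "taylor (jetval l (c, 0))"] by simp
  then show ?thesis using c k by (intro jetval_in_field[OF l _ K th]) (auto simp: fps_in_def)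
qed

section \<open>Transcendence degree by counting monomials\<close>

lemma more_unknowns:
  fixes a :: "'j \<Rightarrow> 'i \<Rightarrow> 'c::field"
  assumes K: "subfield_set K" and "finite I" "finite J" "card I < card J" "\<And>j i. j \<in> J \<Longrightarrow> i \<in> I \<Longrightarrow> a j i \<in> K"
  shows "\<exists>c. (\<exists>j\<in>J. c j \<noteq> 0) \<and> (\<forall>j\<in>J. c j \<in> K) \<and> (\<forall>i\<in>I. (\<Sum>j\<in>J. c j * a j i) = 0)"
  using assms(2-)
proof (induction I arbitrary: J a rule: finite_induct)
  case empty
  then obtain j where "j \<in> J" by (metis card.empty card_gt_0_iff ex_in_conv)
  then show ?case by (intro exI[of _ "\<lambda>_. 1"]) (auto simp: subfield_set_1[OF K])
next
  case (insert i0 I)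
  show ?case
  proof (cases "\<forall>j\<in>J. a j i0 = 0")
    case True
    have "\<exists>c. (\<exists>j\<in>J. c j \<noteq> 0) \<and> (\<forall>j\<in>J. c j \<in> K) \<and> (\<forall>i\<in>I. (\<Sum>j\<in>J. c j * a j i) = 0)"
      by (rule insert.IH) (use insert in auto)
    then show ?thesis using True by auto
  next
    case False
    then obtain j0 where j0: "j0 \<in> J" "a j0 i0 \<noteq> 0" by blast
    let ?J = "J - {j0}"
    define a' where "a' j i = a j0 i0 * a j i - a j i0 * a j0 i" for j i
    have "\<exists>c. (\<exists>j\<in>?J. c j \<noteq> 0) \<and> (\<forall>j\<in>?J. c j \<in> K) \<and> (\<forall>i\<in>I. (\<Sum>j\<in>?J. c j * a' j i) = 0)"
    proof (rule insert.IH)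
      show "card I < card ?J" using insert.prems insert.hyps j0 by simp
      show "a' j i \<in> K" if "j \<in> ?J" "i \<in> I" for j i
        unfolding a'_def using that j0 insert.prems by (intro subfield_set_diff subfield_set_mult K) auto
    qed (use insert.prems in auto)
    then obtain c where c: "\<exists>j\<in>?J. c j \<noteq> 0" "\<forall>j\<in>?J. c j \<in> K" "\<forall>i\<in>I. (\<Sum>j\<in>?J. c j * a' j i) = 0" by (elim exE conjE)
    define c' where "c' j = (if j = j0 then - (\<Sum>j\<in>?J. c j * a j i0) else a j0 i0 * c j)" for j
    have sp: "(\<Sum>j\<in>J. c' j * a j i) = a j0 i0 * (\<Sum>j\<in>?J. c j * a j i) - (\<Sum>j\<in>?J. c j * a j i0) * a j0 i" for i
    proof -
      have "(\<Sum>j\<in>J. c' j * a j i) = c' j0 * a j0 i + (\<Sum>j\<in>?J. c' j * a j i)"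
        by (rule sum.remove) (use insert.prems j0 in auto)
      also have "(\<Sum>j\<in>?J. c' j * a j i) = a j0 i0 * (\<Sum>j\<in>?J. c j * a j i)"
        unfolding sum_distrib_left by (rule sum.cong) (auto simp: c'_def)
      finally show ?thesis by (simp add: c'_def)
    qed
    have "(\<Sum>j\<in>J. c' j * a j i) = 0" if i: "i \<in> insert i0 I" for i
    proof (cases "i = i0")
      case True then show ?thesis unfolding sp by (simp add: mult.commute)
    next
      case False
      then have "(\<Sum>j\<in>?J. c j * a' j i) = 0" using i c(3) by blast
      moreover have "(\<Sum>j\<in>?J. c j * a' j i) = a j0 i0 * (\<Sum>j\<in>?J. c j * a j i) - (\<Sum>j\<in>?J. c j * a j i0) * a j0 i"
        unfolding a'_def sum_distrib_left sum_distrib_right sum_subtractf[symmetric]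
        by (rule sum.cong) (auto simp: algebra_simps)
      ultimately show ?thesis unfolding sp by simp
    qed
    moreover have "\<exists>j\<in>J. c' j \<noteq> 0" using c(1) j0 by (auto simp: c'_def)
    moreover have "\<forall>j\<in>J. c' j \<in> K"
      using c(2) j0 insert.prems unfolding c'_def
      by (auto intro!: subfield_set_uminus subfield_set_sum subfield_set_mult K)
    ultimately show ?thesis by (intro exI[of _ c'] conjI ballI) auto
  qed
qed

inductive_set kspan :: "'c::field set \<Rightarrow> 'c set \<Rightarrow> 'c set" for K V where
  zero: "0 \<in> kspan K V"
| step: "a \<in> K \<Longrightarrow> v \<in> V \<Longrightarrow> x \<in> kspan K V \<Longrightarrow> a * v + x \<in> kspan K V"

lemma kspan_base: "1 \<in> K \<Longrightarrow> v \<in> V \<Longrightarrow> v \<in> kspan K V"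
  using kspan.step[OF _ _ kspan.zero, of 1 K v V] by simp
lemma kspan_add: "x \<in> kspan K V \<Longrightarrow> y \<in> kspan K V \<Longrightarrow> x + y \<in> kspan K V"
  by (induction rule: kspan.induct) (auto simp: add.assoc intro: kspan.step)
lemma kspan_scale:
  assumes "subfield_set K" "a \<in> K" "x \<in> kspan K V" shows "a * x \<in> kspan K V"
  using assms(3)
proof (induction rule: kspan.induct)
  case (step b v x)
  have "(a * b) * v + a * x \<in> kspan K V"
    by (rule kspan.step[OF subfield_set_mult[OF assms(1,2) step.hyps(1)] step.hyps(2) step.IH])
  then show ?case by (simp add: algebra_simps)
qed (simp add: kspan.zero)
lemma kspan_sum: "(\<And>i. i \<in> S \<Longrightarrow> f i \<in> kspan K V) \<Longrightarrow> (\<Sum>i\<in>S. f i) \<in> kspan K V"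
  by (induction S rule: infinite_finite_induct) (auto intro: kspan_add kspan.zero)
lemma kspan_subset:
  assumes K: "subfield_set K" and "V \<subseteq> kspan K W" shows "kspan K V \<subseteq> kspan K W"
proof
  fix x assume "x \<in> kspan K V"
  then show "x \<in> kspan K W"
    by (induction rule: kspan.induct) (use assms in \<open>auto intro!: kspan_add kspan_scale kspan.zero\<close>)
qed
lemma kspan_mono: "subfield_set K \<Longrightarrow> V \<subseteq> W \<Longrightarrow> kspan K V \<subseteq> kspan K W"
  by (rule kspan_subset) (auto intro: kspan_base subfield_set_1)
lemma kspan_mult:
  assumes K: "subfield_set K" and x: "x \<in> kspan K V" and y: "y \<in> kspan K W"
    and VW: "\<And>v w. v \<in> V \<Longrightarrow> w \<in> W \<Longrightarrow> v * w \<in> kspan K U"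
  shows "x * y \<in> kspan K U"
  using x
proof (induction rule: kspan.induct)
  case (step a v x)
  have "v * y \<in> kspan K U" using y
  proof (induction rule: kspan.induct)
    case (step b w y)
    have "v * (b * w + y) = b * (v * w) + v * y" by (simp add: algebra_simps)
    moreover have "b * (v * w) \<in> kspan K U" using step.hyps \<open>v \<in> V\<close> by (intro kspan_scale[OF K] VW)
    ultimately show ?case using step.IH by (simp add: kspan_add)
  qed (simp add: kspan.zero)
  then have "a * (v * y) + x * y \<in> kspan K U" using step by (auto intro!: kspan_add kspan_scale[OF K])
  then show ?case by (simp add: algebra_simps)
qed (simp add: kspan.zero)

lemma kspan_finite:
  assumes "subfield_set K" "finite V" "x \<in> kspan K V"
  shows "\<exists>a. (\<forall>v\<in>V. a v \<in> K) \<and> x = (\<Sum>v\<in>V. a v * v)"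
  using assms(3)
proof (induction rule: kspan.induct)
  case zero
  show ?case by (intro exI[of _ "\<lambda>_. 0"]) (simp add: subfield_set_0 assms)
next
  case (step b w x)
  then obtain a where a: "\<forall>v\<in>V. a v \<in> K" "x = (\<Sum>v\<in>V. a v * v)" by blast
  have "b * w = (\<Sum>v\<in>V. (if v = w then b else 0) * v)"
  proof -
    have "(\<Sum>v\<in>V. (if v = w then b else 0) * v) = (\<Sum>v\<in>V. if v = w then b * w else 0)"
      by (rule sum.cong) auto
    then show ?thesis using assms(2) step.hyps by simp
  qed
  then have "b * w + x = (\<Sum>v\<in>V. ((if v = w then b else 0) + a v) * v)"
    by (simp add: a(2) distrib_right sum.distrib)
  then show ?case using a(1) step.hyps assms(1)
    by (intro exI[of _ "\<lambda>v. (if v = w then b else 0) + a v"]) (auto intro: subfield_set_add)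
qed

lemma kspan_dependent:
  fixes y :: "'j \<Rightarrow> 'c::field"
  assumes K: "subfield_set K" and "finite V" "finite J" "card V < card J" "\<And>j. j \<in> J \<Longrightarrow> y j \<in> kspan K V"
  shows "\<exists>c. (\<exists>j\<in>J. c j \<noteq> 0) \<and> (\<forall>j\<in>J. c j \<in> K) \<and> (\<Sum>j\<in>J. c j * y j) = 0"
proof -
  have "\<forall>j\<in>J. \<exists>a. (\<forall>v\<in>V. a v \<in> K) \<and> y j = (\<Sum>v\<in>V. a v * v)"
    using assms kspan_finite by blast
  then obtain a where a: "\<And>j. j \<in> J \<Longrightarrow> (\<forall>v\<in>V. a j v \<in> K) \<and> y j = (\<Sum>v\<in>V. a j v * v)" by metis
  obtain c where c: "\<exists>j\<in>J. c j \<noteq> 0" "\<forall>j\<in>J. c j \<in> K" "\<forall>v\<in>V. (\<Sum>j\<in>J. c j * a j v) = 0"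
    using more_unknowns[OF K assms(2-4), of a] a by auto
  have "(\<Sum>j\<in>J. c j * y j) = (\<Sum>j\<in>J. \<Sum>v\<in>V. c j * a j v * v)"
    by (rule sum.cong) (use a in \<open>auto simp: sum_distrib_left mult.assoc\<close>)
  also have "\<dots> = (\<Sum>v\<in>V. (\<Sum>j\<in>J. c j * a j v) * v)"
    by (subst sum.swap) (simp add: sum_distrib_right)
  also have "\<dots> = 0" using c(3) by simp
  finally show ?thesis using c by blast
qed

subsection \<open>Algebraic elements\<close>

text \<open>The powers of \<open>x\<close> lie in a space of finite dimension, hence are linearly dependent.\<close>

lemma algebraic_overI_stable:
  assumes K: "subfield_set K" and W: "finite W" "1 \<in> kspan K W" and x: "\<And>w. w \<in> W \<Longrightarrow> x * w \<in> kspan K W"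
  shows "algebraic_over K x"
proof -
  have "x ^ n \<in> kspan K W" for n
  proof (induction n)
    case (Suc n)
    have "x \<in> kspan K {x}" by (rule kspan_base) (simp_all add: subfield_set_1[OF K])
    from kspan_mult[OF K this Suc.IH] x show ?case by simp
  qed (use W in simp)
  then obtain c where c: "\<exists>j\<in>{..card W}. c j \<noteq> 0" "\<forall>j\<in>{..card W}. c j \<in> K" "(\<Sum>j\<in>{..card W}. c j * x ^ j) = 0"
    using kspan_dependent[OF K W(1), of "{..card W}" "\<lambda>j. x ^ j"] by auto
  define p where "p = (\<Sum>j\<le>card W. monom (c j) j)"
  have cp: "poly.coeff p j = (if j \<le> card W then c j else 0)" for j
    by (simp add: p_def coeff_sum)
  have "p \<noteq> 0" using c(1) cp by (metis atMost_iff coeff_0)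
  moreover have "poly p x = 0" using c(3) by (simp add: p_def poly_sum poly_monom)
  ultimately show ?thesis unfolding algebraic_over_def
    using c(2) subfield_set_0[OF K] by (intro exI[of _ p]) (auto simp: cp)
qed

lemma algebraic_over_monic:
  assumes K: "subfield_set K" and x: "algebraic_over K x"
  shows "\<exists>n a. n \<ge> 1 \<and> (\<forall>i<n. a i \<in> K) \<and> x ^ n = (\<Sum>i<n. a i * x ^ i)"
proof -
  obtain p where p: "p \<noteq> 0" "\<And>i. poly.coeff p i \<in> K" "poly p x = 0" using x unfolding algebraic_over_def by blast
  define n where "n = Polynomial.degree p"
  define b where "b = poly.coeff p n"
  have b: "b \<noteq> 0" using p(1) by (simp add: b_def n_def)
  have "n \<ge> 1"
  proof (rule ccontr)
    assume "\<not> n \<ge> 1"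
    then have "n = 0" by simp
    then obtain e where "p = [:e:]" unfolding n_def by (rule degree_eq_zeroE)
    then show False using p by simp
  qed
  have "0 = b * x ^ n + (\<Sum>i<n. poly.coeff p i * x ^ i)"
    using p(3) by (simp add: poly_altdef n_def[symmetric] b_def lessThan_Suc_atMost[symmetric] add.commute)
  then have "b * x ^ n = - (\<Sum>i<n. poly.coeff p i * x ^ i)" by (simp add: eq_neg_iff_add_eq_0)
  then have "x ^ n = inverse b * - (\<Sum>i<n. poly.coeff p i * x ^ i)" using b by (metis field_class.field_inverse mult.assoc mult_1)
  also have "\<dots> = (\<Sum>i<n. (- inverse b * poly.coeff p i) * x ^ i)" by (simp add: sum_distrib_left sum_negf[symmetric] mult.assoc)
  finally have "x ^ n = (\<Sum>i<n. (- inverse b * poly.coeff p i) * x ^ i)" .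
  moreover have "- inverse b * poly.coeff p i \<in> K" for i
    using p(2) by (intro subfield_set_mult subfield_set_uminus subfield_set_inverse K) (auto simp: b_def)
  ultimately show ?thesis using \<open>n \<ge> 1\<close> by (intro exI[of _ n] exI[of _ "\<lambda>i. - inverse b * poly.coeff p i"]) simp
qed

text \<open>The spanning set consists of products of powers of the elements of \<open>C\<close>, with exponents below the degrees of monic equations.\<close>

lemma algebraic_stable_exists:
  assumes K: "subfield_set K" and "finite C" "\<And>x. x \<in> C \<Longrightarrow> algebraic_over K x"
  shows "\<exists>W. finite W \<and> 1 \<in> W \<and> (\<forall>x\<in>C. \<forall>w\<in>W. x * w \<in> kspan K W)"
  using assms(2,3)
proof (induction C rule: finite_induct)
  case empty
  show ?case by (intro exI[of _ "{1}"]) simp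
next
  case (insert y C)
  then obtain W where W: "finite W" "1 \<in> W" "\<forall>x\<in>C. \<forall>w\<in>W. x * w \<in> kspan K W" by auto
  obtain n a where y: "n \<ge> 1" "\<forall>i<n. a i \<in> K" "y ^ n = (\<Sum>i<n. a i * y ^ i)"
    using algebraic_over_monic[OF K] insert.prems by blast
  define W' where "W' = (\<lambda>(w, i). w * y ^ i) ` (W \<times> {..<n})"
  have mem: "w * y ^ i \<in> W'" if "w \<in> W" "i < n" for w i using that by (auto simp: W'_def)
  have memk: "w * y ^ i \<in> kspan K W'" if "w \<in> W" "i < n" for w i
    by (rule kspan_base[OF subfield_set_1[OF K] mem[OF that]])
  have "x * u \<in> kspan K W'" if x: "x \<in> insert y C" and u: "u \<in> W'" for x u
  proof -
    obtain w i where wi: "u = w * y ^ i" "w \<in> W" "i < n" using u by (auto simp: W'_def)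
    show ?thesis
    proof (cases "x \<in> C")
      case True
      then have "x * w \<in> kspan K W" using W wi by blast
      moreover have "y ^ i \<in> kspan K {y ^ i}" by (rule kspan_base) (simp_all add: subfield_set_1[OF K])
      ultimately have "(x * w) * y ^ i \<in> kspan K W'"
        by (rule kspan_mult[OF K]) (use memk wi in auto)
      then show ?thesis by (simp add: wi(1) mult.assoc)
    next
      case False
      then have xy: "x = y" using x by simp
      show ?thesis
      proof (cases "Suc i < n")
        case True
        then show ?thesis using memk[OF wi(2) True] by (simp add: wi(1) xy mult_ac)
      next
        case False
        then have "Suc i = n" using wi(3) by simp
        then have "x * u = w * y ^ n" by (simp add: xy wi(1) mult_ac flip: power_Suc)
        also have "\<dots> = (\<Sum>j<n. a j * (w * y ^ j))" unfolding y(3) sum_distrib_left by (simp add: mult_ac)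
        also have "\<dots> \<in> kspan K W'" using y(2) wi(2) by (intro kspan_sum kspan_scale[OF K] memk) auto
        finally show ?thesis .
      qed
    qed
  qed
  moreover have "1 \<in> W'" using mem[of 1 0] W(2) y(1) by simp
  moreover have "finite W'" using W(1) by (simp add: W'_def)
  ultimately show ?case by blast
qed

lemma algebraic_over_incl: "subfield_set K \<Longrightarrow> x \<in> K \<Longrightarrow> algebraic_over K x"
  unfolding algebraic_over_def
  by (intro exI[of _ "[:- x, 1:]"]) (auto simp: coeff_pCons split: nat.splits intro: subfield_set_uminus subfield_set_1 subfield_set_0)

lemma subfield_set_algebraic:
  assumes K: "subfield_set K" shows "subfield_set {x. algebraic_over K x}"
  unfolding subfield_set_def
proof (intro conjI ballI)
  show "1 \<in> {x. algebraic_over K x}" using algebraic_over_incl[OF K subfield_set_1[OF K]] by simp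
  fix x assume x: "x \<in> {x. algebraic_over K x}"
  have sub: "x + y \<in> {x. algebraic_over K x} \<and> x * y \<in> {x. algebraic_over K x}" if y: "y \<in> {x. algebraic_over K x}" for y
  proof -
    have "\<exists>W. finite W \<and> 1 \<in> W \<and> (\<forall>z\<in>{x, y}. \<forall>w\<in>W. z * w \<in> kspan K W)"
      by (rule algebraic_stable_exists[OF K]) (use x y in auto)
    then obtain W where W: "finite W" "1 \<in> W" "\<forall>z\<in>{x, y}. \<forall>w\<in>W. z * w \<in> kspan K W"
      by (elim exE conjE)
    note W = W(1,2) W(3)[rule_format]
    have 1: "1 \<in> kspan K W" by (rule kspan_base[OF subfield_set_1[OF K] W(2)])
    have "(x + y) * w \<in> kspan K W" if "w \<in> W" for w
      unfolding distrib_right using W(3) that by (intro kspan_add) auto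
    moreover have "(x * y) * w \<in> kspan K W" if "w \<in> W" for w
    proof -
      have "x \<in> kspan K {x}" by (rule kspan_base) (simp_all add: subfield_set_1[OF K])
      from kspan_mult[OF K this W(3)[of y w]] W(3) that show ?thesis by (simp add: mult.assoc)
    qed
    ultimately show ?thesis using algebraic_overI_stable[OF K W(1) 1] by auto
  qed
  then show "x + y \<in> {x. algebraic_over K x}" "x * y \<in> {x. algebraic_over K x}" if "y \<in> {x. algebraic_over K x}" for y using that by blast+
  have "- 1 \<in> {x. algebraic_over K x}" using algebraic_over_incl[OF K] subfield_set_uminus[OF K subfield_set_1[OF K]] by simp
  from sub[OF this] show "- x \<in> {x. algebraic_over K x}" by simp
  show "inverse x \<in> {x. algebraic_over K x}"
  proof (cases "x = 0")
    case False
    obtain p where p: "p \<noteq> 0" "\<And>i. poly.coeff p i \<in> K" "poly p x = 0" using x unfolding algebraic_over_def by blast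
    have "poly (reflect_poly p) (inverse x) = 0" using p False by (simp add: poly_reflect_poly_nz)
    moreover have "poly.coeff (reflect_poly p) i \<in> K" for i using p(2) subfield_set_0[OF K] by (simp add: coeff_reflect_poly)
    moreover have "reflect_poly p \<noteq> 0" using p(1) by simp
    ultimately show ?thesis unfolding algebraic_over_def by blast
  qed (use x in simp)
qed

subsection \<open>Monomials with exponents in a box\<close>

text \<open>The degree is bounded in each variable separately, which makes the number of monomials a power of the bound.\<close>

definition Box :: "'i set \<Rightarrow> nat \<Rightarrow> ('i \<Rightarrow> nat) set" where
  "Box S D = (S \<rightarrow>\<^sub>E {..<D})"

definition box_monomial :: "('i \<Rightarrow> 'c::field) \<Rightarrow> 'i set \<Rightarrow> ('i \<Rightarrow> nat) \<Rightarrow> 'c" where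
  "box_monomial x S m = (\<Prod>i\<in>S. x i ^ m i)"

definition box_monomials :: "('i \<Rightarrow> 'c::field) \<Rightarrow> 'i set \<Rightarrow> nat \<Rightarrow> 'c set" where
  "box_monomials x S D = box_monomial x S ` Box S D"

text \<open>For families instead of sets, so that a repeated element is a dependence.\<close>

definition aindep :: "'c::field set \<Rightarrow> 'i set \<Rightarrow> ('i \<Rightarrow> 'c) \<Rightarrow> bool" where
  "aindep K S x \<longleftrightarrow> (\<forall>D c. (\<forall>m\<in>Box S D. c m \<in> K) \<and> (\<Sum>m\<in>Box S D. c m * box_monomial x S m) = 0 \<longrightarrow> (\<forall>m\<in>Box S D. c m = 0))"

lemma finite_Box: "finite S \<Longrightarrow> finite (Box S D)"
  unfolding Box_def by (intro finite_PiE) auto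
lemma card_Box: "finite S \<Longrightarrow> card (Box S D) = D ^ card S"
  unfolding Box_def by (simp add: card_PiE)
lemma card_box_monomials: "finite S \<Longrightarrow> card (box_monomials x S D) \<le> D ^ card S"
  unfolding box_monomials_def using card_image_le[OF finite_Box, of S "box_monomial x S" D] by (simp add: card_Box)
lemma finite_box_monomials: "finite S \<Longrightarrow> finite (box_monomials x S D)"
  unfolding box_monomials_def by (simp add: finite_Box)
lemma box_monomials_I: "(\<And>i. i \<in> S \<Longrightarrow> m i < D) \<Longrightarrow> (\<Prod>i\<in>S. x i ^ m i) \<in> box_monomials x S D"
  unfolding box_monomials_def Box_def box_monomial_def
  by (rule image_eqI[of _ _ "restrict m S"]) auto
lemma box_monomials_mono: "D \<le> E \<Longrightarrow> box_monomials x S D \<subseteq> box_monomials x S E"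
  unfolding box_monomials_def Box_def by (intro image_mono PiE_mono) auto
lemma box_monomials_mult:
  assumes "u \<in> box_monomials x S D" "v \<in> box_monomials x S E" shows "u * v \<in> box_monomials x S (D + E)"
proof -
  obtain m n where m: "m \<in> Box S D" "u = box_monomial x S m" and n: "n \<in> Box S E" "v = box_monomial x S n"
    using assms by (auto simp: box_monomials_def)
  have "u * v = (\<Prod>i\<in>S. x i ^ (m i + n i))" by (simp add: m n box_monomial_def prod.distrib power_add)
  also have "\<dots> \<in> box_monomials x S (D + E)"
  proof (rule box_monomials_I)
    fix i assume "i \<in> S"
    then have "m i < D" "n i < E" using m n by (auto simp: Box_def)
    then show "m i + n i < D + E" by simp
  qed
  finally show ?thesis .
qed
lemma box_monomials_one: "D \<ge> 1 \<Longrightarrow> 1 \<in> box_monomials x S D"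
  using box_monomials_I[of S "\<lambda>_. 0" D x] by simp

lemma kspan_box_monomials_mult:
  assumes K: "subfield_set K" and "u \<in> kspan K (box_monomials x S D)" "v \<in> kspan K (box_monomials x S E)"
  shows "u * v \<in> kspan K (box_monomials x S (D + E))"
  by (rule kspan_mult[OF assms]) (rule kspan_base[OF subfield_set_1[OF K] box_monomials_mult])

lemma kspan_box_monomials_mono: "subfield_set K \<Longrightarrow> D \<le> E \<Longrightarrow> u \<in> kspan K (box_monomials x S D) \<Longrightarrow> u \<in> kspan K (box_monomials x S E)"
  using kspan_mono[OF _ box_monomials_mono] by blast

lemma kspan_box_monomials_1: "subfield_set K \<Longrightarrow> D \<ge> 1 \<Longrightarrow> 1 \<in> kspan K (box_monomials x S D)"
  by (rule kspan_base[OF subfield_set_1 box_monomials_one])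

lemma kspan_box_monomials_power:
  assumes K: "subfield_set K" and u: "u \<in> kspan K (box_monomials x S e)"
  shows "u ^ n \<in> kspan K (box_monomials x S (n * e + 1))"
proof (induction n)
  case (Suc n)
  from kspan_box_monomials_mult[OF K u Suc.IH] show ?case by (simp add: add.assoc)
qed (simp add: kspan_box_monomials_1[OF K])

lemma kspan_box_monomials_prod:
  assumes K: "subfield_set K" and "finite T" and u: "\<And>t. t \<in> T \<Longrightarrow> u t \<in> kspan K (box_monomials x S e)"
  shows "(\<Prod>t\<in>T. u t) \<in> kspan K (box_monomials x S (card T * e + 1))"
  using assms(2,3)
proof (induction T rule: finite_induct)
  case (insert t T)
  from kspan_box_monomials_mult[OF K insert.prems[of t] insert.IH] insert show ?case by (simp add: add.assoc)
qed (simp add: kspan_box_monomials_1[OF K])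

text \<open>The \<open>D ^ card T\<close> monomials are linearly independent, also after multiplication by \<open>g\<close>.\<close>

lemma aindep_count:
  assumes K: "subfield_set K" and T: "finite T" and ind: "aindep K T y"
    and V: "finite V" and g: "g \<noteq> 0" and "\<And>m. m \<in> Box T D \<Longrightarrow> g * box_monomial y T m \<in> kspan K V"
  shows "D ^ card T \<le> card V"
proof (rule ccontr)
  assume "\<not> D ^ card T \<le> card V"
  then have "card V < card (Box T D)" by (simp add: card_Box[OF T])
  from kspan_dependent[OF K V finite_Box[OF T] this, of "\<lambda>m. g * box_monomial y T m"] assms(6)
  obtain c where c: "\<exists>j\<in>Box T D. c j \<noteq> 0" "\<forall>j\<in>Box T D. c j \<in> K" "(\<Sum>j\<in>Box T D. c j * (g * box_monomial y T j)) = 0" by auto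
  have "g * (\<Sum>j\<in>Box T D. c j * box_monomial y T j) = 0" using c(3) by (simp add: sum_distrib_left mult_ac)
  then have "(\<Sum>j\<in>Box T D. c j * box_monomial y T j) = 0" using g by simp
  then show False using ind c(1,2) unfolding aindep_def by blast
qed

subsection \<open>Generated fields\<close>

lemma ring_type_simps:
  "carrier (ring_of_type_algebra :: 'c::field ring) = UNIV" "\<one>\<^bsub>(ring_of_type_algebra :: 'c ring)\<^esub> = 1"
  "\<zero>\<^bsub>(ring_of_type_algebra :: 'c ring)\<^esub> = 0"
  "x \<oplus>\<^bsub>(ring_of_type_algebra :: 'c ring)\<^esub> y = x + y" "x \<otimes>\<^bsub>(ring_of_type_algebra :: 'c ring)\<^esub> y = x * y"
  by (simp_all add: ring_of_type_algebra_def)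

lemma ring_type_inv:
  "\<ominus>\<^bsub>(ring_of_type_algebra :: 'c::field ring)\<^esub> x = - x"
  "x \<noteq> 0 \<Longrightarrow> inv\<^bsub>(ring_of_type_algebra :: 'c ring)\<^esub> x = inverse x"
proof -
  interpret R: Ring.field "ring_of_type_algebra :: 'c ring" by (rule field_from_type_algebra)
  show "\<ominus>\<^bsub>(ring_of_type_algebra :: 'c ring)\<^esub> x = - x"
    by (rule R.minus_equality) (simp_all add: ring_type_simps)
  show "inv\<^bsub>(ring_of_type_algebra :: 'c ring)\<^esub> x = inverse x" if "x \<noteq> 0"
    by (rule R.comm_inv_char) (use that in \<open>simp_all add: ring_type_simps\<close>)
qed

lemma subfield_set_adjoin: "subfield_set (adjoin K S)"
proof -
  have 0: "(0 :: 'a) \<in> adjoin K S" unfolding adjoin_def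
    using generate_field.eng_add[OF generate_field.one generate_field.a_inv[OF generate_field.one], of "ring_of_type_algebra :: 'a ring" "K \<union> S"]
    by (simp add: ring_type_simps ring_type_inv)
  show ?thesis
    unfolding subfield_set_def
  proof (intro conjI ballI)
    show "1 \<in> adjoin K S" unfolding adjoin_def using generate_field.one[of "ring_of_type_algebra :: 'a ring" "K \<union> S"] by (simp add: ring_type_simps)
    fix x assume x: "x \<in> adjoin K S"
    show "x + y \<in> adjoin K S" "x * y \<in> adjoin K S" if "y \<in> adjoin K S" for y
      using x that generate_field.eng_add[of x "ring_of_type_algebra :: 'a ring" "K \<union> S" y]
        generate_field.eng_mult[of x "ring_of_type_algebra :: 'a ring" "K \<union> S" y]
      unfolding adjoin_def by (simp_all add: ring_type_simps)
    show "- x \<in> adjoin K S"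
      using x generate_field.a_inv[of x "ring_of_type_algebra :: 'a ring" "K \<union> S"]
      unfolding adjoin_def by (simp add: ring_type_inv)
    show "inverse x \<in> adjoin K S"
    proof (cases "x = 0")
      case False
      then show ?thesis using x generate_field.m_inv[of x "ring_of_type_algebra :: 'a ring" "K \<union> S"]
        unfolding adjoin_def by (simp add: ring_type_inv ring_type_simps)
    qed (use 0 in simp)
  qed
qed

lemma adjoin_incl: "x \<in> K \<Longrightarrow> x \<in> adjoin K S" "x \<in> S \<Longrightarrow> x \<in> adjoin K S"
  unfolding adjoin_def by (auto intro: generate_field.incl)

lemma adjoin_least:
  assumes L: "subfield_set L" and "K \<subseteq> L" "S \<subseteq> L" shows "adjoin K S \<subseteq> L"
proof
  fix x assume "x \<in> adjoin K S"
  then show "x \<in> L" unfolding adjoin_def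
    by (induction rule: generate_field.induct)
       (use assms in \<open>auto simp: ring_type_simps ring_type_inv intro: subfield_set_1 subfield_set_add subfield_set_mult subfield_set_uminus subfield_set_inverse\<close>)
qed

lemma adjoin_fraction:
  assumes K: "subfield_set K" and Z: "finite Z" and z: "z \<in> adjoin K Z"
  shows "\<exists>e f g. f \<in> kspan K (box_monomials (\<lambda>x. x) Z e) \<and> g \<in> kspan K (box_monomials (\<lambda>x. x) Z e) \<and> g \<noteq> 0 \<and> z = f / g"
proof -
  let ?M = "\<lambda>e. kspan K (box_monomials (\<lambda>x. x) Z e)"
  define L where "L = {z. \<exists>e f g. f \<in> ?M e \<and> g \<in> ?M e \<and> g \<noteq> 0 \<and> z = f / g}"
  have LI: "f / g \<in> L" if "f \<in> ?M e" "g \<in> ?M e" "g \<noteq> 0" for f g e using that by (auto simp: L_def)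
  have in1: "f \<in> L" if "f \<in> ?M e" for f e
  proof -
    have "f \<in> ?M (e + 1)" by (rule kspan_box_monomials_mono[OF K _ that]) simp
    moreover have "1 \<in> ?M (e + 1)" by (rule kspan_box_monomials_1[OF K]) simp
    ultimately show ?thesis using LI[of f "e + 1" 1] by simp
  qed
  have "subfield_set L"
    unfolding subfield_set_def
  proof (intro conjI ballI)
    show "1 \<in> L" by (rule in1[OF kspan_box_monomials_1[OF K, of 1]]) simp
    fix x assume "x \<in> L"
    then obtain e f g where x: "f \<in> ?M e" "g \<in> ?M e" "g \<noteq> 0" "x = f / g" by (auto simp: L_def)
    show "x + y \<in> L" "x * y \<in> L" if "y \<in> L" for y
    proof -
      obtain e' f' g' where y: "f' \<in> ?M e'" "g' \<in> ?M e'" "g' \<noteq> 0" "y = f' / g'" using \<open>y \<in> L\<close> by (auto simp: L_def)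
      have gg: "g * g' \<in> ?M (e + e')" "g * g' \<noteq> 0" using x y by (auto intro: kspan_box_monomials_mult[OF K])
      have "f * g' \<in> ?M (e + e')" "g * f' \<in> ?M (e + e')" "f * f' \<in> ?M (e + e')" using x y by (auto intro: kspan_box_monomials_mult[OF K])
      then have "(f * g' + g * f') / (g * g') \<in> L" "(f * f') / (g * g') \<in> L" using gg by (auto intro!: LI kspan_add)
      then show "x + y \<in> L" "x * y \<in> L" using x y by (simp_all add: add_frac_eq mult.commute)
    qed
    have "(- 1) * f \<in> ?M e" using x(1) by (intro kspan_scale[OF K] subfield_set_uminus[OF K] subfield_set_1[OF K])
    then show "- x \<in> L" using LI[of "- f" e g] x by simp
    show "inverse x \<in> L"
    proof (cases "f = 0")
      case True
      then show ?thesis using x in1[OF kspan.zero] by simp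
    next
      case False
      then show ?thesis using LI[OF x(2,1)] x by simp
    qed
  qed
  moreover have "K \<subseteq> L"
  proof
    fix a assume "a \<in> K"
    then have "a * 1 \<in> ?M 1" by (intro kspan_scale[OF K] kspan_box_monomials_1[OF K]) auto
    then show "a \<in> L" using in1 by simp
  qed
  moreover have "Z \<subseteq> L"
  proof
    fix x assume x: "x \<in> Z"
    have "(\<Prod>i\<in>Z. i ^ (if i = x then 1 else 0)) \<in> box_monomials (\<lambda>x. x) Z 2" by (rule box_monomials_I) auto
    moreover have "(\<Prod>i\<in>Z. i ^ (if i = x then 1 else 0)) = (\<Prod>i\<in>Z. if i = x then x else 1)" by (rule prod.cong) auto
    ultimately have "x \<in> box_monomials (\<lambda>x. x) Z 2" using Z x by (simp add: prod.delta)
    then show "x \<in> L" by (intro in1 kspan_base[OF subfield_set_1[OF K]])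
  qed
  ultimately have "z \<in> L" using adjoin_least z by blast
  then show ?thesis by (simp add: L_def)
qed

lemma common_denominator:
  assumes K: "subfield_set K" and Z: "finite Z" and "finite T" and "\<And>t. t \<in> T \<Longrightarrow> y t \<in> adjoin K Z"
  shows "\<exists>e G. G \<noteq> 0 \<and> G \<in> kspan K (box_monomials (\<lambda>x. x) Z e) \<and> (\<forall>t\<in>T. G * y t \<in> kspan K (box_monomials (\<lambda>x. x) Z e))"
  using assms(3,4)
proof (induction T rule: finite_induct)
  case empty
  then show ?case using kspan_box_monomials_1[OF K, of 1] by (intro exI[of _ 1]) auto
next
  case (insert t T)
  then obtain e G where G: "G \<noteq> 0" "G \<in> kspan K (box_monomials (\<lambda>x. x) Z e)" "\<forall>t\<in>T. G * y t \<in> kspan K (box_monomials (\<lambda>x. x) Z e)" by auto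
  obtain e' f g where t: "f \<in> kspan K (box_monomials (\<lambda>x. x) Z e')" "g \<in> kspan K (box_monomials (\<lambda>x. x) Z e')" "g \<noteq> 0" "y t = f / g"
    using adjoin_fraction[OF K Z insert.prems[of t]] by auto
  have "G * g * y s \<in> kspan K (box_monomials (\<lambda>x. x) Z (e + e'))" if s: "s \<in> insert t T" for s
  proof (cases "s = t")
    case True
    have "G * g * y s = G * f" unfolding True t(4) using t(3) by simp
    then show ?thesis using kspan_box_monomials_mult[OF K G(2) t(1)] by metis
  next
    case False
    then have "(G * y s) * g \<in> kspan K (box_monomials (\<lambda>x. x) Z (e + e'))" using s G(3) by (intro kspan_box_monomials_mult[OF K _ t(2)]) auto
    then show ?thesis by (simp add: mult_ac)
  qed
  moreover have "G * g \<noteq> 0" "G * g \<in> kspan K (box_monomials (\<lambda>x. x) Z (e + e'))" using G t by (auto intro: kspan_box_monomials_mult[OF K])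
  ultimately show ?case by blast
qed

text \<open>Multiplication by a power of a common denominator moves the \<open>D ^ card T\<close> monomials in \<open>y\<close> into the span of the monomials in \<open>Z\<close>
  with exponents less than \<open>c * D\<close>.  These are at most \<open>(c * D) ^ card Z\<close>, too few for large \<open>D\<close> if \<open>card Z < card T\<close>.\<close>

lemma aindep_card_le:
  assumes K: "subfield_set K" and Z: "finite Z" and T: "finite T" and y: "\<And>t. t \<in> T \<Longrightarrow> y t \<in> adjoin K Z"
    and ind: "aindep K T y"
  shows "card T \<le> card Z"
proof (rule ccontr)
  assume "\<not> card T \<le> card Z"
  then have lt: "Suc (card Z) \<le> card T" by simp
  let ?M = "\<lambda>e. kspan K (box_monomials (\<lambda>x. x) Z e)"
  have "\<exists>e G. G \<noteq> 0 \<and> G \<in> ?M e \<and> (\<forall>t\<in>T. G * y t \<in> ?M e)"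
    by (rule common_denominator[OF K Z T]) (rule y)
  then obtain e G where "G \<noteq> 0" "G \<in> ?M e" "\<forall>t\<in>T. G * y t \<in> ?M e"
    by (elim exE conjE)
  note G = this(1,2) this(3)[rule_format]
  define c where "c = card T * (e + 2) + 1"
  define D where "D = c ^ card Z + 1"
  have D1: "D \<ge> 1" by (simp add: D_def)
  have "D ^ card T \<le> card (box_monomials (\<lambda>x. x) Z (c * D))"
  proof (rule aindep_count[OF K T ind finite_box_monomials[OF Z]])
    show "(G ^ D) ^ card T \<noteq> 0" using G by simp
    fix m assume m: "m \<in> Box T D"
    have "(\<Prod>t\<in>T. G ^ (D - m t) * (G * y t) ^ m t) \<in> ?M (card T * (D * e + 2) + 1)"
    proof (rule kspan_box_monomials_prod[OF K T])
      fix t assume t: "t \<in> T"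
      then have "m t < D" using m by (auto simp: Box_def)
      then have "(D - m t) * e + 1 + (m t * e + 1) = D * e + 2" by (simp flip: distrib_right)
      then show "G ^ (D - m t) * (G * y t) ^ m t \<in> ?M (D * e + 2)"
        using kspan_box_monomials_mult[OF K kspan_box_monomials_power[OF K G(2), of "D - m t"] kspan_box_monomials_power[OF K G(3)[OF t], of "m t"]] by simp
    qed
    moreover have "(\<Prod>t\<in>T. G ^ (D - m t) * (G * y t) ^ m t) = (G ^ D) ^ card T * box_monomial y T m"
    proof -
      have "(\<Prod>t\<in>T. G ^ (D - m t) * (G * y t) ^ m t) = (\<Prod>t\<in>T. G ^ D * y t ^ m t)"
      proof (rule prod.cong[OF refl])
        fix t assume "t \<in> T"
        then have "m t < D" using m by (auto simp: Box_def)
        then show "G ^ (D - m t) * (G * y t) ^ m t = G ^ D * y t ^ m t"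
          by (simp add: power_mult_distrib mult.assoc[symmetric] flip: power_add)
      qed
      then show ?thesis by (simp add: box_monomial_def prod.distrib)
    qed
    moreover have "card T * (D * e + 2) + 1 \<le> c * D"
    proof -
      have "card T * (D * e + 2) + 1 \<le> card T * (D * e + 2 * D) + 1 * D" using D1 by (intro add_mono mult_le_mono2) auto
      then show ?thesis by (simp add: c_def algebra_simps)
    qed
    ultimately show "(G ^ D) ^ card T * box_monomial y T m \<in> ?M (c * D)" using kspan_box_monomials_mono[OF K, where x = "\<lambda>x. x" and S = Z] by (metis (no_types))
  qed
  also have "\<dots> \<le> (c * D) ^ card Z" by (rule card_box_monomials[OF Z])
  finally have "D ^ card T \<le> c ^ card Z * D ^ card Z" by (simp add: power_mult_distrib)
  moreover have "D ^ Suc (card Z) \<le> D ^ card T" using lt D1 by (intro power_increasing) auto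
  ultimately have "D * D ^ card Z \<le> c ^ card Z * D ^ card Z" using order_trans by (metis power_Suc)
  then have "D \<le> c ^ card Z" using D1 by simp
  then show False by (simp add: D_def)
qed

lemma aindep_subset:
  assumes K: "subfield_set K" and T: "finite T" and sub: "S \<subseteq> T" and ind: "aindep K T y"
  shows "aindep K S y"
  unfolding aindep_def
proof (intro allI impI ballI, elim conjE)
  fix D c m
  assume c: "\<forall>m\<in>Box S D. c m \<in> K" "(\<Sum>m\<in>Box S D. c m * box_monomial y S m) = 0" and m: "m \<in> Box S D"
  show "c m = 0"
  proof (cases "D = 0")
    case True
    show ?thesis
    proof (cases "S = {}")
      case True
      then have "Box S D = {\<lambda>_. undefined}" by (simp add: Box_def)
      then show ?thesis using c(2) m True by (simp add: box_monomial_def)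
    next
      case False
      then show ?thesis using m True by (auto simp: Box_def PiE_def Pi_def)
    qed
  next
    case False
    define e where "e n i = (if i \<in> T - S then 0 else n i :: nat)" for n i
    have e_in: "e n \<in> Box T D" if "n \<in> Box S D" for n
      using that False sub unfolding Box_def e_def by (auto simp: PiE_def Pi_def extensional_def)
    have e_r: "restrict (e n) S = n" if "n \<in> Box S D" for n
      using that unfolding Box_def e_def by (intro ext) (auto simp: PiE_def extensional_def restrict_def)
    define c' where "c' n = (if n \<in> e ` Box S D then c (restrict n S) else 0)" for n
    have "(\<Sum>n\<in>Box T D. c' n * box_monomial y T n) = (\<Sum>n\<in>e ` Box S D. c' n * box_monomial y T n)"
      by (rule sum.mono_neutral_right) (use e_in T in \<open>auto simp: finite_Box c'_def\<close>)
    also have "\<dots> = (\<Sum>n\<in>Box S D. c' (e n) * box_monomial y T (e n))"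
      by (subst sum.reindex) (auto intro!: inj_on_inverseI[of _ "\<lambda>n. restrict n S"] e_r)
    also have "\<dots> = (\<Sum>n\<in>Box S D. c n * box_monomial y S n)"
    proof (rule sum.cong[OF refl])
      fix n assume n: "n \<in> Box S D"
      have "box_monomial y T (e n) = (\<Prod>i\<in>S. y i ^ e n i)"
        unfolding box_monomial_def by (rule prod.mono_neutral_right[OF T sub]) (auto simp: e_def)
      also have "\<dots> = box_monomial y S n" unfolding box_monomial_def by (rule prod.cong) (auto simp: e_def)
      finally show "c' (e n) * box_monomial y T (e n) = c n * box_monomial y S n" using n by (simp add: c'_def e_r)
    qed
    finally have "(\<Sum>n\<in>Box T D. c' n * box_monomial y T n) = 0" using c(2) by simp
    moreover have "\<forall>n\<in>Box T D. c' n \<in> K" using c(1) e_r by (auto simp: c'_def subfield_set_0[OF K])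
    ultimately have "\<forall>n\<in>Box T D. c' n = 0" using ind unfolding aindep_def by blast
    then have "c' (e m) = 0" using e_in[OF m] by blast
    then show ?thesis using m by (simp add: c'_def e_r)
  qed
qed

lemma box_monomial_insert:
  assumes "finite T" "t \<notin> T"
  shows "box_monomial y (insert t T) (n(t := j)) = y t ^ j * box_monomial y T n"
proof -
  have "(\<Prod>i\<in>T. y i ^ (n(t := j)) i) = box_monomial y T n" unfolding box_monomial_def
    by (rule prod.cong) (use assms in auto)
  then show ?thesis using assms by (simp add: box_monomial_def)
qed

lemma sum_Box_insert:
  assumes "finite T" "t \<notin> T"
  shows "(\<Sum>m\<in>Box (insert t T) D. f m) = (\<Sum>j<D. \<Sum>n\<in>Box T D. f (n(t := j)))"
proof -
  have "Box (insert t T) D = (\<lambda>(j, n). n(t := j)) ` ({..<D} \<times> Box T D)"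
    unfolding Box_def PiE_insert_eq by simp
  moreover have "inj_on (\<lambda>(j, n). n(t := j)) ({..<D} \<times> Box T D)"
    unfolding Box_def using assms(2) by (rule inj_combinator)
  ultimately show ?thesis
    by (simp add: sum.reindex sum.cartesian_product case_prod_unfold)
qed

text \<open>The premises allow one factor \<open>\<xi>\<close> to be absorbed with each factor \<open>A\<close>.\<close>

lemma reduce_power:
  fixes A \<xi> :: "'c::field"
  assumes K: "subfield_set K"
    and A0: "\<And>i v. v \<in> kspan K (V i) \<Longrightarrow> A * v \<in> kspan K (V (Suc i))"
    and A1: "\<And>i v. v \<in> V i \<Longrightarrow> A * \<xi> * v \<in> kspan K (V (Suc i))"
    and one: "1 \<in> kspan K (V 0)"
  shows "k \<le> i \<Longrightarrow> A ^ i * \<xi> ^ k \<in> kspan K (V i)"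
proof (induction i arbitrary: k)
  case (Suc i)
  show ?case
  proof (cases k)
    case 0
    then show ?thesis using A0[OF Suc.IH[of 0]] by simp
  next
    case (Suc k')
    then have v: "A ^ i * \<xi> ^ k' \<in> kspan K (V i)" using Suc.prems Suc.IH by simp
    have "A * \<xi> \<in> kspan K {A * \<xi>}" by (rule kspan_base) (simp_all add: subfield_set_1[OF K])
    from kspan_mult[OF K this v, of "V (Suc i)"] A1 have "(A * \<xi>) * (A ^ i * \<xi> ^ k') \<in> kspan K (V (Suc i))" by auto
    then show ?thesis by (simp add: Suc mult_ac)
  qed
qed (use one in simp)

text \<open>Let a relation with algebraic coefficients have degree \<open>d\<close> in \<open>y t\<close>, with leading coefficient \<open>A d\<close>, which is not \<open>0\<close>.  Each
  factor \<open>A d\<close> reduces a power of \<open>y t\<close>, so \<open>A d ^ N\<close> moves the \<open>N ^ (card T + 1)\<close> monomials with exponents less than \<open>N\<close> into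
  a space in which \<open>y t\<close> occurs with exponents less than \<open>d\<close>.  Its dimension over \<open>K\<close> is of the order of \<open>N ^ card T\<close>, which contradicts
  independence over \<open>K\<close>.  So all coefficients with respect to \<open>y t\<close> vanish, and the induction hypothesis applies to them.\<close>

lemma aindep_algebraic:
  assumes K: "subfield_set K" and "finite T" "aindep K T y"
  shows "aindep {x. algebraic_over K x} T y"
  using assms(2,3)
proof (induction T rule: finite_induct)
  case empty
  show ?case by (auto simp: aindep_def Box_def box_monomial_def)
next
  case (insert t T)
  define L where "L = {x. algebraic_over K x}"
  have L: "subfield_set L" unfolding L_def by (rule subfield_set_algebraic[OF K])
  have IH: "aindep L T y" unfolding L_def
    by (rule insert.IH) (rule aindep_subset[OF K _ _ insert.prems], use insert.hyps in auto)
  show ?case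
    unfolding L_def[symmetric] aindep_def
  proof (intro allI impI, elim conjE)
    fix D c
    assume c: "\<forall>m\<in>Box (insert t T) D. c m \<in> L" and rel: "(\<Sum>m\<in>Box (insert t T) D. c m * box_monomial y (insert t T) m) = 0"
    define A where "A j = (\<Sum>n\<in>Box T D. c (n(t := j)) * box_monomial y T n)" for j
    have upd: "n(t := j) \<in> Box (insert t T) D" if "n \<in> Box T D" "j < D" for n j
      using that unfolding Box_def by (auto simp: PiE_def extensional_def Pi_def)
    have relA: "(\<Sum>j<D. A j * y t ^ j) = 0"
      using rel unfolding sum_Box_insert[OF insert.hyps] box_monomial_insert[OF insert.hyps] A_def
      by (simp add: sum_distrib_left sum_distrib_right mult_ac)
    have "A j = 0" if "j < D" for j
    proof (rule ccontr)
      assume "A j \<noteq> 0"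
      define d where "d = Max {j. j < D \<and> A j \<noteq> 0}"
      have "d \<in> {j. j < D \<and> A j \<noteq> 0}" unfolding d_def by (rule Max_in) (use that \<open>A j \<noteq> 0\<close> in auto)
      then have d: "d < D" "A d \<noteq> 0" by auto
      have dmax: "A j = 0" if "j < D" "d < j" for j
      proof (rule ccontr)
        assume "A j \<noteq> 0"
        then have "j \<le> d" unfolding d_def by (intro Max_ge) (use that in auto)
        then show False using that by simp
      qed
      have red: "A d * y t ^ d = (\<Sum>j<d. (- A j) * y t ^ j)"
      proof -
        have "(\<Sum>j<D. A j * y t ^ j) = (\<Sum>j<Suc d. A j * y t ^ j)"
          by (rule sum.mono_neutral_right) (use d dmax in auto)
        then show ?thesis using relA by (simp add: sum_negf eq_neg_iff_add_eq_0 add.commute)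
      qed
      have "\<exists>W. finite W \<and> 1 \<in> W \<and> (\<forall>x\<in>c ` Box (insert t T) D. \<forall>w\<in>W. x * w \<in> kspan K W)"
        by (rule algebraic_stable_exists[OF K]) (use c insert.hyps in \<open>auto simp: finite_Box L_def\<close>)
      then obtain W where W: "finite W" "1 \<in> W" "\<forall>x\<in>c ` Box (insert t T) D. \<forall>w\<in>W. x * w \<in> kspan K W"
        by (elim exE conjE)
      \<comment> \<open>W spans the algebra generated over K by the coefficients; the maximum with 1 keeps V i nonempty\<close>
      define V where "V i = (\<lambda>(w, r, \<mu>). w * (y t ^ r * \<mu>)) ` (W \<times> {..<max 1 d} \<times> box_monomials y T (i * D + 1))" for i
      have VI: "w * (y t ^ r * \<mu>) \<in> V i" if "w \<in> W" "r < max 1 d" "\<mu> \<in> box_monomials y T (i * D + 1)" for w r \<mu> i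
        using that unfolding V_def by (intro image_eqI[of _ _ "(w, r, \<mu>)"]) auto
          have Amul: "A j * (w * (y t ^ r * \<mu>)) \<in> kspan K (V (Suc i))"
        if "j < D" "w \<in> W" "r < max 1 d" "\<mu> \<in> box_monomials y T (i * D + 1)" for j w r \<mu> i
      proof -
        have "A j * (w * (y t ^ r * \<mu>)) = (\<Sum>n\<in>Box T D. (c (n(t := j)) * w) * (y t ^ r * (box_monomial y T n * \<mu>)))"
          unfolding A_def sum_distrib_right by (rule sum.cong) (auto simp: mult_ac)
        also have "\<dots> \<in> kspan K (V (Suc i))"
        proof (rule kspan_sum)
          fix n assume n: "n \<in> Box T D"
          have "box_monomial y T n * \<mu> \<in> box_monomials y T (D + (i * D + 1))"
            by (rule box_monomials_mult) (use n that in \<open>auto simp: box_monomials_def\<close>)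
          then have b: "box_monomial y T n * \<mu> \<in> box_monomials y T (Suc i * D + 1)" by (simp add: add.assoc)
          have "c (n(t := j)) * w \<in> kspan K W" using W(3) upd[OF n that(1)] that(2) by blast
          moreover have "y t ^ r * (box_monomial y T n * \<mu>) \<in> kspan K {y t ^ r * (box_monomial y T n * \<mu>)}"
            by (rule kspan_base) (simp_all add: subfield_set_1[OF K])
          ultimately show "(c (n(t := j)) * w) * (y t ^ r * (box_monomial y T n * \<mu>)) \<in> kspan K (V (Suc i))"
            by (rule kspan_mult[OF K])
               (use VI[OF _ that(3) b] in \<open>auto intro!: kspan_base simp: subfield_set_1[OF K]\<close>)
        qed
        finally show ?thesis .
      qed
      have d0: "d \<noteq> 0"
      proof
        assume "d = 0"
        then have "A 0 = 0" using red by simp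
        then show False using d \<open>d = 0\<close> by simp
      qed
      have pw: "A d ^ i * y t ^ k \<in> kspan K (V i)" if "k \<le> i" for i k
      proof (rule reduce_power[OF K _ _ _ that])
        show "A d * v \<in> kspan K (V (Suc i))" if "v \<in> kspan K (V i)" for i v
        proof -
          have "A d \<in> kspan K {A d}" by (rule kspan_base) (simp_all add: subfield_set_1[OF K])
          then show ?thesis using that
          proof (rule kspan_mult[OF K])
            fix a v assume a: "a \<in> {A d}" and "v \<in> V i"
            then obtain w r \<mu> where v': "v = w * (y t ^ r * \<mu>)" "w \<in> W" "r < max 1 d" "\<mu> \<in> box_monomials y T (i * D + 1)"
              by (auto simp: V_def)
            show "a * v \<in> kspan K (V (Suc i))" using a Amul[OF d(1) v'(2-4)] by (simp add: v'(1))
          qed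
        qed
        show "A d * y t * v \<in> kspan K (V (Suc i))" if v: "v \<in> V i" for i v
        proof -
          obtain w r \<mu> where v': "v = w * (y t ^ r * \<mu>)" "w \<in> W" "r < max 1 d" "\<mu> \<in> box_monomials y T (i * D + 1)"
            using v by (auto simp: V_def)
          show ?thesis
          proof (cases "Suc r < d")
            case True
            then show ?thesis using Amul[OF d(1) v'(2) _ v'(4), of "Suc r"] by (simp add: v'(1) mult_ac)
          next
            case False
            then have r: "Suc r = d" using v'(3) d0 by auto
            have "A d * y t * v = (A d * y t ^ d) * (w * \<mu>)" unfolding v'(1) r[symmetric] by (simp add: mult_ac)
            also have "\<dots> = (\<Sum>j<d. (- 1) * (A j * (w * (y t ^ j * \<mu>))))"
              unfolding red sum_distrib_right by (rule sum.cong) (auto simp: mult_ac)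
            also have "\<dots> \<in> kspan K (V (Suc i))"
              using d v' by (intro kspan_sum kspan_scale[OF K] Amul subfield_set_uminus[OF K] subfield_set_1[OF K]) auto
            finally show ?thesis .
          qed
        qed
        have "1 * (y t ^ 0 * 1) \<in> V 0" by (rule VI) (use W in \<open>auto intro!: box_monomials_one\<close>)
        then show "1 \<in> kspan K (V 0)" by (intro kspan_base[OF subfield_set_1[OF K]]) simp
      qed
      define C where "C = card W * max 1 d * (D + 2) ^ card T"
      define N where "N = C + 1"
      have N1: "N \<ge> 1" by (simp add: N_def)
      define U where "U = (\<lambda>(w, r, \<mu>). w * (y t ^ r * \<mu>)) ` (W \<times> {..<max 1 d} \<times> box_monomials y T ((D + 2) * N))"
      have finU: "finite U" unfolding U_def using W insert.hyps by (auto simp: finite_box_monomials)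
      have "N ^ card (insert t T) \<le> card U"
      proof (rule aindep_count[OF K _ insert.prems finU])
        show "finite (insert t T)" using insert.hyps by simp
        show "A d ^ N \<noteq> 0" using d by simp
        fix m assume m: "m \<in> Box (insert t T) N"
        have mt: "m t < N" using m by (auto simp: Box_def)
        have b: "box_monomial y (insert t T) m = y t ^ m t * box_monomial y T m"
          using insert.hyps by (simp add: box_monomial_def)
        have bm: "box_monomial y T m \<in> box_monomials y T N" unfolding box_monomial_def by (rule box_monomials_I) (use m in \<open>auto simp: Box_def\<close>)
        have "A d ^ N * y t ^ m t \<in> kspan K (V N)" using mt by (intro pw) simp
        moreover have "box_monomial y T m \<in> kspan K {box_monomial y T m}" by (rule kspan_base) (simp_all add: subfield_set_1[OF K])
        ultimately have "(A d ^ N * y t ^ m t) * box_monomial y T m \<in> kspan K U"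
        proof (rule kspan_mult[OF K])
          fix v b assume v: "v \<in> V N" and b: "b \<in> {box_monomial y T m}"
          obtain w r \<mu> where v': "v = w * (y t ^ r * \<mu>)" "w \<in> W" "r < max 1 d" "\<mu> \<in> box_monomials y T (N * D + 1)"
            using v by (auto simp: V_def)
          have "\<mu> * box_monomial y T m \<in> box_monomials y T (N * D + 1 + N)" by (rule box_monomials_mult[OF v'(4) bm])
          moreover have "N * D + 1 + N \<le> (D + 2) * N" using N1 by (simp add: algebra_simps)
          ultimately have "\<mu> * box_monomial y T m \<in> box_monomials y T ((D + 2) * N)" using box_monomials_mono by blast
          then have "w * (y t ^ r * (\<mu> * box_monomial y T m)) \<in> U" unfolding U_def using v'
            by (intro image_eqI[of _ _ "(w, r, \<mu> * box_monomial y T m)"]) auto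
          then show "v * b \<in> kspan K U" using b by (intro kspan_base[OF subfield_set_1[OF K]]) (simp add: v'(1) mult.assoc)
        qed
        then show "A d ^ N * box_monomial y (insert t T) m \<in> kspan K U" by (simp add: b mult.assoc)
      qed
      also have "card U \<le> card (W \<times> {..<max 1 d} \<times> box_monomials y T ((D + 2) * N))"
        unfolding U_def by (rule card_image_le) (use W insert.hyps in \<open>auto simp: finite_box_monomials\<close>)
      also have "\<dots> = card W * (max 1 d * card (box_monomials y T ((D + 2) * N)))"
        by (simp add: card_cartesian_product)
      also have "\<dots> \<le> card W * (max 1 d * ((D + 2) * N) ^ card T)"
        by (intro mult_le_mono2 card_box_monomials insert.hyps)
      also have "\<dots> = C * N ^ card T" unfolding C_def power_mult_distrib by (simp only: mult_ac)
      finally have "N * N ^ card T \<le> C * N ^ card T" using insert.hyps by simp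
      then have "N \<le> C" using N1 by simp
      then show False by (simp add: N_def)
    qed
    then have "\<forall>m\<in>Box T D. c (m(t := j)) = 0" if "j < D" for j
      using IH[unfolded aindep_def, rule_format, of D "\<lambda>n. c (n(t := j))"] c upd that by (auto simp: A_def)
    then show "\<forall>m\<in>Box (insert t T) D. c m = 0"
      unfolding Box_def PiE_insert_eq by auto
  qed
qed

definition box_exponent :: "'i set \<Rightarrow> ('i \<Rightarrow> nat) \<Rightarrow> ('i \<Rightarrow>\<^sub>0 nat)" where
  "box_exponent S m = Abs_poly_mapping (\<lambda>i. if i \<in> S then m i else 0)"

lemma lookup_box_exponent:
  "finite S \<Longrightarrow> Poly_Mapping.lookup (box_exponent S m) i = (if i \<in> S then m i else 0)"
  unfolding box_exponent_def by (subst Abs_poly_mapping_inverse) auto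

lemma keys_box_exponent: "finite S \<Longrightarrow> Poly_Mapping.keys (box_exponent S m) \<subseteq> S"
  by (auto simp: in_keys_iff lookup_box_exponent split: if_splits)

lemma box_exponent_inj: "finite S \<Longrightarrow> inj_on (box_exponent S) (Box S D)"
proof (rule inj_onI)
  fix m n assume S: "finite S" and m: "m \<in> Box S D" and n: "n \<in> Box S D" and e: "box_exponent S m = box_exponent S n"
  have "m i = n i" for i
  proof (cases "i \<in> S")
    case True
    then show ?thesis using lookup_box_exponent[OF S, of m i] lookup_box_exponent[OF S, of n i] e by simp
  next
    case False
    then show ?thesis using m n unfolding Box_def by (auto simp: PiE_def extensional_def)
  qed
  then show "m = n" by (rule ext)
qed

lemma mmon_box_exponent: "finite S \<Longrightarrow> mmon x (box_exponent S m) = box_monomial x S m"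
  unfolding box_monomial_def by (subst mmon_superset[OF _ keys_box_exponent]) (auto simp: lookup_box_exponent intro: prod.cong)

text \<open>The passage from sums over a box of exponents to formal polynomials.\<close>

definition box_poly :: "'i set \<Rightarrow> nat \<Rightarrow> (('i \<Rightarrow> nat) \<Rightarrow> 'r::comm_ring_1) \<Rightarrow> (('i \<Rightarrow>\<^sub>0 nat) \<Rightarrow>\<^sub>0 'r)" where
  "box_poly S D c = (\<Sum>m\<in>Box S D. Poly_Mapping.single (box_exponent S m) (c m))"

lemma lookup_box_poly:
  assumes S: "finite S" and m: "m \<in> Box S D"
  shows "Poly_Mapping.lookup (box_poly S D c) (box_exponent S m) = c m"
proof -
  have "Poly_Mapping.lookup (box_poly S D c) (box_exponent S m)
      = (\<Sum>n\<in>Box S D. if n = m then c m else 0)"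
    unfolding box_poly_def lookup_sum
    by (rule sum.cong[OF refl]) (use m inj_on_eq_iff[OF box_exponent_inj[OF S]] in \<open>auto simp: lookup_single when_def\<close>)
  then show ?thesis using m finite_Box[OF S, of D] by simp
qed

lemma keys_box_poly: "Poly_Mapping.keys (box_poly S D c) \<subseteq> box_exponent S ` Box S D"
proof -
  have "Poly_Mapping.keys (box_poly S D c) \<subseteq> (\<Union>m\<in>Box S D. Poly_Mapping.keys (Poly_Mapping.single (box_exponent S m) (c m)))"
    unfolding box_poly_def by (rule keys_sum)
  also have "\<dots> \<subseteq> box_exponent S ` Box S D" by (auto split: if_splits)
  finally show ?thesis .
qed

lemma mev_box_poly:
  assumes "rhom \<phi>" "finite S"
  shows "mev \<phi> x (box_poly S D c) = (\<Sum>m\<in>Box S D. \<phi> (c m) * box_monomial x S m)"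
  unfolding box_poly_def mev_sum[OF assms(1)]
  by (rule sum.cong[OF refl]) (simp add: mev_single rhom_0[OF assms(1)] mmon_box_exponent[OF assms(2)])

lemma eval_at_names_mev: "eval_at_names P = mev (\<lambda>x. x) (\<lambda>x. x) P"
  by (simp add: eval_at_names_def mev_def mmon_def)

lemma alg_indep_imp_aindep:
  assumes K: "subfield_set K" and B: "finite B" and ind: "alg_indep K B"
  shows "aindep K B (\<lambda>x. x)"
  unfolding aindep_def
proof (intro allI impI ballI, elim conjE)
  fix D c m assume c: "\<forall>m\<in>Box B D. c m \<in> K" "(\<Sum>m\<in>Box B D. c m * box_monomial (\<lambda>x. x) B m) = 0" and m: "m \<in> Box B D"
  let ?P = "box_poly B D c"
  have "Poly_Mapping.lookup ?P n \<in> K" for n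
  proof (cases "n \<in> Poly_Mapping.keys ?P")
    case True
    then obtain m' where "m' \<in> Box B D" "n = box_exponent B m'" using keys_box_poly by blast
    then show ?thesis using c lookup_box_poly[OF B] by metis
  next
    case False
    then show ?thesis by (simp add: in_keys_iff subfield_set_0[OF K])
  qed
  moreover have "Poly_Mapping.keys n \<subseteq> B" if "n \<in> Poly_Mapping.keys ?P" for n
    using that keys_box_poly[of B D c] keys_box_exponent[OF B] by blast
  moreover have "eval_at_names ?P = 0"
    unfolding eval_at_names_mev mev_box_poly[OF rhom_id B] using c by simp
  ultimately have "?P = 0" using ind unfolding alg_indep_def by blast
  then show "c m = 0" using lookup_box_poly[OF B m, of c] by simp
qed

lemma aindep_imp_inj:
  assumes K: "subfield_set K" and T: "finite T" and ind: "aindep K T y"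
  shows "inj_on y T"
proof (rule inj_onI, rule ccontr)
  fix i j assume i: "i \<in> T" and j: "j \<in> T" and e: "y i = y j" and ne: "i \<noteq> j"
  define u where "u i = restrict (\<lambda>k. if k = i then 1 else 0 :: nat) T" for i
  have uB: "u i \<in> Box T 2" for i by (auto simp: u_def Box_def)
  have bu: "box_monomial y T (u k) = y k" if "k \<in> T" for k
  proof -
    have "box_monomial y T (u k) = (\<Prod>i\<in>T. if i = k then y k else 1)" unfolding box_monomial_def u_def by (rule prod.cong) auto
    then show ?thesis using T that by simp
  qed
  have "u i i \<noteq> u j i" using ne i by (simp add: u_def)
  then have un: "u i \<noteq> u j" by metis
  define c where "c m = (if m = u i then 1 else if m = u j then - 1 else 0 :: 'a)" for m
  have "(\<Sum>m\<in>Box T 2. c m * box_monomial y T m) = (\<Sum>m\<in>{u i, u j}. c m * box_monomial y T m)"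
    by (rule sum.mono_neutral_right) (auto simp: finite_Box[OF T] uB c_def)
  also have "\<dots> = 0" using un bu i j e by (simp add: c_def)
  finally have "(\<Sum>m\<in>Box T 2. c m * box_monomial y T m) = 0" .
  moreover have "\<forall>m\<in>Box T 2. c m \<in> K" by (simp add: c_def subfield_set_0[OF K] subfield_set_1[OF K] subfield_set_uminus[OF K])
  ultimately have "\<forall>m\<in>Box T 2. c m = 0" using ind unfolding aindep_def by blast
  then have "c (u i) = 0" using uB by blast
  then show False by (simp add: c_def)
qed

lemma aindep_imp_alg_indep:
  assumes K: "subfield_set K" and T: "finite T" and ind: "aindep K T y"
  shows "alg_indep K (y ` T)"
  unfolding alg_indep_def
proof (intro allI impI, elim conjE)
  fix P
  assume P: "\<forall>m. Poly_Mapping.lookup P m \<in> K" "\<forall>m\<in>Poly_Mapping.keys P. Poly_Mapping.keys m \<subseteq> y ` T"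
    and ev: "eval_at_names P = 0"
  have inj: "inj_on y T" by (rule aindep_imp_inj[OF K T ind])
  define f where "f (n :: _ \<Rightarrow>\<^sub>0 nat) = restrict (\<lambda>i. Poly_Mapping.lookup n (y i)) T" for n
  define D where "D = 1 + (\<Sum>n\<in>Poly_Mapping.keys P. \<Sum>i\<in>T. Poly_Mapping.lookup n (y i))"
  have fB: "f n \<in> Box T D" if n: "n \<in> Poly_Mapping.keys P" for n
  proof -
    have "Poly_Mapping.lookup n (y i) < D" if "i \<in> T" for i
    proof -
      have "Poly_Mapping.lookup n (y i) \<le> (\<Sum>i\<in>T. Poly_Mapping.lookup n (y i))"
        by (rule member_le_sum) (use that T in auto)
      also have "\<dots> \<le> (\<Sum>n\<in>Poly_Mapping.keys P. \<Sum>i\<in>T. Poly_Mapping.lookup n (y i))"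
        by (rule member_le_sum[of n]) (use n in auto)
      finally show ?thesis by (simp add: D_def)
    qed
    then show ?thesis by (auto simp: Box_def f_def)
  qed
  have finj: "inj_on f (Poly_Mapping.keys P)"
  proof (rule inj_onI)
    fix n n' assume n: "n \<in> Poly_Mapping.keys P" "n' \<in> Poly_Mapping.keys P" and e: "f n = f n'"
    have "Poly_Mapping.lookup n x = Poly_Mapping.lookup n' x" for x
    proof (cases "x \<in> y ` T")
      case True
      then obtain i where i: "i \<in> T" "x = y i" by blast
      then show ?thesis using fun_cong[OF e, of i] by (simp add: f_def)
    next
      case False
      then have "x \<notin> Poly_Mapping.keys n" "x \<notin> Poly_Mapping.keys n'" using P(2) n by blast+
      then show ?thesis by (simp add: in_keys_iff)
    qed
    then show "n = n'" by (rule poly_mapping_eqI)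
  qed
  have fb: "box_monomial y T (f n) = mmon (\<lambda>x. x) n" if n: "n \<in> Poly_Mapping.keys P" for n
  proof -
    have "mmon (\<lambda>x. x) n = (\<Prod>x\<in>y ` T. x ^ Poly_Mapping.lookup n x)"
      by (rule mmon_superset) (use T P(2) n in auto)
    also have "\<dots> = (\<Prod>i\<in>T. y i ^ Poly_Mapping.lookup n (y i))" by (simp add: prod.reindex[OF inj])
    also have "\<dots> = box_monomial y T (f n)" unfolding box_monomial_def f_def by (rule prod.cong) auto
    finally show ?thesis by simp
  qed
  define c where "c m = (if m \<in> f ` Poly_Mapping.keys P then Poly_Mapping.lookup P (inv_into (Poly_Mapping.keys P) f m) else 0)" for m
  have cf: "c (f n) = Poly_Mapping.lookup P n" if "n \<in> Poly_Mapping.keys P" for n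
    using that by (simp add: c_def inv_into_f_f[OF finj])
  have "(\<Sum>m\<in>Box T D. c m * box_monomial y T m) = (\<Sum>m\<in>f ` Poly_Mapping.keys P. c m * box_monomial y T m)"
    by (rule sum.mono_neutral_right) (use fB T in \<open>auto simp: finite_Box c_def\<close>)
  also have "\<dots> = (\<Sum>n\<in>Poly_Mapping.keys P. Poly_Mapping.lookup P n * mmon (\<lambda>x. x) n)"
    by (simp add: sum.reindex[OF finj] cf fb)
  also have "\<dots> = 0" using ev by (simp add: eval_at_names_mev mev_def)
  finally have "\<forall>m\<in>Box T D. c m = 0"
    using ind[unfolded aindep_def, rule_format, of D c] P(1) by (auto simp: c_def subfield_set_0[OF K])
  then have "Poly_Mapping.keys P = {}" using cf fB by (metis in_keys_iff all_not_in_conv)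
  then show "P = 0" by simp
qed

lemma transc_deg_eqI:
  assumes K: "subfield_set K" and S: "finite S" "card S \<le> card B"
    and B: "finite B" "B \<subseteq> adjoin K S" "alg_indep K B"
  shows "transc_deg K (adjoin K S) = enat (card B)"
  unfolding transc_deg_def
proof (rule antisym)
  show "(SUP B\<in>{B. finite B \<and> B \<subseteq> adjoin K S \<and> alg_indep K B}. enat (card B)) \<le> enat (card B)"
  proof (rule SUP_least)
    fix B' assume "B' \<in> {B. finite B \<and> B \<subseteq> adjoin K S \<and> alg_indep K B}"
    then have "card B' \<le> card S"
      using aindep_card_le[OF K S(1), of B' "\<lambda>x. x"] alg_indep_imp_aindep[OF K] by auto
    then show "enat (card B') \<le> enat (card B)" using S(2) by simp
  qed
  show "enat (card B) \<le> (SUP B\<in>{B. finite B \<and> B \<subseteq> adjoin K S \<and> alg_indep K B}. enat (card B))"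
    by (rule SUP_upper) (use B in simp)
qed

section \<open>Hyperderivatives of separable elements\<close>

abbreviation Kac :: "'a::{field,finite} fls alg_closure set" where "Kac \<equiv> range to_ac"

lemma subfield_set_Kac: "subfield_set Kac"
  unfolding subfield_set_def
  by (auto simp flip: to_ac_1 to_ac_add to_ac_mult to_ac_minus to_ac_inverse)

lemma rhom_to_ac: "rhom to_ac" by (simp add: rhom_def)

lemma CHAR_ac: "CHAR('a::{field,finite} fls alg_closure) = CHAR('a)" by simp

lemma kspan_power:
  fixes W :: "'a::{field,finite} fls alg_closure set"
  assumes "v \<in> kspan Kac W"
  shows "v ^ (CARD('a) ^ N) \<in> kspan Kac ((\<lambda>w. w ^ (CARD('a) ^ N)) ` W)"
  using assms
proof (induction rule: kspan.induct)
  case zero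
  then show ?case by (simp add: power_0_left frobenius_pow_pos kspan.zero)
next
  case (step a v x)
  have "a ^ (CARD('a) ^ N) * v ^ (CARD('a) ^ N) + x ^ (CARD('a) ^ N) \<in> kspan Kac ((\<lambda>w. w ^ (CARD('a) ^ N)) ` W)"
    by (rule kspan.step[OF subfield_set_power[OF subfield_set_Kac step.hyps(1)] _ step.IH]) (use step.hyps in blast)
  then show ?case by (simp add: frobenius_pow_add[OF CHAR_ac] power_mult_distrib)
qed

text \<open>\<open>W\<close> spans a \<open>k\<^sub>\<infinity>\<close>-algebra \<open>V\<close> of finite dimension which is generated as a vector space by its \<open>q\<close>-th powers.  This is a form of
  separability that is evidently stable under sums and products of elements.\<close>

definition sepspan :: "'a::{field,finite} fls alg_closure set \<Rightarrow> bool" where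
  "sepspan W \<longleftrightarrow> finite W \<and> 1 \<in> kspan Kac W \<and> (\<forall>v\<in>W. \<forall>w\<in>W. v * w \<in> kspan Kac W) \<and>
     W \<subseteq> kspan Kac ((\<lambda>w. w ^ CARD('a)) ` W)"

definition Sep :: "'a::{field,finite} fls alg_closure set" where
  "Sep = {x. \<exists>W. sepspan W \<and> x \<in> kspan Kac W}"

lemma sepspan_mult:
  assumes "sepspan W" "x \<in> kspan Kac W" "y \<in> kspan Kac W" shows "x * y \<in> kspan Kac W"
  by (rule kspan_mult[OF subfield_set_Kac assms(2,3)]) (use assms(1) in \<open>auto simp: sepspan_def\<close>)

lemma sepspan_power: "sepspan W \<Longrightarrow> x \<in> kspan Kac W \<Longrightarrow> x ^ n \<in> kspan Kac W"
  by (induction n) (auto intro: sepspan_mult simp: sepspan_def)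

lemma sepspan_level:
  fixes W :: "'a::{field,finite} fls alg_closure set"
  assumes W: "sepspan W"
  shows "W \<subseteq> kspan Kac ((\<lambda>w. w ^ (CARD('a) ^ N)) ` W)"
proof (induction N)
  case 0
  show ?case by (auto intro: kspan_base subfield_set_1[OF subfield_set_Kac])
next
  case (Suc N)
  have "w ^ (CARD('a) ^ N) \<in> kspan Kac ((\<lambda>w. w ^ (CARD('a) ^ Suc N)) ` W)" if "w \<in> W" for w
  proof -
    have "w \<in> kspan Kac ((\<lambda>w. w ^ CARD('a)) ` W)" using W that by (auto simp: sepspan_def)
    from kspan_power[OF this, of N] show ?thesis by (simp add: image_image power_mult)
  qed
  then have "(\<lambda>w. w ^ (CARD('a) ^ N)) ` W \<subseteq> kspan Kac ((\<lambda>w. w ^ (CARD('a) ^ Suc N)) ` W)" by blast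
  from kspan_subset[OF subfield_set_Kac this] Suc.IH show ?case by blast
qed

text \<open>A spanning set of least size.  Its \<open>Q\<close>-th powers span the same space, hence are linearly independent.\<close>

lemma sepspan_basis:
  fixes W :: "'a::{field,finite} fls alg_closure set"
  assumes W: "sepspan W"
  shows "\<exists>W'. sepspan W' \<and> kspan Kac W' = kspan Kac W \<and>
           (\<forall>N c. (\<forall>w\<in>W'. c w \<in> Kac) \<and> (\<Sum>w\<in>W'. c w * w ^ (CARD('a) ^ N)) = 0 \<longrightarrow> (\<forall>w\<in>W'. c w = 0))"
proof -
  let ?P = "\<lambda>W'. finite W' \<and> kspan Kac W' = kspan Kac W"
  have "?P W" using W by (simp add: sepspan_def)
  then obtain W' where W': "?P W'" and min: "\<And>V. ?P V \<Longrightarrow> card W' \<le> card V"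
    using ex_has_least_nat[of ?P W card] by blast
  have sub: "W' \<subseteq> kspan Kac W" using W' kspan_base[OF subfield_set_1[OF subfield_set_Kac]] by blast
  have s: "sepspan W'"
    unfolding sepspan_def
  proof (intro conjI ballI)
    show "1 \<in> kspan Kac W'" using W W' by (simp add: sepspan_def)
    show "v * w \<in> kspan Kac W'" if "v \<in> W'" "w \<in> W'" for v w
      using sepspan_mult[OF W, of v w] sub that W' by auto
    have "(\<lambda>w. w ^ CARD('a)) ` W \<subseteq> kspan Kac ((\<lambda>w. w ^ CARD('a)) ` W')"
    proof
      fix u assume "u \<in> (\<lambda>w. w ^ CARD('a)) ` W"
      then obtain w where w: "w \<in> W" "u = w ^ CARD('a)" by blast
      then have "w \<in> kspan Kac W'" using W' kspan_base[OF subfield_set_1[OF subfield_set_Kac]] by blast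
      from kspan_power[OF this, of 1] show "u \<in> kspan Kac ((\<lambda>w. w ^ CARD('a)) ` W')" by (simp add: w)
    qed
    from kspan_subset[OF subfield_set_Kac this] have "kspan Kac ((\<lambda>w. w ^ CARD('a)) ` W) \<subseteq> kspan Kac ((\<lambda>w. w ^ CARD('a)) ` W')" .
    moreover have "kspan Kac W \<subseteq> kspan Kac ((\<lambda>w. w ^ CARD('a)) ` W)"
      by (rule kspan_subset[OF subfield_set_Kac]) (use W in \<open>simp add: sepspan_def\<close>)
    ultimately show "W' \<subseteq> kspan Kac ((\<lambda>w. w ^ CARD('a)) ` W')" using sub by blast
  qed (use W' in simp)
  moreover have "\<forall>w\<in>W'. c w = 0" if c: "\<forall>w\<in>W'. c w \<in> Kac" and 0: "(\<Sum>w\<in>W'. c w * w ^ (CARD('a) ^ N)) = 0" for N c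
  proof (rule ballI, rule ccontr)
    fix w0 assume w0: "w0 \<in> W'" "c w0 \<noteq> 0"
    let ?Q = "CARD('a) ^ N"
    let ?V = "(\<lambda>w. w ^ ?Q) ` (W' - {w0})"
    have V: "w ^ ?Q \<in> kspan Kac ?V" if w: "w \<in> W' - {w0}" for w
      by (rule kspan_base[OF subfield_set_1[OF subfield_set_Kac]]) (use w in blast)
    have "c w0 * w0 ^ ?Q = - (\<Sum>w\<in>W' - {w0}. c w * w ^ ?Q)"
      using 0 sum.remove[of W' w0 "\<lambda>w. c w * w ^ ?Q"] W' w0 by (simp add: eq_neg_iff_add_eq_0)
    then have "inverse (c w0) * (c w0 * w0 ^ ?Q) = inverse (c w0) * - (\<Sum>w\<in>W' - {w0}. c w * w ^ ?Q)" by simp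
    then have "w0 ^ ?Q = inverse (c w0) * - (\<Sum>w\<in>W' - {w0}. c w * w ^ ?Q)"
      using w0(2) by (simp add: mult.assoc[symmetric])
    also have "\<dots> = (\<Sum>w\<in>W' - {w0}. (- inverse (c w0) * c w) * w ^ ?Q)"
      by (simp add: sum_distrib_left sum_negf[symmetric] mult.assoc)
    also have "\<dots> \<in> kspan Kac ?V"
    proof (rule kspan_sum)
      fix w assume w: "w \<in> W' - {w0}"
      have "- inverse (c w0) * c w \<in> Kac" using c w w0
        by (intro subfield_set_mult[OF subfield_set_Kac] subfield_set_uminus[OF subfield_set_Kac] subfield_set_inverse[OF subfield_set_Kac]) auto
      then show "(- inverse (c w0) * c w) * w ^ ?Q \<in> kspan Kac ?V"
        using V[OF w] by (rule kspan_scale[OF subfield_set_Kac])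
    qed
    finally have "(\<lambda>w. w ^ ?Q) ` W' \<subseteq> kspan Kac ?V" using V by blast
    from kspan_subset[OF subfield_set_Kac this] sepspan_level[OF s, of N]
    have "W' \<subseteq> kspan Kac ?V" by blast
    from kspan_subset[OF subfield_set_Kac this] have "kspan Kac W' \<subseteq> kspan Kac ?V" .
    moreover have "kspan Kac ?V \<subseteq> kspan Kac W'"
    proof (rule kspan_subset[OF subfield_set_Kac])
      show "?V \<subseteq> kspan Kac W'"
        using sepspan_power[OF s kspan_base[OF subfield_set_1[OF subfield_set_Kac]]] by blast
    qed
    ultimately have "?P ?V" using W' by simp
    then have "card W' \<le> card ?V" by (rule min)
    also have "\<dots> \<le> card (W' - {w0})" by (rule card_image_le) (use W' in simp)
    also have "\<dots> < card W'" using w0 W' by (intro card_Diff1_less) auto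
    finally show False by simp
  qed
  ultimately show ?thesis using W' by blast
qed

text \<open>The products of the elements of two spanning sets span the compositum.\<close>

lemma sepspan_join:
  fixes W1 W2 :: "'a::{field,finite} fls alg_closure set"
  assumes 1: "sepspan W1" and 2: "sepspan W2"
  shows "\<exists>W. sepspan W \<and> kspan Kac W1 \<subseteq> kspan Kac W \<and> kspan Kac W2 \<subseteq> kspan Kac W"
proof -
  define W where "W = (\<lambda>(v, w). v * w) ` (W1 \<times> W2)"
  have base: "v * w \<in> kspan Kac W" if "v \<in> W1" "w \<in> W2" for v w
    by (rule kspan_base[OF subfield_set_1[OF subfield_set_Kac]]) (use that in \<open>auto simp: W_def\<close>)
  have prod: "x * y \<in> kspan Kac W" if "x \<in> kspan Kac W1" "y \<in> kspan Kac W2" for x y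
    by (rule kspan_mult[OF subfield_set_Kac that base])
  have one: "1 \<in> kspan Kac W1" "1 \<in> kspan Kac W2" using 1 2 by (simp_all add: sepspan_def)
  have "sepspan W"
    unfolding sepspan_def
  proof (intro conjI ballI)
    show "finite W" using 1 2 by (simp add: W_def sepspan_def)
    show "1 \<in> kspan Kac W" using prod[OF one] by simp
    fix v w assume "v \<in> W" "w \<in> W"
    then obtain v1 v2 w1 w2 where v: "v1 \<in> W1" "v2 \<in> W2" "v = v1 * v2" and w: "w1 \<in> W1" "w2 \<in> W2" "w = w1 * w2"
      by (auto simp: W_def)
    have "(v1 * w1) * (v2 * w2) \<in> kspan Kac W"
      by (rule prod) (use 1 2 v w in \<open>auto simp: sepspan_def\<close>)
    then show "v * w \<in> kspan Kac W" by (simp add: v w mult_ac)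
  next
    show "W \<subseteq> kspan Kac ((\<lambda>w. w ^ CARD('a)) ` W)"
    proof
      fix u assume "u \<in> W"
      then obtain v w where v: "v \<in> W1" "w \<in> W2" "u = v * w" by (auto simp: W_def)
      have "v \<in> kspan Kac ((\<lambda>w. w ^ CARD('a)) ` W1)" "w \<in> kspan Kac ((\<lambda>w. w ^ CARD('a)) ` W2)"
        using 1 2 v by (auto simp: sepspan_def)
      then have "v * w \<in> kspan Kac ((\<lambda>w. w ^ CARD('a)) ` W)"
      proof (rule kspan_mult[OF subfield_set_Kac])
        fix a b assume "a \<in> (\<lambda>w. w ^ CARD('a)) ` W1" "b \<in> (\<lambda>w. w ^ CARD('a)) ` W2"
        then obtain a' b' where "a' \<in> W1" "b' \<in> W2" "a = a' ^ CARD('a)" "b = b' ^ CARD('a)" by blast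
        then have "a * b \<in> (\<lambda>w. w ^ CARD('a)) ` W"
          unfolding W_def by (intro image_eqI[of _ _ "a' * b'"]) (auto simp: power_mult_distrib)
        then show "a * b \<in> kspan Kac ((\<lambda>w. w ^ CARD('a)) ` W)"
          by (rule kspan_base[OF subfield_set_1[OF subfield_set_Kac]])
      qed
      then show "u \<in> kspan Kac ((\<lambda>w. w ^ CARD('a)) ` W)" by (simp add: v)
    qed
  qed
  moreover have "kspan Kac W1 \<subseteq> kspan Kac W" using prod[OF _ one(2)] by auto
  moreover have "kspan Kac W2 \<subseteq> kspan Kac W" using prod[OF one(1)] by auto
  ultimately show ?thesis by blast
qed

lemma sepspan_1: "sepspan {1}"
  by (auto simp: sepspan_def intro: kspan_base subfield_set_1[OF subfield_set_Kac])

lemma Sep_base: "to_ac f \<in> Sep"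
proof -
  have "to_ac f * 1 \<in> kspan Kac {1}"
    by (intro kspan_scale[OF subfield_set_Kac] kspan_base[OF subfield_set_1[OF subfield_set_Kac]]) auto
  then show ?thesis unfolding Sep_def using sepspan_1 by auto
qed

lemma Sep_common:
  assumes "finite S" "S \<subseteq> Sep"
  shows "\<exists>W. sepspan W \<and> S \<subseteq> kspan Kac W"
  using assms
proof (induction S rule: finite_induct)
  case empty
  then show ?case using sepspan_1 by blast
next
  case (insert x S)
  then obtain W where W: "sepspan W" "S \<subseteq> kspan Kac W" by auto
  obtain V where V: "sepspan V" "x \<in> kspan Kac V" using insert.prems by (auto simp: Sep_def)
  from sepspan_join[OF W(1) V(1)] W V show ?case by blast
qed

lemma Sep_add: "x \<in> Sep \<Longrightarrow> y \<in> Sep \<Longrightarrow> x + y \<in> Sep"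
  and Sep_mult: "x \<in> Sep \<Longrightarrow> y \<in> Sep \<Longrightarrow> x * y \<in> Sep"
proof -
  have "x + y \<in> Sep \<and> x * y \<in> Sep" if xy: "x \<in> Sep" "y \<in> Sep"
  proof -
    from Sep_common[of "{x, y}"] xy obtain W where W: "sepspan W" "{x, y} \<subseteq> kspan Kac W" by auto
    have "x + y \<in> kspan Kac W" "x * y \<in> kspan Kac W" using W by (auto intro: kspan_add sepspan_mult)
    then show ?thesis using W(1) by (auto simp: Sep_def)
  qed
  then show "x \<in> Sep \<Longrightarrow> y \<in> Sep \<Longrightarrow> x + y \<in> Sep" "x \<in> Sep \<Longrightarrow> y \<in> Sep \<Longrightarrow> x * y \<in> Sep" by blast+
qed

lemma Sep_0: "0 \<in> Sep" and Sep_1: "1 \<in> Sep" and Sep_uminus1: "- 1 \<in> Sep"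
  using Sep_base[of 0] Sep_base[of 1] Sep_base[of "- 1"] by simp_all
lemma Sep_power: "x \<in> Sep \<Longrightarrow> x ^ n \<in> Sep" by (induction n) (auto intro: Sep_1 Sep_mult)
lemma Sep_sum: "(\<And>i. i \<in> S \<Longrightarrow> f i \<in> Sep) \<Longrightarrow> (\<Sum>i\<in>S. f i) \<in> Sep"
  by (induction S rule: infinite_finite_induct) (auto intro: Sep_0 Sep_add)
lemma Sep_diff: "x \<in> Sep \<Longrightarrow> y \<in> Sep \<Longrightarrow> x - y \<in> Sep"
  using Sep_add[OF _ Sep_mult[OF Sep_uminus1], of x y] by simp

subsection \<open>Coordinates with respect to the powers of \<open>\<theta>\<close>\<close>

lemma theta_coordinate_nth:
  fixes g :: "nat \<Rightarrow> 'a::{field,finite} fls"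
  assumes e: "e < CARD('a) ^ N"
  shows "fls_nth (\<Sum>i<CARD('a) ^ N. fls_X_inv ^ i * g i ^ (CARD('a) ^ N)) (int (CARD('a) ^ N) * k - int e) = fls_nth (g e) k"
proof -
  define Q where "Q = CARD('a) ^ N"
  have Q: "Q > 0" by (simp add: Q_def frobenius_pow_pos)
  have "fls_nth (fls_X_inv ^ i * g i ^ Q) (int Q * k - int e) = (if i = e then fls_nth (g e) k else 0)" if "i < Q" for i
  proof -
    have "fls_nth (fls_X_inv ^ i * g i ^ Q) (int Q * k - int e) = fls_nth (g i ^ Q) (int Q * k + (int i - int e))"
      by (simp add: fls_X_inv_power_times_conv_shift algebra_simps)
    also have "\<dots> = (if i = e then fls_nth (g e) k else 0)"
    proof (cases "i = e")
      case True
      then show ?thesis unfolding Q_def fls_nth_frobenius using Q by (simp add: Q_def)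
    next
      case False
      have "\<not> int Q dvd int Q * k + (int i - int e)"
      proof
        assume "int Q dvd int Q * k + (int i - int e)"
        then have "int Q dvd int i - int e" by (simp add: dvd_add_right_iff)
        then have "\<bar>int Q\<bar> \<le> \<bar>int i - int e\<bar>" using False by (intro dvd_imp_le_int) auto
        then show False using that e by (simp add: Q_def[symmetric])
      qed
      then show ?thesis using False unfolding Q_def fls_nth_frobenius by simp
    qed
    finally show ?thesis .
  qed
  then have "(\<Sum>i<Q. fls_nth (fls_X_inv ^ i * g i ^ Q) (int Q * k - int e)) = (\<Sum>i<Q. if i = e then fls_nth (g e) k else 0)"
    by (intro sum.cong) auto
  then show ?thesis using e by (simp add: fls_nth_sum Q_def[symmetric])
qed

lemma theta_coordinates_zero:
  fixes g :: "nat \<Rightarrow> 'a::{field,finite} fls"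
  assumes "(\<Sum>i<CARD('a) ^ N. fls_X_inv ^ i * g i ^ (CARD('a) ^ N)) = 0" "e < CARD('a) ^ N"
  shows "g e = 0"
  by (rule fls_eqI) (use theta_coordinate_nth[OF assms(2), of g] assms(1) in simp)

lemma theta_coordinates_exist:
  fixes f :: "'a::{field,finite} fls"
  shows "\<exists>g. f = (\<Sum>i<CARD('a) ^ N. fls_X_inv ^ i * g i ^ (CARD('a) ^ N))"
proof -
  define Q where "Q = CARD('a) ^ N"
  have Q: "Q > 0" by (simp add: Q_def frobenius_pow_pos)
  define g where "g e = Abs_fls (\<lambda>k. fls_nth f (int Q * k - int e))" for e
  have g: "fls_nth (g e) k = fls_nth f (int Q * k - int e)" for e k
    unfolding g_def
  proof (rule nth_Abs_fls_lower_bound[of "min 0 (fls_subdegree f)"], intro allI impI)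
    fix k assume k: "k < min 0 (fls_subdegree f)"
    then have "1 * - k \<le> int Q * - k" using Q by (intro mult_right_mono) auto
    then have "int Q * k - int e < fls_subdegree f" using k by linarith
    then show "fls_nth f (int Q * k - int e) = 0" by simp
  qed
  have "f = (\<Sum>i<Q. fls_X_inv ^ i * g i ^ Q)"
  proof (rule fls_eqI)
    fix m :: int
    define e where "e = nat ((- m) mod int Q)"
    define k where "k = - ((- m) div int Q)"
    have e: "e < Q" "int e = (- m) mod int Q" using Q by (auto simp: e_def nat_less_iff)
    have m: "m = int Q * k - int e" using mult_div_mod_eq[of "int Q" "- m"] unfolding k_def e(2) mult_minus_right by linarith
    show "fls_nth f m = fls_nth (\<Sum>i<Q. fls_X_inv ^ i * g i ^ Q) m"
      unfolding m Q_def using theta_coordinate_nth[of e N g k] e(1) g by (simp add: Q_def)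
  qed
  then show ?thesis unfolding Q_def by blast
qed

abbreviation theta_ac :: "'a::{field,finite} fls alg_closure" where "theta_ac \<equiv> to_ac fls_X_inv"

text \<open>Coordinates with respect to a basis with linearly independent \<open>Q\<close>-th powers reduce this to Laurent series, where
  the exponents of the summands lie in different residue classes modulo \<open>Q\<close>.\<close>

lemma Sep_theta_independent:
  fixes z :: "nat \<Rightarrow> 'a::{field,finite} fls alg_closure"
  assumes z: "\<And>e. e < CARD('a) ^ N \<Longrightarrow> z e \<in> Sep"
    and rel: "(\<Sum>e<CARD('a) ^ N. theta_ac ^ e * z e ^ (CARD('a) ^ N)) = 0" and e: "e < CARD('a) ^ N"
  shows "z e = 0"
proof -
  define Q where "Q = CARD('a) ^ N"
  have "\<exists>W. sepspan W \<and> z ` {..<Q} \<subseteq> kspan Kac W"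
    by (rule Sep_common) (use z in \<open>auto simp: Q_def\<close>)
  then obtain W0 where W0: "sepspan W0" "z ` {..<Q} \<subseteq> kspan Kac W0" by blast
  from sepspan_basis[OF W0(1)] obtain W where W: "sepspan W" "kspan Kac W = kspan Kac W0"
    and ind: "\<forall>N c. (\<forall>w\<in>W. c w \<in> Kac) \<and> (\<Sum>w\<in>W. c w * w ^ (CARD('a) ^ N)) = 0 \<longrightarrow> (\<forall>w\<in>W. c w = 0)"
    by (elim exE conjE)
  have fin: "finite W" using W by (simp add: sepspan_def)
  have "\<forall>e\<in>{..<Q}. \<exists>a. (\<forall>w\<in>W. a w \<in> Kac) \<and> z e = (\<Sum>w\<in>W. a w * w)"
    using kspan_finite[OF subfield_set_Kac fin] W0(2) W(2) by blast
  from bchoice[OF this] obtain a where a: "\<forall>e\<in>{..<Q}. (\<forall>w\<in>W. a e w \<in> Kac) \<and> z e = (\<Sum>w\<in>W. a e w * w)" by blast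
  define b where "b e w = of_ac (a e w)" for e w
  have ab: "a e w = to_ac (b e w)" if "e < Q" "w \<in> W" for e w
    unfolding b_def using a that by (intro to_ac_of_ac[symmetric]) auto
  have zb: "z e = (\<Sum>w\<in>W. to_ac (b e w) * w)" if "e < Q" for e
  proof -
    have "z e = (\<Sum>w\<in>W. a e w * w)" using a that by blast
    also have "\<dots> = (\<Sum>w\<in>W. to_ac (b e w) * w)" by (rule sum.cong[OF refl]) (simp add: ab that)
    finally show ?thesis .
  qed
  define g where "g w = (\<Sum>e<Q. fls_X_inv ^ e * b e w ^ Q)" for w
  have "(\<Sum>e<Q. theta_ac ^ e * z e ^ Q) = (\<Sum>e<Q. \<Sum>w\<in>W. to_ac (fls_X_inv ^ e * b e w ^ Q) * w ^ Q)"
  proof (rule sum.cong[OF refl])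
    fix e assume "e \<in> {..<Q}"
    then have "z e = (\<Sum>w\<in>W. to_ac (b e w) * w)" using zb by simp
    then have "z e ^ Q = (\<Sum>w\<in>W. (to_ac (b e w) * w) ^ Q)" unfolding Q_def by (simp only: frobenius_pow_sum[OF CHAR_ac])
    then show "theta_ac ^ e * z e ^ Q = (\<Sum>w\<in>W. to_ac (fls_X_inv ^ e * b e w ^ Q) * w ^ Q)"
      by (simp add: sum_distrib_left power_mult_distrib mult_ac)
  qed
  also have "\<dots> = (\<Sum>w\<in>W. to_ac (g w) * w ^ Q)"
    by (subst sum.swap) (simp add: g_def to_ac_sum sum_distrib_right)
  finally have "(\<Sum>w\<in>W. to_ac (g w) * w ^ Q) = 0" using rel by (simp add: Q_def)
  then have "(\<forall>w\<in>W. to_ac (g w) \<in> Kac) \<and> (\<Sum>w\<in>W. to_ac (g w) * w ^ (CARD('a) ^ N)) = 0"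
    unfolding Q_def by blast
  then have g0: "\<forall>w\<in>W. to_ac (g w) = 0"
    by (rule ind[THEN spec, THEN spec, THEN mp])
  have "b e w = 0" if "w \<in> W" for w
  proof (rule theta_coordinates_zero[OF _ e, of "\<lambda>e. b e w"])
    have "g w = 0" using g0 that by simp
    then show "(\<Sum>i<CARD('a) ^ N. fls_X_inv ^ i * b i w ^ (CARD('a) ^ N)) = 0" by (simp add: g_def Q_def)
  qed
  then show ?thesis using zb[of e] e by (simp add: Q_def)
qed

subsection \<open>Taylor series of separable elements\<close>

abbreviation theta_eps :: "'a::{field,finite} fls alg_closure fps" where "theta_eps \<equiv> fps_const theta_ac + fps_X"

text \<open>\<open>x\<close> is a sum of terms \<open>\<theta>\<^sup>e y\<^sup>Q\<close> with \<open>Q = q\<^sup>N\<close> and separable \<open>y\<close>, and \<open>F\<close> is the sum of the corresponding \<open>(\<theta> + \<epsilon>)\<^sup>e y\<^sup>Q\<close>.  Modulo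
  \<open>\<epsilon>\<^sup>Q\<close> the latter is what a Taylor expansion must be.  Exponents \<open>e \<ge> Q\<close> are admitted, so that products
  of such sums need not be rearranged.\<close>

inductive taylor_rep :: "nat \<Rightarrow> 'a::{field,finite} fls alg_closure \<Rightarrow> 'a fls alg_closure fps \<Rightarrow> bool" for N where
  zero: "taylor_rep N 0 0"
| step: "y \<in> Sep \<Longrightarrow> taylor_rep N x F \<Longrightarrow>
     taylor_rep N (theta_ac ^ e * y ^ (CARD('a) ^ N) + x) (theta_eps ^ e * fps_const (y ^ (CARD('a) ^ N)) + F)"

lemma taylor_rep_add: "taylor_rep N x F \<Longrightarrow> taylor_rep N y G \<Longrightarrow> taylor_rep N (x + y) (F + G)"
  by (induction rule: taylor_rep.induct) (auto simp: add.assoc intro: taylor_rep.step)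

lemma taylor_rep_single_mult:
  fixes u x :: "'a::{field,finite} fls alg_closure"
  assumes u: "u \<in> Sep" and "taylor_rep N x F"
  shows "taylor_rep N (theta_ac ^ d * u ^ (CARD('a) ^ N) * x) (theta_eps ^ d * fps_const (u ^ (CARD('a) ^ N)) * F)"
  using assms(2)
proof (induction rule: taylor_rep.induct)
  case (step y x F e)
  from taylor_rep.step[OF Sep_mult[OF u step.hyps(1)] step.IH, of "d + e"]
  show ?case by (simp add: power_mult_distrib power_add algebra_simps fps_const_mult[symmetric] del: fps_const_mult)
qed (simp add: taylor_rep.zero)

lemma taylor_rep_mult: "taylor_rep N x F \<Longrightarrow> taylor_rep N y G \<Longrightarrow> taylor_rep N (x * y) (F * G)"
proof (induction rule: taylor_rep.induct)
  case (step u x F e)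
  from taylor_rep_add[OF taylor_rep_single_mult[OF step.hyps(1) step.prems] step.IH[OF step.prems]]
  show ?case by (simp add: algebra_simps)
qed (simp add: taylor_rep.zero)

lemma taylor_rep_down: "taylor_rep (Suc N) x F \<Longrightarrow> taylor_rep N x F"
proof (induction rule: taylor_rep.induct)
  case (step y x F e)
  have "(y ^ CARD('a)) ^ (CARD('a) ^ N) = y ^ (CARD('a) ^ Suc N)" by (simp add: power_mult)
  with taylor_rep.step[OF Sep_power[OF step.hyps(1), of "CARD('a)"] step.IH, of e] show ?case by simp
qed (rule taylor_rep.zero)

lemma taylor_rep_le: "N \<le> M \<Longrightarrow> taylor_rep M x F \<Longrightarrow> taylor_rep N x F"
  by (induction M rule: dec_induct) (auto dest: taylor_rep_down)

lemma taylor_rep_nth_0: "taylor_rep N x F \<Longrightarrow> fps_nth F 0 = x"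
proof (induction rule: taylor_rep.induct)
  case (step y x F e)
  have "fps_nth (theta_eps ^ e) 0 = (theta_ac :: 'a fls alg_closure) ^ e" by (simp add: fps_nth_power_0)
  then show ?case using step by simp
qed simp

lemma taylor_rep_nth_Sep: "taylor_rep N x F \<Longrightarrow> fps_nth F i \<in> Sep"
proof (induction arbitrary: i rule: taylor_rep.induct)
  case (step y x F e)
  have th: "fps_nth theta_eps i \<in> (Sep :: 'a fls alg_closure set)" for i by (auto simp: fps_X_def intro: Sep_0 Sep_1 Sep_base)
  have "fps_nth (theta_eps ^ e) i \<in> (Sep :: 'a fls alg_closure set)" for i
  proof (induction e arbitrary: i)
    case (Suc e)
    show ?case unfolding power_Suc fps_mult_nth using Suc th by (intro Sep_sum Sep_mult) auto
  qed (auto intro: Sep_0 Sep_1)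
  then show ?case using step by (auto intro: Sep_add Sep_mult Sep_power)
qed (simp add: Sep_0)

lemma fps_eq_upto_power: "fps_eq_upto n F G \<Longrightarrow> fps_eq_upto n ((F :: 'r::comm_ring_1 fps) ^ m) (G ^ m)"
  by (induction m) (auto intro: fps_eq_upto_mult)

lemma theta_eps_frobenius:
  "fps_eq_upto (CARD('a) ^ N - 1) (theta_eps ^ (CARD('a) ^ N)) (fps_const ((theta_ac :: 'a::{field,finite} fls alg_closure) ^ (CARD('a) ^ N)))"
  unfolding fps_eq_upto_def
proof (intro allI impI)
  fix i assume "i \<le> CARD('a) ^ N - 1"
  then have i: "i < CARD('a) ^ N" using frobenius_pow_pos[where 'a='a, of N] by linarith
  then have d: "CARD('a) ^ N dvd i \<longleftrightarrow> i = 0" by (meson dvd_0_right nat_dvd_not_less neq0_conv)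
  show "fps_nth (theta_eps ^ (CARD('a) ^ N)) i = fps_nth (fps_const ((theta_ac :: 'a fls alg_closure) ^ (CARD('a) ^ N))) i"
    unfolding fps_frobenius_nth[OF CHAR_ac] d by simp
qed

text \<open>Exponents are reduced modulo \<open>Q\<close> by \<open>(\<theta> + \<epsilon>)\<^sup>Q = \<theta>\<^sup>Q + \<epsilon>\<^sup>Q\<close>.\<close>

lemma taylor_rep_normal:
  fixes x :: "'a::{field,finite} fls alg_closure"
  assumes "taylor_rep N x F"
  shows "\<exists>z. (\<forall>e<CARD('a) ^ N. z e \<in> Sep) \<and> x = (\<Sum>e<CARD('a) ^ N. theta_ac ^ e * z e ^ (CARD('a) ^ N)) \<and>
           fps_eq_upto (CARD('a) ^ N - 1) F (\<Sum>e<CARD('a) ^ N. theta_eps ^ e * fps_const (z e ^ (CARD('a) ^ N)))"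
  using assms
proof (induction rule: taylor_rep.induct)
  case zero
  show ?case by (intro exI[of _ "\<lambda>_. 0"]) (simp add: Sep_0 power_0_left frobenius_pow_pos)
next
  case (step y x F e)
  define Q where "Q = CARD('a) ^ N"
  have Q: "Q > 0" by (simp add: Q_def frobenius_pow_pos)
  obtain z where z: "\<forall>e<Q. z e \<in> Sep" "x = (\<Sum>e<Q. theta_ac ^ e * z e ^ Q)"
    "fps_eq_upto (Q - 1) F (\<Sum>e<Q. theta_eps ^ e * fps_const (z e ^ Q))" using step.IH by (auto simp: Q_def)
  define u where "u = theta_ac ^ (e div Q) * y"
  define z' where "z' d = z d + (if d = e mod Q then u else 0)" for d
  have zQ: "z' d ^ Q = z d ^ Q + (if d = e mod Q then u ^ Q else 0)" for d
    using Q by (auto simp: z'_def Q_def frobenius_pow_add[OF CHAR_ac])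
  have m: "e mod Q < Q" using Q by simp
  have eq: "e = e mod Q + Q * (e div Q)" by simp
  have "(\<Sum>d<Q. theta_ac ^ d * z' d ^ Q) = x + theta_ac ^ (e mod Q) * u ^ Q"
    using m by (simp add: zQ distrib_left sum.distrib z(2) if_distrib[of "\<lambda>x. _ * x"] cong: if_cong)
  also have "theta_ac ^ (e mod Q) * u ^ Q = theta_ac ^ e * y ^ Q"
  proof -
    have "(theta_ac :: 'a fls alg_closure) ^ e = theta_ac ^ (e mod Q) * (theta_ac ^ (e div Q)) ^ Q"
      unfolding power_mult[symmetric] power_add[symmetric] by simp
    then show ?thesis by (simp add: u_def power_mult_distrib)
  qed
  finally have 1: "theta_ac ^ e * y ^ Q + x = (\<Sum>d<Q. theta_ac ^ d * z' d ^ Q)" by (simp add: add.commute)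
  have S: "(\<Sum>d<Q. theta_eps ^ d * fps_const (z' d ^ Q)) = (\<Sum>d<Q. theta_eps ^ d * fps_const (z d ^ Q)) + theta_eps ^ (e mod Q) * fps_const (u ^ Q)"
  proof -
    have "theta_eps ^ d * fps_const (z' d ^ Q) = theta_eps ^ d * fps_const (z d ^ Q) + (if d = e mod Q then theta_eps ^ (e mod Q) * fps_const (u ^ Q) else 0)" for d
      by (auto simp: zQ distrib_left fps_const_add[symmetric] simp del: fps_const_add)
    then show ?thesis using m by (simp add: sum.distrib)
  qed
  have "fps_eq_upto (Q - 1) (theta_eps ^ (e mod Q) * (theta_eps ^ Q) ^ (e div Q) * fps_const (y ^ Q))
      (theta_eps ^ (e mod Q) * fps_const (theta_ac ^ Q) ^ (e div Q) * fps_const (y ^ Q))"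
    unfolding Q_def by (intro fps_eq_upto_mult fps_eq_upto_power fps_eq_upto_refl theta_eps_frobenius)
  also have "theta_eps ^ (e mod Q) * (theta_eps ^ Q) ^ (e div Q) * fps_const (y ^ Q) = theta_eps ^ e * fps_const (y ^ Q)"
    unfolding power_mult[symmetric] power_add[symmetric] by simp
  also have "theta_eps ^ (e mod Q) * fps_const (theta_ac ^ Q) ^ (e div Q) * fps_const (y ^ Q) = theta_eps ^ (e mod Q) * fps_const (u ^ Q)"
    by (simp add: u_def fps_const_power power_mult_distrib mult.assoc power_mult[symmetric] mult.commute[of Q])
  finally have "fps_eq_upto (Q - 1) (theta_eps ^ e * fps_const (y ^ Q) + F) (\<Sum>d<Q. theta_eps ^ d * fps_const (z' d ^ Q))"
    unfolding S add.commute[of "\<Sum>d<Q. theta_eps ^ d * fps_const (z d ^ Q)"] by (rule fps_eq_upto_add[OF _ z(3)])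
  moreover have "\<forall>d<Q. z' d \<in> Sep"
    using z(1) step.hyps(1) by (auto simp: z'_def u_def intro!: Sep_add Sep_mult Sep_power Sep_base Sep_0)
  ultimately show ?case using 1 unfolding Q_def by blast
qed

lemma taylor_rep_unique:
  fixes x :: "'a::{field,finite} fls alg_closure"
  assumes "taylor_rep N x F" "taylor_rep N x G" "i < CARD('a) ^ N"
  shows "fps_nth F i = fps_nth G i"
proof -
  define Q where "Q = CARD('a) ^ N"
  obtain z where z: "\<forall>e<Q. z e \<in> Sep" "x = (\<Sum>e<Q. theta_ac ^ e * z e ^ Q)"
    "fps_eq_upto (Q - 1) F (\<Sum>e<Q. theta_eps ^ e * fps_const (z e ^ Q))" using taylor_rep_normal[OF assms(1)] unfolding Q_def by (elim exE conjE)
  obtain z' where z': "\<forall>e<Q. z' e \<in> Sep" "x = (\<Sum>e<Q. theta_ac ^ e * z' e ^ Q)"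
    "fps_eq_upto (Q - 1) G (\<Sum>e<Q. theta_eps ^ e * fps_const (z' e ^ Q))" using taylor_rep_normal[OF assms(2)] unfolding Q_def by (elim exE conjE)
  have "(\<Sum>e<Q. theta_ac ^ e * (z e - z' e) ^ Q) = 0"
    using z(2) z'(2) by (simp add: Q_def frobenius_pow_diff[OF CHAR_ac] right_diff_distrib sum_subtractf)
  then have "z e - z' e = 0" if "e < Q" for e
    unfolding Q_def by (rule Sep_theta_independent[rotated]) (use that z(1) z'(1) in \<open>auto simp: Q_def intro: Sep_diff\<close>)
  then have "(\<Sum>e<Q. theta_eps ^ e * fps_const (z e ^ Q)) = (\<Sum>e<Q. theta_eps ^ e * fps_const (z' e ^ Q))"
    by (intro sum.cong) auto
  then have "fps_eq_upto (Q - 1) F G" using fps_eq_upto_trans[OF z(3)] fps_eq_upto_sym[OF z'(3)] by simp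
  then show ?thesis using assms(3) by (auto simp: fps_eq_upto_def Q_def)
qed

lemma taylor_rep_base:
  fixes f :: "'a::{field,finite} fls"
  shows "\<exists>F. taylor_rep N (to_ac f) F \<and> (\<forall>i<CARD('a) ^ N. fps_nth F i = to_ac (hyperderiv_fls i f))"
proof -
  define Q where "Q = CARD('a) ^ N"
  obtain g where g: "f = (\<Sum>e<Q. fls_X_inv ^ e * g e ^ Q)" using theta_coordinates_exist[of f N] by (auto simp: Q_def)
  have repsum: "taylor_rep N (\<Sum>e<m. theta_ac ^ e * to_ac (g e) ^ Q) (\<Sum>e<m. theta_eps ^ e * fps_const (to_ac (g e) ^ Q))" for m
  proof (induction m)
    case (Suc m)
    from taylor_rep.step[OF Sep_base Suc, of m "g m"] show ?case by (simp add: Q_def add.commute)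
  qed (simp add: taylor_rep.zero)
  have "to_ac f = (\<Sum>e<Q. theta_ac ^ e * to_ac (g e) ^ Q)" by (subst g) (simp add: to_ac_sum)
  then have 1: "taylor_rep N (to_ac f) (\<Sum>e<Q. theta_eps ^ e * fps_const (to_ac (g e) ^ Q))" using repsum[of Q] by simp
  have "fps_nth (\<Sum>e<Q. theta_eps ^ e * fps_const (to_ac (g e) ^ Q)) i = to_ac (hyperderiv_fls i f)" if i: "i < Q" for i
  proof -
    have "fps_eq_upto (Q - 1) (taylor (fls_X_inv ^ e * g e ^ Q)) ((fps_const fls_X_inv + fps_X) ^ e * fps_const (g e ^ Q))" for e
      unfolding rhom_mult[OF rhom_taylor] rhom_power[OF rhom_taylor, of fls_X_inv] taylor_theta Q_def
      by (intro fps_eq_upto_mult fps_eq_upto_refl fps_eq_upto_taylor_frobenius) (use frobenius_pow_pos[where 'a='a, of N] in linarith)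
    then have t: "hyperderiv_fls i (fls_X_inv ^ e * g e ^ Q) = fps_nth ((fps_const fls_X_inv + fps_X) ^ e * fps_const (g e ^ Q)) i" for e
      using i unfolding fps_eq_upto_def taylor_nth by auto
    have th: "fps_nth (theta_eps ^ e) i = to_ac (fps_nth ((fps_const fls_X_inv + fps_X :: 'a fls fps) ^ e) i)" for e i
    proof (induction e arbitrary: i)
      case (Suc e)
      have "fps_nth theta_eps j = to_ac (fps_nth (fps_const fls_X_inv + fps_X :: 'a fls fps) j)" for j by (simp add: fps_X_def)
      then show ?case unfolding power_Suc fps_mult_nth to_ac_sum to_ac_mult Suc by (simp only:)
    qed simp
    have "hyperderiv_fls i f = fps_nth (taylor (\<Sum>e<Q. fls_X_inv ^ e * g e ^ Q)) i" by (simp flip: g)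
    also have "\<dots> = (\<Sum>e<Q. hyperderiv_fls i (fls_X_inv ^ e * g e ^ Q))"
      unfolding rhom_sum[OF rhom_taylor] by (simp add: fps_sum_nth)
    also have "\<dots> = (\<Sum>e<Q. fps_nth ((fps_const fls_X_inv + fps_X) ^ e * fps_const (g e ^ Q)) i)" by (simp add: t)
    finally show ?thesis by (simp add: fps_sum_nth th to_ac_sum)
  qed
  with 1 show ?thesis unfolding Q_def by blast
qed

text \<open>\<open>x\<close> is a combination of \<open>Q\<close>-th powers with coefficients in \<open>k\<^sub>\<infinity>\<close>, and these are combinations of \<open>Q\<close>-th powers with
  coefficients \<open>\<theta>\<^sup>e\<close>.\<close>

lemma taylor_rep_exists:
  fixes x :: "'a::{field,finite} fls alg_closure"
  assumes "x \<in> Sep"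
  shows "\<exists>F. taylor_rep N x F"
proof -
  obtain W where W: "sepspan W" "x \<in> kspan Kac W" using assms by (auto simp: Sep_def)
  then have "x \<in> kspan Kac ((\<lambda>w. w ^ (CARD('a) ^ N)) ` W)"
    using kspan_subset[OF subfield_set_Kac sepspan_level] by blast
  then show ?thesis
  proof (induction rule: kspan.induct)
    case zero
    show ?case using taylor_rep.zero by blast
  next
    case (step a v x)
    obtain w where w: "w \<in> W" "v = w ^ (CARD('a) ^ N)" using step by blast
    have "w \<in> Sep" using W(1) kspan_base[OF subfield_set_1[OF subfield_set_Kac] w(1)] by (auto simp: Sep_def)
    then have "taylor_rep N (theta_ac ^ 0 * w ^ (CARD('a) ^ N) + 0) (theta_eps ^ 0 * fps_const (w ^ (CARD('a) ^ N)) + 0)"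
      by (intro taylor_rep.step taylor_rep.zero)
    moreover obtain f where "a = to_ac f" using step by blast
    moreover obtain F where "taylor_rep N (to_ac f) F" using taylor_rep_base by blast
    moreover obtain G where "taylor_rep N x G" using step.IH by blast
    ultimately show ?case using taylor_rep_add[OF taylor_rep_mult] w(2) by fastforce
  qed
qed

text \<open>The \<open>n\<close>-th coefficient is well defined by \<open>taylor_rep_unique\<close> at level \<open>n\<close>, as \<open>n < q\<^sup>n\<close>.\<close>

definition sep_hyperderiv :: "nat \<Rightarrow> 'a::{field,finite} fls alg_closure \<Rightarrow> 'a fls alg_closure" where
  "sep_hyperderiv n x = fps_nth (SOME F. taylor_rep n x F) n"

lemma sep_hyperderiv_eq:
  fixes x :: "'a::{field,finite} fls alg_closure"
  assumes "taylor_rep N x F" "i \<le> N"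
  shows "sep_hyperderiv i x = fps_nth F i"
proof -
  have r: "taylor_rep i x F" by (rule taylor_rep_le[OF assms(2,1)])
  have "i < CARD('a) ^ i" using card_ge_2[where 'a='a] by (metis less_exp power_mono order_less_le_trans zero_le)
  then show ?thesis unfolding sep_hyperderiv_def by (intro taylor_rep_unique[OF someI[of "taylor_rep i x", OF r] r])
qed

lemma sep_hyperderiv_mult:
  assumes "x \<in> Sep" "y \<in> Sep" shows "sep_hyperderiv n (x * y) = (\<Sum>i\<le>n. sep_hyperderiv i x * sep_hyperderiv (n - i) y)"
proof -
  obtain F G where F: "taylor_rep n x F" and G: "taylor_rep n y G" using taylor_rep_exists assms by meson
  have "sep_hyperderiv n (x * y) = (\<Sum>i\<le>n. fps_nth F i * fps_nth G (n - i))"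
    by (simp add: sep_hyperderiv_eq[OF taylor_rep_mult[OF F G] order_refl] fps_mult_nth atLeast0AtMost)
  also have "\<dots> = (\<Sum>i\<le>n. sep_hyperderiv i x * sep_hyperderiv (n - i) y)"
    by (rule sum.cong) (auto simp: sep_hyperderiv_eq[OF F] sep_hyperderiv_eq[OF G])
  finally show ?thesis .
qed

lemma sep_hyperderiv_add:
  assumes "x \<in> Sep" "y \<in> Sep" shows "sep_hyperderiv n (x + y) = sep_hyperderiv n x + sep_hyperderiv n y"
proof -
  obtain F G where F: "taylor_rep n x F" and G: "taylor_rep n y G" using taylor_rep_exists assms by meson
  show ?thesis using sep_hyperderiv_eq[OF taylor_rep_add[OF F G]] sep_hyperderiv_eq[OF F] sep_hyperderiv_eq[OF G] by simp
qed

lemma sep_hyperderiv_Sep: "x \<in> Sep \<Longrightarrow> sep_hyperderiv n x \<in> Sep"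
  using taylor_rep_exists[of x n] taylor_rep_nth_Sep sep_hyperderiv_eq by (metis order_refl)

lemma sep_hyperderiv_0: "x \<in> Sep \<Longrightarrow> sep_hyperderiv 0 x = x"
  using taylor_rep_exists[of x 0] taylor_rep_nth_0 sep_hyperderiv_eq by (metis order_refl)

lemma sep_hyperderiv_base: "sep_hyperderiv n (to_ac f) = to_ac (hyperderiv_fls n (f :: 'a::{field,finite} fls))"
proof -
  have "n < CARD('a) ^ n" using card_ge_2[where 'a='a] by (metis less_exp power_mono order_less_le_trans zero_le)
  then show ?thesis using taylor_rep_base[of n f] sep_hyperderiv_eq[of n "to_ac f" _ n] by auto
qed

subsection \<open>Separable polynomials\<close>

definition ac_eval :: "'a::{field,finite} fls poly \<Rightarrow> 'a fls alg_closure \<Rightarrow> 'a fls alg_closure" where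
  "ac_eval p x = poly (map_poly to_ac p) x"

lemma map_to_ac_add: "map_poly to_ac (p + g) = map_poly to_ac p + map_poly to_ac g"
  by (rule poly_eqI) (simp add: coeff_map_poly)
lemma map_to_ac_mult: "map_poly to_ac (p * g) = map_poly to_ac p * map_poly to_ac g"
  by (rule poly_eqI) (simp add: coeff_map_poly coeff_mult to_ac_sum)
lemma map_to_ac_pderiv: "map_poly to_ac (pderiv p) = pderiv (map_poly to_ac p)"
  by (rule poly_eqI) (simp add: coeff_map_poly coeff_pderiv)
lemma map_to_ac_eq_0: "map_poly to_ac p = 0 \<longleftrightarrow> p = 0"
  by (simp add: map_poly_eq_0_iff)
lemma map_to_ac_degree: "Polynomial.degree (map_poly to_ac p) = Polynomial.degree p"
  by (rule degree_map_poly) simp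

lemma ac_eval_add: "ac_eval (p + g) x = ac_eval p x + ac_eval g x" by (simp add: ac_eval_def map_to_ac_add)
lemma ac_eval_mult: "ac_eval (p * g) x = ac_eval p x * ac_eval g x" by (simp add: ac_eval_def map_to_ac_mult)
lemma ac_eval_0 [simp]: "ac_eval 0 x = 0" by (simp add: ac_eval_def)
lemma ac_eval_sum: "ac_eval (\<Sum>i\<in>S. p i) x = (\<Sum>i\<in>S. ac_eval (p i) x)"
  by (induction S rule: infinite_finite_induct) (auto simp: ac_eval_add)
lemma ac_eval_monom: "ac_eval (monom c n) x = to_ac c * x ^ n" by (simp add: ac_eval_def map_poly_monom poly_monom)
lemma ac_eval_const: "ac_eval [:c:] x = to_ac c" by (simp add: ac_eval_def map_poly_pCons)

lemma ac_eval_mod: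
  assumes "ac_eval f x = 0" shows "ac_eval (g mod f) x = ac_eval g x"
proof -
  have "ac_eval g x = ac_eval (f * (g div f) + g mod f) x" by (simp only: mult_div_mod_eq)
  then show ?thesis unfolding ac_eval_add ac_eval_mult using assms by simp
qed

lemma min_poly_exists:
  "\<exists>m. m \<noteq> 0 \<and> ac_eval m x = 0 \<and> (\<forall>g. ac_eval g x = 0 \<longrightarrow> Polynomial.degree g < Polynomial.degree m \<longrightarrow> g = 0)"
proof -
  let ?P = "\<lambda>m. m \<noteq> 0 \<and> ac_eval m x = 0"
  obtain p where "?P p" unfolding ac_eval_def using alg_closure_algebraic by blast
  from ex_has_least_nat[of ?P, OF this, of Polynomial.degree] obtain m
    where "?P m" "\<forall>g. ?P g \<longrightarrow> Polynomial.degree m \<le> Polynomial.degree g" by blast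
  then show ?thesis by (intro exI[of _ m]) (meson not_le)
qed

lemma min_poly_dvd:
  assumes "m \<noteq> 0" "ac_eval m x = 0" "\<forall>g. ac_eval g x = 0 \<longrightarrow> Polynomial.degree g < Polynomial.degree m \<longrightarrow> g = 0"
    and "ac_eval g x = 0"
  shows "m dvd g"
proof -
  have "ac_eval (g mod m) x = 0" using assms by (simp add: ac_eval_mod)
  then have "g mod m = 0" using assms(3) degree_mod_less[OF assms(1), of g] by blast
  then show ?thesis by blast
qed

lemma ac_eval_unit: "m \<noteq> 0 \<Longrightarrow> ac_eval m x = 0 \<Longrightarrow> \<not> m dvd 1"
  by (auto simp: is_unit_poly_iff ac_eval_const)

lemma irreducible_minimal:
  assumes f: "Factorial_Ring.irreducible f" "ac_eval f x = 0" and g: "ac_eval g x = 0"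
  shows "f dvd g" "Polynomial.degree g < Polynomial.degree f \<Longrightarrow> g = 0"
proof -
  obtain m where m: "m \<noteq> 0" "ac_eval m x = 0" "\<forall>g. ac_eval g x = 0 \<longrightarrow> Polynomial.degree g < Polynomial.degree m \<longrightarrow> g = 0"
    using min_poly_exists by blast
  from min_poly_dvd[OF m f(2)] obtain h where h: "f = m * h" by blast
  have "h dvd 1" using irreducibleD[OF f(1) h] ac_eval_unit[OF m(1,2)] by blast
  then have "f dvd m" unfolding h by simp
  then show "f dvd g" using min_poly_dvd[OF m g] dvd_trans by blast
  then show "g = 0" if "Polynomial.degree g < Polynomial.degree f"
    using that dvd_imp_degree_le by (metis not_le)
qed

lemma min_poly_irreducible:
  assumes m: "m \<noteq> 0" "ac_eval m x = 0" "\<forall>g. ac_eval g x = 0 \<longrightarrow> Polynomial.degree g < Polynomial.degree m \<longrightarrow> g = 0"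
  shows "Factorial_Ring.irreducible m"
proof (rule irreducibleI[OF m(1) ac_eval_unit[OF m(1,2)]])
  fix a b assume ab: "m = a * b"
  have unit: "d dvd 1" if cd: "m = c * d" and c0: "ac_eval c x = 0" for c d
  proof -
    have nz: "c \<noteq> 0" "d \<noteq> 0" using cd m(1) by auto
    have "\<not> Polynomial.degree c < Polynomial.degree m" using m(3) c0 nz by blast
    then have "Polynomial.degree d = 0" using nz by (simp add: cd degree_mult_eq)
    then show ?thesis using is_unit_iff_degree[OF nz(2)] by simp
  qed
  have "ac_eval a x = 0 \<or> ac_eval b x = 0" using m(2) by (simp add: ab ac_eval_mult)
  then show "a dvd 1 \<or> b dvd 1"
  proof
    assume "ac_eval a x = 0" then show ?thesis using unit[OF ab] by blast
  next
    assume "ac_eval b x = 0" then show ?thesis using unit[of b a] ab by (simp add: mult.commute)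
  qed
qed

lemma rsquarefree_card_roots:
  fixes P :: "'k::alg_closed_field poly"
  assumes "rsquarefree P"
  shows "Polynomial.degree P \<le> card {x. poly P x = 0}"
proof -
  have P: "P \<noteq> 0" using assms by (simp add: rsquarefree_def)
  obtain A where A: "size A = Polynomial.degree P" "P = smult (lead_coeff P) (\<Prod>x\<in>#A. [:-x, 1:])"
    using alg_closed_imp_factorization[OF P] by blast
  have one: "count A a = 1" if a: "a \<in># A" for a
  proof (rule ccontr)
    assume "count A a \<noteq> 1"
    with a have "count A a \<ge> 2" by (metis One_nat_def Suc_1 count_greater_eq_one_iff le_antisym not_less_eq_eq)
    then have "{#a, a#} \<subseteq># A" by (auto simp: subseteq_mset_def)
    then obtain B where B: "A = {#a, a#} + B" by (metis subset_mset.le_iff_add)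
    have "[:-a, 1:] ^ 2 dvd P"
    proof -
      define lin where "lin = (\<lambda>x :: 'k. [:-x, 1:])"
      have "(\<Prod>x\<in>#A. lin x) = lin a ^ 2 * (\<Prod>x\<in>#B. lin x)" unfolding B by (simp add: power2_eq_square)
      then have "lin a ^ 2 dvd smult (lead_coeff P) (\<Prod>x\<in>#A. lin x)" by (intro dvd_smult) simp
      then show ?thesis using A(2) by (simp only: lin_def)
    qed
    then have "2 \<le> order a P" using P order_divides by blast
    moreover have "order a P = 0 \<or> order a P = 1" using assms by (simp add: rsquarefree_def)
    ultimately show False by auto
  qed
  have "size A = (\<Sum>a\<in>set_mset A. count A a)" by (rule size_multiset_overloaded_eq)
  also have "\<dots> = card (set_mset A)" by (simp add: one)
  also have "\<dots> \<le> card {x. poly P x = 0}"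
  proof (rule card_mono[OF poly_roots_finite[OF P]], rule subsetI)
    fix a assume "a \<in> set_mset A"
    then obtain B where "A = {#a#} + B" by (metis insert_DiffM add_mset_add_single union_commute)
    then have "poly (smult (lead_coeff P) (\<Prod>x\<in>#A. [:-x, 1:])) a = 0" by simp
    then show "a \<in> {x. poly P x = 0}" using A(2) by simp
  qed
  finally show ?thesis by (simp add: A(1))
qed

text \<open>The powers of \<open>x\<close> below the degree \<open>d\<close> of \<open>f\<close> span the algebra.  If \<open>g(x\<^sup>q) = 0\<close> with \<open>deg g < d\<close>, then \<open>f(T)\<close> divides \<open>g(T\<^sup>q)\<close>, so the \<open>q\<close>-th
  powers of the \<open>d\<close> roots of \<open>f\<close> are roots of \<open>g\<close>, and \<open>g = 0\<close>.  So the \<open>q\<close>-th powers of the spanning set are \<open>d\<close>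
  independent elements.\<close>

lemma separable_imp_Sep:
  fixes x :: "'a::{field,finite} fls alg_closure"
  assumes f: "Factorial_Ring.irreducible f" "ac_eval f x = 0" "rsquarefree (map_poly to_ac f)"
  shows "x \<in> Sep"
proof -
  let ?q = "CARD('a)"
  define d where "d = Polynomial.degree f"
  define W where "W = (\<lambda>i. x ^ i) ` {..<d}"
  have f0: "f \<noteq> 0" using f(1) by auto
  have fin: "finite W" and cardW: "card W \<le> d"
    unfolding W_def using card_image_le[of "{..<d}" "\<lambda>i. x ^ i"] by auto
  have d1: "d \<ge> 1"
  proof (rule ccontr)
    assume "\<not> d \<ge> 1"
    then have "f dvd 1" using is_unit_iff_degree[OF f0] by (simp add: d_def)
    then show False using f(1) by (simp add: Factorial_Ring.irreducible_def)
  qed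
  have pw: "x ^ n \<in> kspan Kac W" for n
  proof -
    let ?g = "monom 1 n mod f"
    have dg: "Polynomial.degree ?g < d"
      using degree_mod_less[OF f0, of "monom 1 n"] d1 by (auto simp: d_def)
    have "x ^ n = ac_eval (monom 1 n) x" by (simp add: ac_eval_monom)
    also have "\<dots> = ac_eval ?g x" by (simp add: ac_eval_mod[OF f(2)])
    also have "\<dots> = ac_eval (\<Sum>i\<le>d - 1. monom (poly.coeff ?g i) i) x"
      by (subst poly_as_sum_of_monoms') (use dg in auto)
    also have "\<dots> = (\<Sum>i\<le>d - 1. to_ac (poly.coeff ?g i) * x ^ i)" by (simp add: ac_eval_sum ac_eval_monom)
    also have "\<dots> \<in> kspan Kac W"
    proof (rule kspan_sum)
      fix i assume "i \<in> {..d - 1}"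
      then have "x ^ i \<in> W" unfolding W_def using d1 by (intro imageI) auto
      then show "to_ac (poly.coeff ?g i) * x ^ i \<in> kspan Kac W"
        by (intro kspan_scale[OF subfield_set_Kac] kspan_base[OF subfield_set_1[OF subfield_set_Kac]]) auto
    qed
    finally show ?thesis .
  qed
  have ind: "\<forall>j<d. c j = 0" if c: "\<forall>j<d. c j \<in> Kac" and rel: "(\<Sum>j<d. c j * x ^ (?q * j)) = 0" for c
  proof -
    define b where "b j = of_ac (c j)" for j
    have cb: "c j = to_ac (b j)" if "j < d" for j unfolding b_def using c that by (intro to_ac_of_ac[symmetric]) auto
    define g where "g = (\<Sum>j<d. monom (b j) j)"
    define G where "G = (\<Sum>j<d. monom (b j) (?q * j))"
    have "ac_eval G x = (\<Sum>j<d. c j * x ^ (?q * j))" by (simp add: G_def ac_eval_sum ac_eval_monom cb)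
    then have "f dvd G" using rel by (intro irreducible_minimal(1)[OF f(1,2)]) simp
    then have G: "ac_eval G y = 0" if "ac_eval f y = 0" for y using that by (auto simp: ac_eval_mult)
    have gG: "ac_eval g (y ^ ?q) = ac_eval G y" for y
      by (simp add: g_def G_def ac_eval_sum ac_eval_monom power_mult)
    have "g = 0"
    proof (rule ccontr)
      assume g0: "g \<noteq> 0"
      have "Polynomial.degree g < d"
      proof (rule degree_lessI)
        show "\<forall>k\<ge>d. poly.coeff g k = 0" by (auto simp: g_def coeff_sum intro!: sum.neutral)
      qed (use d1 in auto)
      have "d \<le> card {y. ac_eval f y = 0}"
        using rsquarefree_card_roots[OF f(3)] by (simp add: d_def map_to_ac_degree ac_eval_def)
      also have "\<dots> = card ((\<lambda>y. y ^ ?q) ` {y. ac_eval f y = 0})"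
        using frobenius_pow_inj[OF CHAR_ac, of _ 1] by (intro card_image[symmetric] inj_onI) auto
      also have "\<dots> \<le> card {y. poly (map_poly to_ac g) y = 0}"
        using G gG g0 by (intro card_mono poly_roots_finite) (auto simp: map_to_ac_eq_0 ac_eval_def)
      also have "\<dots> \<le> Polynomial.degree g"
        using card_poly_roots_bound[of "map_poly to_ac g"] g0 by (simp add: map_to_ac_eq_0 map_to_ac_degree)
      finally show False using \<open>Polynomial.degree g < d\<close> by simp
    qed
    have "b j = 0" if "j < d" for j
    proof -
      have "poly.coeff g j = b j" using that by (simp add: g_def coeff_sum)
      then show ?thesis using \<open>g = 0\<close> by simp
    qed
    then show ?thesis using cb by simp
  qed
  have "sepspan W"
    unfolding sepspan_def
  proof (intro conjI ballI fin)
    show "1 \<in> kspan Kac W" using pw[of 0] by simp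
    show "v * w \<in> kspan Kac W" if "v \<in> W" "w \<in> W" for v w
      using that pw by (auto simp: W_def simp flip: power_add)
    show "W \<subseteq> kspan Kac ((\<lambda>w. w ^ ?q) ` W)"
    proof
      fix w assume w: "w \<in> W"
      define y where "y j = (if j < d then x ^ (?q * j) else w)" for j
      have "\<exists>c. (\<exists>j\<in>{..d}. c j \<noteq> 0) \<and> (\<forall>j\<in>{..d}. c j \<in> Kac) \<and> (\<Sum>j\<in>{..d}. c j * y j) = 0"
        by (rule kspan_dependent[OF subfield_set_Kac fin]) (use cardW w pw in \<open>auto simp: y_def W_def\<close>)
      then obtain c where c: "\<exists>j\<in>{..d}. c j \<noteq> 0" "\<forall>j\<in>{..d}. c j \<in> Kac" "(\<Sum>j\<in>{..d}. c j * y j) = 0"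
        by (elim exE conjE)
      have rel: "(\<Sum>j<d. c j * x ^ (?q * j)) + c d * w = 0"
        using c(3) by (simp add: lessThan_Suc_atMost[symmetric] y_def)
      have cd: "c d \<noteq> 0"
      proof
        assume "c d = 0"
        then have "\<forall>j<d. c j = 0" using rel c(2) by (intro ind) auto
        then show False using c(1) \<open>c d = 0\<close> by (metis atMost_iff le_neq_implies_less)
      qed
      have "c d * w = - (\<Sum>j<d. c j * x ^ (?q * j))" using rel by (simp add: eq_neg_iff_add_eq_0 add.commute)
      then have "inverse (c d) * (c d * w) = inverse (c d) * - (\<Sum>j<d. c j * x ^ (?q * j))" by simp
      then have "w = inverse (c d) * - (\<Sum>j<d. c j * x ^ (?q * j))" using cd by (simp add: mult.assoc[symmetric])
      also have "\<dots> = (\<Sum>j<d. (- inverse (c d) * c j) * x ^ (?q * j))"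
        by (simp add: sum_distrib_left sum_negf[symmetric] mult.assoc)
      also have "\<dots> \<in> kspan Kac ((\<lambda>w. w ^ ?q) ` W)"
      proof (rule kspan_sum)
        fix j assume j: "j \<in> {..<d}"
        have "x ^ (?q * j) = (x ^ j) ^ ?q" by (simp add: power_mult[symmetric] mult.commute)
        then have "x ^ (?q * j) \<in> (\<lambda>w. w ^ ?q) ` W" using j by (auto simp: W_def)
        moreover have "- inverse (c d) * c j \<in> Kac" using c(2) j
          by (intro subfield_set_mult[OF subfield_set_Kac] subfield_set_uminus[OF subfield_set_Kac] subfield_set_inverse[OF subfield_set_Kac]) auto
        ultimately show "(- inverse (c d) * c j) * x ^ (?q * j) \<in> kspan Kac ((\<lambda>w. w ^ ?q) ` W)"
          by (intro kspan_scale[OF subfield_set_Kac] kspan_base[OF subfield_set_1[OF subfield_set_Kac]])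
      qed
      finally show "w \<in> kspan Kac ((\<lambda>w. w ^ ?q) ` W)" .
    qed
  qed
  then show ?thesis using pw[of 1] by (auto simp: Sep_def)
qed

text \<open>Let the minimal polynomial be \<open>m(T) = \<Sum> c\<^sub>i T\<^bsup>pi\<^esup>\<close>.  Taking \<open>p\<close>-th roots of the coefficients, \<open>\<Sum> h\<^sub>i x\<^sup>i = 0\<close>; the \<open>q\<close>-th power of this
  relation has coefficients in \<open>k\<^sub>\<infinity>\<close> again, namely \<open>c\<^sub>i\<^bsup>q/p\<^esup>\<close>.  Their coordinates with respect to the \<open>\<theta>\<^sup>e\<close> are the coefficients
  of relations for \<open>x\<close> of smaller degree than \<open>m\<close>, by \<open>Sep_theta_independent\<close>; so they vanish.\<close>

lemma Sep_imp_separable: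
  fixes x :: "'a::{field,finite} fls alg_closure"
  assumes x: "x \<in> Sep"
  shows "\<exists>f. Factorial_Ring.irreducible f \<and> ac_eval f x = 0 \<and> rsquarefree (map_poly to_ac f)"
proof -
  define p where "p = CHAR('a)"
  let ?q = "CARD('a)"
  have pr: "prime p" unfolding p_def by (rule prime_CHAR_semidom) (simp add: finite_imp_CHAR_pos)
  have p1: "p \<ge> 2" using prime_ge_2_nat[OF pr] .
  have "p dvd ?q"
  proof -
    have "of_nat (?q choose 1) = (0 :: 'a)" by (rule finite_field_binomial_zero) (use card_ge_2[where 'a='a] in auto)
    then show ?thesis unfolding p_def by (simp add: of_nat_eq_0_iff_char_dvd)
  qed
  then obtain r where r: "?q = p * r" by blast
  obtain m where m: "m \<noteq> 0" "ac_eval m x = 0" "\<forall>g. ac_eval g x = 0 \<longrightarrow> Polynomial.degree g < Polynomial.degree m \<longrightarrow> g = 0"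
    using min_poly_exists by blast
  have irr: "Factorial_Ring.irreducible m" by (rule min_poly_irreducible[OF m])
  have dpos: "Polynomial.degree m > 0" using ac_eval_unit[OF m(1,2)] is_unit_iff_degree[OF m(1)] by simp
  have "rsquarefree (map_poly to_ac m)"
  proof (rule ccontr)
    assume "\<not> rsquarefree (map_poly to_ac m)"
    then obtain a where a: "order a (map_poly to_ac m) \<noteq> 0" "order a (map_poly to_ac m) \<noteq> 1"
      using m(1) by (auto simp: rsquarefree_def map_to_ac_eq_0)
    then have "[:-a, 1:] ^ 2 dvd map_poly to_ac m" by (subst order_divides) auto
    then obtain h where "map_poly to_ac m = [:-a, 1:] ^ 2 * h" by (rule dvdE)
    then have h: "map_poly to_ac m = [:-a, 1:] * ([:-a, 1:] * h)" by (simp only: power2_eq_square mult.assoc)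
    have a0: "ac_eval m a = 0" by (simp add: ac_eval_def h)
    have "ac_eval (pderiv m) a = 0" unfolding ac_eval_def map_to_ac_pderiv h pderiv_mult by simp
    moreover have "Polynomial.degree (pderiv m) < Polynomial.degree m"
      using dpos by (intro degree_lessI) (auto simp: coeff_pderiv coeff_eq_0)
    ultimately have pd: "pderiv m = 0" by (intro irreducible_minimal(2)[OF irr a0])
    have cz: "poly.coeff m j = 0" if "\<not> p dvd j" for j
    proof (cases j)
      case 0 then show ?thesis using that by simp
    next
      case (Suc i)
      have "of_nat (Suc i) * poly.coeff m (Suc i) = poly.coeff (pderiv m) i" by (simp add: coeff_pderiv)
      then have "of_nat (Suc i) * poly.coeff m (Suc i) = 0" using pd by simp
      moreover have "of_nat (Suc i) \<noteq> (0 :: 'a fls)"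
        using that unfolding Suc p_def of_nat_eq_0_iff_char_dvd CHAR_fls .
      ultimately show ?thesis using Suc by simp
    qed
    define d where "d = Polynomial.degree m div p"
    have "poly.coeff m (Polynomial.degree m) \<noteq> 0" using m(1) by simp
    then have "p dvd Polynomial.degree m" using cz[of "Polynomial.degree m"] by auto
    then have dd: "Polynomial.degree m = p * d" by (simp add: d_def)
    define c where "c i = poly.coeff m (p * i)" for i
    have mx: "(\<Sum>i\<le>d. to_ac (c i) * (x ^ i) ^ p) = 0"
    proof -
      have "ac_eval m x = (\<Sum>j\<le>Polynomial.degree m. to_ac (poly.coeff m j) * x ^ j)"
        by (subst poly_as_sum_of_monoms[symmetric]) (simp add: ac_eval_sum ac_eval_monom)
      also have "\<dots> = (\<Sum>j\<in>(\<lambda>i. p * i) ` {..d}. to_ac (poly.coeff m j) * x ^ j)"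
      proof (rule sum.mono_neutral_right)
        show "(\<lambda>i. p * i) ` {..d} \<subseteq> {..Polynomial.degree m}" by (auto simp: dd)
        show "\<forall>i\<in>{..Polynomial.degree m} - (\<lambda>i. p * i) ` {..d}. to_ac (poly.coeff m i) * x ^ i = 0"
        proof
          fix j assume j: "j \<in> {..Polynomial.degree m} - (\<lambda>i. p * i) ` {..d}"
          have "\<not> p dvd j"
          proof
            assume "p dvd j"
            then obtain i where "j = p * i" by blast
            then show False using j p1 by (auto simp: dd)
          qed
          then show "to_ac (poly.coeff m j) * x ^ j = 0" by (simp add: cz)
        qed
      qed simp
      also have "\<dots> = (\<Sum>i\<le>d. to_ac (c i) * (x ^ i) ^ p)"
        using p1 by (subst sum.reindex) (auto simp: inj_on_def c_def power_mult[symmetric] mult.commute)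
      finally show ?thesis using m(2) by simp
    qed
    have "\<exists>y. y ^ p = to_ac (c i)" for i using nth_root_exists[of p "to_ac (c i)"] p1 by auto
    then obtain h' where h': "\<And>i. h' i ^ p = to_ac (c i)" by metis
    have "(\<Sum>i\<le>d. h' i * x ^ i) ^ p = (\<Sum>i\<le>d. (h' i * x ^ i) ^ p)"
      by (rule freshmans_dream_sum) (use pr in \<open>simp_all add: p_def\<close>)
    then have "(\<Sum>i\<le>d. h' i * x ^ i) ^ p = 0" using mx by (simp add: power_mult_distrib h')
    then have s0: "(\<Sum>i\<le>d. h' i * x ^ i) = 0" using p1 by simp
    have "(\<Sum>i\<le>d. to_ac (c i ^ r) * (x ^ i) ^ ?q) = (\<Sum>i\<le>d. (h' i * x ^ i) ^ ?q)"
    proof (rule sum.cong[OF refl])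
      fix i
      have "h' i ^ ?q = to_ac (c i ^ r)" unfolding r power_mult by (simp add: h')
      then show "to_ac (c i ^ r) * (x ^ i) ^ ?q = (h' i * x ^ i) ^ ?q" by (simp add: power_mult_distrib)
    qed
    also have "\<dots> = (\<Sum>i\<le>d. h' i * x ^ i) ^ ?q" using frobenius_pow_sum[OF CHAR_ac, of "\<lambda>i. h' i * x ^ i" "{..d}" 1] by simp
    also have "\<dots> = 0" using s0 by simp
    finally have rel: "(\<Sum>i\<le>d. to_ac (c i ^ r) * (x ^ i) ^ ?q) = 0" .
    have "\<forall>i. \<exists>b. c i ^ r = (\<Sum>e<?q. fls_X_inv ^ e * b e ^ ?q)" using theta_coordinates_exist[where 'a = 'a and N = 1] by simp
    then obtain b where b: "\<And>i. c i ^ r = (\<Sum>e<?q. fls_X_inv ^ e * b i e ^ ?q)" by metis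
    define z where "z e = (\<Sum>i\<le>d. to_ac (b i e) * x ^ i)" for e
    have "(\<Sum>e<?q. theta_ac ^ e * z e ^ ?q) = (\<Sum>e<?q. \<Sum>i\<le>d. to_ac (fls_X_inv ^ e * b i e ^ ?q) * (x ^ i) ^ ?q)"
      using frobenius_pow_sum[OF CHAR_ac, of "\<lambda>i. to_ac (b i e) * x ^ i" "{..d}" 1 for e]
      by (simp add: z_def sum_distrib_left power_mult_distrib mult.assoc)
    also have "\<dots> = (\<Sum>i\<le>d. to_ac (c i ^ r) * (x ^ i) ^ ?q)"
      by (subst sum.swap) (simp add: b to_ac_sum sum_distrib_right del: to_ac_power)
    finally have zrel: "(\<Sum>e<?q ^ 1. theta_ac ^ e * z e ^ (?q ^ 1)) = 0" using rel by simp
    have zS: "z e \<in> Sep" for e unfolding z_def by (intro Sep_sum Sep_mult Sep_power Sep_base x)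
    have bz: "b i e = 0" if e: "e < ?q" and i: "i \<le> d" for i e
    proof -
      have "z e = 0" by (rule Sep_theta_independent[OF zS zrel]) (use e in simp)
      define g where "g = (\<Sum>i\<le>d. monom (b i e) i)"
      have "ac_eval g x = 0" using \<open>z e = 0\<close> by (simp add: g_def z_def ac_eval_sum ac_eval_monom)
      moreover have "d > 0" "2 * d \<le> p * d" using dd dpos p1 by auto
      then have "d < Polynomial.degree m" using dd by linarith
      then have "Polynomial.degree g < Polynomial.degree m"
        by (intro degree_lessI) (auto simp: g_def coeff_sum dpos intro!: sum.neutral)
      ultimately have "g = 0" using m(3) by blast
      moreover have "poly.coeff g i = b i e" using i by (simp add: g_def coeff_sum)
      ultimately show ?thesis by simp
    qed
    have "c d ^ r = 0" unfolding b[of d] by (intro sum.neutral) (auto simp: bz power_0_left)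
    then have "c d = 0" using r by (simp split: if_splits)
    then have "poly.coeff m (Polynomial.degree m) = 0" by (simp only: c_def dd)
    then show False using m(1) by simp
  qed
  then show ?thesis using irr m(2) by blast
qed

context completed_alg_closure begin

lemma rhom_emb: "rhom emb"
proof -
  have "emb 0 + emb 0 = emb 0 + 0" using emb_add[of 0 0] by simp
  then have "emb 0 = 0" by (simp only: add_left_cancel)
  then show ?thesis by (simp add: rhom_def emb_1 emb_add emb_mult)
qed

lemma emb_eq_0: "emb x = 0 \<longleftrightarrow> x = 0"
proof
  assume "emb x = 0"
  show "x = 0"
  proof (rule ccontr)
    assume "x \<noteq> 0"
    then have "emb (x * inverse x) = 1" by (simp add: emb_1)
    then show False using \<open>emb x = 0\<close> by (simp add: emb_mult)
  qed
qed (simp add: rhom_0[OF rhom_emb])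

lemma emb_inj: "emb x = emb y \<longleftrightarrow> x = y"
  using emb_eq_0[of "x - y"] by (simp add: rhom_diff[OF rhom_emb])

lemma k_inf_sep_eq: "k_inf_sep emb = emb ` Sep"
  unfolding k_inf_sep_def using separable_imp_Sep Sep_imp_separable unfolding ac_eval_def by blast

lemma hyperderiv_family_exists: "hyperderiv_family emb (hyperderiv emb)"
proof -
  define D where "D n y = emb (sep_hyperderiv n (SOME x. emb x = y))" for n y
  have D: "D n (emb x) = emb (sep_hyperderiv n x)" for n x
  proof -
    have "(SOME z. emb z = emb x) = x" by (rule some_equality) (simp_all add: emb_inj)
    then show ?thesis by (simp add: D_def)
  qed
  have dc: "sep_hyperderiv n (to_ac (fls_const c) * x) = to_ac (fls_const c) * sep_hyperderiv n x" if "x \<in> Sep" for n c x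
  proof -
    have "sep_hyperderiv n (to_ac (fls_const c) * x) = (\<Sum>i\<le>n. if i = 0 then to_ac (fls_const c) * sep_hyperderiv n x else 0)"
      unfolding sep_hyperderiv_mult[OF Sep_base that]
      by (rule sum.cong) (auto simp: sep_hyperderiv_base hyperderiv_fls_const)
    then show ?thesis by simp
  qed
  have "hyperderiv_family emb D"
    unfolding hyperderiv_family_def k_inf_sep_eq const_field_def
  proof (intro conjI allI ballI)
    show "D n x \<in> emb ` Sep" if "x \<in> emb ` Sep" for n x using that by (auto simp: D intro: sep_hyperderiv_Sep)
    show "D 0 x = x" if "x \<in> emb ` Sep" for x using that by (auto simp: D sep_hyperderiv_0)
    show "D n (x + y) = D n x + D n y" if "x \<in> emb ` Sep" "y \<in> emb ` Sep" for n x y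
      using that by (auto simp: D sep_hyperderiv_add simp flip: emb_add)
    show "D n (c * x) = c * D n x" if "c \<in> range (\<lambda>c. emb (to_ac (fls_const c)))" "x \<in> emb ` Sep" for n c x
      using that by (auto simp: D dc simp flip: emb_mult)
    show "D n (x * y) = (\<Sum>i\<le>n. D i x * D (n - i) y)" if "x \<in> emb ` Sep" "y \<in> emb ` Sep" for n x y
      using that by (auto simp: D sep_hyperderiv_mult rhom_sum[OF rhom_emb] emb_mult simp flip: emb_mult)
    show "D n (emb (to_ac f)) = emb (to_ac (hyperderiv_fls n f))" for n f
      by (simp add: D sep_hyperderiv_base)
  qed
  then show ?thesis unfolding hyperderiv_def by (rule someI[of "hyperderiv_family emb"])
qed

end

section \<open>The values of the twists of \<open>\<Omega>\<close>\<close>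

text \<open>The coefficients of \<open>\<Prod>\<^sub>i\<^sub><\<^sub>N (1 - u\<^sub>i T)\<close>: elementary symmetric polynomials up to sign.\<close>

primrec signed_esym :: "(nat \<Rightarrow> 'r::comm_ring_1) \<Rightarrow> nat \<Rightarrow> nat \<Rightarrow> 'r" where
  "signed_esym u 0 n = (if n = 0 then 1 else 0)"
| "signed_esym u (Suc N) n = signed_esym u N n - u N * (if n = 0 then 0 else signed_esym u N (n - 1))"

lemma fps_prod_signed_esym:
  "fps_nth (\<Prod>i<N. 1 - fps_const (u i) * fps_X) n = signed_esym (u :: nat \<Rightarrow> 'r::comm_ring_1) N n"
proof (induction N arbitrary: n)
  case (Suc N)
  have "(\<Prod>i<Suc N. 1 - fps_const (u i) * fps_X) = (\<Prod>i<N. 1 - fps_const (u i) * fps_X) - fps_const (u N) * (fps_X * (\<Prod>i<N. 1 - fps_const (u i) * fps_X))"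
    by (simp add: algebra_simps)
  then show ?case by (simp add: Suc)
qed simp

lemma rhom_signed_esym: "rhom \<phi> \<Longrightarrow> \<phi> (signed_esym u N n) = signed_esym (\<lambda>i. \<phi> (u i)) N n"
  by (induction N arbitrary: n) (simp_all add: rhom_0 rhom_1 rhom_diff rhom_mult)

lemma signed_esym_scale: "signed_esym (\<lambda>i. u i * t) N n = signed_esym u N n * t ^ n"
proof (induction N arbitrary: n)
  case (Suc N)
  show ?case
  proof (cases n)
    case 0
    show ?thesis using Suc.IH[of 0] by (simp add: 0)
  next
    case (Suc k)
    show ?thesis unfolding Suc signed_esym.simps(2) Suc.IH by (simp add: algebra_simps)
  qed
qed simp

lemma signed_esym_sum: "N \<le> M \<Longrightarrow> (\<Sum>n\<le>M. signed_esym u N n) = (\<Prod>i<N. 1 - u i)"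
proof (induction N arbitrary: M)
  case (Suc N)
  then obtain M' where M: "M = Suc M'" "N \<le> M'" by (cases M) auto
  have "(\<Sum>n\<le>M. signed_esym u (Suc N) n) = (\<Sum>n\<le>M. signed_esym u N n) - u N * (\<Sum>n\<le>M. if n = 0 then 0 else signed_esym u N (n - 1))"
    by (simp add: sum_subtractf sum_distrib_left)
  also have "(\<Sum>n\<le>M. if n = 0 then 0 else signed_esym u N (n - 1)) = (\<Sum>n\<le>M'. signed_esym u N n)"
    unfolding M(1) sum.atMost_Suc_shift by simp
  finally show ?case using Suc.IH[of M] Suc.IH[of M'] M by (simp add: algebra_simps)
qed (simp add: sum.delta)

lemma ord_ge_signed_esym:
  fixes u :: "nat \<Rightarrow> 'a::idom fls"
  assumes "\<And>i. ord_ge (u i) 1"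
  shows "ord_ge (signed_esym u N n) (int n)"
proof (induction N arbitrary: n)
  case (Suc N)
  show ?case
  proof (cases n)
    case 0
    then show ?thesis using Suc[of 0] by simp
  next
    case (Suc k)
    have "ord_ge (u N * signed_esym u N k) (1 + int k)" by (rule ord_ge_mult[OF assms Suc.IH])
    then show ?thesis using Suc.IH[of n] Suc by (auto intro!: ord_ge_diff)
  qed
qed simp

lemma ord_ge_signed_esym_diff:
  fixes u :: "nat \<Rightarrow> 'a::idom fls"
  assumes u: "\<And>i. ord_ge (u i) (int i + 1)" and "N \<le> M"
  shows "ord_ge (signed_esym u M n - signed_esym u N n) (int N)"
  using assms(2)
proof (induction M rule: dec_induct)
  case (step M)
  have u1: "ord_ge (u i) 1" for i using u[of i] by (rule ord_ge_mono) simp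
  have "ord_ge (u M * (if n = 0 then 0 else signed_esym u M (n - 1))) (int N)"
  proof (cases n)
    case (Suc k)
    have "ord_ge (u M * signed_esym u M k) ((int M + 1) + int k)" by (rule ord_ge_mult[OF u ord_ge_signed_esym[OF u1]])
    then show ?thesis using step.hyps Suc by (auto intro: ord_ge_mono)
  qed simp
  from ord_ge_diff[OF step.IH this] show ?case by (simp add: algebra_simps)
qed simp

text \<open>The coefficients of the power series \<open>\<Prod>\<^sub>i (1 - t z\<^bsup>w(c,i)\<^esup>)\<close> and its value at \<open>t = \<theta>\<close>.  Multiplied by \<open>\<theta>\<^sup>n\<close>, the \<open>n\<close>-th coefficient is a
  symmetric function of the \<open>\<theta> z\<^bsup>w(c,i)\<^esup>\<close>, which have positive orders; so the series converges at \<open>\<theta>\<close>, uniformly in the number of factors.\<close>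

lemma product_coefficients:
  assumes l: "l \<ge> 1" and c: "c \<ge> 1"
  shows "\<exists>L :: nat \<Rightarrow> 'a::{field,finite} fls.
    (\<forall>n N. ord_ge (L n - signed_esym (\<lambda>i. fls_X ^ (CARD('a) ^ (c + l * i))) N n) (int N)) \<and>
    (\<forall>M. ord_ge ((\<Sum>n\<le>M. L n * fls_X_inv ^ n) - jetval l (c, 0)) (int M))"
proof -
  let ?y = "\<lambda>i. fls_X ^ (CARD('a) ^ (c + l * i)) :: 'a fls"
  define u where "u i = ?y i * fls_X_inv" for i
  have XX: "fls_X ^ n * fls_X_inv ^ n = (1 :: 'a fls)" for n
    using fls_X_inv_X_power[of n, where 'a = 'a] by (simp add: mult.commute)
  have u: "ord_ge (u i) (int i + 1)" for i
  proof -
    have "2 + i \<le> 2 ^ (1 + i)" by (induction i) auto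
    also have "2 ^ (1 + i) \<le> CARD('a) ^ (1 + i)" using card_ge_2[where 'a = 'a] by (intro power_mono) auto
    also have "\<dots> \<le> CARD('a) ^ (c + l * i)"
    proof (rule power_increasing)
      show "1 + i \<le> c + l * i" using c l by (intro add_mono) auto
    qed (use card_ge_2[where 'a = 'a] in auto)
    finally have e: "2 + i \<le> CARD('a) ^ (c + l * i)" .
    have "ord_ge (u i) (int (2 + i) + (- 1))"
      unfolding u_def
    proof (rule ord_ge_mult[OF ord_ge_X_power])
      show "int (2 + i) \<le> int (CARD('a) ^ (c + l * i))" using e by (simp only: of_nat_le_iff)
      show "ord_ge (fls_X_inv :: 'a fls) (- 1)" using ord_ge_X_inv_power[of "- 1" 1, where 'a = 'a] by simp
    qed
    then show ?thesis by (simp add: add.commute)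
  qed
  have "\<exists>U. \<forall>N. ord_ge (U - signed_esym u N n) (int N)" for n
    by (rule fls_limit_exists) (rule ord_ge_signed_esym_diff[OF u])
  then obtain U where U: "\<And>n N. ord_ge (U n - signed_esym u N n) (int N)" by metis
  define L where "L n = U n * fls_X ^ n" for n
  have "signed_esym u N n = signed_esym ?y N n * fls_X_inv ^ n" for N n unfolding u_def by (rule signed_esym_scale)
  then have y: "signed_esym ?y N n = signed_esym u N n * fls_X ^ n" for N n using XX[of n] by (simp add: mult.assoc mult.commute)
  have 1: "ord_ge (L n - signed_esym ?y N n) (int N)" for n N
  proof -
    have "ord_ge (fls_X ^ n * (U n - signed_esym u N n)) (int N)" by (rule ord_ge_mult0[OF ord_ge_X_power U]) simp
    then show ?thesis unfolding L_def y by (simp add: right_diff_distrib mult.commute)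
  qed
  have "ord_ge ((\<Sum>n\<le>M. L n * fls_X_inv ^ n) - jetval l (c, 0)) (int M)" for M
  proof -
    have LU: "L n * fls_X_inv ^ n = U n" for n using XX[of n] by (simp add: L_def mult.assoc)
    have "(\<Sum>n\<le>M. signed_esym u M n) = jet CARD('a) l c M 0 fls_X_inv fls_X"
      by (simp add: signed_esym_sum jet_0 u_def mult.commute)
    moreover have "ord_ge (\<Sum>n\<le>M. U n - signed_esym u M n) (int M)" by (intro ord_ge_sum U)
    moreover have "ord_ge (jetval l (c, 0) - jet CARD('a) l c M 0 fls_X_inv (fls_X :: 'a fls)) (int M)"
      using jetval[of "(c, 0)" l M, where 'a = 'a] c l by simp
    ultimately have "ord_ge ((\<Sum>n\<le>M. U n - signed_esym u M n) - (jetval l (c, 0) - jet CARD('a) l c M 0 fls_X_inv fls_X)) (int M)"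
      using ord_ge_diff by blast
    then show ?thesis using \<open>(\<Sum>n\<le>M. signed_esym u M n) = _\<close> by (simp add: LU sum_subtractf)
  qed
  with 1 show ?thesis by blast
qed

context completed_alg_closure begin

lemma CHAR_c: "CHAR('c) = CHAR('a)"
proof (rule CHAR_eqI)
  have e: "of_nat n = emb (of_nat n)" for n
    by (induction n) (simp_all add: rhom_0[OF rhom_emb] emb_1 emb_add)
  show "of_nat CHAR('a) = (0 :: 'c)"
  proof -
    have "of_nat CHAR('a fls alg_closure) = (0 :: 'a fls alg_closure)" by (rule of_nat_CHAR)
    then show ?thesis unfolding e CHAR_ac emb_eq_0 .
  qed
  fix n assume "of_nat n = (0 :: 'c)"
  then have "of_nat n = (0 :: 'a fls alg_closure)" unfolding e emb_eq_0 .
  then show "CHAR('a) dvd n" by (simp add: of_nat_eq_0_iff_char_dvd)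
qed

abbreviation iota :: "'a fls \<Rightarrow> 'c" where "iota f \<equiv> emb (to_ac f)"

lemma rhom_iota: "rhom iota" using rhom_comp[OF rhom_to_ac rhom_emb] .

lemma iota_inj: "iota f = iota g \<longleftrightarrow> f = g" by (simp add: emb_inj)

lemma iota_limit: assumes "s \<longlonglongrightarrow> L" shows "(\<lambda>n. iota (s n)) \<longlonglongrightarrow> iota L"
  using assms unfolding lim_sequentially emb_isometry .

lemma theta_X: "theta emb * iota fls_X = 1"
proof -
  have "fls_X_inv * fls_X = (1 :: 'a fls)" using fls_X_inv_X_power[of 1, where 'a = 'a] by simp
  then show ?thesis unfolding theta_def by (metis rhom_mult[OF rhom_iota] rhom_1[OF rhom_iota])
qed

lemma theta_nonzero: "theta emb \<noteq> 0" using theta_X by auto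

text \<open>Continuity of the multiplication comes from the absolute value.\<close>

lemma isCont_scale: "isCont (\<lambda>x :: 'c. a * x) b"
proof (cases "a = 0")
  case False
  have d: "dist (a * x) (a * b) = dist a 0 * dist x b" for x
    by (metis dist_diff dist_mult right_diff_distrib)
  have pos: "dist a 0 > 0" using False by simp
  show ?thesis
    unfolding continuous_at_eps_delta d
  proof (intro allI impI)
    fix e :: real assume "e > 0"
    then show "\<exists>\<delta>>0. \<forall>x'. dist x' b < \<delta> \<longrightarrow> dist a 0 * dist x' b < e"
      using pos by (intro exI[of _ "e / dist a 0"]) (auto simp: pos_less_divide_eq mult.commute[of "dist a 0"])
  qed
qed simp

text \<open>The twist by \<open>-j\<close> divides the exponents \<open>q\<^bsup>il\<^esup>\<close>, \<open>i \<ge> 1\<close>, by \<open>q\<^sup>j\<close>, which leaves the product with \<open>c = l - j\<close>.\<close>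

lemma Omega_value:
  assumes l: "l \<ge> 1" and j: "j < l"
  shows "fps_value (twist CARD('a) (- int j) (Omega emb l r)) (theta emb)
       = inverse (r ^ (CARD('a) ^ (l - j))) * iota (jetval l (l - j, 0))"
proof -
  let ?q = "CARD('a)"
  let ?Q = "CARD('a) ^ j"
  have c: "l - j \<ge> 1" using j by simp
  obtain L :: "nat \<Rightarrow> 'a fls" where L': "\<forall>n N. ord_ge (L n - signed_esym (\<lambda>i. fls_X ^ (?q ^ (l - j + l * i))) N n) (int N)"
    and S': "\<forall>M. ord_ge ((\<Sum>n\<le>M. L n * fls_X_inv ^ n) - jetval l (l - j, 0)) (int M)"
    using product_coefficients[OF l c, where 'a = 'a] by (elim exE conjE)
  note L = L'[rule_format] and S = S'[rule_format]
  have Lj: "ord_ge (L n ^ ?Q - signed_esym (\<lambda>i. fls_X ^ (?q ^ (i * l + l))) N n) (int N)" for n N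
  proof -
    have "ord_ge ((L n - signed_esym (\<lambda>i. fls_X ^ (?q ^ (l - j + l * i))) N n) ^ ?Q) (int ?Q * int N)"
      by (rule ord_ge_power[OF L])
    moreover have "int N \<le> int ?Q * int N" using frobenius_pow_pos[where 'a = 'a, of j] by (simp add: mult_le_cancel_right1)
    ultimately have "ord_ge (L n ^ ?Q - signed_esym (\<lambda>i. fls_X ^ (?q ^ (l - j + l * i))) N n ^ ?Q) (int N)"
      by (metis frobenius_pow_diff[OF CHAR_fls] ord_ge_mono)
    moreover have "(fls_X ^ (?q ^ (l - j + l * i))) ^ ?Q = (fls_X :: 'a fls) ^ (?q ^ (i * l + l))" for i
      using j by (simp add: power_mult[symmetric] power_add[symmetric] mult.commute add.commute)
    ultimately show ?thesis using rhom_signed_esym[OF rhom_frobenius[where 'a = 'a and n = j]] by (simp only:)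
  qed
  define w where "w n = fps_nth (Omega emb l r) n" for n
  have w: "w n = inverse (r ^ (?q ^ l)) * iota (L n ^ ?Q)" for n
  proof -
    have c: "1 / theta emb ^ m = iota (fls_X ^ m)" for m
      using theta_X theta_nonzero rhom_power[OF rhom_iota, of fls_X m]
      by (simp add: field_simps power_mult_distrib[symmetric] del: to_ac_power)
    have "fps_nth (\<Prod>i=1..N. 1 - fps_const (1 / theta emb ^ (?q ^ (i * l))) * fps_X) n
        = iota (signed_esym (\<lambda>i. fls_X ^ (?q ^ (i * l + l))) N n)" for N
    proof -
      have "(\<Prod>i=1..N. 1 - fps_const (1 / theta emb ^ (?q ^ (i * l))) * fps_X)
          = (\<Prod>i<N. 1 - fps_const (iota (fls_X ^ (?q ^ (i * l + l)))) * fps_X)"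
        unfolding One_nat_def prod.atLeast1_atMost_eq c by (simp only: mult_Suc add.commute)
      then show ?thesis by (simp only: fps_prod_signed_esym rhom_signed_esym[OF rhom_iota])
    qed
    moreover have "(\<lambda>N. iota (signed_esym (\<lambda>i. fls_X ^ (?q ^ (i * l + l))) N n)) \<longlonglongrightarrow> iota (L n ^ ?Q)"
    proof (rule iota_limit, rule LIMSEQ_flsI)
      fix N show "ord_ge (signed_esym (\<lambda>i. fls_X ^ (?q ^ (i * l + l))) N n - L n ^ ?Q) (int N)"
        using ord_ge_uminus[OF Lj[of n N]] by simp
    qed
    ultimately show ?thesis unfolding w_def Omega_def by (simp add: limI)
  qed
  define R where "R = inverse (r ^ (?q ^ (l - j)))"
  have Rj: "R ^ ?Q = inverse (r ^ (?q ^ l))"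
    using j by (simp add: R_def power_inverse power_mult[symmetric] power_add[symmetric])
  have t: "fps_nth (twist ?q (- int j) (Omega emb l r)) n = R * iota (L n)" for n
  proof -
    have b: "(R * iota (L n)) ^ ?Q = w n"
      by (simp only: power_mult_distrib Rj w rhom_power[OF rhom_iota, symmetric])
    show ?thesis
    proof (cases "j = 0")
      case True
      then show ?thesis using b by (simp add: twist_def frob_power_def w_def)
    next
      case False
      have "(THE b. b ^ ?Q = w n) = R * iota (L n)"
      proof (rule the_equality)
        show "b = R * iota (L n)" if "b ^ ?Q = w n" for b
          by (rule frobenius_pow_inj[OF CHAR_c, where m = j]) (simp only: that b)
      qed (rule b)
      then show ?thesis using False by (simp add: twist_def frob_power_def w_def)
    qed
  qed
  have "(\<lambda>M. iota (\<Sum>n\<le>M. L n * fls_X_inv ^ n)) \<longlonglongrightarrow> iota (jetval l (l - j, 0))"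
    by (rule iota_limit, rule LIMSEQ_flsI) (rule S)
  then have "(\<lambda>M. R * iota (\<Sum>n\<le>M. L n * fls_X_inv ^ n)) \<longlonglongrightarrow> R * iota (jetval l (l - j, 0))"
    by (rule isCont_tendsto_compose[OF isCont_scale])
  then have "(\<lambda>M. \<Sum>n<Suc M. fps_nth (twist ?q (- int j) (Omega emb l r)) n * theta emb ^ n) \<longlonglongrightarrow> R * iota (jetval l (l - j, 0))"
    unfolding t by (simp add: rhom_sum[OF rhom_iota] rhom_mult[OF rhom_iota] rhom_power[OF rhom_iota] theta_def sum_distrib_left
      mult.assoc lessThan_Suc_atMost emb_mult rhom_power[OF rhom_emb] rhom_sum[OF rhom_emb] to_ac_sum)
  then have "(\<lambda>n. fps_nth (twist ?q (- int j) (Omega emb l r)) n * theta emb ^ n) sums (R * iota (jetval l (l - j, 0)))"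
    unfolding sums_def by (rule LIMSEQ_imp_Suc)
  then show ?thesis unfolding fps_value_def R_def by (rule sums_unique[symmetric])
qed

end

section \<open>The transcendence degrees\<close>

lemma card_power_ge_2: assumes "l \<ge> 1" shows "CARD('a::{field,finite}) ^ l \<ge> 2"
proof -
  have "CARD('a) ^ 1 \<le> CARD('a) ^ l" using assms card_ge_2[where 'a = 'a] by (intro power_increasing) auto
  then show ?thesis using card_ge_2[where 'a = 'a] by simp
qed

lemma monom_add_const_nonzero: assumes "m \<ge> 1" shows "monom 1 m + [:c:] \<noteq> (0 :: 'k::field poly)"
proof
  assume "monom 1 m + [:c:] = 0"
  then have "poly.coeff (monom 1 m + [:c:]) m = 0" by simp
  moreover have "poly.coeff [:c:] m = 0" using assms by (cases m) auto
  ultimately show False by simp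
qed

context completed_alg_closure begin

lemma iota_inverse_unique: "f * g = 1 \<Longrightarrow> inverse (iota f) = iota g"
  by (rule inverse_unique) (simp only: rhom_1[OF rhom_iota] flip: rhom_mult[OF rhom_iota])

lemma iota_inverse: "inverse (iota f) = iota (inverse f)"
proof (cases "f = 0")
  case False
  then show ?thesis by (intro iota_inverse_unique) (rule right_inverse)
qed (simp add: rhom_0[OF rhom_emb])

lemma subfield_set_const_field: "subfield_set (const_field emb)"
  unfolding subfield_set_def
proof (intro conjI ballI)
  have I: "iota (fls_const c) \<in> const_field emb" for c by (simp add: const_field_def)
  show "1 \<in> const_field emb" using I[of 1] by (simp add: emb_1)
  fix x assume "x \<in> const_field emb"
  then obtain c where x: "x = iota (fls_const c)" by (auto simp: const_field_def)
  show "- x \<in> const_field emb" using I[of "- c"] unfolding x rhom_uminus[OF rhom_iota, symmetric] by (simp only: fls_const_uminus)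
  show "inverse x \<in> const_field emb"
  proof (cases "c = 0")
    case True
    then show ?thesis using I[of 0] by (simp add: x rhom_0[OF rhom_emb])
  next
    case False
    then have "fls_const c * fls_const (inverse c) = 1" by (simp add: fls_const_mult_const)
    then show ?thesis using I unfolding x iota_inverse_unique[OF \<open>fls_const c * fls_const (inverse c) = 1\<close>] by blast
  qed
  fix y assume "y \<in> const_field emb"
  then obtain d where y: "y = iota (fls_const d)" by (auto simp: const_field_def)
  show "x + y \<in> const_field emb" using I[of "c + d"] unfolding x y by (simp only: rhom_add[OF rhom_iota, symmetric] fls_plus_const)
  show "x * y \<in> const_field emb" using I[of "c * d"] unfolding x y by (simp only: rhom_mult[OF rhom_iota, symmetric] fls_const_mult_const)
qed

lemma subfield_set_k_field: "subfield_set (k_field emb)"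
  unfolding k_field_def by (rule subfield_set_adjoin)

lemma subfield_set_k_bar: "subfield_set (k_bar emb)"
  unfolding k_bar_def by (rule subfield_set_algebraic[OF subfield_set_k_field])

lemma k_field_sub_k_bar: "x \<in> k_field emb \<Longrightarrow> x \<in> k_bar emb"
  unfolding k_bar_def using algebraic_over_incl[OF subfield_set_k_field] by blast

lemma theta_in_k_field: "theta emb \<in> k_field emb"
  unfolding k_field_def by (rule adjoin_incl) simp

subsection \<open>Taylor series over the separable closure\<close>

lemmas hyperderiv_props = hyperderiv_family_exists[unfolded hyperderiv_family_def]

definition hyper_series :: "'c \<Rightarrow> 'c fps" where
  "hyper_series x = Abs_fps (\<lambda>i. hyperderiv emb i x)"

lemma hyper_series_nth [simp]: "fps_nth (hyper_series x) i = hyperderiv emb i x" by (simp add: hyper_series_def)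

lemma sep_mult: "x \<in> k_inf_sep emb \<Longrightarrow> y \<in> k_inf_sep emb \<Longrightarrow> x * y \<in> k_inf_sep emb"
  unfolding k_inf_sep_eq by (auto simp: Sep_mult simp flip: emb_mult)

lemma sep_iota: "iota f \<in> k_inf_sep emb"
  unfolding k_inf_sep_eq by (intro imageI Sep_base)

lemma sep_power: "x \<in> k_inf_sep emb \<Longrightarrow> x ^ n \<in> k_inf_sep emb"
  using sep_iota[of 1] by (induction n) (auto simp: emb_1 intro: sep_mult)

lemma hyper_series_mult: "x \<in> k_inf_sep emb \<Longrightarrow> y \<in> k_inf_sep emb \<Longrightarrow> hyper_series (x * y) = hyper_series x * hyper_series y"
  using hyperderiv_props by (intro fps_ext) (simp add: fps_mult_nth atLeast0AtMost)

lemma hyper_series_iota: "hyperderiv emb i (iota f) = iota (hyperderiv_fls i f)"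
  using hyperderiv_props by simp

lemma hyper_series_1: "hyper_series 1 = 1"
proof (rule fps_ext)
  fix i
  have "hyperderiv emb i (iota (fls_const 1)) = iota (hyperderiv_fls i (fls_const 1))" by (rule hyper_series_iota)
  then show "fps_nth (hyper_series 1) i = fps_nth 1 i"
    unfolding hyperderiv_fls_const by (auto simp: emb_1 rhom_0[OF rhom_emb])
qed

lemma hyper_series_power: "x \<in> k_inf_sep emb \<Longrightarrow> hyper_series (x ^ n) = hyper_series x ^ n"
  by (induction n) (simp_all add: hyper_series_1 hyper_series_mult sep_power)

subsection \<open>The roots of \<open>-\<theta>\<close>\<close>

text \<open>The polynomial \<open>T\<^bsup>m\<^esup> + \<theta>\<close>, \<open>m = q\<^sup>l - 1\<close>, splits in the algebraic closure of \<open>k\<^sub>\<infinity>\<close>, which therefore contains \<open>r\<close>.  The powers of \<open>r\<close> below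
  the \<open>m\<close>-th span an algebra, and it is spanned by \<open>q\<close>-th powers because \<open>r = - r\<^bsup>q\<^sup>l\<^esup>/\<theta>\<close>.\<close>

lemma root_sep:
  assumes l: "l \<ge> 1" and r: "r ^ (CARD('a) ^ l - 1) = - theta emb"
  shows "r \<in> k_inf_sep emb"
proof -
  let ?q = "CARD('a)"
  define m where "m = ?q ^ l - 1"
  have ql: "?q ^ l \<ge> 2"
    by (rule card_power_ge_2[OF l])
  then have m: "m \<ge> 1" "?q ^ l = Suc m" by (auto simp: m_def)
  obtain A :: "'a fls alg_closure multiset" where
    A: "monom 1 m + [:theta_ac:] = smult (lead_coeff (monom 1 m + [:theta_ac:])) (\<Prod>x\<in>#A. [:-x, 1:])"
  proof -
    show ?thesis using alg_closed_imp_factorization[OF monom_add_const_nonzero[OF m(1), of theta_ac]] that by blast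
  qed
  define a where "a = lead_coeff (monom 1 m + [:theta_ac :: 'a fls alg_closure:])"
  \<comment> \<open>the identity of polynomials, evaluated outside the algebraic closure\<close>
  have "\<exists>y. emb y = r"
  proof -
    define \<Phi> where "\<Phi> p = poly (map_poly emb p) r" for p
    have Padd: "\<Phi> (p + g) = \<Phi> p + \<Phi> g" for p g
    proof -
      have "map_poly emb (p + g) = map_poly emb p + map_poly emb g"
        by (rule poly_eqI) (simp add: coeff_map_poly rhom_0[OF rhom_emb] emb_add)
      then show ?thesis by (simp add: \<Phi>_def)
    qed
    have Pmult: "\<Phi> (p * g) = \<Phi> p * \<Phi> g" for p g
    proof -
      have "map_poly emb (p * g) = map_poly emb p * map_poly emb g"
        by (rule poly_eqI) (simp add: coeff_map_poly rhom_0[OF rhom_emb] coeff_mult rhom_sum[OF rhom_emb] emb_mult)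
      then show ?thesis by (simp add: \<Phi>_def)
    qed
    have Pc: "\<Phi> [:c:] = emb c" for c by (simp add: \<Phi>_def map_poly_pCons rhom_0[OF rhom_emb])
    have Pl: "\<Phi> [:-x, 1:] = r - emb x" for x
      by (simp add: \<Phi>_def map_poly_pCons rhom_0[OF rhom_emb] emb_1 rhom_uminus[OF rhom_emb])
    have Pm: "\<Phi> (monom 1 m) = r ^ m" by (simp add: \<Phi>_def map_poly_monom rhom_0[OF rhom_emb] emb_1 poly_monom)
    have "\<Phi> (\<Prod>x\<in>#A. [:-x, 1:]) = (\<Prod>x\<in>#A. r - emb x)"
    proof (induction A)
      case empty
      have "\<Phi> [:1:] = 1" by (simp only: Pc emb_1)
      then show ?case by (simp add: one_pCons)
    next
      case (add x A)
      show ?case using add by (simp only: image_mset_add_mset prod_mset.add_mset Pmult Pl)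
    qed
    moreover have "\<Phi> (monom 1 m + [:theta_ac:]) = 0" unfolding Padd Pm Pc unfolding m_def r theta_def by simp
    moreover have "smult a (\<Prod>x\<in>#A. [:-x, 1:]) = [:a:] * (\<Prod>x\<in>#A. [:-x, 1:])" by simp
    ultimately have "emb a * (\<Prod>x\<in>#A. r - emb x) = 0" using A by (simp only: a_def[symmetric] Pmult Pc)
    moreover have "a \<noteq> 0"
    proof
      assume "a = 0"
      then have "monom 1 m + [:theta_ac :: 'a fls alg_closure:] = 0" by (simp only: a_def leading_coeff_0_iff)
      then show False using monom_add_const_nonzero[OF m(1)] by blast
    qed
    ultimately have "(\<Prod>x\<in>#A. r - emb x) = 0" by (simp add: emb_eq_0)
    then show ?thesis by (auto simp: prod_mset_zero_iff)
  qed
  then obtain y where y: "emb y = r" by blast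
  have "emb (y ^ m) = emb (- theta_ac)"
    using r by (simp add: rhom_power[OF rhom_emb] rhom_uminus[OF rhom_emb] y m_def theta_def)
  then have ym: "y ^ m = - theta_ac" by (simp only: emb_inj)
  define W where "W = (\<lambda>i. y ^ i) ` {..<m}"
  have K: "(- theta_ac) ^ k \<in> Kac" for k
    by (intro subfield_set_power[OF subfield_set_Kac] subfield_set_uminus[OF subfield_set_Kac]) simp
  have red: "y ^ n = (- theta_ac) ^ (n div m) * y ^ (n mod m)" for n
  proof -
    have "y ^ n = y ^ (m * (n div m) + n mod m)" by simp
    then show ?thesis unfolding power_add power_mult ym .
  qed
  have pw: "y ^ n \<in> kspan Kac W" for n
    unfolding red[of n] using m(1)
    by (intro kspan_scale[OF subfield_set_Kac K] kspan_base[OF subfield_set_1[OF subfield_set_Kac]]) (auto simp: W_def)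
  have pwq: "(y ^ n) ^ ?q \<in> kspan Kac ((\<lambda>w. w ^ ?q) ` W)" for n
    using kspan_power[OF pw[of n], of 1] by simp
  have "sepspan W"
    unfolding sepspan_def
  proof (intro conjI ballI subsetI)
    show "finite W" by (simp add: W_def)
    show "1 \<in> kspan Kac W" using pw[of 0] by simp
    show "v * w \<in> kspan Kac W" if "v \<in> W" "w \<in> W" for v w
      using that pw by (auto simp: W_def simp flip: power_add)
    fix w assume "w \<in> W"
    then obtain i where i: "w = y ^ i" by (auto simp: W_def)
    \<comment> \<open>y is -1/theta times the q-th power of another power of y\<close>
    have "y ^ (?q ^ l) = - theta_ac * y" unfolding m(2) power_Suc ym by (simp add: mult.commute)
    moreover have "?q ^ l = ?q ^ (l - 1) * ?q" using l by (metis Suc_diff_1 less_eq_Suc_le One_nat_def power_Suc2)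
    ultimately have e: "(y ^ ?q ^ (l - 1)) ^ ?q = - theta_ac * y" by (simp add: power_mult)
    have "w = inverse ((- theta_ac) ^ i) * (y ^ (i * ?q ^ (l - 1))) ^ ?q"
    proof -
      have "(y ^ (i * ?q ^ (l - 1))) ^ ?q = ((y ^ ?q ^ (l - 1)) ^ ?q) ^ i"
        by (simp add: power_mult[symmetric] mult_ac)
      also have "\<dots> = (- theta_ac) ^ i * y ^ i" unfolding e power_mult_distrib ..
      finally show ?thesis by (simp add: i)
    qed
    also have "\<dots> \<in> kspan Kac ((\<lambda>w. w ^ ?q) ` W)"
      by (intro kspan_scale[OF subfield_set_Kac] subfield_set_inverse[OF subfield_set_Kac] K pwq)
    finally show "w \<in> kspan Kac ((\<lambda>w. w ^ ?q) ` W)" .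
  qed
  then have "y \<in> Sep" using pw[of 1] by (auto simp: Sep_def)
  then show ?thesis unfolding k_inf_sep_eq y[symmetric] by (rule imageI)
qed

text \<open>In the Taylor expansion of \<open>r\<^bsup>q\<^sup>l\<^esup> = - \<theta> r\<close>, the \<open>i\<close>-th coefficient on the left is \<open>0\<close> or a power of a lower hyperderivative of \<open>r\<close>, and on
  the right it is \<open>- (\<theta> \<partial>\<^sup>(\<^sup>i\<^sup>)r + \<partial>\<^sup>(\<^sup>i\<^sup>-\<^sup>1\<^sup>)r)\<close>.\<close>

lemma root_hyperderiv_algebraic:
  assumes l: "l \<ge> 1" and r: "r ^ (CARD('a) ^ l - 1) = - theta emb"
  shows "hyperderiv emb i r \<in> k_bar emb"
proof -
  let ?Q = "CARD('a) ^ l"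
  have kb: "subfield_set (k_bar emb)" by (rule subfield_set_k_bar)
  have th: "theta emb \<in> k_bar emb" by (rule k_field_sub_k_bar[OF theta_in_k_field])
  have Q2: "?Q \<ge> 2"
    by (rule card_power_ge_2[OF l])
  have rS: "r \<in> k_inf_sep emb" by (rule root_sep[OF l r])
  have "algebraic_over (k_field emb) r"
    unfolding algebraic_over_def
  proof (intro exI[of _ "monom 1 (?Q - 1) + [:theta emb:]"] conjI allI)
    show "monom 1 (?Q - 1) + [:theta emb:] \<noteq> 0" by (rule monom_add_const_nonzero) (use Q2 in simp)
    show "poly.coeff (monom 1 (?Q - 1) + [:theta emb:]) i \<in> k_field emb" for i
      using theta_in_k_field subfield_set_k_field
      by (auto simp: coeff_pCons split: nat.splits intro!: subfield_set_add intro: subfield_set_0 subfield_set_1)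
    show "poly (monom 1 (?Q - 1) + [:theta emb:]) r = 0" using r by (simp add: poly_monom)
  qed
  then have r0: "r \<in> k_bar emb" by (simp add: k_bar_def)
  have "r ^ ?Q = r ^ Suc (?Q - 1)" using Q2 by simp
  then have "r ^ ?Q = - theta emb * r" using r by (simp only: power_Suc2)
  then have "r ^ ?Q = iota (- fls_X_inv) * r" by (simp add: rhom_uminus[OF rhom_emb] theta_def)
  then have Heq: "hyper_series r ^ ?Q = hyper_series (iota (- fls_X_inv)) * hyper_series r"
    by (simp only: hyper_series_power[OF rS, symmetric] hyper_series_mult[OF sep_iota rS])
  have Hth: "hyper_series (iota (- fls_X_inv)) = - (fps_const (theta emb) + fps_X)"
  proof (rule fps_ext)
    fix i
    have "hyperderiv_fls i (- fls_X_inv) = fps_nth (- taylor fls_X_inv) i"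
      using rhom_uminus[OF rhom_taylor, of fls_X_inv] taylor_nth by metis
    then have "hyperderiv_fls i (- fls_X_inv) = - fps_nth (fps_const fls_X_inv + fps_X :: 'a fls fps) i"
      by (simp only: taylor_theta fps_neg_nth)
    then show "fps_nth (hyper_series (iota (- fls_X_inv))) i = fps_nth (- (fps_const (theta emb) + fps_X)) i"
      unfolding hyper_series_nth hyper_series_iota by (simp add: rhom_uminus[OF rhom_iota] rhom_0[OF rhom_iota] rhom_1[OF rhom_iota] rhom_uminus[OF rhom_emb]
         rhom_0[OF rhom_emb] emb_1 emb_add theta_def)
  qed
  show ?thesis
  proof (induction i rule: less_induct)
    case (less i)
    show ?case
    proof (cases i)
      case 0
      have "hyperderiv emb 0 r = r" using hyperderiv_props rS by simp
      then show ?thesis using r0 0 by simp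
    next
      case (Suc k)
      define b where "b = (if ?Q dvd i then hyperderiv emb (i div ?Q) r ^ ?Q else 0)"
      have "i div ?Q < i" using Suc Q2 by (intro div_less_dividend) auto
      then have b: "b \<in> k_bar emb" unfolding b_def using less.IH subfield_set_power[OF kb] subfield_set_0[OF kb] by auto
      have "b = fps_nth (hyper_series r ^ ?Q) i" unfolding fps_frobenius_nth[OF CHAR_c] by (simp add: b_def)
      also have "\<dots> = - (theta emb * hyperderiv emb i r + hyperderiv emb k r)"
      proof -
        have "- (fps_const (theta emb) + fps_X) * hyper_series r = - (fps_const (theta emb) * hyper_series r) - fps_X * hyper_series r"
          by (simp only: minus_add_distrib distrib_right mult_minus_left diff_conv_add_uminus)
        then show ?thesis unfolding Heq Hth by (simp add: Suc)
      qed
      finally have "theta emb * hyperderiv emb i r = - (b + hyperderiv emb k r)" by (simp add: eq_neg_iff_add_eq_0 algebra_simps)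
      then have "hyperderiv emb i r = inverse (theta emb) * - (b + hyperderiv emb k r)"
        using theta_nonzero by (metis (no_types) mult.assoc left_inverse mult_1)
      also have "\<dots> \<in> k_bar emb"
        using less.IH[of k] Suc b th by (intro subfield_set_mult subfield_set_inverse subfield_set_uminus subfield_set_add kb) auto
      finally show ?thesis .
    qed
  qed
qed

text \<open>\<open>P\<^sub>l\<^sub>-\<^sub>j\<close> is the value of \<open>\<Omega>\<^sub>l\<^bsup>(-j)\<^esup>\<close> times a power of \<open>r\<close>, whose hyperderivatives are algebraic over \<open>k\<close>.\<close>

lemma jetval_in_Omega_field:
  assumes l: "l \<ge> 1" and j: "j < l" and r: "r ^ (CARD('a) ^ l - 1) = - theta emb"
    and L: "subfield_set L" "k_bar emb \<subseteq> L"
    and D: "\<And>i. i \<le> n \<Longrightarrow> hyperderiv emb i (fps_value (twist CARD('a) (- int j) (Omega emb l r)) (theta emb)) \<in> L"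
    and i: "i \<le> n"
  shows "iota (hyperderiv_fls i (jetval l (l - j, 0))) \<in> L"
proof -
  let ?V = "fps_value (twist CARD('a) (- int j) (Omega emb l r)) (theta emb)"
  let ?e = "CARD('a) ^ (l - j)"
  let ?P = "jetval l (l - j, 0) :: 'a fls"
  have rS: "r \<in> k_inf_sep emb" by (rule root_sep[OF l r])
  have V: "?V = inverse (r ^ ?e) * iota ?P" by (rule Omega_value[OF l j])
  have Q2: "CARD('a) ^ l \<ge> 2"
    by (rule card_power_ge_2[OF l])
  have rn: "r \<noteq> 0" using r theta_nonzero Q2 by (auto simp: power_0_left)
  have "r * (iota (- fls_X) * r ^ (CARD('a) ^ l - 2)) = 1"
  proof -
    have "r * r ^ (CARD('a) ^ l - 2) = r ^ Suc (CARD('a) ^ l - 2)" by simp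
    also have "Suc (CARD('a) ^ l - 2) = CARD('a) ^ l - 1" using Q2 by simp
    finally have "r * r ^ (CARD('a) ^ l - 2) = - theta emb" by (simp only: r)
    moreover have "iota (- fls_X) = - iota fls_X" by (rule rhom_uminus[OF rhom_iota])
    ultimately have "iota (- fls_X) * (r * r ^ (CARD('a) ^ l - 2)) = 1" using theta_X by (simp only: minus_mult_minus mult.commute)
    then show ?thesis by (simp only: mult_ac)
  qed
  then have "inverse r = iota (- fls_X) * r ^ (CARD('a) ^ l - 2)" by (rule inverse_unique)
  then have "inverse r \<in> k_inf_sep emb" by (simp only: sep_mult[OF sep_iota sep_power[OF rS]])
  then have VS: "?V \<in> k_inf_sep emb" unfolding V power_inverse[symmetric] by (intro sep_mult sep_power sep_iota)
  have "iota ?P = r ^ ?e * ?V" unfolding V using rn by simp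
  then have HP: "hyper_series (iota ?P) = hyper_series r ^ ?e * hyper_series ?V" by (simp only: hyper_series_mult[OF sep_power[OF rS] VS] hyper_series_power[OF rS])
  have "fps_in n L (hyper_series r)" using root_hyperderiv_algebraic[OF l r] L(2) by (auto simp: fps_in_def)
  moreover have "fps_in n L (hyper_series ?V)" using D by (simp add: fps_in_def)
  ultimately have "fps_in n L (hyper_series (iota ?P))" unfolding HP by (intro fps_in_mult fps_in_power L(1))
  then show ?thesis using i by (simp add: fps_in_def hyper_series_iota)
qed

subsection \<open>Independence over the algebraic closure of \<open>k\<close>\<close>

lemma const_span_polynomial:
  assumes "x \<in> kspan (const_field emb) (box_monomials (\<lambda>x. x) {theta emb} e)"
  shows "\<exists>p. x = iota p \<and> laurent_within e 0 p"
  using assms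
proof (induction rule: kspan.induct)
  case zero
  show ?case by (intro exI[of _ 0]) (simp add: rhom_0[OF rhom_iota] rhom_0[OF rhom_emb])
next
  case (step a v x)
  obtain c where c: "a = iota (fls_const c)" using step.hyps(1) by (auto simp: const_field_def)
  obtain d where m: "d < e" "v = theta emb ^ d"
    using step.hyps(2) by (auto simp: box_monomials_def Box_def box_monomial_def PiE_def Pi_def)
  obtain p where p: "x = iota p" "laurent_within e 0 p" using step.IH by blast
  have "a * v + x = iota (fls_const c * fls_X_inv ^ d + p)"
    unfolding c m(2) p(1) theta_def by (simp add: emb_add emb_mult rhom_power[OF rhom_emb])
  moreover have "laurent_within (0 + e) (0 + 0) (fls_const c * fls_X_inv ^ d)"
    using m(1) by (intro laurent_within_mult laurent_within_const laurent_within_X_inv_power) simp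
  ultimately show ?case using p(2) by (intro exI[of _ "fls_const c * fls_X_inv ^ d + p"]) (simp add: laurent_within_add)
qed

text \<open>Clearing denominators turns a relation over \<open>k\<close> into one over \<open>\<F>\<^sub>q[\<theta>]\<close>.\<close>

lemma jetval_aindep_k_field:
  assumes l: "l \<ge> 1"
  shows "aindep (k_field emb) ({1..l} \<times> {..n}) (\<lambda>i. iota (jetval l i))"
  unfolding aindep_def
proof (intro allI impI, elim conjE)
  let ?T = "{1..l} \<times> {..n} :: (nat \<times> nat) set"
  fix D c
  assume c: "\<forall>m\<in>Box ?T D. c m \<in> k_field emb" and rel: "(\<Sum>m\<in>Box ?T D. c m * box_monomial (\<lambda>i. iota (jetval l i)) ?T m) = 0"
  have fin: "finite ?T" by simp
  let ?M = "\<lambda>e. kspan (const_field emb) (box_monomials (\<lambda>x. x) {theta emb} e)"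
  have "\<exists>e G. G \<noteq> 0 \<and> G \<in> ?M e \<and> (\<forall>m\<in>Box ?T D. G * c m \<in> ?M e)"
    by (rule common_denominator[OF subfield_set_const_field]) (use c finite_Box[OF fin, of D] in \<open>auto simp: k_field_def\<close>)
  then obtain e G where G: "G \<noteq> 0" "\<forall>m\<in>Box ?T D. G * c m \<in> ?M e" by (elim exE conjE)
  have "\<forall>m\<in>Box ?T D. \<exists>p. G * c m = iota p \<and> laurent_within e 0 p" using G(2) const_span_polynomial by blast
  from bchoice[OF this] obtain p where p: "\<forall>m\<in>Box ?T D. G * c m = iota (p m) \<and> laurent_within e 0 (p m)" by blast
  define R where "R = box_poly ?T D p"
  have "R = 0"
  proof (rule jetval_independent[OF l])
    show "mvars_in ({1..l} \<times> UNIV) R"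
      unfolding R_def box_poly_def using keys_box_exponent[OF fin] by (intro mvars_in_sum mvars_in_single) blast
    show "coeffs_laurent_within e 0 R" unfolding R_def box_poly_def using p by (intro coeffs_laurent_within_sum coeffs_laurent_within_single) blast
    have "iota (mev (\<lambda>x. x) (jetval l) R) = (\<Sum>m\<in>Box ?T D. iota (p m) * box_monomial (\<lambda>i. iota (jetval l i)) ?T m)"
      unfolding R_def mev_box_poly[OF rhom_id fin] rhom_sum[OF rhom_iota] rhom_mult[OF rhom_iota] box_monomial_def rhom_prod[OF rhom_iota] rhom_power[OF rhom_iota] ..
    also have "\<dots> = G * (\<Sum>m\<in>Box ?T D. c m * box_monomial (\<lambda>i. iota (jetval l i)) ?T m)"
      unfolding sum_distrib_left by (rule sum.cong) (use p in \<open>auto simp: mult.assoc[symmetric]\<close>)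
    also have "\<dots> = iota 0" using rel by (simp add: rhom_0[OF rhom_emb])
    finally show "mev (\<lambda>x. x) (jetval l) R = 0" unfolding iota_inj .
  qed
  show "\<forall>m\<in>Box ?T D. c m = 0"
  proof
    fix m assume m: "m \<in> Box ?T D"
    have "p m = 0" using lookup_box_poly[OF fin m, of p] \<open>R = 0\<close> by (simp add: R_def)
    then have "G * c m = 0" using p m by (simp add: rhom_0[OF rhom_emb])
    then show "c m = 0" using G(1) by simp
  qed
qed

lemma transc_deg_jets:
  assumes l: "l \<ge> 1" and S: "finite S" "card S \<le> l * (n + 1)"
    and mem: "\<And>c k. c \<in> {1..l} \<Longrightarrow> k \<le> n \<Longrightarrow> iota (jetval l (c, k)) \<in> adjoin (k_bar emb) S"
  shows "transc_deg (k_bar emb) (adjoin (k_bar emb) S) = enat (l * (n + 1))"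
proof -
  let ?T = "{1..l} \<times> {..n} :: (nat \<times> nat) set"
  let ?y = "\<lambda>i. iota (jetval l i)"
  have ind: "aindep (k_bar emb) ?T ?y"
    unfolding k_bar_def by (rule aindep_algebraic[OF subfield_set_k_field _ jetval_aindep_k_field[OF l]]) simp
  have "card (?y ` ?T) = card ?T" by (rule card_image[OF aindep_imp_inj[OF subfield_set_k_bar _ ind]]) simp
  then have card: "card (?y ` ?T) = l * (n + 1)" by (simp add: card_cartesian_product)
  have "transc_deg (k_bar emb) (adjoin (k_bar emb) S) = enat (card (?y ` ?T))"
  proof (rule transc_deg_eqI[OF subfield_set_k_bar S(1)])
    show "alg_indep (k_bar emb) (?y ` ?T)" by (rule aindep_imp_alg_indep[OF subfield_set_k_bar _ ind]) simp
  qed (use S(2) card mem in auto)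
  then show ?thesis by (simp only: card)
qed

lemma preimage_subfield:
  assumes "subfield_set L" shows "subfield_set {f. iota f \<in> L}"
proof -
  show ?thesis
    unfolding subfield_set_def mem_Collect_eq
    by (auto simp only: iota_inverse[symmetric] rhom_1[OF rhom_iota] rhom_add[OF rhom_iota] rhom_mult[OF rhom_iota] rhom_uminus[OF rhom_iota]
       intro!: subfield_set_1[OF assms] subfield_set_add[OF assms] subfield_set_mult[OF assms] subfield_set_uminus[OF assms] subfield_set_inverse[OF assms])
qed

lemma k_bar_adjoin: "k_bar emb \<subseteq> adjoin (k_bar emb) S" using adjoin_incl(1) by blast

lemma theta_preimage: "fls_X_inv \<in> {f. iota f \<in> adjoin (k_bar emb) S}"
  using k_bar_adjoin k_field_sub_k_bar[OF theta_in_k_field] by (auto simp: theta_def)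

lemma generators_finite:
  fixes g :: "nat \<Rightarrow> nat \<Rightarrow> 'c"
  shows "finite {g i j | i j. i \<le> n \<and> j < l}" "card {g i j | i j. i \<le> n \<and> j < l} \<le> l * (n + 1)"
proof -
  have e: "{g i j | i j. i \<le> n \<and> j < l} = (\<lambda>(i, j). g i j) ` ({..n} \<times> {..<l})" by auto
  show "finite {g i j | i j. i \<le> n \<and> j < l}" unfolding e by simp
  have "card ((\<lambda>(i, j). g i j) ` ({..n} \<times> {..<l})) \<le> card ({..n} \<times> {..<l})" by (rule card_image_le) simp
  then show "card {g i j | i j. i \<le> n \<and> j < l} \<le> l * (n + 1)" unfolding e by (simp add: card_cartesian_product mult.commute)
qed

lemma transc_deg_gamma:
  assumes l: "l \<ge> 1"
  shows "transc_deg (k_bar emb) (adjoin (k_bar emb)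
      {iota (hyperderiv_fls i (arith_gamma (of_nat CARD('a) ^ j / (1 - of_nat CARD('a) ^ l)))) | i j. i \<le> n \<and> j < l}) = enat (l * (n + 1))"
    (is "transc_deg _ (adjoin _ ?S) = _")
proof (rule transc_deg_jets[OF l generators_finite])
  fix c k assume c: "c \<in> {1..l}" and k: "k \<le> n"
  have "jetval l (c, k) \<in> {f. iota f \<in> adjoin (k_bar emb) ?S}"
  proof (rule jetval_in_gamma_field[OF l preimage_subfield[OF subfield_set_adjoin] theta_preimage c k])
    fix i j assume "i \<le> n" "j < l"
    then show "hyperderiv_fls i (arith_gamma (of_nat CARD('a) ^ j / (1 - of_nat CARD('a) ^ l))) \<in> {f. iota f \<in> adjoin (k_bar emb) ?S}"
      by (intro CollectI adjoin_incl(2)) (rule exI[of _ i], rule exI[of _ j], simp)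
  qed
  then show "iota (jetval l (c, k)) \<in> adjoin (k_bar emb) ?S" by simp
qed

lemma transc_deg_Omega:
  assumes l: "l \<ge> 1" and r: "r ^ (CARD('a) ^ l - 1) = - theta emb"
  shows "transc_deg (k_bar emb) (adjoin (k_bar emb)
      {hyperderiv emb i (fps_value (twist CARD('a) (- int j) (Omega emb l r)) (theta emb)) | i j. i \<le> n \<and> j < l}) = enat (l * (n + 1))"
    (is "transc_deg _ (adjoin _ ?S) = _")
proof (rule transc_deg_jets[OF l generators_finite])
  fix c k assume c: "c \<in> {1..l}" and k: "k \<le> n"
  define j where "j = l - c"
  have j: "j < l" "l - j = c" using c by (auto simp: j_def)
  have "jetval l (c, k) \<in> {f. iota f \<in> adjoin (k_bar emb) ?S}"
  proof (rule jetval_in_field[OF l _ preimage_subfield[OF subfield_set_adjoin] theta_preimage _ k])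
    fix i assume i: "i \<le> n"
    have "iota (hyperderiv_fls i (jetval l (l - j, 0))) \<in> adjoin (k_bar emb) ?S"
    proof (rule jetval_in_Omega_field[OF l j(1) r subfield_set_adjoin k_bar_adjoin _ i])
      fix i assume "i \<le> n"
      then show "hyperderiv emb i (fps_value (twist CARD('a) (- int j) (Omega emb l r)) (theta emb)) \<in> adjoin (k_bar emb) ?S"
        by (intro adjoin_incl(2) CollectI) (rule exI[of _ i], rule exI[of _ j], simp add: j(1))
    qed
    then show "hyperderiv_fls i (jetval l (c, 0)) \<in> {f. iota f \<in> adjoin (k_bar emb) ?S}" by (simp add: j(2))
  qed (use c in simp)
  then show "iota (jetval l (c, k)) \<in> adjoin (k_bar emb) ?S" by simp
qed

end

theorem theorem3p11:
  fixes emb :: "'a::{field,finite} fls alg_closure \<Rightarrow> 'c::{field,complete_space}"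
    and n l q :: nat and r :: 'c
  assumes "completed_alg_closure emb"
    and "q = CARD('a)"
    and "l \<ge> 1"
    and "r ^ (q ^ l - 1) = - theta emb"
  shows "transc_deg (k_bar emb)
           (adjoin (k_bar emb)
             {emb (to_ac (hyperderiv_fls i (arith_gamma (of_nat q ^ j / (1 - of_nat q ^ l)))))
               | i j. i \<le> n \<and> j < l})
         = transc_deg (k_bar emb)
             (adjoin (k_bar emb)
               {hyperderiv emb i (fps_value (twist q (- int j) (Omega emb l r)) (theta emb))
                 | i j. i \<le> n \<and> j < l})
       \<and> transc_deg (k_bar emb)
             (adjoin (k_bar emb)
               {hyperderiv emb i (fps_value (twist q (- int j) (Omega emb l r)) (theta emb))
                 | i j. i \<le> n \<and> j < l})
         = enat (l * (n + 1))"
proof -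
  interpret completed_alg_closure emb by (rule assms(1))
  show ?thesis
    using transc_deg_gamma[OF assms(3), of n] transc_deg_Omega[OF assms(3), of r n] assms(2,4) by simp
qed

end
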